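(* Let $f$ be a germ of holomorphic self-map of $\mathbb{C}^2$ at the origin $O$, fixing $O$ and tangent to the identity (i.e. $f(O)=O$, $df_O=\mathrm{id}$), with the origin as a non-dicritical isolated fixed point. Let $[v]\in\mathbb{P}^1$ be a characteristic direction of $f$, and assume that $f$ is regular along $[v]$ with $\mathrm{Ind}(\tilde f,\mathbb{P}^1,[v])\neq 0$, where $\tilde f$ is the blow-up of $f$ at the origin and $\mathbb{P}^1$ is identified with the exceptional divisor of the blow-up of the origin. Then there exist parabolic curves (that is, at least one parabolic curve) for $f$ tangent to $[v]$ at the origin.
   Context: Order, dicritical point, characteristic direction. Write $f=(f_1,f_2)$ with homogeneous expansions $f_j(z_1,z_2)=z_j+\sum_{k\ge2}P_{j,k}(z_1,z_2)$, where $P_{j,k}$ is homogeneous of degree $k$ or zero. The order $\nu(f)$ is the least $k\ge 2$ such that $P_{1,k}$ and $P_{2,k}$ are not both zero. The origin is dicritical if $z_2P_{1,\nu(f)}(z_1,z_2)\equiv z_1P_{2,\nu(f)}(z_1,z_2)$. A characteristic direction of $f$ is a point $[v]=[v_1:v_2]\in\mathbb{P}^1$ such that there is $\lambda\in\mathbb{C}$ with $P_{j,\nu(f)}(v_1,v_2)=\lambda v_j$ for $j=1,2$. Blow-up. Let $\pi:M\to\mathbb{C}^2$ (near $O$) be the blow-up of the origin, with exceptional divisor $S=\pi^{-1}(O)=\mathbb{P}(T_O\mathbb{C}^2)\cong\mathbb{P}^1$. The blow-up $\tilde f$ of $f$ is the unique germ about $S$ of holomorphic self-map of $M$ sending $S$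 into itself with $\pi\circ\tilde f=f\circ\pi$. One has $\tilde f|_S=\mathrm{id}_S$, $d\tilde f$ acts as the identity on the normal bundle of $S$ in $M$, and $\tilde f$ is tangential to $S$ (as defined below) because the origin is non-dicritical. Pure order and regularity. Let $\mathcal{O}_2$ be the ring of germs at $O$ of holomorphic functions on $\mathbb{C}^2$. The order $\nu(g)$ of a nonzero $g\in\mathcal{O}_2$ is the least degree of a nonzero homogeneous term in its power series expansion at $O$ (and $\nu(0)=\infty$). For a germ $F\neq\mathrm{id}$ fixing $O$, write $F=(z+g,\,w+h)$, $l=\gcd(g,h)$ in $\mathcal{O}_2$, $g=lg^o$, $h=lh^o$; the pure order is $\nu_o(F,O)=\min\{\nu(g^o),\nu(h^o)\}$. For $p\in S$, $\nu_o(\tilde f,p)$ is defined using any chart of $M$ centered at $p$. The map $f$ is regular along $[v]$ if $\nu_o(\tilde f,[v])=1$, where $[v]$ is viewed as a point of $S$. Tangentiality and residual index. Let $p\in S$ and let $(z,w)$ be a chart of $M$ centered at $p$ in which $S=\{z=0\}$. There $\tilde f=(\tilde f_1,\tilde f_2)$ with $\tilde f_1=z+z^{\mu+2}\hat g(z,w)$, $\tilde f_2=w+z^{\nu+1}\hat h(z,w)$, where $\mu,\nu\in\mathbb{N}\cup\{\infty\}$ ($\mathbb N$ includes $0$; the value $\infty$ means that $\hat g\equiv 0$, resp. $\hat h\equiv 0$), and $z$ divides neither $\hat g$ nor $\hat h$ otherwise. Put $$k(w)=\lim_{z\to0}\frac{\tilde f_1(z,w)-z}{z(\tilde f_2(z,w)-w)},$$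 so $k\equiv0$ if $\mu>\nu$, $k(w)=(\hat g/\hat h)(0,w)$ if $\mu=\nu$, $k\equiv\infty$ if $\mu<\nu$. The map $\tilde f$ is tangential to $S$ if $k\not\equiv\infty$, and then $\mathrm{Ind}(\tilde f,S,p)=\mathrm{Res}_{w=0}\,k(w)$. Both notions are independent of the chart. Parabolic curve. A parabolic curve for $f$ at the origin is an injective holomorphic map $\varphi:\Delta\to\mathbb{C}^2$ such that: (i) $\Delta\subset\mathbb{C}$ is a simply connected domain with $0\in\partial\Delta$; (ii) $\varphi$ is continuous at the origin, with $\varphi(0)=O$; (iii) $\varphi(\Delta)$ is invariant under $f$, and $(f|_{\varphi(\Delta)})^k\to O$ as $k\to\infty$. It is tangent to $[v]\in\mathbb{P}^1$ at the origin if $[\varphi(\zeta)]\to[v]$ as $\zeta\to0$, where $[\cdot]:\mathbb{C}^2\setminus\{O\}\to\mathbb{P}^1$ is the canonical projection. *)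

theory Defs
  imports "HOL-Complex_Analysis.Complex_Analysis"
begin

section \<open>Holomorphic functions and germs in two variables\<close>

text \<open>Complex (not merely real) Frechet differentiability: the derivative is complex linear.
  Only used for open \<open>U\<close>.\<close>

definition holomorphic2_on :: "(complex \<times> complex \<Rightarrow> complex) \<Rightarrow> (complex \<times> complex) set \<Rightarrow> bool"
  where "holomorphic2_on g U \<longleftrightarrow>
    (\<forall>p\<in>U. \<exists>a b. (g has_derivative (\<lambda>h. a * fst h + b * snd h)) (at p))"

definition holomorphic_map2_on ::
    "(complex \<times> complex \<Rightarrow> complex \<times> complex) \<Rightarrow> (complex \<times> complex) set \<Rightarrow> bool"
  where "holomorphic_map2_on F U \<longleftrightarrow>
    holomorphic2_on (\<lambda>p. fst (F p)) U \<and> holomorphic2_on (\<lambda>p. snd (F p)) U"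

text \<open>The ring \<open>\<O>\<^sub>2\<close> of germs at the origin. A germ is given by a representative, and equality of
  germs is equality eventually in \<open>nhds 0\<close>.\<close>

definition germs2 :: "(complex \<times> complex \<Rightarrow> complex) set"
  where "germs2 = {g. \<exists>U. open U \<and> 0 \<in> U \<and> holomorphic2_on g U}"

definition germ_eq :: "(complex \<times> complex \<Rightarrow> 'a) \<Rightarrow> (complex \<times> complex \<Rightarrow> 'a) \<Rightarrow> bool"
  where "germ_eq g h \<longleftrightarrow> (\<forall>\<^sub>F p in nhds 0. g p = h p)"

definition germ_dvd :: "(complex \<times> complex \<Rightarrow> complex) \<Rightarrow> (complex \<times> complex \<Rightarrow> complex) \<Rightarrow> bool"
  where "germ_dvd d g \<longleftrightarrow> (\<exists>q\<in>germs2. germ_eq g (\<lambda>p. d p * q p))"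

definition germ_is_gcd :: "(complex \<times> complex \<Rightarrow> complex) \<Rightarrow>
    (complex \<times> complex \<Rightarrow> complex) \<Rightarrow> (complex \<times> complex \<Rightarrow> complex) \<Rightarrow> bool"
  where "germ_is_gcd l g h \<longleftrightarrow> l \<in> germs2 \<and> germ_dvd l g \<and> germ_dvd l h \<and>
    (\<forall>d\<in>germs2. germ_dvd d g \<longrightarrow> germ_dvd d h \<longrightarrow> germ_dvd d l)"

text \<open>The coefficient of \<open>z\<^sup>i w\<^sup>j\<close> in the power series expansion at the origin, the homogeneous
  term of degree \<open>k\<close>, and the order (\<open>\<infinity>\<close> for the zero germ, being the infimum of the empty set).\<close>

definition taylor_coeff2 :: "(complex \<times> complex \<Rightarrow> complex) \<Rightarrow> nat \<Rightarrow> nat \<Rightarrow> complex"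
  where "taylor_coeff2 g i j =
    (deriv ^^ i) (\<lambda>z. (deriv ^^ j) (\<lambda>w. g (z, w)) 0) 0 / (fact i * fact j)"

definition hom_part :: "(complex \<times> complex \<Rightarrow> complex) \<Rightarrow> nat \<Rightarrow> complex \<times> complex \<Rightarrow> complex"
  where "hom_part g k p = (\<Sum>i\<le>k. taylor_coeff2 g i (k - i) * fst p ^ i * snd p ^ (k - i))"

definition germ_order :: "(complex \<times> complex \<Rightarrow> complex) \<Rightarrow> enat"
  where "germ_order g = (INF k\<in>{k. \<exists>p. hom_part g k p \<noteq> 0}. enat k)"

text \<open>Pure order of a germ \<open>F \<noteq> id\<close> fixing the origin. It is stated as a relation because the
  gcd \<open>l\<close> is determined only up to a unit; the value \<open>n\<close> does not depend on this choice.\<close>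

definition has_pure_order :: "(complex \<times> complex \<Rightarrow> complex \<times> complex) \<Rightarrow> enat \<Rightarrow> bool"
  where "has_pure_order F n \<longleftrightarrow> F 0 = 0 \<and> \<not> germ_eq F (\<lambda>p. p) \<and>
    (let g = (\<lambda>p. fst (F p) - fst p); h = (\<lambda>p. snd (F p) - snd p) in
      \<exists>l. \<exists>g\<^sub>o\<in>germs2. \<exists>h\<^sub>o\<in>germs2. germ_is_gcd l g h \<and>
        germ_eq g (\<lambda>p. l p * g\<^sub>o p) \<and> germ_eq h (\<lambda>p. l p * h\<^sub>o p) \<and>
        n = min (germ_order g\<^sub>o) (germ_order h\<^sub>o))"

section \<open>The projective line\<close>

definition line_through :: "complex \<times> complex \<Rightarrow> (complex \<times> complex) set"
  where "line_through v = range (\<lambda>c. (c * fst v, c * snd v))"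

typedef proj_line = "{L. \<exists>v. v \<noteq> 0 \<and> L = line_through v}"
  morphisms points_of Abs_proj_line
proof -
  have "(1, 0) \<noteq> (0 :: complex \<times> complex)" by (simp add: zero_prod_def)
  then show ?thesis by blast
qed

text \<open>The canonical projection; the value at \<open>0\<close> is meaningless.\<close>

definition proj_pt :: "complex \<times> complex \<Rightarrow> proj_line"
  where "proj_pt v = Abs_proj_line (line_through v)"

lemma points_of_proj_pt: "v \<noteq> 0 \<Longrightarrow> points_of (proj_pt v) = line_through v"
  unfolding proj_pt_def by (rule Abs_proj_line_inverse) blast

lemma proj_pt_cases: obtains v where "v \<noteq> 0" "L = proj_pt v"
proof -
  have "points_of L \<in> {L. \<exists>v. v \<noteq> 0 \<and> L = line_through v}" by (rule points_of)
  then obtain v where v: "v \<noteq> 0" "points_of L = line_through v" by blast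
  have "L = Abs_proj_line (points_of L)" by (rule points_of_inverse [symmetric])
  also have "\<dots> = proj_pt v" by (simp only: v(2) proj_pt_def)
  finally show ?thesis using v(1) that by blast
qed

text \<open>The quotient topology with respect to \<open>proj_pt\<close> on the complement of the origin.\<close>

instantiation proj_line :: topological_space
begin

definition open_proj_line :: "proj_line set \<Rightarrow> bool"
  where "open_proj_line A \<longleftrightarrow> open {v. v \<noteq> 0 \<and> proj_pt v \<in> A}"

instance
proof
  have "{v. v \<noteq> 0 \<and> proj_pt v \<in> UNIV} = - {0}" by auto
  then show "open (UNIV :: proj_line set)"
    unfolding open_proj_line_def by (simp add: open_Compl)
next
  fix A B :: "proj_line set"
  assume AB: "open A" "open B"
  have "{v. v \<noteq> 0 \<and> proj_pt v \<in> A \<inter> B} =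
    {v. v \<noteq> 0 \<and> proj_pt v \<in> A} \<inter> {v. v \<noteq> 0 \<and> proj_pt v \<in> B}" by blast
  then show "open (A \<inter> B)" using AB unfolding open_proj_line_def by (simp only: open_Int)
next
  fix K :: "proj_line set set"
  assume K: "\<forall>A\<in>K. open A"
  have "{v. v \<noteq> 0 \<and> proj_pt v \<in> \<Union>K} = (\<Union>A\<in>K. {v. v \<noteq> 0 \<and> proj_pt v \<in> A})" by blast
  moreover have "open (\<Union>A\<in>K. {v. v \<noteq> 0 \<and> proj_pt v \<in> A})"
    using K unfolding open_proj_line_def by (intro open_UN) blast
  ultimately show "open (\<Union>K)" unfolding open_proj_line_def by (simp only:)
qed

end

section \<open>Order, dicritical origin, characteristic directions\<close>

definition map_order :: "(complex \<times> complex \<Rightarrow> complex \<times> complex) \<Rightarrow> nat"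
  where "map_order f = (LEAST k. 2 \<le> k \<and>
    (\<exists>p. hom_part (\<lambda>q. fst (f q)) k p \<noteq> 0 \<or> hom_part (\<lambda>q. snd (f q)) k p \<noteq> 0))"

definition dicritical :: "(complex \<times> complex \<Rightarrow> complex \<times> complex) \<Rightarrow> bool"
  where "dicritical f \<longleftrightarrow> (\<forall>z\<^sub>1 z\<^sub>2.
    z\<^sub>2 * hom_part (\<lambda>q. fst (f q)) (map_order f) (z\<^sub>1, z\<^sub>2) =
    z\<^sub>1 * hom_part (\<lambda>q. snd (f q)) (map_order f) (z\<^sub>1, z\<^sub>2))"

definition characteristic_direction ::
    "(complex \<times> complex \<Rightarrow> complex \<times> complex) \<Rightarrow> proj_line \<Rightarrow> bool"
  where "characteristic_direction f L \<longleftrightarrow> (\<exists>v c. v \<noteq> 0 \<and> L = proj_pt v \<and>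
    hom_part (\<lambda>q. fst (f q)) (map_order f) v = c * fst v \<and>
    hom_part (\<lambda>q. snd (f q)) (map_order f) v = c * snd v)"

section \<open>The blow-up of the origin\<close>

type_synonym blowup_point = "(complex \<times> complex) \<times> proj_line"

text \<open>The blow-up \<open>M\<close> is the incidence variety, with \<open>\<pi> = fst\<close>. The exceptional divisor is
  identified with the projective line by \<open>L \<mapsto> (0, L)\<close>.\<close>

definition blowup :: "blowup_point set"
  where "blowup = {(x, L). x \<in> points_of L}"

definition exceptional_divisor :: "blowup_point set"
  where "exceptional_divisor = {0} \<times> UNIV"

text \<open>The two standard affine parametrizations (inverses of the charts) giving \<open>M\<close> its complex
  structure; in both the exceptional divisor is \<open>z = 0\<close>.\<close>

definition blowup_chart1 :: "complex \<times> complex \<Rightarrow> blowup_point"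
  where "blowup_chart1 = (\<lambda>(z, w). ((z, z * w), proj_pt (1, w)))"

definition blowup_chart2 :: "complex \<times> complex \<Rightarrow> blowup_point"
  where "blowup_chart2 = (\<lambda>(z, w). ((z * w, z), proj_pt (w, 1)))"

lemma line_through_eq1: "line_through (1, w) = line_through (1, w') \<longleftrightarrow> w = w'"
proof
  assume "line_through (1, w) = line_through (1, w')"
  moreover have "(1, w) \<in> line_through (1, w)"
    unfolding line_through_def by (rule image_eqI[of _ _ 1]) auto
  ultimately show "w = w'" unfolding line_through_def by auto
qed simp

lemma line_through_eq2: "line_through (w, 1) = line_through (w', 1) \<longleftrightarrow> w = w'"
proof
  assume "line_through (w, 1) = line_through (w', 1)"
  moreover have "(w, 1) \<in> line_through (w, 1)"
    unfolding line_through_def by (rule image_eqI[of _ _ 1]) auto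
  ultimately show "w = w'" unfolding line_through_def by auto
qed simp

lemma proj_pt_eq1: "proj_pt (1, w) = proj_pt (1, w') \<longleftrightarrow> w = w'"
proof -
  have "(1, w) \<noteq> (0 :: complex \<times> complex)" "(1, w') \<noteq> (0 :: complex \<times> complex)"
    by (simp_all add: zero_prod_def)
  then show ?thesis by (metis line_through_eq1 points_of_proj_pt)
qed

lemma proj_pt_eq2: "proj_pt (w, 1) = proj_pt (w', 1) \<longleftrightarrow> w = w'"
proof -
  have "(w, 1) \<noteq> (0 :: complex \<times> complex)" "(w', 1) \<noteq> (0 :: complex \<times> complex)"
    by (simp_all add: zero_prod_def)
  then show ?thesis by (metis line_through_eq2 points_of_proj_pt)
qed

lemma inj_blowup_chart1: "inj blowup_chart1"
  by (auto simp: inj_on_def blowup_chart1_def proj_pt_eq1)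

lemma inj_blowup_chart2: "inj blowup_chart2"
  by (auto simp: inj_on_def blowup_chart2_def proj_pt_eq2)

lemma line_through_scale:
  assumes "c \<noteq> 0" shows "line_through (c * a, c * b) = line_through (a, b)"
proof
  show "line_through (c * a, c * b) \<subseteq> line_through (a, b)"
  proof
    fix x assume "x \<in> line_through (c * a, c * b)"
    then obtain d where "x = (d * (c * a), d * (c * b))" by (auto simp: line_through_def)
    then have "x = ((d * c) * a, (d * c) * b)" by simp
    then show "x \<in> line_through (a, b)"
      unfolding line_through_def by (intro image_eqI[where x = "d * c"]) simp_all
  qed
next
  show "line_through (a, b) \<subseteq> line_through (c * a, c * b)"
  proof
    fix x assume "x \<in> line_through (a, b)"
    then obtain d where "x = (d * a, d * b)" by (auto simp: line_through_def)
    then have "x = ((d / c) * (c * a), (d / c) * (c * b))" using assms by simp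
    then show "x \<in> line_through (c * a, c * b)"
      unfolding line_through_def by (intro image_eqI[where x = "d / c"]) simp_all
  qed
qed

lemma proj_pt_affine_cases:
  obtains w where "L = proj_pt (1, w)" | "L = proj_pt (0, 1)"
proof -
  obtain v where "v \<noteq> 0" "L = proj_pt v" by (rule proj_pt_cases)
  then obtain a b where ab: "(a, b) \<noteq> (0, 0)" "L = proj_pt (a, b)"
    by (cases v) (auto simp: zero_prod_def)
  show thesis
  proof (cases "a = 0")
    case True
    then have "L = proj_pt (0, 1)"
      using ab line_through_scale[of b 0 1] by (simp add: proj_pt_def)
    then show ?thesis using that by blast
  next
    case False
    then have "L = proj_pt (1, b / a)"
      using ab line_through_scale[of a 1 "b / a"] by (simp add: proj_pt_def)
    then show ?thesis using that by blast
  qed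
qed

lemma blowup_eq_charts: "blowup = range blowup_chart1 \<union> range blowup_chart2"
proof (intro set_eqI iffI)
  fix p assume "p \<in> blowup"
  then obtain x L where p: "p = (x, L)" "x \<in> points_of L" unfolding blowup_def by auto
  show "p \<in> range blowup_chart1 \<union> range blowup_chart2"
  proof (cases L rule: proj_pt_affine_cases)
    case (1 w)
    then obtain c where "x = (c, c * w)"
      using p by (auto simp: points_of_proj_pt zero_prod_def line_through_def)
    then have "p = blowup_chart1 (c, w)" using p 1 by (simp add: blowup_chart1_def)
    then show ?thesis by blast
  next
    case 2
    then obtain c where "x = (0, c)"
      using p by (auto simp: points_of_proj_pt zero_prod_def line_through_def)
    then have "p = blowup_chart2 (c, 0)" using p 2 by (simp add: blowup_chart2_def)
    then show ?thesis by blast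
  qed
next
  fix p assume "p \<in> range blowup_chart1 \<union> range blowup_chart2"
  then consider z w where "p = blowup_chart1 (z, w)" | z w where "p = blowup_chart2 (z, w)"
    by auto
  then show "p \<in> blowup"
  proof cases
    case (1 z w)
    moreover have "(z, z * w) \<in> line_through (1, w)"
      unfolding line_through_def by (intro image_eqI[where x = z]) simp_all
    ultimately show ?thesis
      by (simp add: blowup_def blowup_chart1_def points_of_proj_pt zero_prod_def)
  next
    case (2 z w)
    moreover have "(z * w, z) \<in> line_through (w, 1)"
      unfolding line_through_def by (intro image_eqI[where x = z]) simp_all
    ultimately show ?thesis
      by (simp add: blowup_def blowup_chart2_def points_of_proj_pt zero_prod_def)
  qed
qed

text \<open>Holomorphic maps \<open>W \<inter> M \<rightarrow> M\<close> for open \<open>W\<close>; by continuity, the sets on which the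
  coordinate expressions are required to be holomorphic are open.\<close>

definition blowup_holomorphic_on :: "(blowup_point \<Rightarrow> blowup_point) \<Rightarrow> blowup_point set \<Rightarrow> bool"
  where "blowup_holomorphic_on F W \<longleftrightarrow>
    F ` (W \<inter> blowup) \<subseteq> blowup \<and> continuous_on (W \<inter> blowup) F \<and>
    (\<forall>\<kappa>\<in>{blowup_chart1, blowup_chart2}. \<forall>\<kappa>'\<in>{blowup_chart1, blowup_chart2}.
      holomorphic_map2_on (inv \<kappa>' \<circ> F \<circ> \<kappa>) {p. \<kappa> p \<in> W \<and> F (\<kappa> p) \<in> range \<kappa>'})"

text \<open>\<open>F\<close> represents the germ about the exceptional divisor obtained by blowing up \<open>f\<close>; that germ
  is determined by these conditions.\<close>

definition is_blowup_of ::
    "(complex \<times> complex \<Rightarrow> complex \<times> complex) \<Rightarrow> (blowup_point \<Rightarrow> blowup_point) \<Rightarrow> bool"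
  where "is_blowup_of f F \<longleftrightarrow> (\<exists>W. open W \<and> exceptional_divisor \<subseteq> W \<and>
    blowup_holomorphic_on F W \<and> F ` exceptional_divisor \<subseteq> exceptional_divisor \<and>
    (\<forall>x \<in> W \<inter> blowup. fst (F x) = f (fst x)))"

text \<open>The standard parametrization of \<open>M\<close> centered at the point \<open>L\<close> of the exceptional divisor,
  and the expression of \<open>F\<close> in it. The notions evaluated below in these coordinates do not depend
  on the chosen centered chart (in which, for the index, the divisor is \<open>z = 0\<close>).\<close>

definition blowup_chart_at :: "proj_line \<Rightarrow> complex \<times> complex \<Rightarrow> blowup_point"
  where "blowup_chart_at L =
    (if \<exists>a. L = proj_pt (1, a)
     then (\<lambda>(z, w). blowup_chart1 (z, w + (THE a. L = proj_pt (1, a))))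
     else blowup_chart2)"

lemma blowup_chart_at_0: "blowup_chart_at L 0 = (0, L)"
proof (cases "\<exists>a. L = proj_pt (1, a)")
  case True
  then obtain a where a: "L = proj_pt (1, a)" by blast
  then have "blowup_chart_at L = (\<lambda>(z, w). blowup_chart1 (z, w + a))"
    by (simp add: blowup_chart_at_def proj_pt_eq1)
  then show ?thesis using a by (simp add: blowup_chart1_def zero_prod_def)
next
  case False
  have "L = proj_pt (0, 1)" by (cases L rule: proj_pt_affine_cases) (use False in blast)+
  moreover have "blowup_chart_at L = blowup_chart2"
    unfolding blowup_chart_at_def using False by (simp only: if_False)
  ultimately show ?thesis by (simp add: blowup_chart2_def zero_prod_def)
qed

definition local_form ::
    "(blowup_point \<Rightarrow> blowup_point) \<Rightarrow> proj_line \<Rightarrow> complex \<times> complex \<Rightarrow> complex \<times> complex"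
  where "local_form F L = inv (blowup_chart_at L) \<circ> F \<circ> blowup_chart_at L"

text \<open>Regularity of \<open>f\<close> along \<open>L\<close>, where \<open>F\<close> is the blow-up of \<open>f\<close>.\<close>

definition regular_along :: "(blowup_point \<Rightarrow> blowup_point) \<Rightarrow> proj_line \<Rightarrow> bool"
  where "regular_along F L \<longleftrightarrow> has_pure_order (local_form F L) 1"

text \<open>The residue at \<open>w = 0\<close> of the limit function \<open>k\<close>. It is only meaningful when \<open>F\<close> is tangential
  to the exceptional divisor; then the limit exists for all small \<open>w \<noteq> 0\<close>, and the possibly
  meaningless value \<open>k 0\<close> is irrelevant for the residue.\<close>

definition residual_index :: "(blowup_point \<Rightarrow> blowup_point) \<Rightarrow> proj_line \<Rightarrow> complex"
  where "residual_index F L = residue (\<lambda>w. Lim (at 0) (\<lambda>z.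
    (fst (local_form F L (z, w)) - z) / (z * (snd (local_form F L (z, w)) - w)))) 0"

section \<open>Parabolic curves\<close>

text \<open>\<open>U\<close> is the domain of the chosen representative \<open>f\<close>. Convergence of the iterates on the curve
  is, as usual for sequences of holomorphic maps, uniform on compact subsets.\<close>

definition parabolic_curve :: "(complex \<times> complex \<Rightarrow> complex \<times> complex) \<Rightarrow>
    (complex \<times> complex) set \<Rightarrow> complex set \<Rightarrow> (complex \<Rightarrow> complex \<times> complex) \<Rightarrow> bool"
  where "parabolic_curve f U \<Delta> \<phi> \<longleftrightarrow>
    open \<Delta> \<and> connected \<Delta> \<and> simply_connected \<Delta> \<and> 0 \<in> frontier \<Delta> \<and>
    (\<lambda>\<zeta>. fst (\<phi> \<zeta>)) holomorphic_on \<Delta> \<and> (\<lambda>\<zeta>. snd (\<phi> \<zeta>)) holomorphic_on \<Delta> \<and>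
    inj_on \<phi> \<Delta> \<and> (\<phi> \<longlongrightarrow> 0) (at 0 within \<Delta>) \<and>
    \<phi> ` \<Delta> \<subseteq> U \<and> f ` (\<phi> ` \<Delta>) \<subseteq> \<phi> ` \<Delta> \<and>
    (\<forall>K. compact K \<and> K \<subseteq> \<Delta> \<longrightarrow>
      uniform_limit K (\<lambda>k \<zeta>. (f ^^ k) (\<phi> \<zeta>)) (\<lambda>_. 0) sequentially)"

definition tangent_at_origin :: "(complex \<Rightarrow> complex \<times> complex) \<Rightarrow> complex set \<Rightarrow> proj_line \<Rightarrow> bool"
  where "tangent_at_origin \<phi> \<Delta> L \<longleftrightarrow> (\<forall>\<^sub>F \<zeta> in at 0 within \<Delta>. \<phi> \<zeta> \<noteq> 0) \<and>
    ((\<lambda>\<zeta>. proj_pt (\<phi> \<zeta>)) \<longlongrightarrow> L) (at 0 within \<Delta>)"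

end

theory Submission
  imports Defs "HOL-Real_Asymp.Real_Asymp"
begin

text \<open>In the blow-up chart at \<open>[v]\<close> the lifted map is \<open>(z, w) \<mapsto> (z + z\<^sup>r a, w + z\<^sup>r\<^sup>-\<^sup>1 b)\<close>,
  where \<open>r\<close> is the order of \<open>f\<close>, and the index is the residue of \<open>a(0, w) / b(0, w)\<close> at \<open>0\<close>.
  As the fixed point is isolated, regularity says that \<open>a(0, 0)\<close> or the linear part of \<open>b\<close> does not vanish.
  A nonzero residue then leaves two cases: \<open>a(0, 0) \<noteq> 0\<close>, or for some \<open>k \<ge> 2\<close> the function \<open>a(0, w)\<close>
  vanishes to the exact order \<open>k - 1\<close> and \<open>b(0, w)\<close> at least to the order \<open>k\<close>, while \<open>\<partial>b/\<partial>z(0, 0) \<noteq> 0\<close>.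

  In both cases the map agrees to high order with the time-one map of a polynomial vector field
  \<open>z' = z\<^sup>r A, w' = z\<^sup>r\<^sup>-\<^sup>1 B\<close>, which has a complex solution curve on a half plane \<open>Re t > R\<close> tending to the
  origin: in the second case one substitutes \<open>z = x w\<^sup>k\<close>. With \<open>u = Ln t\<close> the half plane becomes part of the
  strip \<open>\<bar>Im u\<bar> < \<pi>/2\<close>, where integration from a suitable base point or from infinity inverts \<open>d/du + \<mu>\<close>
  boundedly for exponential weights, so that the solution is a fixed point of a contraction. A second contraction, for the
  difference equation along \<open>t \<mapsto> t + 1\<close>, corrects it to a curve on which the lifted map is conjugate
  to \<open>t \<mapsto> t + 1\<close>. Restricted to a sector and written in \<open>\<zeta> = 1/t\<close>, it is the parabolic curve.\<close>

section \<open>Holomorphic functions of two variables\<close>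

text \<open>The obstacle is a loop between constants. Along a curve with
  \<open>z^(r-1) w^(k-1)\<close> of size \<open>1/t\<close>, the linearised invariance equation has
  coefficients of size \<open>C/t\<close>, so its solutions behave like powers of \<open>t\<close>
  with exponents that are merely bounded. Summation from infinity contracts without any
  diagonalisation once the correction is sought in the class \<open>O(t^-q)\<close> with
  \<open>q\<close> large compared with \<open>C\<close>. The price is an approximate curve whose
  error relative to its size is \<open>O(t^(-q-1))\<close>. Such a curve comes from a field that
  agrees with the map to a large order \<open>n\<close>, and the field changes with
  \<open>n\<close>. Therefore the constants \<open>C\<close>, \<open>\<delta>\<close>,
  \<open>c\<close> of the solution curves are fixed from a few low-order coefficients alone, before
  the field is known, and the interpolation preserves these coefficients.

  In the second case the rescaled coordinate \<open>x = z / w^k\<close> tends to an equilibrium. If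
  that is nonzero, \<open>x\<close> is the equilibrium times an exponential close to 1; if it is 0,
  the equilibrium is double and \<open>x\<close> decays only like \<open>1 / Ln t\<close>, which
  needs its own differential equation and weights.\<close>

abbreviation bidisc :: "real \<Rightarrow> (complex \<times> complex) set" where "bidisc e \<equiv> ball 0 e \<times> ball 0 e"

abbreviation dz :: "(complex \<times> complex \<Rightarrow> complex) \<Rightarrow> complex \<times> complex \<Rightarrow> complex"
  where "dz g \<equiv> \<lambda>p. deriv (\<lambda>\<zeta>. g (\<zeta>, snd p)) (fst p)"

abbreviation dw :: "(complex \<times> complex \<Rightarrow> complex) \<Rightarrow> complex \<times> complex \<Rightarrow> complex"
  where "dw g \<equiv> \<lambda>p. deriv (\<lambda>\<eta>. g (fst p, \<eta>)) (snd p)"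

lemma holomorphic2_on_subset: "holomorphic2_on g U \<Longrightarrow> V \<subseteq> U \<Longrightarrow> holomorphic2_on g V"
  unfolding holomorphic2_on_def by blast

lemma holomorphic2_has_derivative:
  assumes "holomorphic2_on g U" "p \<in> U"
  shows "(g has_derivative (\<lambda>h. dz g p * fst h + dw g p * snd h)) (at p)"
proof -
  obtain a b where d: "(g has_derivative (\<lambda>h. a * fst h + b * snd h)) (at (fst p, snd p))"
    using assms unfolding holomorphic2_on_def by auto
  have "((\<lambda>\<zeta>. g (\<zeta>, snd p)) has_derivative (\<lambda>h. a * fst (h, 0::complex) + b * snd (h, 0::complex))) (at (fst p))"
    by (rule has_derivative_compose[where f = "\<lambda>\<zeta>. (\<zeta>, snd p)" and g = g, OF _ d])
       (auto intro!: derivative_eq_intros)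
  then have "DERIV (\<lambda>\<zeta>. g (\<zeta>, snd p)) (fst p) :> a"
    by (simp add: has_field_derivative_def)
  then have 1: "dz g p = a" by (rule DERIV_imp_deriv)
  have "((\<lambda>\<zeta>. g (fst p, \<zeta>)) has_derivative (\<lambda>h. a * fst (0::complex, h) + b * snd (0::complex, h))) (at (snd p))"
    by (rule has_derivative_compose[where f = "\<lambda>\<zeta>. (fst p, \<zeta>)" and g = g, OF _ d])
       (auto intro!: derivative_eq_intros)
  then have "DERIV (\<lambda>\<zeta>. g (fst p, \<zeta>)) (snd p) :> b"
    by (simp add: has_field_derivative_def)
  then have "dw g p = b" by (rule DERIV_imp_deriv)
  with 1 d show ?thesis by simp
qed

lemma holomorphic2_has_field_derivative_curve:
  assumes "holomorphic2_on g U" "(x t, y t) \<in> U"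
    "DERIV x t :> x'" "DERIV y t :> y'"
  shows "DERIV (\<lambda>t. g (x t, y t)) t :> dz g (x t, y t) * x' + dw g (x t, y t) * y'"
proof -
  have "((\<lambda>t. g (x t, y t)) has_derivative
      (\<lambda>h. dz g (x t, y t) * fst (x' * h, y' * h) + dw g (x t, y t) * snd (x' * h, y' * h))) (at t)"
    by (rule has_derivative_compose[where f = "\<lambda>t. (x t, y t)", OF _ holomorphic2_has_derivative[OF assms(1,2)]])
      (use assms(3,4) in \<open>auto intro!: has_derivative_Pair simp: has_field_derivative_def\<close>)
  then show ?thesis unfolding has_field_derivative_def
    by (rule has_derivative_eq_rhs) (auto simp: algebra_simps)
qed

lemma holomorphic2_compose_curve:
  assumes "holomorphic2_on g U" "x holomorphic_on D" "y holomorphic_on D" "open D"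
    "\<And>t. t \<in> D \<Longrightarrow> (x t, y t) \<in> U"
  shows "(\<lambda>t. g (x t, y t)) holomorphic_on D"
proof -
  have "(\<lambda>t. g (x t, y t)) field_differentiable at t" if "t \<in> D" for t
    using holomorphic2_has_field_derivative_curve[OF assms(1) assms(5)[OF that]
       holomorphic_derivI[OF assms(2,4) that] holomorphic_derivI[OF assms(3,4) that]]
    by (auto simp: field_differentiable_def)
  then show ?thesis
    using assms(4) by (simp add: holomorphic_on_open field_differentiable_def)
qed

lemma holomorphic2_on_continuous_on:
  "holomorphic2_on g U \<Longrightarrow> continuous_on U g"
  unfolding holomorphic2_on_def
  by (auto intro!: continuous_at_imp_continuous_on dest!: bspec intro: has_derivative_continuous)

lemma holomorphic2_compose:
  assumes "holomorphic2_on g V" "holomorphic2_on x U" "holomorphic2_on y U"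
    "\<And>p. p \<in> U \<Longrightarrow> (x p, y p) \<in> V"
  shows "holomorphic2_on (\<lambda>p. g (x p, y p)) U"
  unfolding holomorphic2_on_def
proof
  fix p assume p: "p \<in> U"
  obtain a b where g: "(g has_derivative (\<lambda>h. a * fst h + b * snd h)) (at (x p, y p))"
    using assms(1,4) p unfolding holomorphic2_on_def by blast
  obtain a1 b1 where x: "(x has_derivative (\<lambda>h. a1 * fst h + b1 * snd h)) (at p)"
    using assms(2) p unfolding holomorphic2_on_def by blast
  obtain a2 b2 where y: "(y has_derivative (\<lambda>h. a2 * fst h + b2 * snd h)) (at p)"
    using assms(3) p unfolding holomorphic2_on_def by blast
  have "((\<lambda>p. g (x p, y p)) has_derivative
      (\<lambda>h. a * fst (a1 * fst h + b1 * snd h, a2 * fst h + b2 * snd h) +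
           b * snd (a1 * fst h + b1 * snd h, a2 * fst h + b2 * snd h))) (at p)"
    by (rule has_derivative_compose[where f = "\<lambda>p. (x p, y p)", OF has_derivative_Pair[OF x y] g])
  then show "\<exists>a b. ((\<lambda>p. g (x p, y p)) has_derivative (\<lambda>h. a * fst h + b * snd h)) (at p)"
    by (intro exI[of _ "a * a1 + b * a2"] exI[of _ "a * b1 + b * b2"])
       (erule has_derivative_eq_rhs, auto simp: algebra_simps)
qed

lemma holomorphic2_compose1:
  assumes "h holomorphic_on V" "open V" "holomorphic2_on x U" "\<And>p. p \<in> U \<Longrightarrow> x p \<in> V"
  shows "holomorphic2_on (\<lambda>p. h (x p)) U"
  unfolding holomorphic2_on_def
proof
  fix p assume p: "p \<in> U"
  obtain a1 b1 where x: "(x has_derivative (\<lambda>h. a1 * fst h + b1 * snd h)) (at p)"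
    using assms(3) p unfolding holomorphic2_on_def by blast
  have h: "(h has_derivative (*) (deriv h (x p))) (at (x p))"
    using holomorphic_derivI[OF assms(1,2) assms(4)[OF p]] by (simp add: has_field_derivative_def)
  show "\<exists>a b. ((\<lambda>p. h (x p)) has_derivative (\<lambda>h. a * fst h + b * snd h)) (at p)"
    by (intro exI[of _ "deriv h (x p) * a1"] exI[of _ "deriv h (x p) * b1"]
          has_derivative_eq_rhs[OF has_derivative_compose[OF x h]])
       (auto simp: algebra_simps)
qed

lemma holomorphic2_const: "holomorphic2_on (\<lambda>p. c) U"
  unfolding holomorphic2_on_def by (intro ballI exI[of _ 0]) auto

lemma holomorphic2_fst: "holomorphic2_on fst U"
  unfolding holomorphic2_on_def
  by (intro ballI exI[of _ 1] exI[of _ 0]) (auto intro!: derivative_eq_intros)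

lemma holomorphic2_snd: "holomorphic2_on snd U"
  unfolding holomorphic2_on_def
  by (intro ballI exI[of _ 1] exI[of _ 0]) (auto intro!: derivative_eq_intros)

lemma holomorphic2_add:
  assumes "holomorphic2_on f U" "holomorphic2_on g U"
  shows "holomorphic2_on (\<lambda>p. f p + g p) U"
proof -
  have "holomorphic2_on (\<lambda>p. fst p + snd p) UNIV"
    unfolding holomorphic2_on_def
    by (intro ballI exI[of _ 1]) (auto intro!: derivative_eq_intros)
  from holomorphic2_compose[OF this assms] show ?thesis by simp
qed

lemma holomorphic2_mult:
  assumes "holomorphic2_on f U" "holomorphic2_on g U"
  shows "holomorphic2_on (\<lambda>p. f p * g p) U"
proof -
  have "holomorphic2_on (\<lambda>p. fst p * snd p) UNIV"
    unfolding holomorphic2_on_def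
  proof
    fix p :: "complex \<times> complex"
    have "((\<lambda>p. fst p * snd p) has_derivative (\<lambda>h. snd p * fst h + fst p * snd h)) (at p)"
      by (auto intro!: derivative_eq_intros)
    then show "\<exists>a b. ((\<lambda>p. fst p * snd p) has_derivative (\<lambda>h. a * fst h + b * snd h)) (at p)"
      by blast
  qed
  from holomorphic2_compose[OF this assms] show ?thesis by simp
qed

lemma holomorphic2_uminus:
  "holomorphic2_on f U \<Longrightarrow> holomorphic2_on (\<lambda>p. - f p) U"
  using holomorphic2_mult[OF holomorphic2_const[of "-1"], of f U] by simp

lemma holomorphic2_diff:
  "holomorphic2_on f U \<Longrightarrow> holomorphic2_on g U \<Longrightarrow> holomorphic2_on (\<lambda>p. f p - g p) U"
  using holomorphic2_add[OF _ holomorphic2_uminus, of f U g] by simp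

lemma holomorphic2_power:
  "holomorphic2_on f U \<Longrightarrow> holomorphic2_on (\<lambda>p. f p ^ n) U"
  by (induction n) (simp_all add: holomorphic2_const holomorphic2_mult)

lemma holomorphic2_divide:
  assumes "holomorphic2_on f U" "holomorphic2_on g U" "\<And>p. p \<in> U \<Longrightarrow> g p \<noteq> 0"
  shows "holomorphic2_on (\<lambda>p. f p / g p) U"
proof -
  have "holomorphic2_on (\<lambda>p. inverse (g p)) U"
    by (rule holomorphic2_compose1[where V = "-{0}", OF _ _ assms(2)])
       (use assms(3) in \<open>auto intro!: holomorphic_intros\<close>)
  from holomorphic2_mult[OF assms(1) this] show ?thesis by (simp add: divide_inverse)
qed

lemma holomorphic2_sum:
  "(\<And>i. i \<in> I \<Longrightarrow> holomorphic2_on (f i) U) \<Longrightarrow> holomorphic2_on (\<lambda>p. \<Sum>i\<in>I. f i p) U"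
  by (induction I rule: infinite_finite_induct) (simp_all add: holomorphic2_const holomorphic2_add)

lemmas holomorphic2_intros = holomorphic2_const holomorphic2_fst holomorphic2_snd holomorphic2_add
  holomorphic2_mult holomorphic2_uminus holomorphic2_diff holomorphic2_power holomorphic2_divide
  holomorphic2_sum

lemma holomorphic2_swap:
  assumes "holomorphic2_on g U"
  shows "holomorphic2_on (\<lambda>p. g (snd p, fst p)) {p. (snd p, fst p) \<in> U}"
  by (rule holomorphic2_compose[OF assms]) (auto intro: holomorphic2_intros)

lemma holomorphic2_slice1:
  assumes "holomorphic2_on g U" "open U"
  shows "(\<lambda>\<zeta>. g (\<zeta>, w)) holomorphic_on {\<zeta>. (\<zeta>, w) \<in> U}"
proof -
  have "open {\<zeta>. (\<zeta>, w) \<in> U}"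
    using open_vimage[OF assms(2), of "\<lambda>\<zeta>. (\<zeta>, w)"]
    by (simp add: vimage_def continuous_on_Pair)
  then show ?thesis by (intro holomorphic2_compose_curve[OF assms(1)]) auto
qed

lemma holomorphic2_slice2:
  assumes "holomorphic2_on g U" "open U"
  shows "(\<lambda>\<zeta>. g (z, \<zeta>)) holomorphic_on {\<zeta>. (z, \<zeta>) \<in> U}"
proof -
  have "open {\<zeta>. (z, \<zeta>) \<in> U}"
    using open_vimage[OF assms(2), of "\<lambda>\<zeta>. (z, \<zeta>)"]
    by (simp add: vimage_def continuous_on_Pair)
  then show ?thesis by (intro holomorphic2_compose_curve[OF assms(1)]) auto
qed

section \<open>Separate and joint holomorphy\<close>

lemma open_contains_polydisc:
  fixes U :: "(complex \<times> complex) set"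
  assumes "open U" "(a, b) \<in> U"
  obtains e where "e > 0" "ball a e \<times> ball b e \<subseteq> U"
proof -
  obtain A B where AB: "open A" "open B" "(a, b) \<in> A \<times> B" "A \<times> B \<subseteq> U"
    using open_prod_elim[OF assms] by blast
  then obtain e1 where e1: "e1 > 0" "ball a e1 \<subseteq> A" by (auto simp: open_contains_ball)
  moreover obtain e2 where "e2 > 0" "ball b e2 \<subseteq> B" using AB by (auto simp: open_contains_ball)
  ultimately show ?thesis using AB(4)
    by (intro that[of "min e1 e2"]) (auto simp: subset_iff)
qed

lemma open_slice1: "open U \<Longrightarrow> open {\<zeta>. (\<zeta>, w) \<in> U}"
  using open_vimage[of U "\<lambda>\<zeta>. (\<zeta>, w)"] by (simp add: vimage_def continuous_on_Pair)

lemma open_slice2: "open U \<Longrightarrow> open {\<zeta>. (w, \<zeta>) \<in> U}"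
  using open_vimage[of U "\<lambda>\<zeta>. (w, \<zeta>)"] by (simp add: vimage_def continuous_on_Pair)

lemma open_contains_closed_polydisc:
  fixes U :: "(complex \<times> complex) set"
  assumes "open U" "(a, b) \<in> U"
  obtains e where "e > 0" "cball a e \<times> cball b e \<subseteq> U"
proof -
  obtain e where "e > 0" "ball a e \<times> ball b e \<subseteq> U" by (rule open_contains_polydisc[OF assms])
  then show ?thesis by (intro that[of "e / 2"]) (auto simp: subset_iff)
qed

text \<open>After translation to a fixed disc around 0, the slices through nearby points converge
  uniformly, by uniform continuity of \<open>g\<close> on a compact bidisc. Derivatives at a point
  pass to uniform limits of holomorphic functions.\<close>

lemma continuous_on_dz:
  assumes U: "open U" and cont: "continuous_on U g"
    and hol: "\<And>w. (\<lambda>\<zeta>. g (\<zeta>, w)) holomorphic_on {\<zeta>. (\<zeta>, w) \<in> U}"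
  shows "continuous_on U (dz g)"
proof (rule continuous_at_imp_continuous_on, rule ballI)
  fix p assume "p \<in> U"
  obtain a b where p: "p = (a, b)" by (cases p)
  with \<open>p \<in> U\<close> obtain e where e: "e > 0" "cball a e \<times> cball b e \<subseteq> U"
    using open_contains_closed_polydisc[OF U] by blast
  have uc: "uniformly_continuous_on (cball a e \<times> cball b e) g"
    by (intro compact_uniformly_continuous continuous_on_subset[OF cont e(2)] compact_Times compact_cball)
  define h where "h = (\<lambda>q \<zeta>. g (fst q + \<zeta>, snd q) :: complex)"
  have near: "\<forall>\<^sub>F q in at p. dist q p < e / 2"
    using e(1) by (auto simp: eventually_at intro!: exI[of _ "e / 2"])
  have in_e: "(fst q + \<zeta>, snd q) \<in> cball a e \<times> cball b e"
    if "dist q p < e / 2" "\<zeta> \<in> ball 0 (e / 2)" for q \<zeta>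
  proof -
    have "dist (fst q) a < e / 2" "dist (snd q) b < e / 2"
      using dist_fst_le[of q p] dist_snd_le[of q p] that p by auto
    moreover have "dist (fst q + \<zeta>) a \<le> dist (fst q) a + norm \<zeta>"
      by (simp add: dist_norm) (metis add_diff_eq diff_add_eq norm_triangle_ineq)
    moreover have "0 \<le> dist (snd q) b" by simp
    moreover have "norm \<zeta> < e / 2" using that by simp
    ultimately have "dist (fst q + \<zeta>) a \<le> e" "dist (snd q) b \<le> e" by linarith+
    then show ?thesis by (simp add: dist_commute)
  qed
  have "uniform_limit (ball 0 (e / 2)) h (h p) (at p)"
  proof (rule uniform_limitI)
    fix \<epsilon> :: real assume "\<epsilon> > 0"
    then obtain d where d: "d > 0" "\<And>x y. x \<in> cball a e \<times> cball b e \<Longrightarrow> y \<in> cball a e \<times> cball b e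
        \<Longrightarrow> dist y x < d \<Longrightarrow> dist (g y) (g x) < \<epsilon>"
      using uc unfolding uniformly_continuous_on_def by metis
    have "\<forall>\<^sub>F q in at p. dist q p < d"
      using d(1) by (auto simp: eventually_at intro!: exI[of _ d])
    with near show "\<forall>\<^sub>F q in at p. \<forall>\<zeta>\<in>ball 0 (e / 2). dist (h q \<zeta>) (h p \<zeta>) < \<epsilon>"
    proof eventually_elim
      case (elim q)
      show ?case
      proof
        fix \<zeta> :: complex assume z: "\<zeta> \<in> ball 0 (e / 2)"
        have "dist (fst q + \<zeta>, snd q) (fst p + \<zeta>, snd p) = dist q p"
          by (cases q, cases p) (simp add: dist_Pair_Pair dist_norm)
        then show "dist (h q \<zeta>) (h p \<zeta>) < \<epsilon>"
          unfolding h_def using z elim e(1) by (intro d(2) in_e) auto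
      qed
    qed
  qed
  moreover have "\<forall>\<^sub>F q in at p. h q holomorphic_on ball 0 (e / 2)"
    using near
  proof eventually_elim
    case (elim q)
    have "(\<lambda>\<zeta>. fst q + \<zeta>) ` ball 0 (e / 2) \<subseteq> {\<zeta>. (\<zeta>, snd q) \<in> U}"
      using in_e[OF elim] e(2) by blast
    then have "(\<lambda>\<zeta>. g (\<zeta>, snd q)) \<circ> (\<lambda>\<zeta>. fst q + \<zeta>) holomorphic_on ball 0 (e / 2)"
      by (intro holomorphic_on_compose_gen[OF _ hol[of "snd q"]]) (intro holomorphic_intros)
    then show ?case by (simp add: h_def o_def)
  qed
  ultimately have "((\<lambda>q. deriv (h q) 0) \<longlongrightarrow> deriv (h p) 0) (at p)"
    by (rule deriv_complex_uniform_limit) (use e(1) in auto)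
  moreover have "deriv (h q) 0 = dz g q" for q
    unfolding h_def by (subst deriv_shift_0[of _ "fst q"]) (simp add: o_def)
  ultimately show "isCont (dz g) p" by (simp add: isCont_def)
qed

lemma continuous_on_dw:
  assumes U: "open U" and cont: "continuous_on U g"
    and hol: "\<And>z. (\<lambda>\<zeta>. g (z, \<zeta>)) holomorphic_on {\<zeta>. (z, \<zeta>) \<in> U}"
  shows "continuous_on U (dw g)"
proof -
  define V where "V = (\<lambda>p. (snd p, fst p)) -` U"
  have V: "open V" unfolding V_def
    by (intro open_vimage[OF U]) (intro continuous_intros)
  have "continuous_on V (dz (\<lambda>p. g (snd p, fst p)))"
  proof (rule continuous_on_dz[OF V])
    show "continuous_on V (\<lambda>p. g (snd p, fst p))"
      by (rule continuous_on_compose2[OF cont]) (auto simp: V_def intro!: continuous_intros)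
    show "(\<lambda>\<zeta>. g (snd (\<zeta>, w), fst (\<zeta>, w))) holomorphic_on {\<zeta>. (\<zeta>, w) \<in> V}" for w
      using hol[of w] by (simp add: V_def)
  qed
  then have "continuous_on U (\<lambda>p. dz (\<lambda>p. g (snd p, fst p)) (snd p, fst p))"
    by (rule continuous_on_compose2) (auto simp: V_def intro!: continuous_intros)
  then show ?thesis by simp
qed

text \<open>One partial derivative at the point together with continuity of the other one yields
  joint differentiability; the continuity is \<open>continuous_on_dw\<close>. The result reduces
  holomorphy of \<open>dz g\<close> and of quotients by \<open>z\<close> to a check on
  slices.\<close>

theorem osgood:
  assumes U: "open U" and cont: "continuous_on U g"
    and hol1: "\<And>w. (\<lambda>\<zeta>. g (\<zeta>, w)) holomorphic_on {\<zeta>. (\<zeta>, w) \<in> U}"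
    and hol2: "\<And>z. (\<lambda>\<zeta>. g (z, \<zeta>)) holomorphic_on {\<zeta>. (z, \<zeta>) \<in> U}"
  shows "holomorphic2_on g U"
  unfolding holomorphic2_on_def
proof
  fix p assume "p \<in> U"
  obtain a b where p: "p = (a, b)" by (cases p)
  with \<open>p \<in> U\<close> obtain e where e: "e > 0" "ball a e \<times> ball b e \<subseteq> U"
    using open_contains_polydisc[OF U] by blast
  have cdw: "continuous_on U (dw g)" by (rule continuous_on_dw[OF U cont hol2])
  have "((\<lambda>(x, y). g (x, y)) has_derivative
      (\<lambda>(tx, ty). dz g (a, b) * tx + blinfun_apply (blinfun_mult_right (dw g (a, b))) ty))
      (at (a, b) within ball a e \<times> ball b e)"
  proof (rule has_derivative_partialsI[where fy = "\<lambda>x y. blinfun_mult_right (dw g (x, y))"])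
    have "DERIV (\<lambda>x. g (x, b)) a :> dz g (a, b)"
      using holomorphic_derivI[OF hol1 open_slice1[OF U], of a b] \<open>p \<in> U\<close> p by simp
    then show "((\<lambda>x. g (x, b)) has_derivative (*) (dz g (a, b))) (at a within ball a e)"
      by (simp add: has_field_derivative_def has_derivative_at_withinI)
  next
    fix x y assume "x \<in> ball a e" "y \<in> ball b e"
    then have "y \<in> {\<zeta>. (x, \<zeta>) \<in> U}" using e(2) by blast
    from holomorphic_derivI[OF hol2 open_slice2[OF U] this, of UNIV]
    have "DERIV (\<lambda>y. g (x, y)) y :> dw g (x, y)" by simp
    then show "((\<lambda>y. g (x, y)) has_derivative blinfun_apply (blinfun_mult_right (dw g (x, y))))
        (at y within ball b e)"
      by (simp add: has_field_derivative_def has_derivative_at_withinI blinfun_mult_right.rep_eq)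
  next
    have "continuous_on U (\<lambda>q. blinfun_mult_right (dw g q))"
      by (rule bounded_linear.continuous_on[OF bounded_linear_blinfun_mult_right cdw])
    then have "continuous_on (ball a e \<times> ball b e) (\<lambda>q. blinfun_mult_right (dw g q))"
      using e(2) by (rule continuous_on_subset)
    then show "continuous (at (a, b) within ball a e \<times> ball b e)
        (\<lambda>(x, y). blinfun_mult_right (dw g (x, y)))"
      using e(1) by (auto simp: continuous_on_eq_continuous_within split_def)
  qed (use e in auto)
  then have "(g has_derivative (\<lambda>h. dz g p * fst h + dw g p * snd h))
      (at (a, b) within ball a e \<times> ball b e)"
    by (simp add: split_def blinfun_mult_right.rep_eq p)
  then have "(g has_derivative (\<lambda>h. dz g p * fst h + dw g p * snd h)) (at p)"
    using e(1) by (subst (asm) at_within_open) (auto simp: p intro!: open_Times)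
  then show "\<exists>a b. (g has_derivative (\<lambda>h. a * fst h + b * snd h)) (at p)" by blast
qed

lemma holomorphic2_continuous_on_dz:
  "holomorphic2_on g U \<Longrightarrow> open U \<Longrightarrow> continuous_on U (dz g)"
  by (intro continuous_on_dz holomorphic2_on_continuous_on holomorphic2_slice1)

text \<open>By \<open>osgood\<close> the work lies in the second variable: there \<open>dz g\<close>
  is a locally uniform limit of difference quotients, each holomorphic in \<open>w\<close>.\<close>

theorem holomorphic2_dz:
  assumes g: "holomorphic2_on g U" and U: "open U"
  shows "holomorphic2_on (dz g) U"
proof (rule osgood[OF U])
  show cont: "continuous_on U (dz g)" by (rule holomorphic2_continuous_on_dz[OF assms])
  show "(\<lambda>\<zeta>. dz g (\<zeta>, w)) holomorphic_on {\<zeta>. (\<zeta>, w) \<in> U}" for w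
    using holomorphic_deriv[OF holomorphic2_slice1[OF g U] open_slice1[OF U], of w] by simp
  fix a
  have ev: "\<exists>d>0. (\<lambda>\<zeta>. dz g (a, \<zeta>)) holomorphic_on ball b d" if ab: "(a, b) \<in> U" for b
  proof -
    obtain e where e: "e > 0" "cball a e \<times> cball b e \<subseteq> U"
      using open_contains_closed_polydisc[OF U ab] by blast
    have uc: "uniformly_continuous_on (cball a e \<times> cball b e) (dz g)"
      by (intro compact_uniformly_continuous continuous_on_subset[OF cont e(2)] compact_Times compact_cball)
    define h where "h = (\<lambda>n. complex_of_real (e / real (Suc n)))"
    have hn: "norm (h n) = e / real (Suc n)" "h n \<noteq> 0" for n
      using e(1) unfolding h_def norm_of_real by (auto simp del: of_nat_Suc)
    have hle: "norm (h n) \<le> e" for n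
      using e(1) by (simp add: hn field_simps)
    have ul: "uniform_limit (cball b e) (\<lambda>n w. (g (a + h n, w) - g (a, w)) / h n) (\<lambda>w. dz g (a, w)) sequentially"
    proof (rule uniform_limitI)
      fix \<epsilon> :: real assume "\<epsilon> > 0"
      then obtain d where d: "d > 0" "\<And>x y. x \<in> cball a e \<times> cball b e \<Longrightarrow> y \<in> cball a e \<times> cball b e
          \<Longrightarrow> dist y x < d \<Longrightarrow> dist (dz g y) (dz g x) < \<epsilon> / 2"
        using uc unfolding uniformly_continuous_on_def by (metis half_gt_zero)
      have "(\<lambda>n. e / real (Suc n)) \<longlonglongrightarrow> 0" by real_asymp
      then have "\<forall>\<^sub>F n in sequentially. e / real (Suc n) < d"
        using d(1) by (rule order_tendstoD)
      then show "\<forall>\<^sub>F n in sequentially. \<forall>w\<in>cball b e.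
          dist ((g (a + h n, w) - g (a, w)) / h n) (dz g (a, w)) < \<epsilon>"
      proof eventually_elim
        case (elim n)
        show ?case
        proof
          fix w assume w: "w \<in> cball b e"
          \<comment> \<open>Subtracting the linear term turns the mean value inequality into an
            estimate of the difference quotient against the derivative.\<close>
          define G where "G = (\<lambda>\<zeta>. g (\<zeta>, w) - dz g (a, w) * \<zeta>)"
          have "norm (G (a + h n) - G a) \<le> \<epsilon> / 2 * norm ((a + h n) - a)"
          proof (rule field_differentiable_bound[where S = "cball a (norm (h n))"])
            fix \<zeta> assume z: "\<zeta> \<in> cball a (norm (h n))"
            then have z': "\<zeta> \<in> cball a e" using hle[of n] by auto
            then have "(\<zeta>, w) \<in> U" using e(2) w by auto
            then have "DERIV (\<lambda>\<zeta>. g (\<zeta>, w)) \<zeta> :> dz g (\<zeta>, w)"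
              using holomorphic_derivI[OF holomorphic2_slice1[OF g U] open_slice1[OF U], of \<zeta> w] by simp
            then have "DERIV G \<zeta> :> (dz g (\<zeta>, w) - dz g (a, w) * 1)"
              unfolding G_def by (intro DERIV_diff DERIV_cmult DERIV_ident)
            then show "(G has_field_derivative (dz g (\<zeta>, w) - dz g (a, w))) (at \<zeta> within cball a (norm (h n)))"
              by (simp add: has_field_derivative_at_within)
            have "dist (dz g (\<zeta>, w)) (dz g (a, w)) < \<epsilon> / 2"
              using z z' w e(1) elim hn(1)[of n]
              by (intro d(2)) (auto simp: dist_Pair_Pair dist_commute)
            then show "norm (dz g (\<zeta>, w) - dz g (a, w)) \<le> \<epsilon> / 2" by (simp add: dist_norm)
          qed (auto simp: dist_norm)
          also have "G (a + h n) - G a = ((g (a + h n, w) - g (a, w)) / h n - dz g (a, w)) * h n"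
            using hn(2)[of n] by (simp add: G_def field_simps)
          finally have "norm ((g (a + h n, w) - g (a, w)) / h n - dz g (a, w)) \<le> \<epsilon> / 2"
            using hn(2)[of n] by (simp add: norm_mult)
          then show "dist ((g (a + h n, w) - g (a, w)) / h n) (dz g (a, w)) < \<epsilon>"
            using \<open>\<epsilon> > 0\<close> by (simp add: dist_norm)
        qed
      qed
    qed
    have "(\<lambda>w. dz g (a, w)) holomorphic_on ball b e"
    proof (rule holomorphic_uniform_sequence[where f = "\<lambda>n w. (g (a + h n, w) - g (a, w)) / h n"])
      fix n
      have "(\<lambda>\<zeta>. g (z, \<zeta>)) holomorphic_on ball b e" if "z \<in> cball a e" for z
        by (rule holomorphic_on_subset[OF holomorphic2_slice2[OF g U]]) (use that e(2) in auto)
      from this[of "a + h n"] this[of a] show "(\<lambda>w. (g (a + h n, w) - g (a, w)) / h n) holomorphic_on ball b e"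
        using hle[of n] e(1) hn(2)[of n] by (intro holomorphic_intros) (auto simp: dist_norm)
    next
      fix x assume "x \<in> ball b e"
      then obtain d where "d > 0" "cball x d \<subseteq> ball b e" using open_contains_cball[of "ball b e"] by blast
      then show "\<exists>d>0. cball x d \<subseteq> ball b e \<and>
          uniform_limit (cball x d) (\<lambda>n w. (g (a + h n, w) - g (a, w)) / h n) (\<lambda>w. dz g (a, w)) sequentially"
        using uniform_limit_on_subset[OF ul] ball_subset_cball by (intro exI[of _ d]) blast
    qed auto
    then show ?thesis using e(1) by blast
  qed
  then have "(\<lambda>\<zeta>. dz g (a, \<zeta>)) analytic_on {\<zeta>. (a, \<zeta>) \<in> U}" unfolding analytic_on_def by blast
  then show "(\<lambda>\<zeta>. dz g (a, \<zeta>)) holomorphic_on {\<zeta>. (a, \<zeta>) \<in> U}" by (rule analytic_imp_holomorphic)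
qed

theorem holomorphic2_dw:
  assumes g: "holomorphic2_on g U" and U: "open U"
  shows "holomorphic2_on (dw g) U"
proof -
  define V where "V = {p. (snd p, fst p) \<in> U}"
  have V: "open V" using open_vimage[OF U, of "\<lambda>p. (snd p, fst p)"]
    by (simp add: V_def vimage_def continuous_intros)
  have "holomorphic2_on (dz (\<lambda>p. g (snd p, fst p))) V"
    by (rule holomorphic2_dz[OF holomorphic2_swap[OF g, folded V_def] V])
  from holomorphic2_swap[OF this] show ?thesis by (simp add: V_def)
qed

text \<open>Removable singularities along \<open>z = 0\<close>. Slices in \<open>z\<close> are
  covered by the one-variable theorem. Continuity across the divisor comes from the mean value
  inequality, because \<open>dz g\<close> is close to its limit value on the whole disc of radius
  \<open>norm z\<close> in the slice.\<close>

lemma holomorphic2_division: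
  assumes g: "holomorphic2_on g U" and U: "open U" and g0: "\<And>w. (0, w) \<in> U \<Longrightarrow> g (0, w) = 0"
  shows "holomorphic2_on (\<lambda>p. if fst p = 0 then dz g p else g p / fst p) U" (is "holomorphic2_on ?q U")
proof (rule osgood[OF U])
  have cdz: "continuous_on U (dz g)" by (rule holomorphic2_continuous_on_dz[OF g U])
  show "continuous_on U ?q"
  proof (rule continuous_at_imp_continuous_on, rule ballI)
    fix p assume pU: "p \<in> U"
    show "isCont ?q p"
    proof (cases "fst p = 0")
      case False
      have "open (U \<inter> {p. fst p \<noteq> 0})"
        by (intro open_Int U open_Collect_neq continuous_intros)
      moreover have "continuous_on (U \<inter> {p. fst p \<noteq> 0}) (\<lambda>p. g p / fst p)"
        by (intro continuous_intros continuous_on_subset[OF holomorphic2_on_continuous_on[OF g]]) auto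
      then have "continuous_on (U \<inter> {p. fst p \<noteq> 0}) ?q"
        by (rule continuous_on_eq) auto
      ultimately show ?thesis using pU False
        by (simp add: continuous_on_eq_continuous_at)
    next
      case True
      then obtain b where p: "p = (0, b)" by (cases p) auto
      show ?thesis unfolding continuous_at_eps_delta
      proof (intro allI impI)
        fix \<epsilon> :: real assume "\<epsilon> > 0"
        have "isCont (dz g) p" using cdz U pU by (simp add: continuous_on_eq_continuous_at)
        then obtain d where d: "d > 0" "\<And>x. dist x p < d \<Longrightarrow> dist (dz g x) (dz g p) < \<epsilon> / 2"
          unfolding continuous_at_eps_delta using \<open>\<epsilon> > 0\<close> by (metis half_gt_zero)
        obtain d' where d': "d' > 0" "ball p d' \<subseteq> U" using U pU by (auto simp: open_contains_ball)
        show "\<exists>d>0. \<forall>x'. dist x' p < d \<longrightarrow> dist (?q x') (?q p) < \<epsilon>"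
        proof (intro exI[of _ "min d d'"] conjI allI impI)
          fix x assume x: "dist x p < min d d'"
          obtain z w where xzw: "x = (z, w)" by (cases x)
          show "dist (?q x) (?q p) < \<epsilon>"
          proof (cases "z = 0")
            case True
            have "dist (dz g x) (dz g p) < \<epsilon> / 2" using x by (intro d(2)) auto
            then show ?thesis using \<open>\<epsilon> > 0\<close> True xzw p by simp
          next
            case False
            have near: "dist (\<zeta>, w) p < min d d'" if "\<zeta> \<in> cball 0 (norm z)" for \<zeta>
            proof -
              have "dist (\<zeta>, w) p \<le> dist x p"
                using that unfolding xzw p dist_Pair_Pair by (intro real_sqrt_le_mono) (auto intro!: power_mono)
              with x show ?thesis by linarith
            qed
            define G where "G = (\<lambda>\<zeta>. g (\<zeta>, w) - dz g p * \<zeta>)"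
            have "norm (G z - G 0) \<le> \<epsilon> / 2 * norm (z - 0)"
            proof (rule field_differentiable_bound[where S = "cball 0 (norm z)"])
              fix \<zeta> :: complex assume z: "\<zeta> \<in> cball 0 (norm z)"
              have "(\<zeta>, w) \<in> U" using near[OF z] d'(2) by (auto simp: dist_commute)
              then have "DERIV (\<lambda>\<zeta>. g (\<zeta>, w)) \<zeta> :> dz g (\<zeta>, w)"
                using holomorphic_derivI[OF holomorphic2_slice1[OF g U] open_slice1[OF U], of \<zeta> w] by simp
              then have "DERIV G \<zeta> :> (dz g (\<zeta>, w) - dz g p * 1)"
                unfolding G_def by (intro DERIV_diff DERIV_cmult DERIV_ident)
              then show "(G has_field_derivative (dz g (\<zeta>, w) - dz g p)) (at \<zeta> within cball 0 (norm z))"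
                by (simp add: has_field_derivative_at_within)
              have "dist (dz g (\<zeta>, w)) (dz g p) < \<epsilon> / 2"
                using near[OF z] by (intro d(2)) auto
              then show "norm (dz g (\<zeta>, w) - dz g p) \<le> \<epsilon> / 2" by (simp add: dist_norm)
            qed auto
            also have "G z - G 0 = (g (z, w) / z - dz g p) * z"
            proof -
              have "(0, w) \<in> U" using near[of 0] d'(2) by (auto simp: dist_commute)
              then show ?thesis using False by (simp add: G_def g0 field_simps)
            qed
            finally have "norm (g (z, w) / z - dz g p) \<le> \<epsilon> / 2"
              using False by (simp add: norm_mult)
            then show ?thesis using \<open>\<epsilon> > 0\<close> False xzw p by (simp add: dist_norm)
          qed
        qed (use d d' in auto)
      qed
    qed
  qed
next
  fix w :: complex
  have hol: "(\<lambda>\<zeta>. g (\<zeta>, w)) holomorphic_on {\<zeta>. (\<zeta>, w) \<in> U}" by (rule holomorphic2_slice1[OF g U])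
  show "(\<lambda>\<zeta>. ?q (\<zeta>, w)) holomorphic_on {\<zeta>. (\<zeta>, w) \<in> U}"
  proof (cases "(0, w) \<in> U")
    case True
    show ?thesis
      by (rule pole_theorem_open_0[OF hol open_slice1[OF U], of 0]) (use g0[OF True] in auto)
  next
    case False
    then have "(\<lambda>\<zeta>. g (\<zeta>, w) / \<zeta>) holomorphic_on {\<zeta>. (\<zeta>, w) \<in> U}"
      using hol by (intro holomorphic_intros) auto
    then show ?thesis by (rule holomorphic_transform) (use False in auto)
  qed
next
  fix z :: complex
  show "(\<lambda>\<zeta>. ?q (z, \<zeta>)) holomorphic_on {\<zeta>. (z, \<zeta>) \<in> U}"
    using holomorphic2_slice2[OF g U, of z] holomorphic2_slice2[OF holomorphic2_dz[OF g U] U, of z]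
    by (cases "z = 0") (auto intro!: holomorphic_intros)
qed

lemma holomorphic2_factor_fst:
  assumes "holomorphic2_on g U" "open U" "\<And>w. (0, w) \<in> U \<Longrightarrow> g (0, w) = 0"
  obtains q where "holomorphic2_on q U" "\<And>p. p \<in> U \<Longrightarrow> g p = fst p * q p"
    "\<And>w. q (0, w) = dz g (0, w)"
proof
  show "holomorphic2_on (\<lambda>p. if fst p = 0 then dz g p else g p / fst p) U"
    by (rule holomorphic2_division[OF assms])
qed (use assms(3) in \<open>auto simp: prod_eq_iff\<close>)

section \<open>Division by powers of a coordinate, Taylor expansion and homogeneous parts\<close>

lemma higher_deriv_ident_mult:
  assumes "h holomorphic_on S" "open S" "0 \<in> S"
  shows "(deriv ^^ Suc n) (\<lambda>z. z * h z) 0 = of_nat (Suc n) * (deriv ^^ n) h 0"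
proof -
  have "(deriv ^^ Suc n) (\<lambda>z. z * h z) 0 =
      (\<Sum>i = 0..Suc n. of_nat (Suc n choose i) * (deriv ^^ i) (\<lambda>z. z) 0 * (deriv ^^ (Suc n - i)) h 0)"
    by (rule higher_deriv_mult[OF _ assms]) (intro holomorphic_intros)
  also have "\<dots> = (\<Sum>i \<in> {1}. of_nat (Suc n choose i) * (deriv ^^ i) (\<lambda>z. z) 0 * (deriv ^^ (Suc n - i)) h 0)"
    by (rule sum.mono_neutral_right) (auto simp: higher_deriv_ident)
  also have "\<dots> = of_nat (Suc n) * (deriv ^^ n) h 0" by (simp add: higher_deriv_ident)
  finally show ?thesis .
qed

lemma higher_deriv_power_mult:
  assumes "h holomorphic_on S" "open S" "0 \<in> S"
  shows "(deriv ^^ (n + m)) (\<lambda>z. z ^ m * h z) 0 / fact (n + m) = (deriv ^^ n) h 0 / fact n"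
proof (induction m)
  case (Suc m)
  have "(deriv ^^ Suc (n + m)) (\<lambda>z. z * (z ^ m * h z)) 0
      = of_nat (Suc (n + m)) * (deriv ^^ (n + m)) (\<lambda>z. z ^ m * h z) 0"
    by (rule higher_deriv_ident_mult[OF _ assms(2,3)]) (intro holomorphic_intros assms(1))
  with Suc show ?case by (simp add: mult.assoc del: funpow.simps of_nat_Suc)
qed simp

lemma higher_deriv_power_mult_less:
  assumes "h holomorphic_on S" "open S" "0 \<in> S" "n < m"
  shows "(deriv ^^ n) (\<lambda>z. z ^ m * h z) 0 = 0"
proof -
  have "(deriv ^^ (0 + n)) (\<lambda>z. z ^ n * (z ^ (m - n) * h z)) 0 / fact (0 + n)
      = (deriv ^^ 0) (\<lambda>z. z ^ (m - n) * h z) 0 / fact 0"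
    by (rule higher_deriv_power_mult[OF _ assms(2,3)]) (intro holomorphic_intros assms(1))
  then show ?thesis using assms(4) by (simp add: mult.assoc[symmetric] power_add[symmetric] power_0_left)
qed

text \<open>The Taylor coefficients of each slice vanish below degree \<open>r\<close>, so \<open>g\<close> is divisible by \<open>z\<^sup>r\<close>.\<close>

lemma holomorphic2_factor_fst_power:
  assumes "holomorphic2_on g U" "open U"
    and "\<And>w i. (0, w) \<in> U \<Longrightarrow> i < r \<Longrightarrow> (deriv ^^ i) (\<lambda>\<zeta>. g (\<zeta>, w)) 0 = 0"
  obtains q where "holomorphic2_on q U" "\<And>p. p \<in> U \<Longrightarrow> g p = fst p ^ r * q p"
    "\<And>w. (0, w) \<in> U \<Longrightarrow> q (0, w) = (deriv ^^ r) (\<lambda>\<zeta>. g (\<zeta>, w)) 0 / fact r"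
proof -
  have "\<exists>q. holomorphic2_on q U \<and> (\<forall>p\<in>U. g p = fst p ^ r * q p)"
    using assms(3)
  proof (induction r)
    case 0
    then show ?case using assms(1) by auto
  next
    case (Suc r)
    then obtain q where q: "holomorphic2_on q U" "\<And>p. p \<in> U \<Longrightarrow> g p = fst p ^ r * q p" by auto
    \<comment> \<open>One more factor \<open>z\<close> splits off when \<open>q\<close> vanishes on
      the divisor, and \<open>q (0, w)\<close> is the coefficient of \<open>z^r\<close> of the
      slice.\<close>
    have "q (0, w) = 0" if w: "(0, w) \<in> U" for w
    proof -
      have "(deriv ^^ (0 + r)) (\<lambda>\<zeta>. \<zeta> ^ r * q (\<zeta>, w)) 0 / fact (0 + r) = (deriv ^^ 0) (\<lambda>\<zeta>. q (\<zeta>, w)) 0 / fact 0"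
        by (rule higher_deriv_power_mult[OF holomorphic2_slice1[OF q(1) assms(2)] open_slice1[OF assms(2)]])
          (use w in simp)
      moreover have "(deriv ^^ r) (\<lambda>\<zeta>. \<zeta> ^ r * q (\<zeta>, w)) 0 = (deriv ^^ r) (\<lambda>\<zeta>. g (\<zeta>, w)) 0"
      proof (rule higher_deriv_cong_ev)
        show "\<forall>\<^sub>F \<zeta> in nhds 0. \<zeta> ^ r * q (\<zeta>, w) = g (\<zeta>, w)"
          unfolding eventually_nhds using w q(2) open_slice1[OF assms(2), of w]
          by (intro exI[of _ "{\<zeta>. (\<zeta>, w) \<in> U}"]) auto
      qed simp
      ultimately show ?thesis using Suc.prems[OF w, of r] by simp
    qed
    then obtain q' where "holomorphic2_on q' U" "\<And>p. p \<in> U \<Longrightarrow> q p = fst p * q' p"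
      using holomorphic2_factor_fst[OF q(1) assms(2)] by metis
    then show ?case using q(2) by (intro exI[of _ q']) (simp add: mult.assoc)
  qed
  then obtain q where q: "holomorphic2_on q U" "\<And>p. p \<in> U \<Longrightarrow> g p = fst p ^ r * q p" by auto
  show ?thesis
  proof (rule that[OF q])
    fix w assume w: "(0, w) \<in> U"
    have "(deriv ^^ (0 + r)) (\<lambda>\<zeta>. \<zeta> ^ r * q (\<zeta>, w)) 0 / fact (0 + r) = (deriv ^^ 0) (\<lambda>\<zeta>. q (\<zeta>, w)) 0 / fact 0"
      by (rule higher_deriv_power_mult[OF holomorphic2_slice1[OF q(1) assms(2)] open_slice1[OF assms(2)]])
        (use w in simp)
    moreover have "(deriv ^^ r) (\<lambda>\<zeta>. \<zeta> ^ r * q (\<zeta>, w)) 0 = (deriv ^^ r) (\<lambda>\<zeta>. g (\<zeta>, w)) 0"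
    proof (rule higher_deriv_cong_ev)
      show "\<forall>\<^sub>F \<zeta> in nhds 0. \<zeta> ^ r * q (\<zeta>, w) = g (\<zeta>, w)"
        unfolding eventually_nhds using w q(2) open_slice1[OF assms(2), of w]
        by (intro exI[of _ "{\<zeta>. (\<zeta>, w) \<in> U}"]) auto
    qed simp
    ultimately show "q (0, w) = (deriv ^^ r) (\<lambda>\<zeta>. g (\<zeta>, w)) 0 / fact r" by simp
  qed
qed

text \<open>Iterating \<open>dw\<close> as an operator on functions of two variables makes the
  Taylor coefficients in \<open>w\<close> visibly holomorphic in \<open>z\<close>.\<close>

lemma funpow_dw: "((\<lambda>g. dw g) ^^ j) g p = (deriv ^^ j) (\<lambda>\<eta>. g (fst p, \<eta>)) (snd p)"
proof (induction j arbitrary: p)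
  case (Suc j)
  have "(\<lambda>\<eta>. ((\<lambda>g. dw g) ^^ j) g (fst p, \<eta>)) = (deriv ^^ j) (\<lambda>\<eta>. g (fst p, \<eta>))"
    by (simp add: Suc.IH fun_eq_iff)
  then show ?case by simp
qed simp

lemma holomorphic2_funpow_dw:
  "holomorphic2_on g U \<Longrightarrow> open U \<Longrightarrow> holomorphic2_on (((\<lambda>g. dw g) ^^ j) g) U"
  by (induction j) (simp_all add: holomorphic2_dw)

lemma holomorphic_higher_deriv_snd:
  assumes "holomorphic2_on g U" "open U"
  shows "(\<lambda>z. (deriv ^^ j) (\<lambda>w. g (z, w)) 0) holomorphic_on {z. (z, 0) \<in> U}"
  using holomorphic2_slice1[OF holomorphic2_funpow_dw[OF assms, of j] assms(2), of 0]
  by (simp add: funpow_dw)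

lemma higher_deriv_polynomial:
  "(deriv ^^ i) (\<lambda>z. \<Sum>j<n. z ^ j * c j) (0::complex) = (if i < n then fact i * c i else 0)"
proof (induction n)
  case (Suc n)
  have "(deriv ^^ i) (\<lambda>z. (\<Sum>j<n. z ^ j * c j) + z ^ n * c n) 0
      = (deriv ^^ i) (\<lambda>z. \<Sum>j<n. z ^ j * c j) 0 + (deriv ^^ i) (\<lambda>z. z ^ n * c n) 0"
    by (rule higher_deriv_add[of _ UNIV]) (auto intro!: holomorphic_intros)
  also have "(deriv ^^ i) (\<lambda>z. z ^ n * c n) 0 = (if i = n then fact i * c i else 0)"
  proof (cases "i < n")
    case True
    then show ?thesis using higher_deriv_power_mult_less[of "\<lambda>_. c n" UNIV i n] by simp
  next
    case False
    then obtain m where "i = m + n" by (metis le_add_diff_inverse2 not_less)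
    then show ?thesis using higher_deriv_power_mult[of "\<lambda>_. c n" UNIV m n]
      by (cases m) (auto simp: divide_simps simp del: funpow.simps fact_Suc)
  qed
  finally show ?case using Suc.IH by auto
qed (cases i; simp)

text \<open>The difference from the Taylor polynomial has vanishing \<open>w\<close>-derivatives
  below \<open>p\<close> on every slice, so \<open>w^p\<close> splits off with a quotient
  holomorphic in both variables.\<close>

lemma taylor_expansion_snd:
  assumes g: "holomorphic2_on g (bidisc e)"
  obtains q where "holomorphic2_on q (bidisc e)"
    "\<And>z w. z \<in> ball 0 e \<Longrightarrow> w \<in> ball 0 e \<Longrightarrow>
      g (z, w) = (\<Sum>j<p. w ^ j * ((deriv ^^ j) (\<lambda>w. g (z, w)) 0 / fact j)) + w ^ p * q (z, w)"
proof -
  let ?B = "bidisc e"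
  have B: "open ?B" by (intro open_Times open_ball)
  define G where "G = (\<lambda>j z. (deriv ^^ j) (\<lambda>w. g (z, w)) 0 / fact j)"
  have G: "G j holomorphic_on ball 0 e" for j
  proof (cases "e > 0")
    case True
    then show ?thesis using holomorphic_higher_deriv_snd[OF g B, of j] unfolding G_def
      by (intro holomorphic_intros) (auto simp: dist_norm)
  qed (simp add: ball_empty holomorphic_on_def)
  define h where "h = (\<lambda>p'. g (snd p', fst p') - (\<Sum>j<p. fst p' ^ j * G j (snd p')))"
  have h: "holomorphic2_on h ?B"
    unfolding h_def
  proof (intro holomorphic2_intros holomorphic2_compose1[OF G])
    show "holomorphic2_on (\<lambda>p'. g (snd p', fst p')) ?B"
      by (rule holomorphic2_compose[OF g]) (auto intro: holomorphic2_intros)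
  qed (auto intro: holomorphic2_intros)
  obtain q where q: "holomorphic2_on q ?B" "\<And>p'. p' \<in> ?B \<Longrightarrow> h p' = fst p' ^ p * q p'"
  proof (rule holomorphic2_factor_fst_power[OF h B, of p])
    fix z i assume z: "(0, z) \<in> ?B" and i: "i < p"
    have "(deriv ^^ i) (\<lambda>\<zeta>. g (z, \<zeta>) - (\<Sum>j<p. \<zeta> ^ j * G j z)) 0
      = (deriv ^^ i) (\<lambda>\<zeta>. g (z, \<zeta>)) 0 - (deriv ^^ i) (\<lambda>\<zeta>. \<Sum>j<p. \<zeta> ^ j * G j z) 0"
      using holomorphic2_slice2[OF g B, of z] open_slice2[OF B, of z] z
      by (intro higher_deriv_diff[of _ "{\<zeta>. (z, \<zeta>) \<in> ?B}"]) (auto intro!: holomorphic_intros)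
    also have "\<dots> = 0" using i unfolding higher_deriv_polynomial by (simp add: G_def)
    finally show "(deriv ^^ i) (\<lambda>\<zeta>. h (\<zeta>, z)) 0 = 0" by (simp add: h_def)
  qed (use that in blast)
  show ?thesis
  proof (rule that[of "\<lambda>p'. q (snd p', fst p')"])
    show "holomorphic2_on (\<lambda>p'. q (snd p', fst p')) ?B"
      by (rule holomorphic2_compose[OF q(1)]) (auto intro: holomorphic2_intros)
    fix z w :: complex assume "z \<in> ball 0 e" "w \<in> ball 0 e"
    then have "h (w, z) = w ^ p * q (w, z)" using q(2)[of "(w, z)"] by simp
    then show "g (z, w) = (\<Sum>j<p. w ^ j * ((deriv ^^ j) (\<lambda>w. g (z, w)) 0 / fact j))
        + w ^ p * q (snd (z, w), fst (z, w))"
      by (simp add: h_def G_def diff_eq_eq)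
  qed
qed

text \<open>The coefficients are defined by iterated slice derivatives; here the homogeneous part
  becomes a single derivative along the line through \<open>v\<close>. This form is compatible with
  exchanging the coordinates and with the substitution \<open>(z, z * (w + s))\<close> of the
  blow-up.\<close>

lemma hom_part_eq_line_deriv:
  assumes "g \<in> germs2"
  shows "hom_part g k v = (deriv ^^ k) (\<lambda>\<zeta>. g (\<zeta> * fst v, \<zeta> * snd v)) 0 / fact k"
proof -
  obtain U where U: "open U" "(0, 0) \<in> U" "holomorphic2_on g U"
    using assms unfolding germs2_def zero_prod_def by blast
  obtain e where e: "e > 0" "bidisc e \<subseteq> U" by (rule open_contains_polydisc[OF U(1,2)])
  let ?B = "bidisc e"
  have B: "open ?B" by (intro open_Times open_ball)
  have g: "holomorphic2_on g ?B" by (rule holomorphic2_on_subset[OF U(3) e(2)])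
  define G where "G = (\<lambda>j z. (deriv ^^ j) (\<lambda>w. g (z, w)) 0 / fact j)"
  have G: "G j holomorphic_on ball 0 e" for j
    using holomorphic_higher_deriv_snd[OF g B, of j] e(1) unfolding G_def
    by (intro holomorphic_intros) (auto simp: dist_norm)
  obtain q where q: "holomorphic2_on q ?B" "\<And>z w. z \<in> ball 0 e \<Longrightarrow> w \<in> ball 0 e \<Longrightarrow>
      g (z, w) = (\<Sum>j<Suc k. w ^ j * G j z) + w ^ Suc k * q (z, w)"
    using taylor_expansion_snd[OF g, of "Suc k"] unfolding G_def by blast
  obtain v1 v2 where v: "v = (v1, v2)" by (cases v)
  define M where "M = norm v1 + norm v2 + 1"
  define S where "S = ball (0::complex) (e / M)"
  have M: "M > 0" "norm v1 \<le> M" "norm v2 \<le> M" unfolding M_def by (auto intro: add_nonneg_pos)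
  have S: "open S" "0 \<in> S" using e(1) M by (auto simp: S_def)
  have inB: "v1 * \<zeta> \<in> ball 0 e" "v2 * \<zeta> \<in> ball 0 e" if "\<zeta> \<in> S" for \<zeta>
  proof -
    have "norm \<zeta> * M < e" using that M by (simp add: S_def field_simps)
    moreover have "norm v1 * norm \<zeta> \<le> norm \<zeta> * M" "norm v2 * norm \<zeta> \<le> norm \<zeta> * M"
      using mult_right_mono[OF M(2), of "norm \<zeta>"] mult_right_mono[OF M(3), of "norm \<zeta>"]
      by (simp_all add: mult.commute)
    ultimately show "v1 * \<zeta> \<in> ball 0 e" "v2 * \<zeta> \<in> ball 0 e" by (auto simp: norm_mult)
  qed
  have Gh: "(\<lambda>\<zeta>. G j (v1 * \<zeta>)) holomorphic_on S" for j
  proof -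
    have "G j \<circ> (\<lambda>\<zeta>. v1 * \<zeta>) holomorphic_on S"
      by (rule holomorphic_on_compose_gen[OF _ G]) (use inB in \<open>auto intro!: holomorphic_intros\<close>)
    then show ?thesis by (simp add: o_def)
  qed
  have qh: "(\<lambda>\<zeta>. q (v1 * \<zeta>, v2 * \<zeta>)) holomorphic_on S"
    by (rule holomorphic2_compose_curve[OF q(1) _ _ S(1)]) (use inB in \<open>auto intro!: holomorphic_intros\<close>)
  \<comment> \<open>\<open>A\<close> collects the terms of \<open>w\<close>-degree up to
    \<open>k\<close>; the remainder \<open>R\<close> has the factor \<open>\<zeta> ^ Suc k\<close>,
    which the \<open>k\<close>-th derivative at 0 does not see.\<close>
  define A where "A = (\<lambda>\<zeta>. \<Sum>j<Suc k. v2 ^ j * (\<zeta> ^ j * G j (v1 * \<zeta>)))"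
  define R where "R = (\<lambda>\<zeta>. \<zeta> ^ Suc k * (v2 ^ Suc k * q (v1 * \<zeta>, v2 * \<zeta>)))"
  have Ah: "A holomorphic_on S" unfolding A_def by (intro holomorphic_intros Gh)
  have Rh: "R holomorphic_on S" unfolding R_def by (intro holomorphic_intros qh)
  have "(deriv ^^ k) (\<lambda>\<zeta>. g (\<zeta> * fst v, \<zeta> * snd v)) 0 = (deriv ^^ k) (\<lambda>\<zeta>. A \<zeta> + R \<zeta>) 0"
  proof (rule higher_deriv_cong_ev)
    have "g (\<zeta> * fst v, \<zeta> * snd v) = A \<zeta> + R \<zeta>" if "\<zeta> \<in> S" for \<zeta>
      using q(2)[OF inB[OF that]]
      by (simp add: A_def R_def v power_mult_distrib mult_ac)
    then show "\<forall>\<^sub>F \<zeta> in nhds 0. g (\<zeta> * fst v, \<zeta> * snd v) = A \<zeta> + R \<zeta>"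
      unfolding eventually_nhds using S by blast
  qed simp
  also have "\<dots> = (deriv ^^ k) A 0 + (deriv ^^ k) R 0"
    by (rule higher_deriv_add[OF Ah Rh S])
  also have "(deriv ^^ k) R 0 = 0"
    unfolding R_def by (rule higher_deriv_power_mult_less[OF _ S]) (auto intro!: holomorphic_intros qh)
  also have "(deriv ^^ k) A 0 = (\<Sum>j<Suc k. v2 ^ j * (fact k * (v1 ^ (k - j) * (deriv ^^ (k - j)) (G j) 0 / fact (k - j))))"
  proof -
    have "(deriv ^^ k) (\<lambda>\<zeta>. \<Sum>j<n. v2 ^ j * (\<zeta> ^ j * G j (v1 * \<zeta>))) 0 =
      (\<Sum>j<n. v2 ^ j * (fact k * (v1 ^ (k - j) * (deriv ^^ (k - j)) (G j) 0 / fact (k - j))))" if "n \<le> Suc k" for n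
      using that
    proof (induction n)
      case (Suc n)
      have "(deriv ^^ k) (\<lambda>\<zeta>. (\<Sum>j<n. v2 ^ j * (\<zeta> ^ j * G j (v1 * \<zeta>))) + v2 ^ n * (\<zeta> ^ n * G n (v1 * \<zeta>))) 0
        = (deriv ^^ k) (\<lambda>\<zeta>. \<Sum>j<n. v2 ^ j * (\<zeta> ^ j * G j (v1 * \<zeta>))) 0
          + (deriv ^^ k) (\<lambda>\<zeta>. v2 ^ n * (\<zeta> ^ n * G n (v1 * \<zeta>))) 0"
        by (rule higher_deriv_add[OF _ _ S]) (intro holomorphic_intros Gh)+
      also have "(deriv ^^ k) (\<lambda>\<zeta>. v2 ^ n * (\<zeta> ^ n * G n (v1 * \<zeta>))) 0
          = v2 ^ n * (deriv ^^ k) (\<lambda>\<zeta>. \<zeta> ^ n * G n (v1 * \<zeta>)) 0"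
        by (rule higher_deriv_cmult[OF _ S(2,1)]) (intro holomorphic_intros Gh)
      also have "(deriv ^^ k) (\<lambda>\<zeta>. \<zeta> ^ n * G n (v1 * \<zeta>)) 0
          = fact k * ((deriv ^^ (k - n)) (\<lambda>\<zeta>. G n (v1 * \<zeta>)) 0 / fact (k - n))"
        using higher_deriv_power_mult[OF Gh S, of "k - n" n n] Suc.prems by (simp add: field_simps)
      also have "(deriv ^^ (k - n)) (\<lambda>\<zeta>. G n (v1 * \<zeta>)) 0 = v1 ^ (k - n) * (deriv ^^ (k - n)) (G n) (v1 * 0)"
        by (rule higher_deriv_compose_linear[OF G S(1) _ S(2)]) (use inB in auto)
      finally show ?case using Suc by simp
    qed simp
    then show ?thesis unfolding A_def by blast
  qed
  also have "\<dots> + 0 = fact k * (\<Sum>j<Suc k. taylor_coeff2 g (k - j) j * v1 ^ (k - j) * v2 ^ j)"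
  proof -
    have Gj: "(deriv ^^ i) (G j) 0 / fact i = taylor_coeff2 g i j" for i j
    proof -
      have "(\<lambda>z. (deriv ^^ j) (\<lambda>w. g (z, w)) 0) holomorphic_on ball 0 e"
        using holomorphic_higher_deriv_snd[OF g B, of j] e(1)
        by (rule_tac holomorphic_on_subset) auto
      from higher_deriv_cmult[OF this _ open_ball, of 0 i "1 / fact j"] e(1)
      show ?thesis by (simp add: G_def taylor_coeff2_def)
    qed
    show ?thesis unfolding Gj[symmetric] sum_distrib_left add_0_right
      by (intro sum.cong refl) (simp add: field_simps)
  qed
  also have "(\<Sum>j<Suc k. taylor_coeff2 g (k - j) j * v1 ^ (k - j) * v2 ^ j)
      = (\<Sum>i<Suc k. taylor_coeff2 g i (k - i) * v1 ^ i * v2 ^ (k - i))"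
    by (subst sum.nat_diff_reindex[symmetric]) (auto intro!: sum.cong)
  also have "\<dots> = hom_part g k v" by (simp add: hom_part_def v lessThan_Suc_atMost)
  finally show ?thesis by simp
qed

section \<open>Polynomials in \<open>z\<close> with coefficients in \<open>w\<close>, and Taylor
  polynomials of holomorphic functions\<close>

definition eval2 :: "complex poly poly \<Rightarrow> complex \<Rightarrow> complex \<Rightarrow> complex"
  where "eval2 P z w = poly (poly P [:z:]) w"

lemma eval2_simps [simp]:
  "eval2 0 z w = 0" "eval2 1 z w = 1" "eval2 (P + Q) z w = eval2 P z w + eval2 Q z w"
  "eval2 (P - Q) z w = eval2 P z w - eval2 Q z w" "eval2 (- P) z w = - eval2 P z w"
  "eval2 (P * Q) z w = eval2 P z w * eval2 Q z w" "eval2 (P ^ n) z w = eval2 P z w ^ n"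
  "eval2 [:0, 1:] z w = z" "eval2 [:p:] z w = poly p w" "eval2 (smult p P) z w = poly p w * eval2 P z w"
  by (simp_all add: eval2_def poly_power)

lemma eval2_sum: "eval2 (\<Sum>i\<in>I. P i) z w = (\<Sum>i\<in>I. eval2 (P i) z w)"
  by (simp add: eval2_def poly_sum)

lemma eval2_pCons: "eval2 (pCons a P) z w = poly a w + z * eval2 P z w"
  by (simp add: eval2_def)

lemma eval2_monom: "eval2 (monom p i) z w = poly p w * z ^ i"
  by (simp add: eval2_def poly_monom poly_power)

lemma holomorphic2_eval2: "holomorphic2_on (\<lambda>p. eval2 P (fst p) (snd p)) U"
proof (induction P)
  case (pCons a P)
  have "holomorphic2_on (\<lambda>p. poly a (snd p)) U"
    by (rule holomorphic2_compose1[of _ UNIV]) (auto intro!: holomorphic_intros holomorphic2_intros)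
  then show ?case using pCons unfolding eval2_pCons by (intro holomorphic2_intros)
qed (simp add: holomorphic2_const)

text \<open>Read off from the two-variable expansion of a function that ignores its first
  argument.\<close>

lemma taylor_polynomial_1:
  assumes "h holomorphic_on ball 0 e" "e > 0"
  obtains k where "k holomorphic_on ball 0 e"
    "\<And>z. z \<in> ball 0 e \<Longrightarrow> h z = (\<Sum>j<n. z ^ j * ((deriv ^^ j) h 0 / fact j)) + z ^ n * k z"
proof -
  have "holomorphic2_on (\<lambda>p. h (snd p)) (bidisc e)"
    by (rule holomorphic2_compose1[OF assms(1)]) (auto intro: holomorphic2_intros)
  then obtain q where q: "holomorphic2_on q (bidisc e)"
    "\<And>z w. z \<in> ball 0 e \<Longrightarrow> w \<in> ball 0 e \<Longrightarrow>
      h w = (\<Sum>j<n. w ^ j * ((deriv ^^ j) h 0 / fact j)) + w ^ n * q (z, w)"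
    using taylor_expansion_snd[of "\<lambda>p. h (snd p)" e n] by auto
  show ?thesis
  proof (rule that[of "\<lambda>w. q (0, w)"])
    show "(\<lambda>w. q (0, w)) holomorphic_on ball 0 e"
      by (rule holomorphic2_compose_curve[OF q(1)]) (use assms(2) in auto)
  qed (use q(2)[of 0] assms(2) in auto)
qed

lemma holomorphic2_bounded_polydisc:
  assumes "holomorphic2_on g (bidisc e)" "d < e"
  obtains M where "M > 0" "\<And>z w. norm z \<le> d \<Longrightarrow> norm w \<le> d \<Longrightarrow> norm (g (z, w)) \<le> M"
proof -
  have "compact (g ` (cball 0 d \<times> cball 0 d))"
    using assms(2) by (intro compact_continuous_image compact_Times compact_cball
      continuous_on_subset[OF holomorphic2_on_continuous_on[OF assms(1)]]) auto
  then obtain M where "M > 0" "\<And>x. x \<in> g ` (cball 0 d \<times> cball 0 d) \<Longrightarrow> norm x \<le> M"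
    using bounded_pos compact_imp_bounded by metis
  then show ?thesis by (intro that[of M]) auto
qed

text \<open>Expansion in \<open>w\<close>, then expansion of each coefficient in \<open>z\<close>:
  the remainder is \<open>z^n K + w^n q\<close>. The truncation by the square \<open>i < n\<close>,
  \<open>j < n\<close>, rather than by total degree, is what two successive expansions
  produce.\<close>

lemma taylor_polynomial_2:
  assumes g: "holomorphic2_on g (bidisc e)" and e: "e > 0"
  obtains P C where "\<And>i j. coeff (coeff P i) j = (if i < n \<and> j < n then taylor_coeff2 g i j else 0)"
    "C > 0" "\<And>z w. norm z \<le> e / 2 \<Longrightarrow> norm w \<le> e / 2 \<Longrightarrow>
      norm (g (z, w) - eval2 P z w) \<le> C * max (norm z) (norm w) ^ n"
proof -
  let ?B = "bidisc e"
  have B: "open ?B" by (intro open_Times open_ball)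
  define G where "G = (\<lambda>j z. (deriv ^^ j) (\<lambda>w. g (z, w)) 0 / fact j)"
  have G0: "(\<lambda>z. (deriv ^^ j) (\<lambda>w. g (z, w)) 0) holomorphic_on ball 0 e" for j
    using holomorphic_higher_deriv_snd[OF g B, of j] e by (rule_tac holomorphic_on_subset) auto
  then have G: "G j holomorphic_on ball 0 e" for j
    unfolding G_def by (intro holomorphic_intros) auto
  have coef: "(deriv ^^ i) (G j) 0 / fact i = taylor_coeff2 g i j" for i j
    using higher_deriv_cmult[OF G0 _ open_ball, of 0 i "1 / fact j" j] e
    by (simp add: G_def taylor_coeff2_def)
  obtain q where q: "holomorphic2_on q ?B" "\<And>z w. z \<in> ball 0 e \<Longrightarrow> w \<in> ball 0 e \<Longrightarrow>
      g (z, w) = (\<Sum>j<n. w ^ j * G j z) + w ^ n * q (z, w)"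
    using taylor_expansion_snd[OF g, of n] unfolding G_def by blast
  define k_spec where "k_spec = (\<lambda>j k. k holomorphic_on ball 0 e \<and> (\<forall>z\<in>ball 0 e.
      G j z = (\<Sum>i<n. z ^ i * taylor_coeff2 g i j) + z ^ n * k z))"
  have "\<exists>k. k_spec j k" for j
  proof -
    obtain k where "k holomorphic_on ball 0 e"
      "\<And>z. z \<in> ball 0 e \<Longrightarrow> G j z = (\<Sum>i<n. z ^ i * ((deriv ^^ i) (G j) 0 / fact i)) + z ^ n * k z"
      by (rule taylor_polynomial_1[OF G[of j] e, of n]) blast
    then show ?thesis unfolding k_spec_def coef by blast
  qed
  then obtain k where "\<And>j. k_spec j (k j)" by metis
  then have k: "\<And>j. k j holomorphic_on ball 0 e"
    "\<And>j z. z \<in> ball 0 e \<Longrightarrow> G j z = (\<Sum>i<n. z ^ i * taylor_coeff2 g i j) + z ^ n * k j z"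
    unfolding k_spec_def by blast+
  define P where "P = (\<Sum>i<n. monom (\<Sum>j<n. monom (taylor_coeff2 g i j) j) i)"
  have P: "coeff (coeff P i) j = (if i < n \<and> j < n then taylor_coeff2 g i j else 0)" for i j
  proof -
    have "coeff P i = (if i < n then \<Sum>j<n. monom (taylor_coeff2 g i j) j else 0)"
      unfolding P_def coeff_sum coeff_monom by (simp add: sum.delta')
    then show ?thesis by (simp add: coeff_sum)
  qed
  have evP: "eval2 P z w = (\<Sum>j<n. w ^ j * (\<Sum>i<n. z ^ i * taylor_coeff2 g i j))" for z w
    unfolding P_def eval2_sum eval2_monom poly_sum poly_monom sum_distrib_left sum_distrib_right
    by (subst sum.swap) (simp add: mult_ac)
  define K where "K = (\<lambda>p. \<Sum>j<n. snd p ^ j * k j (fst p))"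
  have K: "holomorphic2_on K ?B"
    unfolding K_def by (intro holomorphic2_intros holomorphic2_compose1[OF k(1)])
      (auto intro: holomorphic2_intros)
  obtain M1 where M1: "M1 > 0" "\<And>z w. norm z \<le> e / 2 \<Longrightarrow> norm w \<le> e / 2 \<Longrightarrow> norm (K (z, w)) \<le> M1"
    using holomorphic2_bounded_polydisc[OF K, of "e / 2"] e by auto
  obtain M2 where M2: "M2 > 0" "\<And>z w. norm z \<le> e / 2 \<Longrightarrow> norm w \<le> e / 2 \<Longrightarrow> norm (q (z, w)) \<le> M2"
    using holomorphic2_bounded_polydisc[OF q(1), of "e / 2"] e by auto
  show ?thesis
  proof (rule that[OF P, of "M1 + M2"])
    fix z w :: complex assume zw: "norm z \<le> e / 2" "norm w \<le> e / 2"
    let ?m = "max (norm z) (norm w)"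
    have zw': "z \<in> ball 0 e" "w \<in> ball 0 e" using zw e by auto
    have "g (z, w) - eval2 P z w = z ^ n * K (z, w) + w ^ n * q (z, w)"
      unfolding q(2)[OF zw'] evP k(2)[OF zw'(1)] K_def
      by (simp add: algebra_simps sum.distrib sum_distrib_left)
    also have "norm \<dots> \<le> norm z ^ n * norm (K (z, w)) + norm w ^ n * norm (q (z, w))"
      by (rule order_trans[OF norm_triangle_ineq]) (simp add: norm_mult norm_power)
    also have "\<dots> \<le> ?m ^ n * M1 + ?m ^ n * M2"
      by (intro add_mono mult_mono power_mono M1(2) M2(2) zw) (auto intro!: zero_le_power simp: le_max_iff_disj)
    finally show "norm (g (z, w) - eval2 P z w) \<le> (M1 + M2) * ?m ^ n"
      by (simp add: algebra_simps)
  qed (use M1 M2 in auto)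
qed

section \<open>Interpolation by a polynomial vector field\<close>

abbreviation pvarz :: "complex poly poly" where "pvarz \<equiv> [:0, 1:]"
abbreviation pvarw :: "complex poly poly" where "pvarw \<equiv> [:[:0, 1:]:]"
abbreviation pdw :: "complex poly poly \<Rightarrow> complex poly poly" where "pdw \<equiv> map_poly pderiv"

lemma coeff_pdw: "coeff (pdw P) i = pderiv (coeff P i)"
  by (simp add: coeff_map_poly)

lemma pdw_diff: "pdw (P - Q) = pdw P - pdw Q"
  by (simp add: poly_eq_iff coeff_pdw pderiv_diff)

lemma pdw_pCons: "pdw (pCons a P) = pCons (pderiv a) (pdw P)"
  by (simp add: map_poly_pCons)

lemma pdw_pvarz_mult: "pdw (pvarz ^ n * P) = pvarz ^ n * pdw P"
  by (induction n) (simp_all add: pdw_pCons mult.assoc)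

lemma eval2_has_field_derivative:
  assumes "DERIV z t :> z'" "DERIV w t :> w'"
  shows "((\<lambda>t. eval2 P (z t) (w t)) has_field_derivative
    z' * eval2 (pderiv P) (z t) (w t) + w' * eval2 (pdw P) (z t) (w t)) (at t)"
proof (induction P)
  case (pCons a P)
  have "DERIV (\<lambda>t. poly a (w t)) t :> poly (pderiv a) (w t) * w'"
    by (rule DERIV_chain2[OF poly_DERIV assms(2)])
  from DERIV_add[OF this DERIV_mult[OF assms(1) pCons.IH]] show ?case
    unfolding eval2_pCons pderiv_pCons pdw_pCons by (simp add: eval2_pCons algebra_simps)
qed simp

text \<open>The derivative of \<open>P\<close> along the vector field \<open>X\<close>. Its iterates
  are the time derivatives of \<open>P\<close> along solutions of the field.\<close>

definition lie :: "complex poly poly \<times> complex poly poly \<Rightarrow> complex poly poly \<Rightarrow> complex poly poly"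
  where "lie X P = fst X * pderiv P + snd X * pdw P"

text \<open>Membership in the \<open>n\<close>-th power of the maximal ideal at the origin; it is
  the valuation in which the Picard iteration converges.\<close>

definition ord_ge :: "nat \<Rightarrow> complex poly poly \<Rightarrow> bool"
  where "ord_ge n P \<longleftrightarrow> (\<forall>i j. i + j < n \<longrightarrow> coeff (coeff P i) j = 0)"

lemma ord_ge_0 [simp]: "ord_ge 0 P" "ord_ge n 0" by (simp_all add: ord_ge_def)

lemma ord_ge_mono: "ord_ge n P \<Longrightarrow> m \<le> n \<Longrightarrow> ord_ge m P" by (auto simp: ord_ge_def)

lemma ord_ge_add: "ord_ge n P \<Longrightarrow> ord_ge n Q \<Longrightarrow> ord_ge n (P + Q)"
  and ord_ge_diff: "ord_ge n P \<Longrightarrow> ord_ge n Q \<Longrightarrow> ord_ge n (P - Q)"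
  by (simp_all add: ord_ge_def)

lemma ord_ge_sum: "(\<And>i. i \<in> I \<Longrightarrow> ord_ge n (P i)) \<Longrightarrow> ord_ge n (\<Sum>i\<in>I. P i)"
  by (induction I rule: infinite_finite_induct) (auto intro: ord_ge_add)

lemma ord_ge_mult:
  assumes "ord_ge m P" "ord_ge n Q"
  shows "ord_ge (m + n) (P * Q)"
  unfolding ord_ge_def
proof (intro allI impI)
  fix i j assume ij: "i + j < m + n"
  have "coeff (coeff P k) l * coeff (coeff Q (i - k)) (j - l) = 0" if "k \<le> i" "l \<le> j" for k l
  proof (cases "k + l < m")
    case False
    then have "(i - k) + (j - l) < n" using ij that by linarith
    then show ?thesis using assms(2) by (simp add: ord_ge_def)
  qed (use assms(1) in \<open>simp add: ord_ge_def\<close>)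
  then show "coeff (coeff (P * Q) i) j = 0"
    unfolding coeff_mult coeff_sum by (intro sum.neutral ballI) (metis atMost_iff)
qed

lemma ord_ge_pderiv: "ord_ge (Suc n) P \<Longrightarrow> ord_ge n (pderiv P)"
  unfolding ord_ge_def coeff_pderiv of_nat_poly by simp

lemma ord_ge_pdw: "ord_ge (Suc n) P \<Longrightarrow> ord_ge n (pdw P)"
  unfolding ord_ge_def coeff_pdw coeff_pderiv by simp

lemma ord_ge_lie:
  assumes "ord_ge m (fst X)" "ord_ge m (snd X)" "ord_ge (Suc n) P"
  shows "ord_ge (m + n) (lie X P)"
  unfolding lie_def using assms by (intro ord_ge_add ord_ge_mult ord_ge_pderiv ord_ge_pdw)

lemma ord_ge_bound:
  assumes "ord_ge n P"
  obtains C where "C \<ge> 0" "\<And>z w s. norm z \<le> s \<Longrightarrow> norm w \<le> s \<Longrightarrow> s \<le> 1 \<Longrightarrow> norm (eval2 P z w) \<le> C * s ^ n"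
proof
  define C where "C = (\<Sum>i\<le>degree P. \<Sum>j\<le>degree (coeff P i). norm (coeff (coeff P i) j))"
  show "C \<ge> 0" unfolding C_def by (intro sum_nonneg) auto
  fix z w :: complex and s :: real assume zw: "norm z \<le> s" "norm w \<le> s" "s \<le> 1"
  have s: "s \<ge> 0" using zw norm_ge_zero order_trans by blast
  have "eval2 P z w = (\<Sum>i\<le>degree P. \<Sum>j\<le>degree (coeff P i). coeff (coeff P i) j * w ^ j * z ^ i)"
    by (simp add: eval2_def poly_altdef[of P] poly_sum poly_power poly_altdef[of "coeff P _"] sum_distrib_right)
  also have "norm \<dots> \<le> (\<Sum>i\<le>degree P. \<Sum>j\<le>degree (coeff P i). norm (coeff (coeff P i) j) * s ^ n)"
  proof (intro order_trans[OF norm_sum] sum_mono)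
    fix i j
    show "norm (coeff (coeff P i) j * w ^ j * z ^ i) \<le> norm (coeff (coeff P i) j) * s ^ n"
    proof (cases "i + j < n")
      case True
      then show ?thesis using assms by (simp add: ord_ge_def)
    next
      case False
      have "norm w ^ j * norm z ^ i \<le> s ^ j * s ^ i"
        using zw s by (intro mult_mono power_mono) auto
      also have "\<dots> = s ^ (i + j)" by (simp add: power_add)
      also have "\<dots> \<le> s ^ n" using False s zw(3) by (intro power_decreasing) auto
      finally show ?thesis by (simp add: norm_mult norm_power mult.assoc mult_left_mono)
    qed
  qed
  also have "\<dots> = C * s ^ n" by (simp add: C_def sum_distrib_right)
  finally show "norm (eval2 P z w) \<le> C * s ^ n" .
qed

lemma lie_diff: "lie X P - lie Y Q = lie X (P - Q) + lie (fst X - fst Y, snd X - snd Y) Q"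
  by (simp add: lie_def pderiv_diff pdw_diff algebra_simps)

lemma ord_ge_lie_funpow:
  assumes "ord_ge 2 (fst X)" "ord_ge 2 (snd X)" "ord_ge 1 P"
  shows "ord_ge (Suc j) ((lie X ^^ j) P)"
proof (induction j)
  case (Suc j)
  then show ?case using ord_ge_lie[OF assms(1,2), of j] by simp
qed (use assms in simp)

text \<open>A field of order 2 raises the order by one at each derivation, and a difference of order
  \<open>n\<close> between the fields acts on something of order \<open>j + 1\<close> after
  \<open>j\<close> derivations. Hence one order is gained from two derivations on; with a single
  derivation the difference is that of the fields themselves. This is why the Picard map contains
  the terms with \<open>j \<ge> 2\<close> only.\<close>

lemma ord_ge_lie_funpow_diff:
  assumes X: "ord_ge 2 (fst X)" "ord_ge 2 (snd X)" and Y: "ord_ge 2 (fst Y)" "ord_ge 2 (snd Y)"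
    and XY: "ord_ge n (fst X - fst Y)" "ord_ge n (snd X - snd Y)" and n: "n \<ge> 1" and P: "ord_ge 1 P"
  shows "ord_ge (if j \<ge> 2 then Suc n else n) ((lie X ^^ j) P - (lie Y ^^ j) P)"
proof (induction j)
  case (Suc j)
  let ?d = "(lie X ^^ j) P - (lie Y ^^ j) P"
  have "ord_ge n ?d" using Suc.IH by (auto intro: ord_ge_mono split: if_splits)
  then have 1: "ord_ge (2 + (n - 1)) (lie X ?d)" using n by (intro ord_ge_lie X) simp
  have 2: "ord_ge (n + j) (lie (fst X - fst Y, snd X - snd Y) ((lie Y ^^ j) P))"
    using XY ord_ge_lie_funpow[OF Y P] by (intro ord_ge_lie) auto
  have "ord_ge (if Suc j \<ge> 2 then Suc n else n) (lie X ?d + lie (fst X - fst Y, snd X - snd Y) ((lie Y ^^ j) P))"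
    by (intro ord_ge_add ord_ge_mono[OF 1] ord_ge_mono[OF 2]) (use n in auto)
  then show ?case by (simp add: lie_diff)
qed simp

text \<open>Since \<open>X\<close> is \<open>z^(r-1)\<close> times \<open>(z A, B)\<close>, whose
  first component vanishes on \<open>z = 0\<close>, a power of \<open>z\<close> survives the
  derivation and \<open>z^(r-1)\<close> is gained.\<close>

lemma lie_pvarz_power:
  assumes "X = (pvarz ^ r * A, pvarz ^ (r - 1) * B)" "r \<ge> 1"
  shows "lie X (pvarz ^ n * U) = pvarz ^ (n + (r - 1)) * (of_nat n * A * U + pvarz * A * pderiv U + B * pdw U)"
proof (cases n)
  case 0
  have "pvarz ^ r = pvarz ^ (r - 1) * pvarz" using assms(2) by (cases r) auto
  with 0 show ?thesis by (simp add: assms(1) lie_def algebra_simps del: mult_pCons_left mult_pCons_right)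
next
  case (Suc m)
  have r: "pvarz ^ r = pvarz ^ (r - 1) * pvarz" using assms(2) by (cases r) auto
  have "pderiv (pvarz ^ n * U) = of_nat n * pvarz ^ m * U + pvarz ^ n * pderiv U"
  proof -
    have "pderiv (pvarz ^ Suc m) = of_nat (Suc m) * pvarz ^ m"
    proof -
      have sm: "smult a p = [:a:] * p" for a :: "complex poly" and p by simp
      show ?thesis unfolding pderiv_power_Suc
        by (simp add: sm pderiv_pCons of_nat_poly one_pCons[symmetric] mult.commute
            del: mult_pCons_left mult_pCons_right)
    qed
    then show ?thesis unfolding Suc pderiv_mult
      by (simp only: mult.commute add.commute mult.left_commute)
  qed
  then show ?thesis unfolding lie_def pdw_pvarz_mult assms(1) fst_conv snd_conv r
    by (simp add: Suc algebra_simps power_add del: mult_pCons_left mult_pCons_right)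
qed

text \<open>The iterated derivatives of the coordinate functions, apart from the zeroth and first ones,
  have an extra factor \<open>z\<^sup>r\<^sup>-\<^sup>1\<close>; this keeps the leading terms of the vector field fixed.\<close>

lemma lie_funpow_factor:
  assumes X: "X = (pvarz ^ r * A, pvarz ^ (r - 1) * B)" "r \<ge> 2" and B: "eval2 B 0 0 = 0"
  shows "\<exists>V. (lie X ^^ (j + 2)) pvarz = pvarz ^ (r + (r - 1)) * V"
    and "\<exists>V. (lie X ^^ (j + 2)) pvarw = pvarz ^ ((r - 1) + (r - 1)) * V \<and> eval2 V 0 0 = 0"
proof -
  \<comment> \<open>The new cofactor vanishes at the origin again, because \<open>V\<close>,
    \<open>z\<close> and \<open>B\<close> do.\<close>
  have step: "\<exists>V'. lie X (pvarz ^ n * V) = pvarz ^ (n + (r - 1)) * V' \<and> (eval2 V 0 0 = 0 \<longrightarrow> eval2 V' 0 0 = 0)"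
    for n V
    using lie_pvarz_power[OF X(1), of n V] X(2) B
    by (intro exI[of _ "of_nat n * A * V + pvarz * A * pderiv V + B * pdw V"])
      (simp del: mult_pCons_left mult_pCons_right)
  \<comment> \<open>The gain is given up after the second derivation: one factor common to all
    \<open>j\<close> is enough.\<close>
  have step': "\<exists>V'. lie X (pvarz ^ n * V) = pvarz ^ n * V' \<and> (eval2 V 0 0 = 0 \<longrightarrow> eval2 V' 0 0 = 0)" for n V
  proof -
    obtain V' where V': "lie X (pvarz ^ n * V) = pvarz ^ (n + (r - 1)) * V'"
        "eval2 V 0 0 = 0 \<longrightarrow> eval2 V' 0 0 = 0" using step by blast
    show ?thesis
      by (intro exI[of _ "pvarz ^ (r - 1) * V'"])
         (use V' in \<open>simp add: power_add mult.assoc del: mult_pCons_left mult_pCons_right\<close>)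
  qed
  have z1: "lie X pvarz = pvarz ^ r * A" by (simp add: lie_def X(1) pderiv_pCons pdw_pCons)
  have w1: "lie X pvarw = pvarz ^ (r - 1) * B"
    by (simp add: lie_def X(1) pderiv_pCons pdw_pCons one_pCons[symmetric])
  show "\<exists>V. (lie X ^^ (j + 2)) pvarz = pvarz ^ (r + (r - 1)) * V"
  proof (induction j)
    case 0
    show ?case using step[of r A] z1 by (auto simp: numeral_2_eq_2)
  next
    case (Suc j)
    then obtain V where "(lie X ^^ (j + 2)) pvarz = pvarz ^ (r + (r - 1)) * V" by blast
    then have "(lie X ^^ (Suc j + 2)) pvarz = lie X (pvarz ^ (r + (r - 1)) * V)" by simp
    then show ?case using step' by metis
  qed
  show "\<exists>V. (lie X ^^ (j + 2)) pvarw = pvarz ^ ((r - 1) + (r - 1)) * V \<and> eval2 V 0 0 = 0"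
  proof (induction j)
    case 0
    show ?case using step[of "r - 1" B] w1 B by (auto simp: numeral_2_eq_2)
  next
    case (Suc j)
    then obtain V where V: "(lie X ^^ (j + 2)) pvarw = pvarz ^ ((r - 1) + (r - 1)) * V" "eval2 V 0 0 = 0" by blast
    then have "(lie X ^^ (Suc j + 2)) pvarw = lie X (pvarz ^ ((r - 1) + (r - 1)) * V)" by simp
    then show ?case using step' V(2) by metis
  qed
qed

text \<open>Picard iteration for \<open>exp X = id + (z\<^sup>r A\<^sub>0, z\<^sup>r\<^sup>-\<^sup>1 B\<^sub>0)\<close> in the form
  \<open>X = (z\<^sup>r A\<^sub>0, z\<^sup>r\<^sup>-\<^sup>1 B\<^sub>0) - \<Sum>\<^bsub>j \<ge> 2\<^esub> X\<^sup>j / j!\<close>; each step gains one order.\<close>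

lemma interpolating_vector_field:
  assumes r: "r \<ge> 2" and B0: "eval2 B0 0 0 = 0" and K: "K \<ge> 1"
  obtains A B where "\<exists>Q. A = A0 + pvarz * Q" "\<exists>Q. B = B0 + pvarz * Q \<and> eval2 Q 0 0 = 0"
    "ord_ge p ((\<Sum>j\<le>K. [:[:1 / fact j:]:] * (lie (pvarz ^ r * A, pvarz ^ (r - 1) * B) ^^ j) pvarz)
      - (pvarz + pvarz ^ r * A0))"
    "ord_ge p ((\<Sum>j\<le>K. [:[:1 / fact j:]:] * (lie (pvarz ^ r * A, pvarz ^ (r - 1) * B) ^^ j) pvarw)
      - (pvarw + pvarz ^ (r - 1) * B0))"
proof -
  note [simp del] = mult_pCons_left mult_pCons_right
  define c where "c = (\<lambda>j. [:[:1 / fact j :: complex:]:])"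
  define S where "S = (\<lambda>X P. \<Sum>j\<in>{2..K}. c j * (lie X ^^ j) P)"
  define \<Psi> where "\<Psi> = (\<lambda>X. (pvarz ^ r * A0 - S X pvarz, pvarz ^ (r - 1) * B0 - S X pvarw))"
  \<comment> \<open>The shape preserved by the iteration. \<open>A\<close> keeps its restriction to
    \<open>z = 0\<close>; \<open>B\<close> keeps in addition its \<open>z\<close>-derivative at the
    origin, as \<open>Q\<close> vanishes there. These are the data on which the constants of the
    model curves depend.\<close>
  define ok where "ok = (\<lambda>X. \<exists>A B. X = (pvarz ^ r * A, pvarz ^ (r - 1) * B) \<and>
    (\<exists>Q. A = A0 + pvarz * Q) \<and> (\<exists>Q. B = B0 + pvarz * Q \<and> eval2 Q 0 0 = 0))"
  have sum_factor: "\<exists>V. (\<Sum>j\<in>{2..K}. c j * F j) = G * V \<and> (E \<longrightarrow> eval2 V 0 0 = 0)"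
    if fac: "\<And>j. \<exists>V. F (j + 2) = G * V \<and> (E \<longrightarrow> eval2 V 0 0 = 0)" for F G E
  proof -
    obtain V where V: "\<And>j. F (j + 2) = G * V j" "\<And>j. E \<longrightarrow> eval2 (V j) 0 0 = 0" using fac by metis
    have "(\<Sum>j\<in>{2..K}. c j * F j) = (\<Sum>j\<in>{2..K}. G * (c j * V (j - 2)))"
    proof (rule sum.cong)
      fix j assume "j \<in> {2..K}"
      then have "j - 2 + 2 = j" by auto
      then have "F j = G * V (j - 2)" using V(1)[of "j - 2"] by (simp only:)
      then show "c j * F j = G * (c j * V (j - 2))" by (simp add: mult_ac)
    qed simp
    also have "\<dots> = G * (\<Sum>j\<in>{2..K}. c j * V (j - 2))" by (simp add: sum_distrib_left)
    finally show ?thesis using V(2) by (intro exI[of _ "\<Sum>j\<in>{2..K}. c j * V (j - 2)"]) (simp add: eval2_sum)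
  qed
  have ok_\<Psi>: "ok (\<Psi> X)" if okX: "ok X" for X
  proof -
    obtain A B Q where X: "X = (pvarz ^ r * A, pvarz ^ (r - 1) * B)" "B = B0 + pvarz * Q" "eval2 Q 0 0 = 0"
      using okX unfolding ok_def by blast
    have B00: "eval2 B 0 0 = 0" using X(2) B0 by simp
    have "\<exists>V. S X pvarz = pvarz ^ (r + (r - 1)) * V \<and> (False \<longrightarrow> eval2 V 0 0 = 0)"
      unfolding S_def by (rule sum_factor) (use lie_funpow_factor(1)[OF X(1) r B00] in simp)
    then obtain V1 where V1: "S X pvarz = pvarz ^ (r + (r - 1)) * V1" by blast
    have "\<exists>V. S X pvarw = pvarz ^ ((r - 1) + (r - 1)) * V \<and> (True \<longrightarrow> eval2 V 0 0 = 0)"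
      unfolding S_def by (rule sum_factor) (use lie_funpow_factor(2)[OF X(1) r B00] in simp)
    then obtain V2 where V2: "S X pvarw = pvarz ^ ((r - 1) + (r - 1)) * V2" "eval2 V2 0 0 = 0" by blast
    \<comment> \<open>Because \<open>r \<ge> 2\<close>, both powers of \<open>z\<close> exceed
      \<open>z^r\<close> and \<open>z^(r-1)\<close> by at least one factor, so the correction has
      the form \<open>z\<close> times a polynomial.\<close>
    obtain m where m: "r = m + 2" using r by (metis add.commute le_Suc_ex)
    have "\<Psi> X = (pvarz ^ r * (A0 + pvarz * (- (pvarz ^ m * V1))),
                 pvarz ^ (r - 1) * (B0 + pvarz * (- (pvarz ^ m * V2))))"
      by (simp add: \<Psi>_def V1 V2 m power_add algebra_simps)
    then show ?thesis unfolding ok_def using V2(2)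
      by (intro exI[of _ "A0 + pvarz * (- (pvarz ^ m * V1))"] exI[of _ "B0 + pvarz * (- (pvarz ^ m * V2))"]
          conjI exI[of _ "- (pvarz ^ m * V1)"] exI[of _ "- (pvarz ^ m * V2)"]) simp_all
  qed
  have ord_var: "ord_ge 1 pvarz" "ord_ge 1 pvarw"
    by (simp_all add: ord_ge_def)
  have ord_pow: "ord_ge n (pvarz ^ n)" for n
  proof (induction n)
    case (Suc n)
    from ord_ge_mult[OF ord_var(1) Suc] show ?case by simp
  qed simp
  have ok_ord: "ord_ge 2 (fst X)" "ord_ge 2 (snd X)" if okX: "ok X" for X
  proof -
    obtain A B Q where X: "X = (pvarz ^ r * A, pvarz ^ (r - 1) * B)" "B = B0 + pvarz * Q"
      using okX unfolding ok_def by blast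
    have "eval2 B 0 0 = 0" using X(2) B0 by simp
    then have "ord_ge 1 B" by (simp add: ord_ge_def eval2_def poly_0_coeff_0)
    from ord_ge_mult[OF ord_pow[of "r - 1"] this] ord_ge_mult[OF ord_pow[of r] ord_ge_0(1)[of A]]
    show "ord_ge 2 (fst X)" "ord_ge 2 (snd X)"
      using r by (auto simp: X intro: ord_ge_mono)
  qed
  define F where "F = (pvarz ^ r * A0, pvarz ^ (r - 1) * B0)"
  have okF: "ok F" unfolding ok_def F_def
    by (intro exI[of _ A0] exI[of _ B0]) (auto intro!: exI[of _ 0])
  have ok_n: "ok ((\<Psi> ^^ n) F)" for n by (induction n) (simp_all add: okF ok_\<Psi>)
  have S_diff: "ord_ge (Suc n) (S X P - S Y P)"
    if "ok X" "ok Y" "ord_ge n (fst X - fst Y)" "ord_ge n (snd X - snd Y)" "n \<ge> 1" "ord_ge 1 P" for X Y n P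
  proof -
    have "S X P - S Y P = (\<Sum>j\<in>{2..K}. c j * ((lie X ^^ j) P - (lie Y ^^ j) P))"
      by (simp add: S_def sum_subtractf algebra_simps)
    moreover have "ord_ge (0 + Suc n) (c j * ((lie X ^^ j) P - (lie Y ^^ j) P))" if "j \<in> {2..K}" for j
      using ord_ge_lie_funpow_diff[OF ok_ord[OF \<open>ok X\<close>] ok_ord[OF \<open>ok Y\<close>], of n P j] that
        \<open>ord_ge n (fst X - fst Y)\<close> \<open>ord_ge n (snd X - snd Y)\<close> \<open>n \<ge> 1\<close> \<open>ord_ge 1 P\<close>
      by (intro ord_ge_mult) auto
    ultimately show ?thesis by (auto intro!: ord_ge_sum)
  qed
  \<comment> \<open>Convergence in the order valuation: each application of \<open>\<Psi>\<close>
    makes consecutive iterates agree to one order more.\<close>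
  have diff_n: "ord_ge (n + 1) (fst ((\<Psi> ^^ Suc n) F) - fst ((\<Psi> ^^ n) F)) \<and>
                ord_ge (n + 1) (snd ((\<Psi> ^^ Suc n) F) - snd ((\<Psi> ^^ n) F))" for n
  proof (induction n)
    case 0
    show ?case using ok_ord[OF okF] ok_ord[OF ok_\<Psi>[OF okF]]
      by (auto intro!: ord_ge_diff ord_ge_mono[of 2 _ "Suc 0"])
  next
    case (Suc n)
    let ?X = "(\<Psi> ^^ Suc n) F" and ?Y = "(\<Psi> ^^ n) F"
    have sd: "ord_ge (Suc (n + 1)) (S ?X P - S ?Y P)" if "ord_ge 1 P" for P
      using Suc.IH by (intro S_diff ok_n that) auto
    have "fst (\<Psi> ?X) - fst (\<Psi> ?Y) = 0 - (S ?X pvarz - S ?Y pvarz)"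
         "snd (\<Psi> ?X) - snd (\<Psi> ?Y) = 0 - (S ?X pvarw - S ?Y pvarw)"
      by (simp_all add: \<Psi>_def)
    moreover have "\<Psi> ?X = (\<Psi> ^^ Suc (Suc n)) F" "\<Psi> ?Y = (\<Psi> ^^ Suc n) F" by simp_all
    ultimately show ?case
      using ord_ge_diff[OF ord_ge_0(2) sd[OF ord_var(1)]] ord_ge_diff[OF ord_ge_0(2) sd[OF ord_var(2)]]
      by (simp del: funpow.simps)
  qed
  define X where "X = (\<Psi> ^^ p) F"
  obtain A B where AB: "X = (pvarz ^ r * A, pvarz ^ (r - 1) * B)" "\<exists>Q. A = A0 + pvarz * Q"
    "\<exists>Q. B = B0 + pvarz * Q \<and> eval2 Q 0 0 = 0"
    using ok_n[of p] unfolding X_def[symmetric] ok_def by blast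
  have split: "(\<Sum>j\<le>K. c j * (lie X ^^ j) P) = P + lie X P + S X P" for P
  proof -
    have "{..K} = insert 0 (insert 1 {2..K})" using K by auto
    then show ?thesis by (simp add: S_def c_def one_pCons[symmetric])
  qed
  have err: "ord_ge p (fst X - fst (\<Psi> X))" "ord_ge p (snd X - snd (\<Psi> X))"
  proof -
    have swap: "ord_ge p (P - Q)" if "ord_ge (p + 1) (Q - P)" for P Q
      using that by (auto simp: ord_ge_def)
    show "ord_ge p (fst X - fst (\<Psi> X))" "ord_ge p (snd X - snd (\<Psi> X))"
      using diff_n[of p] by (auto intro!: swap simp: X_def)
  qed
  have "lie X pvarz = fst X" by (simp add: lie_def pderiv_pCons pdw_pCons)
  moreover have "lie X pvarw = snd X"
    by (simp add: lie_def pderiv_pCons pdw_pCons one_pCons[symmetric])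
  ultimately have "(\<Sum>j\<le>K. c j * (lie X ^^ j) pvarz) - (pvarz + pvarz ^ r * A0) = fst X - fst (\<Psi> X)"
            "(\<Sum>j\<le>K. c j * (lie X ^^ j) pvarw) - (pvarw + pvarz ^ (r - 1) * B0) = snd X - snd (\<Psi> X)"
    unfolding split by (simp_all add: \<Psi>_def)
  then show ?thesis using err AB(2,3) by (intro that[of A B]) (simp_all add: AB(1) c_def)
qed

abbreviation solves_field_at where "solves_field_at r A B s z w t \<equiv>
  DERIV z t :> z t ^ r * eval2 A (z t) (w t) \<and> DERIV w t :> z t ^ (r - 1) * eval2 B (z t) (w t) \<and>
  norm (z t) \<le> s \<and> norm (w t) \<le> s"

text \<open>Along a solution the \<open>j\<close>-th time derivative of \<open>P\<close> is
  \<open>(lie X ^^ j) P\<close>, so Taylor's formula over the step from \<open>\<tau>\<close> to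
  \<open>\<tau> + 1\<close> reproduces the truncated exponential of the field. No flow has to be
  constructed: any solution on this segment is compared with the map, and \<open>s\<close> bounds
  its size there.\<close>

lemma interpolating_flow:
  assumes r: "r \<ge> 2" and B0: "eval2 B0 0 0 = 0"
  obtains A B C where "\<exists>Q. A = A0 + pvarz * Q" "\<exists>Q. B = B0 + pvarz * Q \<and> eval2 Q 0 0 = 0" "C \<ge> 0"
    "\<And>z w \<tau> s. s \<le> 1 \<Longrightarrow> (\<And>t. t \<in> closed_segment \<tau> (\<tau> + 1) \<Longrightarrow> solves_field_at r A B s z w t) \<Longrightarrow>
      norm (z (\<tau> + 1) - (z \<tau> + z \<tau> ^ r * eval2 A0 (z \<tau>) (w \<tau>))) \<le> C * s ^ p \<and>
      norm (w (\<tau> + 1) - (w \<tau> + z \<tau> ^ (r - 1) * eval2 B0 (z \<tau>) (w \<tau>))) \<le> C * s ^ p"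
proof -
  \<comment> \<open>Each derivation raises the order by one, so the Taylor remainder, a derivative
    of order \<open>Suc K\<close>, vanishes at least to order \<open>p\<close>.\<close>
  define K where "K = Suc p"
  obtain A B where AB: "\<exists>Q. A = A0 + pvarz * Q" "\<exists>Q. B = B0 + pvarz * Q \<and> eval2 Q 0 0 = 0"
    and err: "ord_ge p ((\<Sum>j\<le>K. [:[:1 / fact j:]:] * (lie (pvarz ^ r * A, pvarz ^ (r - 1) * B) ^^ j) pvarz)
      - (pvarz + pvarz ^ r * A0))"
    "ord_ge p ((\<Sum>j\<le>K. [:[:1 / fact j:]:] * (lie (pvarz ^ r * A, pvarz ^ (r - 1) * B) ^^ j) pvarw)
      - (pvarw + pvarz ^ (r - 1) * B0))"
    by (rule interpolating_vector_field[OF r B0, of K A0 p]) (auto simp: K_def)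
  define X where "X = (pvarz ^ r * A, pvarz ^ (r - 1) * B)"
  have B00: "eval2 B 0 0 = 0" using AB(2) B0 by (auto simp: eval2_pCons)
  have ord_var: "ord_ge 1 pvarz" "ord_ge 1 pvarw" by (simp_all add: ord_ge_def)
  have ord_pow: "ord_ge n (pvarz ^ n)" for n
  proof (induction n)
    case (Suc n)
    from ord_ge_mult[OF ord_var(1) Suc] show ?case by simp
  qed simp
  have "ord_ge 1 B" using B00 by (simp add: ord_ge_def eval2_def poly_0_coeff_0)
  from ord_ge_mult[OF ord_pow[of "r - 1"] this] ord_ge_mult[OF ord_pow[of r] ord_ge_0(1)[of A]]
  have X2: "ord_ge 2 (fst X)" "ord_ge 2 (snd X)" using r by (auto simp: X_def intro: ord_ge_mono)
  have main: "\<exists>C\<ge>0. \<forall>z w \<tau> s. s \<le> 1 \<longrightarrow> (\<forall>t\<in>closed_segment \<tau> (\<tau> + 1). solves_field_at r A B s z w t) \<longrightarrow>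
      norm (eval2 P (z (\<tau> + 1)) (w (\<tau> + 1)) - eval2 T (z \<tau>) (w \<tau>)) \<le> C * s ^ p"
    if P: "ord_ge 1 P" and T: "ord_ge p ((\<Sum>j\<le>K. [:[:1 / fact j:]:] * (lie X ^^ j) P) - T)" for P T
  proof -
    have "ord_ge p ((lie X ^^ Suc K) P)"
      by (rule ord_ge_mono[OF ord_ge_lie_funpow[OF X2 P, of "Suc K"]]) (simp add: K_def)
    then obtain C1 where C1: "C1 \<ge> 0" "\<And>z w s. norm z \<le> s \<Longrightarrow> norm w \<le> s \<Longrightarrow> s \<le> 1 \<Longrightarrow>
        norm (eval2 ((lie X ^^ Suc K) P) z w) \<le> C1 * s ^ p" using ord_ge_bound by blast
    obtain C2 where C2: "C2 \<ge> 0" "\<And>z w s. norm z \<le> s \<Longrightarrow> norm w \<le> s \<Longrightarrow> s \<le> 1 \<Longrightarrow>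
        norm (eval2 ((\<Sum>j\<le>K. [:[:1 / fact j:]:] * (lie X ^^ j) P) - T) z w) \<le> C2 * s ^ p"
      using ord_ge_bound[OF T] by blast
    show ?thesis
    proof (intro exI[of _ "C1 + C2"] conjI allI impI)
      fix z w :: "complex \<Rightarrow> complex" and \<tau> s
      assume s: "s \<le> 1" and ode: "\<forall>t\<in>closed_segment \<tau> (\<tau> + 1). solves_field_at r A B s z w t"
      define f where "f = (\<lambda>j t. eval2 ((lie X ^^ j) P) (z t) (w t))"
      have s0: "s \<ge> 0" using ode ends_in_segment(1) norm_ge_zero order_trans by blast
      have "norm (f 0 (\<tau> + 1) - (\<Sum>j\<le>K. f j \<tau> * ((\<tau> + 1) - \<tau>) ^ j / fact j))
          \<le> (C1 * s ^ p) * norm ((\<tau> + 1) - \<tau>) ^ Suc K / fact K"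
      proof (rule field_Taylor[where S = "closed_segment \<tau> (\<tau> + 1)"])
        fix j t assume t: "t \<in> closed_segment \<tau> (\<tau> + 1)"
        have "DERIV (f j) t :> f (Suc j) t"
          using eval2_has_field_derivative[of z _ t w _ "(lie X ^^ j) P"] bspec[OF ode t]
          by (simp add: f_def lie_def X_def)
        then show "(f j has_field_derivative f (Suc j) t) (at t within closed_segment \<tau> (\<tau> + 1))"
          by (rule has_field_derivative_at_within)
      next
        fix t assume t: "t \<in> closed_segment \<tau> (\<tau> + 1)"
        show "norm (f (Suc K) t) \<le> C1 * s ^ p"
          unfolding f_def using bspec[OF ode t] s by (intro C1(2)) auto
      qed auto
      also have "\<dots> \<le> C1 * s ^ p"
        using mult_left_mono[OF fact_ge_1[of K, where ?'a = real], of "C1 * s ^ p"] C1(1) s0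
        by (simp add: divide_le_eq)
      also have "(\<Sum>j\<le>K. f j \<tau> * ((\<tau> + 1) - \<tau>) ^ j / fact j)
          = eval2 (\<Sum>j\<le>K. [:[:1 / fact j:]:] * (lie X ^^ j) P) (z \<tau>) (w \<tau>)"
        by (simp add: eval2_sum f_def del: mult_pCons_left)
      finally have 1: "norm (f 0 (\<tau> + 1) - eval2 (\<Sum>j\<le>K. [:[:1 / fact j:]:] * (lie X ^^ j) P) (z \<tau>) (w \<tau>)) \<le> C1 * s ^ p" .
      have 2: "norm (eval2 (\<Sum>j\<le>K. [:[:1 / fact j:]:] * (lie X ^^ j) P) (z \<tau>) (w \<tau>) - eval2 T (z \<tau>) (w \<tau>)) \<le> C2 * s ^ p"
        using C2(2)[of "z \<tau>" s "w \<tau>"] ode s by (simp del: mult_pCons_left)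
      from norm_triangle_mono[OF 1 2] show "norm (eval2 P (z (\<tau> + 1)) (w (\<tau> + 1)) - eval2 T (z \<tau>) (w \<tau>)) \<le> (C1 + C2) * s ^ p"
        by (simp add: f_def algebra_simps)
    qed (use C1 C2 in auto)
  qed
  from main[OF ord_var(1) err(1)[folded X_def]] obtain C1 where C1: "C1 \<ge> 0"
    "\<And>z w \<tau> s. s \<le> 1 \<Longrightarrow> (\<forall>t\<in>closed_segment \<tau> (\<tau> + 1). solves_field_at r A B s z w t) \<Longrightarrow>
      norm (z (\<tau> + 1) - (z \<tau> + z \<tau> ^ r * eval2 A0 (z \<tau>) (w \<tau>))) \<le> C1 * s ^ p"
    by (auto simp del: mult_pCons_left)
  from main[OF ord_var(2) err(2)[folded X_def]] obtain C2 where C2: "C2 \<ge> 0"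
    "\<And>z w \<tau> s. s \<le> 1 \<Longrightarrow> (\<forall>t\<in>closed_segment \<tau> (\<tau> + 1). solves_field_at r A B s z w t) \<Longrightarrow>
      norm (w (\<tau> + 1) - (w \<tau> + z \<tau> ^ (r - 1) * eval2 B0 (z \<tau>) (w \<tau>))) \<le> C2 * s ^ p"
    by (auto simp del: mult_pCons_left)
  show ?thesis
  proof (rule that[OF AB, of "C1 + C2"])
    fix z w :: "complex \<Rightarrow> complex" and \<tau> s
    assume s: "s \<le> 1" and ode: "\<And>t. t \<in> closed_segment \<tau> (\<tau> + 1) \<Longrightarrow> solves_field_at r A B s z w t"
    have "s \<ge> 0" using ode ends_in_segment(1) norm_ge_zero order_trans by blast
    then have le: "C1 * s ^ p \<le> (C1 + C2) * s ^ p" "C2 * s ^ p \<le> (C1 + C2) * s ^ p"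
      using C1(1) C2(1) by (auto intro!: mult_right_mono)
    show "norm (z (\<tau> + 1) - (z \<tau> + z \<tau> ^ r * eval2 A0 (z \<tau>) (w \<tau>))) \<le> (C1 + C2) * s ^ p \<and>
        norm (w (\<tau> + 1) - (w \<tau> + z \<tau> ^ (r - 1) * eval2 B0 (z \<tau>) (w \<tau>))) \<le> (C1 + C2) * s ^ p"
      using order_trans[OF C1(2)[OF s] le(1)] order_trans[OF C2(2)[OF s] le(2)] ode by blast
  qed (use C1 C2 in auto)
qed

section \<open>Correcting an approximate invariant curve\<close>

text \<open>Picard iteration from 0 in the unit ball of a weighted sup norm. The geometric
  convergence is locally uniform because the weights are continuous, so the limit is holomorphic.
  The index \<open>i\<close> numbers the unknown functions, and one \<open>d\<close> common to all
  of them measures the distance.\<close>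

lemma weighted_contraction_fixed_point:
  fixes D :: "complex set" and W :: "'i \<Rightarrow> complex \<Rightarrow> real" and T :: "('i \<Rightarrow> complex \<Rightarrow> complex) \<Rightarrow> 'i \<Rightarrow> complex \<Rightarrow> complex"
  defines "B \<equiv> \<lambda>u. \<forall>i. u i holomorphic_on D \<and> (\<forall>t\<in>D. norm (u i t) \<le> W i t)"
  assumes D: "open D" and W: "\<And>i. continuous_on D (W i)" "\<And>i t. t \<in> D \<Longrightarrow> W i t \<ge> 0"
    and T: "\<And>u. B u \<Longrightarrow> B (T u)"
    and contr: "\<And>u v d. B u \<Longrightarrow> B v \<Longrightarrow> d \<ge> 0 \<Longrightarrow> (\<And>i t. t \<in> D \<Longrightarrow> norm (u i t - v i t) \<le> d * W i t) \<Longrightarrow>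
        (\<And>i t. t \<in> D \<Longrightarrow> norm (T u i t - T v i t) \<le> d / 2 * W i t)"
  obtains u where "\<And>i. u i holomorphic_on D" "\<And>i t. t \<in> D \<Longrightarrow> norm (u i t) \<le> W i t"
    "\<And>i t. t \<in> D \<Longrightarrow> T u i t = u i t"
proof -
  define U where "U = (\<lambda>n. (T ^^ n) (\<lambda>i t. 0))"
  have "B (\<lambda>i t. 0)" unfolding B_def using W(2) by simp
  then have BU: "B (U n)" for n
    by (induction n) (simp_all add: U_def T)
  have step: "norm (U (Suc n) i t - U n i t) \<le> 2 * (1 / 2) ^ n * W i t" if "t \<in> D" for n i t
    using that
  proof (induction n arbitrary: i t)
    case 0
    have "norm (U 1 i t) \<le> W i t" "norm (U 0 i t) \<le> W i t" using BU 0 unfolding B_def by blast+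
    then show ?case using norm_triangle_ineq4[of "U 1 i t" "U 0 i t"] by simp
  next
    case (Suc n)
    have "norm (T (U (Suc n)) i t - T (U n) i t) \<le> (2 * (1 / 2) ^ n) / 2 * W i t"
      by (rule contr[OF BU BU _ Suc.IH Suc.prems]) auto
    then show ?case by (simp add: U_def)
  qed
  have dist_le: "norm (U (n + k) i t - U n i t) \<le> 4 * (1 / 2) ^ n * W i t" if "t \<in> D" for n k i t
  proof -
    have "norm (U (n + k) i t - U n i t) \<le> (4 * (1 / 2) ^ n - 4 * (1 / 2) ^ (n + k)) * W i t"
    proof (induction k)
      case (Suc k)
      have "norm (U (n + Suc k) i t - U n i t)
          \<le> norm (U (Suc (n + k)) i t - U (n + k) i t) + norm (U (n + k) i t - U n i t)"
        using norm_triangle_ineq[of "U (Suc (n + k)) i t - U (n + k) i t" "U (n + k) i t - U n i t"] by simp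
      also have "\<dots> \<le> 2 * (1 / 2) ^ (n + k) * W i t + (4 * (1 / 2) ^ n - 4 * (1 / 2) ^ (n + k)) * W i t"
        by (intro add_mono step that Suc.IH)
      finally show ?case by (simp add: algebra_simps)
    qed simp
    also have "\<dots> \<le> 4 * (1 / 2) ^ n * W i t" using W(2)[OF that] by (intro mult_right_mono) auto
    finally show ?thesis .
  qed
  define u where "u = (\<lambda>i t. lim (\<lambda>n. U n i t))"
  have lim: "(\<lambda>n. U n i t) \<longlonglongrightarrow> u i t" if t: "t \<in> D" for i t
  proof -
    have "Cauchy (\<lambda>n. U n i t)"
    proof (rule CauchyI)
      fix e :: real assume e: "e > 0"
      have "(\<lambda>n. 8 * (1 / 2) ^ n * W i t) \<longlonglongrightarrow> 8 * 0 * W i t"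
        by (intro tendsto_intros LIMSEQ_power_zero) auto
      then have "\<forall>\<^sub>F n in sequentially. 8 * (1 / 2) ^ n * W i t < e"
        using e by (intro order_tendstoD) auto
      then obtain N where N: "8 * (1 / 2) ^ N * W i t < e" by (auto simp: eventually_sequentially)
      have "norm (U m i t - U n i t) < e" if "m \<ge> N" "n \<ge> N" for m n
      proof -
        have "norm (U m i t - U n i t) \<le> norm (U m i t - U N i t) + norm (U n i t - U N i t)"
          using norm_triangle_ineq4[of "U m i t - U N i t" "U n i t - U N i t"] by simp
        also have "\<dots> \<le> 4 * (1 / 2) ^ N * W i t + 4 * (1 / 2) ^ N * W i t"
          using dist_le[OF t, of N "m - N" i] dist_le[OF t, of N "n - N" i] that by (intro add_mono) simp_all
        finally show ?thesis using N by (simp add: mult_ac)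
      qed
      then show "\<exists>M. \<forall>m\<ge>M. \<forall>n\<ge>M. norm (U m i t - U n i t) < e" by blast
    qed
    then show ?thesis by (simp add: u_def Cauchy_convergent_iff convergent_LIMSEQ_iff)
  qed
  have close: "norm (u i t - U n i t) \<le> 4 * (1 / 2) ^ n * W i t" if "t \<in> D" for n i t
  proof (rule LIMSEQ_le_const2)
    show "(\<lambda>m. norm (U (m + n) i t - U n i t)) \<longlonglongrightarrow> norm (u i t - U n i t)"
      by (intro tendsto_intros LIMSEQ_ignore_initial_segment lim that)
    show "\<exists>N. \<forall>m\<ge>N. norm (U (m + n) i t - U n i t) \<le> 4 * (1 / 2) ^ n * W i t"
      using dist_le[OF that, of n _ i] by (auto simp: add.commute)
  qed
  have u_hol: "u i holomorphic_on D" for i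
  proof (rule holomorphic_uniform_sequence[OF D])
    show "U n i holomorphic_on D" for n using BU unfolding B_def by blast
    fix x assume "x \<in> D"
    then obtain d where d: "d > 0" "cball x d \<subseteq> D" using D open_contains_cball by blast
    have "compact (W i ` cball x d)"
      by (intro compact_continuous_image continuous_on_subset[OF W(1) d(2)] compact_cball)
    then obtain M where M: "\<And>t. t \<in> cball x d \<Longrightarrow> W i t \<le> M"
      by (meson bounded_imp_bdd_above compact_imp_bounded bdd_above.E imageI)
    have "uniform_limit (cball x d) (\<lambda>n. U n i) (u i) sequentially"
    proof (rule uniform_limitI)
      fix e :: real assume e: "e > 0"
      have "(\<lambda>n. 4 * (1 / 2) ^ n * M) \<longlonglongrightarrow> 4 * 0 * M"
        by (intro tendsto_intros LIMSEQ_power_zero) auto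
      then have "\<forall>\<^sub>F n in sequentially. 4 * (1 / 2) ^ n * M < e"
        using e by (intro order_tendstoD) auto
      then show "\<forall>\<^sub>F n in sequentially. \<forall>t\<in>cball x d. dist (U n i t) (u i t) < e"
      proof eventually_elim
        case (elim n)
        show ?case
        proof
          fix t assume t: "t \<in> cball x d"
          then have "norm (u i t - U n i t) \<le> 4 * (1 / 2) ^ n * W i t" using d(2) by (intro close) auto
          also have "\<dots> \<le> 4 * (1 / 2) ^ n * M" using M[OF t] by (intro mult_left_mono) auto
          finally show "dist (U n i t) (u i t) < e" using elim by (simp add: dist_norm norm_minus_commute)
        qed
      qed
    qed
    then show "\<exists>d>0. cball x d \<subseteq> D \<and> uniform_limit (cball x d) (\<lambda>n. U n i) (u i) sequentially"
      using d by blast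
  qed
  have u_W: "norm (u i t) \<le> W i t" if "t \<in> D" for i t
    by (rule LIMSEQ_le_const2[OF tendsto_norm[OF lim[OF that]]]) (use BU that in \<open>auto simp: B_def\<close>)
  have Bu: "B u" unfolding B_def using u_hol u_W by blast
  have "T u i t = u i t" if t: "t \<in> D" for i t
  proof -
    have "(\<lambda>n. U (Suc n) i t - T u i t) \<longlonglongrightarrow> 0"
    proof (rule Lim_null_comparison)
      have "norm (T (U n) i t - T u i t) \<le> (4 * (1 / 2) ^ n) / 2 * W i t" for n
        by (rule contr[OF BU Bu _ _ t]) (use close in \<open>auto simp: norm_minus_commute\<close>)
      then show "\<forall>\<^sub>F n in sequentially. norm (U (Suc n) i t - T u i t) \<le> 2 * (1 / 2) ^ n * W i t"
        by (auto simp: U_def intro!: always_eventually)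
      have "(\<lambda>n. 2 * (1 / 2) ^ n * W i t) \<longlonglongrightarrow> 2 * 0 * W i t"
        by (intro tendsto_intros LIMSEQ_power_zero) auto
      then show "(\<lambda>n. 2 * (1 / 2) ^ n * W i t) \<longlonglongrightarrow> 0" by simp
    qed
    then have "(\<lambda>n. U (Suc n) i t) \<longlonglongrightarrow> T u i t" by (rule LIM_zero_cancel)
    moreover have "(\<lambda>n. U (Suc n) i t) \<longlonglongrightarrow> u i t" by (rule LIMSEQ_Suc[OF lim[OF t]])
    ultimately show ?thesis by (rule LIMSEQ_unique)
  qed
  then show ?thesis using that u_hol u_W by blast
qed

section \<open>Difference equations along \<open>t -> t + 1\<close> on a half plane\<close>

definition half_plane :: "real \<Rightarrow> complex set" where "half_plane R = {t. Re t > R}"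

lemma open_half_plane: "open (half_plane R)"
  unfolding half_plane_def by (rule open_halfspace_Re_gt)

lemma convex_half_plane: "convex (half_plane R)"
  unfolding half_plane_def by (rule convex_halfspace_Re_gt)

lemma half_plane_add: "t \<in> half_plane R \<Longrightarrow> t + of_nat n \<in> half_plane R"
  by (simp add: half_plane_def)

text \<open>The discrete analogue of differentiating \<open>1 / y^q\<close>, by Bernoulli's
  inequality. The factor 2 comes from \<open>y + q \<le> 2 y\<close>.\<close>

lemma inverse_power_diff_ge:
  fixes y :: real
  assumes "y \<ge> real q" "q \<ge> 1"
  shows "1 / y ^ Suc q \<le> 2 / real q * (1 / y ^ q - 1 / (y + 1) ^ q)"
proof -
  have y: "y > 0" using assms by linarith
  have "1 + real q * (1 / y) \<le> (1 + 1 / y) ^ q" by (rule Bernoulli_inequality) (use y in \<open>simp add: order_trans[of "-1" 0]\<close>)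
  then have 1: "(1 + real q / y) \<le> ((y + 1) / y) ^ q" using y by (simp add: field_simps)
  have "1 / ((y + 1) / y) ^ q \<le> 1 / (1 + real q / y)"
    using 1 y assms by (intro divide_left_mono mult_pos_pos) (auto intro!: add_pos_nonneg)
  then have "y ^ q / (y + 1) ^ q \<le> y / (y + real q)"
    using y by (simp add: power_divide divide_simps split: if_splits)
  then have "1 - y ^ q / (y + 1) ^ q \<ge> real q / (y + real q)"
    using y assms by (simp add: field_simps)
  moreover have "real q / (y + real q) \<ge> real q / (2 * y)"
    using assms y by (intro divide_left_mono mult_pos_pos) auto
  ultimately have "real q / (2 * y) \<le> 1 - y ^ q / (y + 1) ^ q" by linarith
  then have "(real q / (2 * y)) * (1 / y ^ q) \<le> (1 - y ^ q / (y + 1) ^ q) * (1 / y ^ q)"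
    using y by (intro mult_right_mono) auto
  also have "\<dots> = 1 / y ^ q - 1 / (y + 1) ^ q" using y by (simp add: field_simps)
  finally show ?thesis using assms y by (simp add: field_simps)
qed

text \<open>Telescoping. The factor \<open>2 / q\<close> is the source of smallness in
  \<open>discrete_solution\<close>.\<close>

lemma sum_inverse_power_shift:
  fixes x :: real
  assumes "x \<ge> real q" "q \<ge> 1"
  shows "summable (\<lambda>n. 1 / (x + real n) ^ Suc q)" "(\<Sum>n. 1 / (x + real n) ^ Suc q) \<le> 2 / real q * (1 / x ^ q)"
proof -
  have x: "x > 0" using assms by linarith
  define b where "b = (\<lambda>n. 1 / (x + real n) ^ q)"
  have "b \<longlonglongrightarrow> 0" unfolding b_def using assms(2) by real_asymp
  then have "(\<lambda>n. b n - b (Suc n)) sums (b 0 - 0)" by (rule telescope_sums')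
  then have s: "(\<lambda>n. 2 / real q * (b n - b (Suc n))) sums (2 / real q * (1 / x ^ q))"
    by (intro sums_mult) (simp add: b_def)
  have le: "1 / (x + real n) ^ Suc q \<le> 2 / real q * (b n - b (Suc n))" for n
    using inverse_power_diff_ge[of q "x + real n"] assms by (simp add: b_def add_ac)
  show sm: "summable (\<lambda>n. 1 / (x + real n) ^ Suc q)"
    by (rule summable_comparison_test'[OF sums_summable[OF s], of 0]) (use le x in auto)
  show "(\<Sum>n. 1 / (x + real n) ^ Suc q) \<le> 2 / real q * (1 / x ^ q)"
    using suminf_le[OF le sm sums_summable[OF s]] sums_unique[OF s] by simp
qed

text \<open>The sum over the forward orbit of \<open>t -> t + 1\<close> inverts the difference
  operator; it loses one power of \<open>Re t\<close> and gains the factor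
  \<open>2 / q\<close>.\<close>

lemma half_plane_shift_sum:
  assumes R: "R \<ge> real q" "q \<ge> 1" and g: "g holomorphic_on half_plane R"
    and bound: "\<And>t. t \<in> half_plane R \<Longrightarrow> norm (g t) \<le> c / Re t ^ Suc q"
  defines "G \<equiv> \<lambda>t. \<Sum>n. g (t + of_nat n)"
  shows "G holomorphic_on half_plane R"
    and "\<And>t. t \<in> half_plane R \<Longrightarrow> summable (\<lambda>n. g (t + of_nat n))"
    and "\<And>t. t \<in> half_plane R \<Longrightarrow> G t - G (t + 1) = g t"
    and "\<And>t. t \<in> half_plane R \<Longrightarrow> norm (G t) \<le> c * (2 / real q) / Re t ^ q"
proof -
  have R0: "R > 0" using R by linarith
  have c: "c \<ge> 0"
  proof -
    have "of_real (R + 1) \<in> half_plane R" by (simp add: half_plane_def)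
    from order_trans[OF norm_ge_zero bound[OF this]] have "0 \<le> c / (R + 1) ^ Suc q" by simp
    moreover have "0 < (R + 1) ^ Suc q" using R0 by (intro zero_less_power) simp
    ultimately show ?thesis by (auto simp only: zero_le_divide_iff)
  qed
  have le: "norm (g (t + of_nat n)) \<le> c * (1 / (Re t + real n) ^ Suc q)" if "t \<in> half_plane R" for t n
    using bound[OF half_plane_add[OF that, of n]] by simp
  have sm: "summable (\<lambda>n. norm (g (t + of_nat n)))" if t: "t \<in> half_plane R" for t
    by (rule summable_comparison_test'[OF summable_mult[OF sum_inverse_power_shift(1)[of q "Re t"]], of 0 _ c])
      (use t R le[OF t] in \<open>auto simp: half_plane_def\<close>)
  show sm': "summable (\<lambda>n. g (t + of_nat n))" if "t \<in> half_plane R" for t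
    by (rule summable_norm_cancel[OF sm[OF that]])
  show "G t - G (t + 1) = g t" if t: "t \<in> half_plane R" for t
    using suminf_split_head[OF sm'[OF t]] by (simp add: G_def add_ac)
  show "norm (G t) \<le> c * (2 / real q) / Re t ^ q" if t: "t \<in> half_plane R" for t
  proof -
    have x: "Re t \<ge> real q" using t R by (simp add: half_plane_def)
    have "norm (G t) \<le> (\<Sum>n. norm (g (t + of_nat n)))" unfolding G_def by (rule summable_norm[OF sm[OF t]])
    also have "\<dots> \<le> (\<Sum>n. c * (1 / (Re t + real n) ^ Suc q))"
      by (rule suminf_le[OF le[OF t] sm[OF t] summable_mult[OF sum_inverse_power_shift(1)[OF x R(2)]]])
    also have "\<dots> = c * (\<Sum>n. 1 / (Re t + real n) ^ Suc q)"
      by (rule suminf_mult[OF sum_inverse_power_shift(1)[OF x R(2)]])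
    also have "\<dots> \<le> c * (2 / real q * (1 / Re t ^ q))"
      by (intro mult_left_mono sum_inverse_power_shift(2) x R c)
    finally show ?thesis by simp
  qed
  show "G holomorphic_on half_plane R"
  proof (rule holomorphic_uniform_sequence[OF open_half_plane])
    show "(\<lambda>t. \<Sum>n<N. g (t + of_nat n)) holomorphic_on half_plane R" for N
    proof (intro holomorphic_intros)
      fix n
      have "g \<circ> (\<lambda>t. t + of_nat n) holomorphic_on half_plane R"
        by (rule holomorphic_on_compose_gen[OF _ g]) (auto intro!: holomorphic_intros half_plane_add)
      then show "(\<lambda>t. g (t + of_nat n)) holomorphic_on half_plane R" by (simp add: o_def)
    qed
    fix x assume "x \<in> half_plane R"
    then obtain d where d: "d > 0" "cball x d \<subseteq> half_plane R" using open_half_plane open_contains_cball by blast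
    have "uniform_limit (half_plane R) (\<lambda>N t. \<Sum>n<N. g (t + of_nat n)) G sequentially"
      unfolding G_def
    proof (rule Weierstrass_m_test)
      show "summable (\<lambda>n. c * (1 / (R + real n) ^ Suc q))"
        by (intro summable_mult sum_inverse_power_shift(1) R)
      fix n t assume t: "t \<in> half_plane R"
      have "norm (g (t + of_nat n)) \<le> c * (1 / (Re t + real n) ^ Suc q)" by (rule le[OF t])
      also have "\<dots> \<le> c * (1 / (R + real n) ^ Suc q)"
        using t R0 c by (intro mult_left_mono divide_left_mono power_mono mult_pos_pos)
          (auto simp: half_plane_def intro!: zero_less_power mult_pos_pos add_pos_nonneg)
      finally show "norm (g (t + of_nat n)) \<le> c * (1 / (R + real n) ^ Suc q)" .
    qed
    then show "\<exists>d>0. cball x d \<subseteq> half_plane R \<and>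
        uniform_limit (cball x d) (\<lambda>N t. \<Sum>n<N. g (t + of_nat n)) G sequentially"
      using d uniform_limit_on_subset by blast
  qed
qed

text \<open>Cauchy's inequality on discs of radius \<open>\<rho> / 4\<close>, which stay inside the
  large disc when centred in the one of half the radius.\<close>

lemma lipschitz_of_bounded_holomorphic:
  assumes h: "h holomorphic_on ball 0 \<rho>" and B: "\<And>x. norm x < \<rho> \<Longrightarrow> norm (h x) \<le> B" and \<rho>: "\<rho> > 0"
    and x: "norm x \<le> \<rho> / 2" "norm x' \<le> \<rho> / 2"
  shows "norm (h x - h x') \<le> 4 * B / \<rho> * norm (x - x')"
proof (rule field_differentiable_bound[where S = "cball 0 (\<rho> / 2)" and f' = "deriv h"])
  fix y :: complex assume y: "y \<in> cball 0 (\<rho> / 2)"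
  show "(h has_field_derivative deriv h y) (at y within cball 0 (\<rho> / 2))"
    by (rule holomorphic_derivI[OF h]) (use y \<rho> in auto)
  have sub: "cball y (\<rho> / 4) \<subseteq> ball 0 \<rho>"
  proof
    fix v assume "v \<in> cball y (\<rho> / 4)"
    then have "norm (v - y) \<le> \<rho> / 4" by (simp add: dist_norm norm_minus_commute)
    then show "v \<in> ball 0 \<rho>" using y \<rho> norm_triangle_ineq[of "v - y" y] by auto
  qed
  have "norm ((deriv ^^ 1) h y) \<le> fact 1 * B / (\<rho> / 4) ^ 1"
  proof (rule Cauchy_inequality)
    show "h holomorphic_on ball y (\<rho> / 4)" using sub by (intro holomorphic_on_subset[OF h]) auto
    show "continuous_on (cball y (\<rho> / 4)) h"
      using sub by (intro holomorphic_on_imp_continuous_on holomorphic_on_subset[OF h]) auto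
    fix v assume "norm (y - v) = \<rho> / 4"
    then show "norm (h v) \<le> B" using sub by (intro B) (auto simp: dist_norm subset_iff)
  qed (use \<rho> in auto)
  then show "norm (deriv h y) \<le> 4 * B / \<rho>" by (simp add: field_simps)
qed (use x in auto)

text \<open>A solution is a fixed point of the map that sends \<open>u\<close> to minus the sum of
  \<open>g\<close> along the forward orbit. The bound \<open>B / Re t\<close> on a disc of radius
  \<open>\<rho>\<close> gives the Lipschitz constant \<open>L / Re t\<close> with
  \<open>L = 4 B / \<rho>\<close>, and on the ball of radius \<open>1 / (Re t)^q\<close> the sum
  multiplies distances by at most \<open>4 L / q\<close>. The condition on \<open>q\<close> reads
  \<open>q \<ge> 4 + 8 L\<close>: from \<open>4 + 4 L \<le> q\<close> the ball is invariant, from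
  \<open>8 L \<le> q\<close> the factor is at most \<open>1 / 2\<close>.\<close>

lemma discrete_solution:
  fixes g :: "bool \<Rightarrow> complex \<Rightarrow> complex \<Rightarrow> complex \<Rightarrow> complex"
  assumes \<rho>: "\<rho> > 0" and B: "B \<ge> 0"
    and q: "real q \<ge> 4 + 32 * B / \<rho>" and R: "R \<ge> real q" "R \<ge> 2 / \<rho>"
    and holo: "\<And>i x y. x holomorphic_on half_plane R \<Longrightarrow> y holomorphic_on half_plane R \<Longrightarrow>
      (\<And>t. t \<in> half_plane R \<Longrightarrow> norm (x t) \<le> \<rho> \<and> norm (y t) \<le> \<rho>) \<Longrightarrow>
      (\<lambda>t. g i t (x t) (y t)) holomorphic_on half_plane R"
    and hx: "\<And>i t y. t \<in> half_plane R \<Longrightarrow> norm y < \<rho> \<Longrightarrow> (\<lambda>x. g i t x y) holomorphic_on ball 0 \<rho>"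
    and hy: "\<And>i t x. t \<in> half_plane R \<Longrightarrow> norm x < \<rho> \<Longrightarrow> (\<lambda>y. g i t x y) holomorphic_on ball 0 \<rho>"
    and bound: "\<And>i t x y. t \<in> half_plane R \<Longrightarrow> norm x < \<rho> \<Longrightarrow> norm y < \<rho> \<Longrightarrow> norm (g i t x y) \<le> B / Re t"
    and small: "\<And>i t. t \<in> half_plane R \<Longrightarrow> norm (g i t 0 0) \<le> 2 / Re t ^ Suc q"
  obtains x y where "x holomorphic_on half_plane R" "y holomorphic_on half_plane R"
    "\<And>t. t \<in> half_plane R \<Longrightarrow> norm (x t) \<le> 1 / Re t ^ q"
    "\<And>t. t \<in> half_plane R \<Longrightarrow> norm (y t) \<le> 1 / Re t ^ q"
    "\<And>t. t \<in> half_plane R \<Longrightarrow> x (t + 1) = x t + g True t (x t) (y t)"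
    "\<And>t. t \<in> half_plane R \<Longrightarrow> y (t + 1) = y t + g False t (x t) (y t)"
proof -
  let ?H = "half_plane R"
  define L where "L = 4 * B / \<rho>"
  have L: "L \<ge> 0" "real q \<ge> 4 + 8 * L" using B \<rho> q by (auto simp: L_def)
  then have q1: "q \<ge> 1" "real q \<ge> 4" by linarith+
  have R1: "R \<ge> 1" using R(1) q1 by linarith
  have W_le: "1 / Re t ^ q \<le> \<rho> / 2" if "t \<in> ?H" for t
  proof -
    have t: "Re t > R" using that by (simp add: half_plane_def)
    have "Re t ^ 1 \<le> Re t ^ q" using t R1 q1 by (intro power_increasing) auto
    then have "1 / Re t ^ q \<le> 1 / Re t" using t R1 by (intro divide_left_mono) auto
    also have "\<dots> \<le> 1 / (2 / \<rho>)" using t R \<rho> R1 by (intro divide_left_mono mult_pos_pos) auto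
    finally show ?thesis by simp
  qed
  have lip: "norm (g i t x y - g i t x' y') \<le> L / Re t * (norm (x - x') + norm (y - y'))"
    if t: "t \<in> ?H" and xy: "norm x \<le> \<rho> / 2" "norm y \<le> \<rho> / 2" "norm x' \<le> \<rho> / 2" "norm y' \<le> \<rho> / 2" for i t x y x' y'
  proof -
    have lt: "norm y < \<rho>" "norm x' < \<rho>" using xy \<rho> by auto
    have "norm (g i t x y - g i t x' y) \<le> 4 * (B / Re t) / \<rho> * norm (x - x')"
      by (rule lipschitz_of_bounded_holomorphic[OF hx[OF t lt(1)] bound[OF t _ lt(1)] \<rho> xy(1,3)])
    moreover have "norm (g i t x' y - g i t x' y') \<le> 4 * (B / Re t) / \<rho> * norm (y - y')"
      by (rule lipschitz_of_bounded_holomorphic[OF hy[OF t lt(2)] bound[OF t lt(2)] \<rho> xy(2,4)])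
    ultimately have "norm (g i t x y - g i t x' y) + norm (g i t x' y - g i t x' y')
        \<le> L / Re t * (norm (x - x') + norm (y - y'))"
      by (simp add: L_def algebra_simps add_divide_distrib)
    then show ?thesis using norm_triangle_ineq[of "g i t x y - g i t x' y" "g i t x' y - g i t x' y'"] by simp
  qed
  define W where "W = (\<lambda>(i::bool) t. 1 / Re t ^ q)"
  define G where "G = (\<lambda>u i t. g i t (u True t) (u False t))"
  define T where "T = (\<lambda>u i t. - (\<Sum>n. G u i (t + of_nat n)))"
  define OK where "OK = (\<lambda>u. \<forall>i. u i holomorphic_on ?H \<and> (\<forall>t\<in>?H. norm (u i t) \<le> W i t))"
  have OK_le: "norm (u i t) \<le> \<rho> / 2" if "OK u" "t \<in> ?H" for u i t
    using order_trans[OF _ W_le[OF that(2)], of "norm (u i t)"] that unfolding OK_def W_def by blast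
  have Ghol: "G u i holomorphic_on ?H" if "OK u" for u i
    unfolding G_def
  proof (rule holo)
    show "u True holomorphic_on ?H" "u False holomorphic_on ?H" using that by (simp_all add: OK_def)
    fix t assume t: "t \<in> ?H"
    then show "norm (u True t) \<le> \<rho> \<and> norm (u False t) \<le> \<rho>"
      using OK_le[OF that t, of True] OK_le[OF that t, of False] \<rho> by auto
  qed
  have Re_pos: "Re t > 0" if "t \<in> ?H" for t using that R1 by (auto simp: half_plane_def)
  have Gdiff: "norm (G u i t - G v i t) \<le> (2 * L * d) / Re t ^ Suc q"
    if "OK u" "OK v" "\<And>i t. t \<in> ?H \<Longrightarrow> norm (u i t - v i t) \<le> d * W i t" "t \<in> ?H" for u v d i t
  proof -
    have "norm (G u i t - G v i t) \<le> L / Re t * (norm (u True t - v True t) + norm (u False t - v False t))"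
      unfolding G_def using that by (intro lip OK_le)
    also have "\<dots> \<le> L / Re t * (d * (1 / Re t ^ q) + d * (1 / Re t ^ q))"
      using that(3)[OF that(4)] L Re_pos[OF that(4)] unfolding W_def
      by (intro mult_left_mono add_mono) auto
    also have "\<dots> = (2 * L * d) / Re t ^ Suc q" by (simp add: field_simps)
    finally show ?thesis .
  qed
  have OK0: "OK (\<lambda>i t. 0)"
    unfolding OK_def W_def using Re_pos by (auto simp: less_imp_le)
  have Gle: "norm (G u i t) \<le> (2 + 2 * L) / Re t ^ Suc q" if "OK u" "t \<in> ?H" for u i t
  proof -
    have "norm (G u i t - G (\<lambda>i t. 0) i t) \<le> (2 * L * 1) / Re t ^ Suc q"
      using that(1) by (intro Gdiff OK0 that) (auto simp: OK_def)
    moreover have "norm (G (\<lambda>i t. 0) i t) \<le> 2 / Re t ^ Suc q" unfolding G_def by (rule small[OF that(2)])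
    ultimately show ?thesis
      using norm_triangle_ineq[of "G u i t - G (\<lambda>i t. 0) i t" "G (\<lambda>i t. 0) i t"] by (simp add: add_divide_distrib)
  qed
  have T_eq: "T u i (t + 1) = T u i t + G u i t" if "OK u" "t \<in> ?H" for u i t
    using half_plane_shift_sum(3)[OF R(1) q1(1) Ghol[OF that(1)] Gle[OF that(1)] that(2)]
    by (simp add: T_def algebra_simps)
    have T_OK: "OK (T u)" if u: "OK u" for u
      unfolding OK_def
    proof (intro allI conjI ballI)
      fix i
      show "T u i holomorphic_on ?H" unfolding T_def
        by (intro holomorphic_intros half_plane_shift_sum(1)[OF R(1) q1(1) Ghol[OF u] Gle[OF u]])
      fix t assume t: "t \<in> ?H"
      have "norm (T u i t) \<le> (2 + 2 * L) * (2 / real q) / Re t ^ q"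
        unfolding T_def norm_minus_cancel
        by (rule half_plane_shift_sum(4)[OF R(1) q1(1) Ghol[OF u] Gle[OF u] t])
      also have "\<dots> \<le> 1 / Re t ^ q"
        using L q1 Re_pos[OF t] by (intro divide_right_mono) (auto simp: field_simps)
      finally show "norm (T u i t) \<le> W i t" by (simp add: W_def)
    qed
    have contr: "norm (T u i t - T v i t) \<le> d / 2 * W i t"
      if uv: "OK u" "OK v" and d: "0 \<le> d" "\<And>i t. t \<in> ?H \<Longrightarrow> norm (u i t - v i t) \<le> d * W i t" and t: "t \<in> ?H"
      for u v d i t
    proof -
    let ?D = "\<lambda>t. G u i t - G v i t"
    have Dhol: "?D holomorphic_on ?H" by (intro holomorphic_intros Ghol uv)
    have Dle: "norm (?D t) \<le> (2 * L * d) / Re t ^ Suc q" if "t \<in> ?H" for t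
      using Gdiff[OF uv d(2) that] .
    have "summable (\<lambda>n. G w i (t + of_nat n))" if "OK w" for w
      by (rule half_plane_shift_sum(2)[OF R(1) q1(1) Ghol[OF that] Gle[OF that] t])
    from suminf_diff[OF this[OF uv(1)] this[OF uv(2)]]
    have "T u i t - T v i t = - (\<Sum>n. ?D (t + of_nat n))"
      unfolding T_def minus_diff_minus by (simp only:)
    then have "norm (T u i t - T v i t) = norm (\<Sum>n. ?D (t + of_nat n))" by (simp only: norm_minus_cancel)
    also have "\<dots> \<le> (2 * L * d) * (2 / real q) / Re t ^ q"
      by (rule half_plane_shift_sum(4)[OF R(1) q1(1) Dhol Dle t])
    also have "\<dots> \<le> (d / 2) / Re t ^ q"
    proof (rule divide_right_mono)
      have "d * (8 * L) \<le> d * real q" using L d(1) by (intro mult_left_mono) auto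
      then show "(2 * L * d) * (2 / real q) \<le> d / 2" using q1 by (simp add: field_simps)
      show "0 \<le> Re t ^ q" using Re_pos[OF t] by simp
    qed
    finally show "norm (T u i t - T v i t) \<le> d / 2 * W i t" by (simp add: W_def)
    qed
  obtain u where u: "\<And>i. u i holomorphic_on ?H" "\<And>i t. t \<in> ?H \<Longrightarrow> norm (u i t) \<le> W i t"
    "\<And>i t. t \<in> ?H \<Longrightarrow> T u i t = u i t"
  proof (rule weighted_contraction_fixed_point[of ?H W T, OF open_half_plane _ _ T_OK[unfolded OK_def] contr[unfolded OK_def]])
    show "continuous_on ?H (W i)" for i unfolding W_def
      using Re_pos by (intro continuous_intros) force
    show "0 \<le> W i t" if "t \<in> ?H" for i t unfolding W_def using Re_pos[OF that] by simp
  qed (use that in blast)+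
  have "OK u" using u unfolding OK_def by blast
  have shift: "t + 1 \<in> ?H" if "t \<in> ?H" for t using half_plane_add[OF that, of 1] by simp
  show ?thesis
  proof (rule that[of "u True" "u False"])
    fix t assume t: "t \<in> ?H"
    show "u True (t + 1) = u True t + g True t (u True t) (u False t)"
         "u False (t + 1) = u False t + g False t (u True t) (u False t)"
      using T_eq[OF \<open>OK u\<close> t] u(3)[OF t] u(3)[OF shift[OF t]] by (simp_all add: G_def)
  qed (use u in \<open>auto simp: W_def\<close>)
qed

text \<open>The unknown curve is \<open>Z = z0 (1 + x)\<close>, \<open>W = w0 + om y\<close>, so the
  correction is measured relative to \<open>z0\<close> in the first coordinate and in units of
  \<open>om\<close> in the second. The bounds \<open>ba\<close>, \<open>bb\<close>,
  \<open>e3\<close> make the right-hand sides of the equations for \<open>x\<close> and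
  \<open>y\<close> of size \<open>1 / t\<close>, and \<open>e1\<close>, \<open>e2\<close> say that
  \<open>x = y = 0\<close> solves them up to \<open>t^(-q-1)\<close>.\<close>

lemma invariant_curve_near_model:
  fixes a b :: "complex \<times> complex \<Rightarrow> complex" and z0 w0 om :: "complex \<Rightarrow> complex"
  assumes V: "open V" and a: "holomorphic2_on a V" and b: "holomorphic2_on b V" and r: "r \<ge> 1"
    and \<rho>: "0 < \<rho>" "\<rho> \<le> 1 / 2" and C: "C \<ge> 0"
    and q: "real q \<ge> 4 + 32 * (8 * C + 4) / \<rho>" and R: "R \<ge> real q" "R \<ge> 2 / \<rho>" "R \<ge> 2 * (C + 1)"
    and hol: "z0 holomorphic_on half_plane R" "w0 holomorphic_on half_plane R" "om holomorphic_on half_plane R"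
    and nz: "\<And>t. t \<in> half_plane R \<Longrightarrow> z0 t \<noteq> 0" "\<And>t. t \<in> half_plane R \<Longrightarrow> om t \<noteq> 0"
    and dom: "\<And>t x y. t \<in> half_plane R \<Longrightarrow> norm x \<le> \<rho> \<Longrightarrow> norm y \<le> \<rho> \<Longrightarrow>
      (z0 t * (1 + x), w0 t + om t * y) \<in> V"
    and ba: "\<And>t x y. t \<in> half_plane R \<Longrightarrow> norm x \<le> \<rho> \<Longrightarrow> norm y \<le> \<rho> \<Longrightarrow>
      norm ((z0 t * (1 + x)) ^ (r - 1) * a (z0 t * (1 + x), w0 t + om t * y)) \<le> C / norm t"
    and bb: "\<And>t x y. t \<in> half_plane R \<Longrightarrow> norm x \<le> \<rho> \<Longrightarrow> norm y \<le> \<rho> \<Longrightarrow>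
      norm ((z0 t * (1 + x)) ^ (r - 1) * b (z0 t * (1 + x), w0 t + om t * y)) \<le> C * norm (om t) / norm t"
    and e1: "\<And>t. t \<in> half_plane R \<Longrightarrow>
      norm (z0 (t + 1) - (z0 t + z0 t ^ r * a (z0 t, w0 t))) \<le> norm (z0 t) / norm t ^ Suc q"
    and e2: "\<And>t. t \<in> half_plane R \<Longrightarrow>
      norm (w0 (t + 1) - (w0 t + z0 t ^ (r - 1) * b (z0 t, w0 t))) \<le> norm (om t) / norm t ^ Suc q"
    and e3: "\<And>t. t \<in> half_plane R \<Longrightarrow> norm (om (t + 1) - om t) \<le> C * norm (om t) / norm t"
  obtains x y where "x holomorphic_on half_plane R" "y holomorphic_on half_plane R"
    "\<And>t. t \<in> half_plane R \<Longrightarrow> norm (x t) \<le> 1 / Re t ^ q"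
    "\<And>t. t \<in> half_plane R \<Longrightarrow> norm (y t) \<le> 1 / Re t ^ q"
    "\<And>t. t \<in> half_plane R \<Longrightarrow> norm (x t) \<le> \<rho> \<and> norm (y t) \<le> \<rho>"
    "\<And>t Z W. t \<in> half_plane R \<Longrightarrow> Z = z0 t * (1 + x t) \<Longrightarrow> W = w0 t + om t * y t \<Longrightarrow>
      z0 (t + 1) * (1 + x (t + 1)) = Z + Z ^ r * a (Z, W) \<and>
      w0 (t + 1) + om (t + 1) * y (t + 1) = W + Z ^ (r - 1) * b (Z, W)"
proof -
  let ?H = "half_plane R"
  have "32 * (8 * C + 4) / \<rho> \<ge> 0" using C \<rho> by simp
  then have q4: "real q \<ge> 4" "q \<ge> 1" using q by linarith+
  have R1: "R \<ge> 1" using q4 R by linarith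
  have t_facts: "Re t > R" "Re t \<ge> 1" "norm t \<ge> Re t" "norm t \<ge> 1" "t \<noteq> 0" if "t \<in> ?H" for t
    using that R1 complex_Re_le_cmod[of t] by (auto simp: half_plane_def)
  have shift: "t + 1 \<in> ?H" if "t \<in> ?H" for t using half_plane_add[OF that, of 1] by simp
  have pw: "1 / norm t ^ Suc q \<le> 1 / Re t ^ Suc q" "1 / norm t ^ Suc q \<le> 1 / norm t" if "t \<in> ?H" for t
  proof -
    note f = t_facts[OF that]
    have "Re t ^ Suc q \<le> norm t ^ Suc q" using f by (intro power_mono) auto
    then show "1 / norm t ^ Suc q \<le> 1 / Re t ^ Suc q" using f by (intro divide_left_mono mult_pos_pos zero_less_power) auto
    have "norm t ^ 1 \<le> norm t ^ Suc q" using f by (intro power_increasing) auto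
    then show "1 / norm t ^ Suc q \<le> 1 / norm t" using f by (intro divide_left_mono mult_pos_pos zero_less_power) auto
  qed
  define U1 where "U1 = (\<lambda>t x y. (z0 t * (1 + x)) ^ (r - 1) * a (z0 t * (1 + x), w0 t + om t * y))"
  define U2 where "U2 = (\<lambda>t x y. (z0 t * (1 + x)) ^ (r - 1) * b (z0 t * (1 + x), w0 t + om t * y))"
  define s1 where "s1 = (\<lambda>t. z0 (t + 1) / z0 t)"
  define E2 where "E2 = (\<lambda>t. w0 (t + 1) - w0 t - U2 t 0 0)"
  \<comment> \<open>The invariance equation solved for the increments. The first coordinate gives
    \<open>1 + x (t + 1) = (1 + x) (1 + U1) / s1\<close>; in the second,
    \<open>w0 (t + 1) - w0 t\<close> is replaced by \<open>U2 t 0 0 + E2 t\<close>, so that at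
    \<open>x = y = 0\<close> only the defect \<open>E2\<close> remains.\<close>
  define g where "g = (\<lambda>i t x y. if i then (1 + x) * (1 + U1 t x y - s1 t) / s1 t
      else (om t * y - om (t + 1) * y + U2 t x y - U2 t 0 0 - E2 t) / om (t + 1))"
  have rpow: "z ^ r = z * z ^ (r - 1)" for z :: complex using r by (cases r) auto
  have s1_err: "norm (1 + U1 t 0 0 - s1 t) \<le> 1 / norm t ^ Suc q" if t: "t \<in> ?H" for t
  proof -
    have "z0 (t + 1) - (z0 t + z0 t ^ r * a (z0 t, w0 t)) = - (z0 t * (1 + U1 t 0 0 - s1 t))"
      using nz(1)[OF t] unfolding rpow by (simp add: U1_def s1_def field_simps)
    then have "norm (z0 t) * norm (1 + U1 t 0 0 - s1 t) \<le> norm (z0 t) * (1 / norm t ^ Suc q)"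
      using e1[OF t] by (simp add: norm_mult)
    then show ?thesis by (rule mult_left_le_imp_le) (use nz(1)[OF t] in simp)
  qed
  have U1_le: "norm (U1 t x y) \<le> C / norm t" if "t \<in> ?H" "norm x \<le> \<rho>" "norm y \<le> \<rho>" for t x y
    unfolding U1_def by (rule ba[OF that])
  have U2_le: "norm (U2 t x y) \<le> C * norm (om t) / norm t" if "t \<in> ?H" "norm x \<le> \<rho>" "norm y \<le> \<rho>" for t x y
    unfolding U2_def by (rule bb[OF that])
  have half: "(C + 1) / norm t \<le> 1 / 2" if "t \<in> ?H" for t
    using t_facts[OF that] R(3) C by (simp add: field_simps)
  have s1_half: "norm (s1 t) \<ge> 1 / 2" if t: "t \<in> ?H" for t
  proof -
    have "norm (1 - s1 t) \<le> norm (1 + U1 t 0 0 - s1 t) + norm (U1 t 0 0)"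
      using norm_triangle_ineq4[of "1 + U1 t 0 0 - s1 t" "U1 t 0 0"] by simp
    also have "\<dots> \<le> 1 / norm t + C / norm t"
      using s1_err[OF t] pw(2)[OF t] U1_le[OF t, of 0 0] \<rho> by (intro add_mono) auto
    also have "\<dots> \<le> 1 / 2" using half[OF t] by (simp add: add_divide_distrib add.commute)
    finally show ?thesis using norm_triangle_ineq2[of 1 "1 - s1 t"] by simp
  qed
  have om_half: "norm (om (t + 1)) \<ge> norm (om t) / 2" if t: "t \<in> ?H" for t
  proof -
    have "norm (om (t + 1) - om t) \<le> norm (om t) * (C / norm t)" using e3[OF t] by (simp add: mult.commute)
    also have "\<dots> \<le> norm (om t) * (1 / 2)"
    proof (rule mult_left_mono)
      have "C / norm t \<le> (C + 1) / norm t" by (rule divide_right_mono) auto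
      then show "C / norm t \<le> 1 / 2" using half[OF t] by linarith
    qed simp
    finally show ?thesis using norm_triangle_ineq2[of "om t" "om t - om (t + 1)"]
      by (simp add: norm_minus_commute)
  qed
  have E2_le: "norm (E2 t) \<le> norm (om t) / norm t ^ Suc q" if t: "t \<in> ?H" for t
    using e2[OF t] by (simp add: E2_def U2_def algebra_simps)
  have holU: "(\<lambda>t. (z0 t * (1 + x t)) ^ (r - 1) * f (z0 t * (1 + x t), w0 t + om t * y t)) holomorphic_on ?H"
    if "x holomorphic_on ?H" "y holomorphic_on ?H" "\<And>t. t \<in> ?H \<Longrightarrow> norm (x t) \<le> \<rho> \<and> norm (y t) \<le> \<rho>"
      "holomorphic2_on f V" for x y f
  proof (intro holomorphic_intros holomorphic2_compose_curve[OF that(4)] hol that open_half_plane)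
    fix t assume "t \<in> ?H"
    then show "(z0 t * (1 + x t), w0 t + om t * y t) \<in> V" using dom that(3) by blast
  qed
  have hol_shift: "(\<lambda>t. f (t + 1)) holomorphic_on ?H" if "f holomorphic_on ?H" for f
  proof -
    have "f \<circ> (\<lambda>t. t + 1) holomorphic_on ?H"
      by (rule holomorphic_on_compose_gen[OF _ that]) (auto intro!: holomorphic_intros shift)
    then show ?thesis by (simp add: o_def)
  qed
  have s1_nz: "s1 t \<noteq> 0" if "t \<in> ?H" for t using s1_half[OF that] by auto
  obtain x y where xy: "x holomorphic_on ?H" "y holomorphic_on ?H"
    "\<And>t. t \<in> ?H \<Longrightarrow> norm (x t) \<le> 1 / Re t ^ q" "\<And>t. t \<in> ?H \<Longrightarrow> norm (y t) \<le> 1 / Re t ^ q"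
    "\<And>t. t \<in> ?H \<Longrightarrow> x (t + 1) = x t + g True t (x t) (y t)"
    "\<And>t. t \<in> ?H \<Longrightarrow> y (t + 1) = y t + g False t (x t) (y t)"
  proof (rule discrete_solution[of \<rho> "8 * C + 4" q R g])
    fix i and x y :: "complex \<Rightarrow> complex"
    assume h: "x holomorphic_on ?H" "y holomorphic_on ?H" "\<And>t. t \<in> ?H \<Longrightarrow> norm (x t) \<le> \<rho> \<and> norm (y t) \<le> \<rho>"
    have 0: "(\<lambda>t. U2 t 0 0) holomorphic_on ?H"
      using holU[of "\<lambda>_. 0" "\<lambda>_. 0" b] b \<rho> unfolding U2_def by auto
    have 1: "(\<lambda>t. U1 t (x t) (y t)) holomorphic_on ?H" "(\<lambda>t. U2 t (x t) (y t)) holomorphic_on ?H"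
      unfolding U1_def U2_def by (intro holU h a b; blast)+
    show "(\<lambda>t. g i t (x t) (y t)) holomorphic_on ?H"
    proof (cases i)
      case True
      have "s1 holomorphic_on ?H" unfolding s1_def
        by (intro holomorphic_intros hol hol_shift) (use nz in auto)
      then show ?thesis using True s1_nz unfolding g_def by (auto intro!: holomorphic_intros 1 h)
    next
      case False
      have "(\<lambda>t. (om t * y t - om (t + 1) * y t + U2 t (x t) (y t) - U2 t 0 0 - E2 t) / om (t + 1)) holomorphic_on ?H"
        unfolding E2_def
        by (intro holomorphic_intros hol hol_shift 0 1 h) (use nz(2) shift in auto)
      then show ?thesis using False unfolding g_def by simp
    qed
  next
    have V': "(\<lambda>x. f (z0 t * (1 + x), w0 t + om t * y)) holomorphic_on ball 0 \<rho>"
      if "t \<in> ?H" "norm y < \<rho>" "holomorphic2_on f V" for f t y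
      by (intro holomorphic2_compose_curve[OF that(3)] holomorphic_intros) (use dom that in auto)
    show "(\<lambda>x. g i t x y) holomorphic_on ball 0 \<rho>" if t: "t \<in> ?H" and n: "norm y < \<rho>" for i t y
    proof -
      have "(\<lambda>x. U1 t x y) holomorphic_on ball 0 \<rho>" unfolding U1_def
        by (rule holomorphic_on_mult[OF _ V'[OF t n a]]) (intro holomorphic_intros)
      moreover have "(\<lambda>x. U2 t x y) holomorphic_on ball 0 \<rho>" unfolding U2_def
        by (rule holomorphic_on_mult[OF _ V'[OF t n b]]) (intro holomorphic_intros)
      ultimately show ?thesis
        using s1_nz[OF t] nz(2)[OF shift[OF t]] unfolding g_def
        by (cases i) (auto intro!: holomorphic_intros)
    qed
    have V'': "(\<lambda>y. f (z0 t * (1 + x), w0 t + om t * y)) holomorphic_on ball 0 \<rho>"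
      if "t \<in> ?H" "norm x < \<rho>" "holomorphic2_on f V" for f t x
      by (intro holomorphic2_compose_curve[OF that(3)] holomorphic_intros) (use dom that in auto)
    show "(\<lambda>y. g i t x y) holomorphic_on ball 0 \<rho>" if t: "t \<in> ?H" and n: "norm x < \<rho>" for i t x
    proof -
      have "(\<lambda>y. U1 t x y) holomorphic_on ball 0 \<rho>" unfolding U1_def
        by (rule holomorphic_on_mult[OF _ V''[OF t n a]]) (intro holomorphic_intros)
      moreover have "(\<lambda>y. U2 t x y) holomorphic_on ball 0 \<rho>" unfolding U2_def
        by (rule holomorphic_on_mult[OF _ V''[OF t n b]]) (intro holomorphic_intros)
      ultimately show ?thesis
        using s1_nz[OF t] nz(2)[OF shift[OF t]] unfolding g_def
        by (cases i) (auto intro!: holomorphic_intros)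
    qed
  next
    fix i t and x y :: complex assume t: "t \<in> ?H" and x: "norm x < \<rho>" and y: "norm y < \<rho>"
    note f = t_facts[OF t]
    \<comment> \<open>The first component costs \<open>2 * (2 * C + 1) * 2\<close>, from
      \<open>norm (1 + x) \<le> 2\<close> and \<open>norm s1 \<ge> 1 / 2\<close>; the second costs
      \<open>6 * C + 2\<close>.\<close>
    have "norm (g i t x y) \<le> (8 * C + 4) / norm t"
    proof (cases i)
      case True
      have "norm (1 + U1 t x y - s1 t) \<le> norm (1 + U1 t 0 0 - s1 t) + (norm (U1 t x y) + norm (U1 t 0 0))"
      proof -
        have eq: "1 + U1 t x y - s1 t = (1 + U1 t 0 0 - s1 t) + (U1 t x y - U1 t 0 0)" by simp
        show ?thesis by (subst eq)
          (use norm_triangle_ineq[of "1 + U1 t 0 0 - s1 t" "U1 t x y - U1 t 0 0"]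
            norm_triangle_ineq4[of "U1 t x y" "U1 t 0 0"] in linarith)
      qed
      also have "\<dots> \<le> 1 / norm t + (C / norm t + C / norm t)"
        using s1_err[OF t] pw(2)[OF t] U1_le[OF t, of 0 0] U1_le[OF t, of x y] x y \<rho> by (intro add_mono) auto
      finally have 1: "norm (1 + U1 t x y - s1 t) \<le> (2 * C + 1) / norm t" by (simp add: add_divide_distrib)
      have "norm (1 + x) \<le> 2" using norm_triangle_ineq[of 1 x] x \<rho> by simp
      with 1 have "norm (1 + x) * norm (1 + U1 t x y - s1 t) \<le> 2 * ((2 * C + 1) / norm t)"
        by (intro mult_mono) auto
      then have "norm (1 + x) * norm (1 + U1 t x y - s1 t) / norm (s1 t) \<le> 2 * ((2 * C + 1) / norm t) / (1 / 2)"
        using s1_half[OF t] C by (intro frac_le) auto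
      then show ?thesis using True by (simp add: g_def norm_mult norm_divide)
    next
      case False
      have "norm (om t * y - om (t + 1) * y + U2 t x y - U2 t 0 0 - E2 t)
          \<le> norm (om (t + 1) - om t) * norm y + norm (U2 t x y) + norm (U2 t 0 0) + norm (E2 t)"
      proof -
        have "om t * y - om (t + 1) * y + U2 t x y - U2 t 0 0 - E2 t
            = - ((om (t + 1) - om t) * y) + U2 t x y - U2 t 0 0 - E2 t" by (simp add: algebra_simps)
        then show ?thesis
          by (smt (verit) norm_triangle_ineq norm_triangle_ineq4 norm_minus_cancel norm_mult)
      qed
      also have "\<dots> \<le> (C * norm (om t) / norm t) * 1 + C * norm (om t) / norm t + C * norm (om t) / norm t
          + norm (om t) * (1 / norm t)"
      proof -
        have "norm (E2 t) \<le> norm (om t) * (1 / norm t)"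
          using E2_le[OF t] mult_left_mono[OF pw(2)[OF t], of "norm (om t)"] by simp
        then show ?thesis
          using U2_le[OF t, of 0 0] U2_le[OF t, of x y] e3[OF t] x y \<rho> C by (intro add_mono mult_mono) auto
      qed
      also have "\<dots> = (3 * C + 1) / norm t * norm (om t)" by (simp add: algebra_simps add_divide_distrib)
      finally have 1: "norm (om t * y - om (t + 1) * y + U2 t x y - U2 t 0 0 - E2 t) \<le> (3 * C + 1) / norm t * norm (om t)" .
      have "norm (g i t x y) \<le> ((3 * C + 1) / norm t * norm (om t)) / (norm (om t) / 2)"
      proof -
        have "g i t x y = (om t * y - om (t + 1) * y + U2 t x y - U2 t 0 0 - E2 t) / om (t + 1)"
          using False by (simp add: g_def)
        then show ?thesis unfolding norm_divide
          by (simp only: norm_divide) (intro frac_le 1 om_half[OF t], use nz(2)[OF t] C in auto)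
      qed
      also have "\<dots> = (6 * C + 2) / norm t" using nz(2)[OF t] f(5) by (simp add: divide_simps)
      also have "\<dots> \<le> (8 * C + 4) / norm t" using C by (intro divide_right_mono) auto
      finally show ?thesis .
    qed
    also have "\<dots> \<le> (8 * C + 4) / Re t" using f C by (intro divide_left_mono mult_pos_pos) auto
    finally show "norm (g i t x y) \<le> (8 * C + 4) / Re t" .
  next
    fix i t assume t: "t \<in> ?H"
    have "norm (g i t 0 0) \<le> 2 * (1 / norm t ^ Suc q)"
    proof (cases i)
      case True
      have "norm (1 + U1 t 0 0 - s1 t) / norm (s1 t) \<le> (1 / norm t ^ Suc q) / (1 / 2)"
        using s1_err[OF t] s1_half[OF t] by (intro frac_le) auto
      then show ?thesis using True by (simp add: g_def norm_divide)
    next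
      case False
      have "norm (E2 t) / norm (om (t + 1)) \<le> (norm (om t) / norm t ^ Suc q) / (norm (om t) / 2)"
        using E2_le[OF t] om_half[OF t] nz(2)[OF t] by (intro frac_le) auto
      then show ?thesis using False nz(2)[OF t] by (simp add: g_def norm_divide)
    qed
    also have "\<dots> \<le> 2 * (1 / Re t ^ Suc q)" by (intro mult_left_mono pw(1)[OF t]) auto
    finally show "norm (g i t 0 0) \<le> 2 / Re t ^ Suc q" by simp
  qed (use \<rho> C q R in auto)
  show ?thesis
  proof (rule that[OF xy(1-4)])
    fix t assume t: "t \<in> ?H"
    note f = t_facts[OF t]
    have "Re t ^ 1 \<le> Re t ^ q" using f q4 by (intro power_increasing) auto
    then have "1 / Re t ^ q \<le> 1 / Re t" using f by (intro divide_left_mono) auto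
    also have "\<dots> \<le> 1 / (2 / \<rho>)" using f R \<rho> by (intro divide_left_mono mult_pos_pos) auto
    also have "\<dots> \<le> \<rho>" using \<rho> by simp
    finally show "norm (x t) \<le> \<rho> \<and> norm (y t) \<le> \<rho>" using xy(3,4)[OF t] by auto
    fix Z W assume Z: "Z = z0 t * (1 + x t)" and W: "W = w0 t + om t * y t"
    have "1 + x (t + 1) = (1 + x t) * (1 + U1 t (x t) (y t)) / s1 t"
      using xy(5)[OF t] s1_nz[OF t] by (simp add: g_def field_simps)
    then have "z0 (t + 1) * (1 + x (t + 1)) = z0 (t + 1) * ((1 + x t) * (1 + U1 t (x t) (y t)) / s1 t)"
      by (simp only:)
    also have "\<dots> = z0 t * (1 + x t) * (1 + U1 t (x t) (y t))"
      using nz(1)[OF t] nz(1)[OF shift[OF t]] by (simp add: s1_def)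
    also have "\<dots> = Z + Z ^ r * a (Z, W)" unfolding rpow by (simp add: Z W U1_def algebra_simps)
    finally have 1: "z0 (t + 1) * (1 + x (t + 1)) = Z + Z ^ r * a (Z, W)" .
    have "om (t + 1) * y (t + 1) = om (t + 1) * y t + (om t * y t - om (t + 1) * y t + U2 t (x t) (y t) - U2 t 0 0 - E2 t)"
      using xy(6)[OF t] nz(2)[OF shift[OF t]] by (simp add: g_def distrib_left)
    then have "w0 (t + 1) + om (t + 1) * y (t + 1) = W + Z ^ (r - 1) * b (Z, W)"
      by (simp add: E2_def U2_def W Z algebra_simps)
    with 1 show "z0 (t + 1) * (1 + x (t + 1)) = Z + Z ^ r * a (Z, W) \<and>
      w0 (t + 1) + om (t + 1) * y (t + 1) = W + Z ^ (r - 1) * b (Z, W)" ..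
  qed
qed

section \<open>Differential equations on a half strip\<close>

text \<open>The image under \<open>Ln\<close> of the part of the right half plane outside the disc
  of radius \<open>exp U\<close>.\<close>

definition strip :: "real \<Rightarrow> complex set" where "strip U = {u. U < Re u \<and> \<bar>Im u\<bar> < pi / 2}"

lemma strip_eq: "strip U = {u. Re u > U} \<inter> ({u. Im u < pi / 2} \<inter> {u. Im u > - (pi / 2)})"
  by (auto simp: strip_def)

lemma open_strip: "open (strip U)"
  unfolding strip_eq by (intro open_Int open_halfspace_Re_gt open_halfspace_Im_gt open_halfspace_Im_lt)

lemma convex_strip: "convex (strip U)"
  unfolding strip_eq by (intro convex_Int convex_halfspace_Re_gt convex_halfspace_Im_gt convex_halfspace_Im_lt)

lemma strip_of_real: "x > U \<Longrightarrow> of_real x \<in> strip U"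
  by (simp add: strip_def)

lemma strip_add: "u \<in> strip U \<Longrightarrow> u + of_nat n \<in> strip U"
  by (simp add: strip_def)

lemma strip_increment_bound:
  assumes F: "\<And>s. s \<in> strip U \<Longrightarrow> DERIV F s :> h s"
    and uv: "u \<in> strip U" "v \<in> strip U" and c: "\<And>s. s \<in> closed_segment u v \<Longrightarrow> norm (h s) \<le> c"
  shows "norm (F v - F u) \<le> c * norm (v - u)"
proof (rule field_differentiable_bound[where S = "closed_segment u v"])
  fix s assume "s \<in> closed_segment u v"
  then have "s \<in> strip U" using uv convex_strip convex_contains_segment by blast
  then show "(F has_field_derivative h s) (at s within closed_segment u v)"
    using F has_field_derivative_at_within by blast
qed (use c in auto)

lemma Re_closed_segment:
  assumes "s \<in> closed_segment u v"
  shows "min (Re u) (Re v) \<le> Re s" "Re s \<le> max (Re u) (Re v)"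
proof -
  obtain x where x: "0 \<le> x" "x \<le> 1" "s = (1 - x) *\<^sub>R u + x *\<^sub>R v" using assms by (auto simp: closed_segment_def)
  have "Re s = (1 - x) * Re u + x * Re v" by (simp add: x(3))
  moreover have "(1 - x) * min (Re u) (Re v) + x * min (Re u) (Re v) \<le> (1 - x) * Re u + x * Re v"
    using x by (intro add_mono mult_left_mono) auto
  moreover have "(1 - x) * Re u + x * Re v \<le> (1 - x) * max (Re u) (Re v) + x * max (Re u) (Re v)"
    using x by (intro add_mono mult_left_mono) auto
  ultimately show "min (Re u) (Re v) \<le> Re s" "Re s \<le> max (Re u) (Re v)" by (simp_all add: algebra_simps)
qed

text \<open>Unit steps to the left lead from \<open>u\<close> close to the base point
  \<open>U + 1\<close>; for a growing weight their contributions form a geometric series dominated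
  by the step next to \<open>u\<close>.\<close>

lemma strip_primitive_growing:
  assumes F: "\<And>s. s \<in> strip U \<Longrightarrow> DERIV F s :> h s"
    and h: "\<And>s. s \<in> strip U \<Longrightarrow> norm (h s) \<le> c * exp (\<nu> * Re s)" and \<nu>: "\<nu> > 0"
    and F0: "F (of_real (U + 1)) = 0" and u: "u \<in> strip U"
  shows "norm (F u) \<le> (3 * exp \<nu> + 1 / (1 - exp (- \<nu>))) * c * exp (\<nu> * Re u)"
proof -
  let ?u0 = "of_real (U + 1) :: complex"
  have u0: "?u0 \<in> strip U" by (rule strip_of_real) simp
  have c: "c \<ge> 0"
    using order_trans[OF norm_ge_zero h[OF u0]] by (simp add: zero_le_mult_iff)
  \<comment> \<open>The first term covers the points with \<open>Re u \<le> U + 1\<close>, whose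
    distance from the base point is at most 3. The second is the fixed point of
    \<open>K -> K * exp (- \<nu>) + 1\<close>, the recursion of one unit step.\<close>
  define K where "K = 3 * exp \<nu> + 1 / (1 - exp (- \<nu>))"
  have e1: "1 - exp (- \<nu>) > 0" using \<nu> by simp
  have K0: "K \<ge> 3 * exp \<nu>" "K \<ge> 0" using e1 by (auto simp: K_def)
  have "1 / (1 - exp (- \<nu>)) \<le> K" by (simp add: K_def)
  then have K1: "K * exp (- \<nu>) + 1 \<le> K" using e1 by (simp add: field_simps)
  have "norm (F u) \<le> K * c * exp (\<nu> * Re u)" if "Re u \<le> U + 1 + real n" "u \<in> strip U" for n u
    using that
  proof (induction n arbitrary: u)
    case 0
    have "norm (F u - F ?u0) \<le> (c * exp (\<nu> * (U + 1))) * norm (u - ?u0)"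
    proof (rule strip_increment_bound[OF F u0 0(2)])
      fix s assume s: "s \<in> closed_segment ?u0 u"
      then have "s \<in> strip U" using u0 0(2) convex_strip convex_contains_segment by blast
      then have "norm (h s) \<le> c * exp (\<nu> * Re s)" by (rule h)
      also have "\<dots> \<le> c * exp (\<nu> * (U + 1))"
        using Re_closed_segment(2)[OF s] 0 c \<nu> by (intro mult_left_mono) auto
      finally show "norm (h s) \<le> c * exp (\<nu> * (U + 1))" .
    qed auto
    also have "norm (u - ?u0) \<le> 3"
    proof -
      have "norm (u - ?u0) \<le> \<bar>Re (u - ?u0)\<bar> + \<bar>Im (u - ?u0)\<bar>" by (rule cmod_le)
      also have "\<dots> \<le> 1 + pi / 2" using 0 by (intro add_mono) (auto simp: strip_def)
      finally show ?thesis using pi_less_4 by linarith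
    qed
    then have "(c * exp (\<nu> * (U + 1))) * norm (u - ?u0) \<le> (c * exp (\<nu> * (U + 1))) * 3"
      using c by (intro mult_left_mono) auto
    also have "\<dots> = (3 * exp \<nu>) * (c * exp (\<nu> * U))" by (simp add: algebra_simps exp_add)
    also have "\<dots> \<le> K * (c * exp (\<nu> * Re u))"
      using K0 c \<nu> 0(2) by (intro mult_mono) (auto simp: strip_def)
    finally show ?case using F0 by (simp add: mult.assoc)
  next
    case (Suc n)
    show ?case
    proof (cases "Re u \<le> U + 1 + real n")
      case False
      then have v: "u - 1 \<in> strip U" using Suc.prems(2) by (auto simp: strip_def)
      have "norm (F u - F (u - 1)) \<le> (c * exp (\<nu> * Re u)) * norm (u - (u - 1))"
      proof (rule strip_increment_bound[OF F v Suc.prems(2)])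
        fix s assume s: "s \<in> closed_segment (u - 1) u"
        then have "s \<in> strip U" using v Suc.prems(2) convex_strip convex_contains_segment by blast
        then have "norm (h s) \<le> c * exp (\<nu> * Re s)" by (rule h)
        also have "\<dots> \<le> c * exp (\<nu> * Re u)"
          using Re_closed_segment(2)[OF s] c \<nu> by (intro mult_left_mono) auto
        finally show "norm (h s) \<le> c * exp (\<nu> * Re u)" .
      qed auto
      moreover have "norm (F (u - 1)) \<le> K * c * exp (\<nu> * Re (u - 1))"
        by (rule Suc.IH[OF _ v]) (use Suc.prems in simp)
      ultimately have "norm (F u) \<le> K * c * exp (\<nu> * Re (u - 1)) + c * exp (\<nu> * Re u)"
        using norm_triangle_sub[of "F u" "F (u - 1)"] by simp
      also have "\<dots> = (K * exp (- \<nu>) + 1) * (c * exp (\<nu> * Re u))"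
        by (simp add: algebra_simps exp_diff exp_minus field_simps)
      also have "\<dots> \<le> K * (c * exp (\<nu> * Re u))" using K1 c by (intro mult_right_mono) auto
      finally show ?thesis by (simp add: mult.assoc)
    qed (use Suc in auto)
  qed
  moreover obtain n where "Re u - (U + 1) \<le> real n" using real_arch_simple by blast
  ultimately show ?thesis using u unfolding K_def by (metis add.commute diff_le_eq)
qed

text \<open>The increments over unit steps are bounded by a geometric series, so the primitive has a
  limit to the right. The limit is the same from every starting point, because the derivative tends
  to 0 while the distance between two translated points stays fixed. Subtracting it amounts to
  integrating from infinity.\<close>

lemma strip_primitive_decaying:
  assumes F: "\<And>s. s \<in> strip U \<Longrightarrow> DERIV F s :> h s"
    and h: "\<And>s. s \<in> strip U \<Longrightarrow> norm (h s) \<le> c * exp (- \<nu> * Re s)" and \<nu>: "\<nu> > 0"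
  obtains l where "\<And>u. u \<in> strip U \<Longrightarrow> (\<lambda>n. F (u + of_nat n)) \<longlonglongrightarrow> l"
    "\<And>u. u \<in> strip U \<Longrightarrow> norm (F u - l) \<le> 1 / (1 - exp (- \<nu>)) * c * exp (- \<nu> * Re u)"
proof -
  let ?u0 = "of_real (U + 1) :: complex"
  have u0: "?u0 \<in> strip U" by (rule strip_of_real) simp
  have c: "c \<ge> 0"
    using order_trans[OF norm_ge_zero h[OF u0]] by (simp add: zero_le_mult_iff)
  define K where "K = 1 / (1 - exp (- \<nu>))"
  have e1: "1 - exp (- \<nu>) > 0" using \<nu> by simp
  have hn: "norm (h s) \<le> c * exp (- \<nu> * (x + real n))" if "s \<in> strip U" "Re s \<ge> x + real n" for s x n
  proof -
    have "norm (h s) \<le> c * exp (- \<nu> * Re s)" by (rule h[OF that(1)])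
    also have "\<dots> \<le> c * exp (- \<nu> * (x + real n))" using that(2) c \<nu> by (intro mult_left_mono) auto
    finally show ?thesis .
  qed
  have step: "norm (F (u + of_nat (Suc n)) - F (u + of_nat n)) \<le> c * exp (- \<nu> * Re u) * exp (- \<nu>) ^ n"
    if u: "u \<in> strip U" for u n
  proof -
    have "norm (F (u + of_nat (Suc n)) - F (u + of_nat n))
        \<le> (c * exp (- \<nu> * (Re u + real n))) * norm ((u + of_nat (Suc n)) - (u + of_nat n))"
    proof (rule strip_increment_bound[OF F strip_add[OF u] strip_add[OF u]])
      fix s assume s: "s \<in> closed_segment (u + of_nat n) (u + of_nat (Suc n))"
      then have "s \<in> strip U" using strip_add[OF u] convex_strip convex_contains_segment by blast
      then show "norm (h s) \<le> c * exp (- \<nu> * (Re u + real n))"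
        using Re_closed_segment(1)[OF s] by (intro hn) auto
    qed auto
    also have "\<dots> = c * exp (- \<nu> * Re u) * exp (- \<nu>) ^ n"
      by (simp add: exp_of_nat_mult[symmetric] exp_add[symmetric] algebra_simps)
    finally show ?thesis .
  qed
  have geo: "summable (\<lambda>n. c * exp (- \<nu> * Re u) * exp (- \<nu>) ^ n)"
    "(\<Sum>n. c * exp (- \<nu> * Re u) * exp (- \<nu>) ^ n) = K * c * exp (- \<nu> * Re u)" for u
    using \<nu> by (auto intro!: summable_mult summable_geometric simp: suminf_mult summable_geometric suminf_geometric K_def)
  have sm: "summable (\<lambda>n. F (u + of_nat (Suc n)) - F (u + of_nat n))" if "u \<in> strip U" for u
    by (rule summable_comparison_test'[OF geo(1), of 0]) (use step[OF that] in auto)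
  define l where "l = (\<lambda>u. F u + (\<Sum>n. F (u + of_nat (Suc n)) - F (u + of_nat n)))"
  have lim: "(\<lambda>n. F (u + of_nat n)) \<longlonglongrightarrow> l u" if u: "u \<in> strip U" for u
  proof -
    have "(\<lambda>N. \<Sum>n<N. F (u + of_nat (Suc n)) - F (u + of_nat n)) \<longlonglongrightarrow> (\<Sum>n. F (u + of_nat (Suc n)) - F (u + of_nat n))"
      by (rule summable_LIMSEQ[OF sm[OF u]])
    then have "(\<lambda>N. F (u + of_nat N) - F u) \<longlonglongrightarrow> (\<Sum>n. F (u + of_nat (Suc n)) - F (u + of_nat n))"
      by (simp add: sum_lessThan_telescope[of "\<lambda>n. F (u + of_nat n)"] del: of_nat_Suc)
    from tendsto_add[OF tendsto_const[of "F u"] this] show ?thesis by (simp add: l_def)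
  qed
  have bound: "norm (F u - l u) \<le> K * c * exp (- \<nu> * Re u)" if u: "u \<in> strip U" for u
  proof -
    have sn: "summable (\<lambda>n. norm (F (u + of_nat (Suc n)) - F (u + of_nat n)))"
      by (rule summable_comparison_test'[OF geo(1), of 0]) (use step[OF u] in auto)
    have "norm (F u - l u) \<le> (\<Sum>n. norm (F (u + of_nat (Suc n)) - F (u + of_nat n)))"
      unfolding l_def using summable_norm[OF sn] by simp
    also have "\<dots> \<le> (\<Sum>n. c * exp (- \<nu> * Re u) * exp (- \<nu>) ^ n)"
      by (rule suminf_le[OF step[OF u] sn geo(1)])
    finally show ?thesis unfolding geo(2) .
  qed
  have same: "l u = l ?u0" if u: "u \<in> strip U" for u
  proof -
    have "(\<lambda>n. F (u + of_nat n) - F (?u0 + of_nat n)) \<longlonglongrightarrow> 0"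
    proof (rule Lim_null_comparison)
      show "\<forall>\<^sub>F n in sequentially. norm (F (u + of_nat n) - F (?u0 + of_nat n))
          \<le> c * exp (- \<nu> * (U + real n)) * norm (u - ?u0)"
      proof (rule always_eventually, rule allI)
        fix n
        have "norm (F (u + of_nat n) - F (?u0 + of_nat n))
          \<le> c * exp (- \<nu> * (U + real n)) * norm ((u + of_nat n) - (?u0 + of_nat n))"
        proof (rule strip_increment_bound[OF F strip_add[OF u0] strip_add[OF u]])
          fix s assume s: "s \<in> closed_segment (?u0 + of_nat n) (u + of_nat n)"
          then have "s \<in> strip U" using strip_add u u0 convex_strip convex_contains_segment by blast
          then show "norm (h s) \<le> c * exp (- \<nu> * (U + real n))"
            using Re_closed_segment(1)[OF s] u by (intro hn) (auto simp: strip_def)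
        qed auto
        then show "norm (F (u + of_nat n) - F (?u0 + of_nat n)) \<le> c * exp (- \<nu> * (U + real n)) * norm (u - ?u0)"
          by simp
      qed
      show "(\<lambda>n. c * exp (- \<nu> * (U + real n)) * norm (u - ?u0)) \<longlonglongrightarrow> 0"
        using \<nu> by real_asymp
    qed
    with tendsto_diff[OF lim[OF u] lim[OF u0]] have "l u - l ?u0 = 0" using LIMSEQ_unique by blast
    then show ?thesis by simp
  qed
  show ?thesis
    by (rule that[of "l ?u0"]) (use lim bound same in \<open>auto simp: K_def\<close>)
qed

text \<open>\<open>J\<close> is a right inverse of \<open>d/du + \<mu>\<close> on the strip, bounded by \<open>K\<close> from the
  \<open>V\<close>-weighted to the \<open>W\<close>-weighted sup norm.\<close>

definition right_inverse :: "real \<Rightarrow> complex \<Rightarrow> (complex \<Rightarrow> real) \<Rightarrow> (complex \<Rightarrow> real) \<Rightarrow> real \<Rightarrow>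
    ((complex \<Rightarrow> complex) \<Rightarrow> complex \<Rightarrow> complex) \<Rightarrow> bool"
  where "right_inverse U \<mu> V W K J \<longleftrightarrow>
    (\<forall>g c. g holomorphic_on strip U \<longrightarrow> (\<forall>u\<in>strip U. norm (g u) \<le> c * V u) \<longrightarrow>
      (\<forall>u\<in>strip U. DERIV (J g) u :> g u - \<mu> * J g u \<and> norm (J g u) \<le> K * c * W u)) \<and>
    (\<forall>g g' c c'. g holomorphic_on strip U \<longrightarrow> (\<forall>u\<in>strip U. norm (g u) \<le> c' * V u) \<longrightarrow>
      g' holomorphic_on strip U \<longrightarrow> (\<forall>u\<in>strip U. norm (g' u) \<le> c' * V u) \<longrightarrow>
      (\<forall>u\<in>strip U. norm (g u - g' u) \<le> c * V u) \<longrightarrow>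
      (\<forall>u\<in>strip U. norm (J g u - J g' u) \<le> K * c * W u))"

section \<open>Inverting \<open>d/du + \<mu>\<close> between weighted spaces\<close>

lemma strip_primitive:
  assumes "g holomorphic_on strip U"
  shows "\<exists>G. \<forall>u\<in>strip U. DERIV G u :> g u"
  using holomorphic_convex_primitive'[OF convex_strip open_strip assms]
  by (metis at_within_open open_strip)

lemma norm_exp_mult_strip:
  assumes "u \<in> strip U"
  shows "norm (exp (\<mu> * u)) \<le> exp (\<bar>Im \<mu>\<bar> * 2) * exp (Re \<mu> * Re u)"
proof -
  have "Re (\<mu> * u) \<le> Re \<mu> * Re u + \<bar>Im \<mu>\<bar> * \<bar>Im u\<bar>"
    using abs_ge_minus_self[of "Im \<mu> * Im u"] by (simp add: abs_mult)
  also have "\<bar>Im \<mu>\<bar> * \<bar>Im u\<bar> \<le> \<bar>Im \<mu>\<bar> * 2"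
    using assms pi_less_4 by (intro mult_left_mono) (auto simp: strip_def)
  finally have "exp (Re (\<mu> * u)) \<le> exp (\<bar>Im \<mu>\<bar> * 2 + Re \<mu> * Re u)" by simp
  then show ?thesis by (simp add: exp_add)
qed

text \<open>Variation of constants: \<open>J g\<close> is \<open>exp (- \<mu> u)\<close> times a
  primitive of \<open>exp (\<mu> u) g\<close>, whose integrand has the growth rate
  \<open>Re \<mu> - \<delta>\<close>. A positive rate is integrated from a base point, a negative
  one from infinity. \<open>K\<close> is independent of \<open>U\<close>, because \<open>U\<close>
  is chosen later, in terms of \<open>K\<close>.\<close>

lemma right_inverse_exists:
  assumes "Re \<mu> \<noteq> \<delta>"
  obtains K where "K > 0" "\<And>U. \<exists>J. right_inverse U \<mu> (\<lambda>u. exp (- \<delta> * Re u)) (\<lambda>u. exp (- \<delta> * Re u)) K J"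
proof -
  define M where "M = exp (\<bar>Im \<mu>\<bar> * 2)"
  have M: "M > 0" "norm (exp (\<mu> * u)) \<le> M * exp (Re \<mu> * Re u)" "norm (exp (- (\<mu> * u))) \<le> M * exp (- Re \<mu> * Re u)"
    if "u \<in> strip U" for u U
    using norm_exp_mult_strip[OF that, of \<mu>] norm_exp_mult_strip[OF that, of "- \<mu>"] by (auto simp: M_def)
  have M0: "M > 0" by (simp add: M_def)
  \<comment> \<open>A choice of primitives need not be additive in \<open>g\<close>. Differences are
    therefore estimated on their own, as primitives of
    \<open>exp (\<mu> * u) * (g u - g' u)\<close>.\<close>
  define prim where "prim = (\<lambda>U g. SOME G. \<forall>u\<in>strip U. DERIV G u :> exp (\<mu> * u) * g u)"
  have prim: "DERIV (prim U g) u :> exp (\<mu> * u) * g u"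
    if "g holomorphic_on strip U" "u \<in> strip U" for U g u
  proof -
    have "\<exists>G. \<forall>u\<in>strip U. DERIV G u :> exp (\<mu> * u) * g u"
      by (rule strip_primitive) (intro holomorphic_intros that)
    from someI_ex[OF this] show ?thesis using that(2) unfolding prim_def by blast
  qed
  have hb: "norm (exp (\<mu> * u) * g) \<le> M * c * exp ((Re \<mu> - \<delta>) * Re u)"
    if "u \<in> strip U" "norm g \<le> c * exp (- \<delta> * Re u)" for u g c U
  proof -
    have "norm (exp (\<mu> * u)) * norm g \<le> (M * exp (Re \<mu> * Re u)) * (c * exp (- \<delta> * Re u))"
      using that M0 by (intro mult_mono M) auto
    also have "\<dots> = M * c * (exp (Re \<mu> * Re u) * exp (- \<delta> * Re u))" by simp
    finally show ?thesis by (simp only: norm_mult mult_exp_exp) (simp add: algebra_simps)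
  qed
  have untwist: "norm (exp (- (\<mu> * u)) * F) \<le> (M * M * k) * c * exp (- \<delta> * Re u)"
    if "u \<in> strip U" "norm F \<le> k * (M * c) * exp ((Re \<mu> - \<delta>) * Re u)" for u F c k U
  proof -
    have "norm (exp (- (\<mu> * u))) * norm F \<le> (M * exp (- Re \<mu> * Re u)) * (k * (M * c) * exp ((Re \<mu> - \<delta>) * Re u))"
      using that M0 by (intro mult_mono M) auto
    also have "\<dots> = (M * M * k) * c * (exp (- Re \<mu> * Re u) * exp ((Re \<mu> - \<delta>) * Re u))" by simp
    finally show ?thesis by (simp only: norm_mult mult_exp_exp) (simp add: algebra_simps)
  qed
  \<comment> \<open>\<open>C g\<close> normalises the primitive: it is the value at the base point
    in one case and the limit at infinity in the other.\<close>
  let ?bound = "\<lambda>k E U. \<exists>C. (\<forall>g. g holomorphic_on strip U \<longrightarrow> (\<exists>c. \<forall>u\<in>strip U. norm (g u) \<le> c * exp (- \<delta> * Re u)) \<longrightarrow>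
      (\<forall>g'. g' holomorphic_on strip U \<longrightarrow> (\<exists>c. \<forall>u\<in>strip U. norm (g' u) \<le> c * exp (- \<delta> * Re u)) \<longrightarrow>
      (\<forall>c. (\<forall>u\<in>strip U. norm (g u - g' u) \<le> c * exp (- \<delta> * Re u)) \<longrightarrow>
        (\<forall>u\<in>strip U. norm ((prim U g u - C g) - (prim U g' u - C g')) \<le> k * (M * c) * exp (E * Re u)))))
      \<and> (\<forall>g c. g holomorphic_on strip U \<longrightarrow> (\<forall>u\<in>strip U. norm (g u) \<le> c * exp (- \<delta> * Re u)) \<longrightarrow>
        (\<forall>u\<in>strip U. norm (prim U g u - C g) \<le> k * (M * c) * exp (E * Re u)))"
  have "\<exists>k>0. \<forall>U. ?bound k (Re \<mu> - \<delta>) U"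
  proof (cases "Re \<mu> > \<delta>")
    case True
    define \<nu> where "\<nu> = Re \<mu> - \<delta>"
    have \<nu>: "\<nu> > 0" using True by (simp add: \<nu>_def)
    show ?thesis
    proof (intro exI[of _ "3 * exp \<nu> + 1 / (1 - exp (- \<nu>))"] conjI allI)
      show "0 < 3 * exp \<nu> + 1 / (1 - exp (- \<nu>))" using \<nu> by (intro add_pos_pos) auto
      fix U
      define u0 where "u0 = complex_of_real (U + 1)"
      have A: "norm (prim U g u - prim U g u0) \<le> (3 * exp \<nu> + 1 / (1 - exp (- \<nu>))) * (M * c) * exp (\<nu> * Re u)"
        if g: "g holomorphic_on strip U" "\<forall>u\<in>strip U. norm (g u) \<le> c * exp (- \<delta> * Re u)" and u: "u \<in> strip U" for g c u
        by (rule strip_primitive_growing[where F = "\<lambda>u. prim U g u - prim U g u0" and h = "\<lambda>u. exp (\<mu> * u) * g u" and U = U])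
          (use prim[OF g(1)] hb[of _ U "g _" c] g(2) \<nu> u in \<open>auto simp: u0_def \<nu>_def intro!: derivative_eq_intros\<close>)
      have B: "norm ((prim U g u - prim U g u0) - (prim U g' u - prim U g' u0))
          \<le> (3 * exp \<nu> + 1 / (1 - exp (- \<nu>))) * (M * c) * exp (\<nu> * Re u)"
        if g: "g holomorphic_on strip U" "g' holomorphic_on strip U"
          "\<forall>u\<in>strip U. norm (g u - g' u) \<le> c * exp (- \<delta> * Re u)" and u: "u \<in> strip U" for g g' c u
      proof (rule strip_primitive_growing[where F = "\<lambda>u. (prim U g u - prim U g u0) - (prim U g' u - prim U g' u0)"
            and h = "\<lambda>u. exp (\<mu> * u) * (g u - g' u)" and U = U, OF _ _ \<nu> _ u])
        fix s assume s: "s \<in> strip U"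
        have "((\<lambda>u. (prim U g u - prim U g u0) - (prim U g' u - prim U g' u0)) has_field_derivative
            (exp (\<mu> * s) * g s - 0) - (exp (\<mu> * s) * g' s - 0)) (at s)"
          by (intro DERIV_diff prim g s DERIV_const)
        then show "((\<lambda>u. (prim U g u - prim U g u0) - (prim U g' u - prim U g' u0)) has_field_derivative
            exp (\<mu> * s) * (g s - g' s)) (at s)" by (simp add: algebra_simps)
        show "norm (exp (\<mu> * s) * (g s - g' s)) \<le> M * c * exp (\<nu> * Re s)"
          unfolding \<nu>_def by (rule hb[OF s]) (use g(3) s in auto)
      qed (simp add: u0_def)
      show "?bound (3 * exp \<nu> + 1 / (1 - exp (- \<nu>))) (Re \<mu> - \<delta>) U"
        using A B unfolding \<nu>_def by (intro exI[of _ "\<lambda>g. prim U g u0"]) blast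
    qed
  next
    case False
    define \<nu> where "\<nu> = \<delta> - Re \<mu>"
    have \<nu>: "\<nu> > 0" "Re \<mu> - \<delta> = - \<nu>" using False assms by (simp_all add: \<nu>_def)
    show ?thesis unfolding \<nu>(2)
    proof (intro exI[of _ "1 / (1 - exp (- \<nu>))"] conjI allI)
      show "0 < 1 / (1 - exp (- \<nu>))" using \<nu> by auto
      fix U
      define C where "C = (\<lambda>g. lim (\<lambda>n. prim U g (of_real (U + 1) + of_nat n)))"
      have u0: "complex_of_real (U + 1) \<in> strip U" by (rule strip_of_real) simp
      have A: "(\<lambda>n. prim U g (u + of_nat n)) \<longlonglongrightarrow> C g \<and>
          norm (prim U g u - C g) \<le> 1 / (1 - exp (- \<nu>)) * (M * c) * exp (- \<nu> * Re u)"
        if g: "g holomorphic_on strip U" "\<forall>u\<in>strip U. norm (g u) \<le> c * exp (- \<delta> * Re u)" and u: "u \<in> strip U" for g c u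
      proof -
        obtain l where l: "\<And>u. u \<in> strip U \<Longrightarrow> (\<lambda>n. prim U g (u + of_nat n)) \<longlonglongrightarrow> l"
          "\<And>u. u \<in> strip U \<Longrightarrow> norm (prim U g u - l) \<le> 1 / (1 - exp (- \<nu>)) * (M * c) * exp (- \<nu> * Re u)"
        proof (rule strip_primitive_decaying[OF prim[OF g(1)] _ \<nu>(1), of U "M * c"])
          show "norm (exp (\<mu> * s) * g s) \<le> M * c * exp (- \<nu> * Re s)" if "s \<in> strip U" for s
            unfolding \<nu>(2)[symmetric] by (rule hb[OF that]) (use g(2) that in auto)
        qed auto
        moreover have "C g = l" using limI[OF l(1)[OF u0]] by (simp add: C_def)
        ultimately show ?thesis using u by blast
      qed
      have B: "norm ((prim U g u - C g) - (prim U g' u - C g')) \<le> 1 / (1 - exp (- \<nu>)) * (M * c) * exp (- \<nu> * Re u)"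
        if g: "g holomorphic_on strip U" "\<forall>u\<in>strip U. norm (g u) \<le> c1 * exp (- \<delta> * Re u)"
          "g' holomorphic_on strip U" "\<forall>u\<in>strip U. norm (g' u) \<le> c2 * exp (- \<delta> * Re u)"
          "\<forall>u\<in>strip U. norm (g u - g' u) \<le> c * exp (- \<delta> * Re u)" and u: "u \<in> strip U" for g g' c c1 c2 u
      proof -
        obtain l where l: "\<And>u. u \<in> strip U \<Longrightarrow> (\<lambda>n. prim U g (u + of_nat n) - prim U g' (u + of_nat n)) \<longlonglongrightarrow> l"
          "\<And>u. u \<in> strip U \<Longrightarrow> norm ((prim U g u - prim U g' u) - l) \<le> 1 / (1 - exp (- \<nu>)) * (M * c) * exp (- \<nu> * Re u)"
        proof (rule strip_primitive_decaying[where F = "\<lambda>u. prim U g u - prim U g' u"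
            and h = "\<lambda>u. exp (\<mu> * u) * (g u - g' u)" and U = U and c = "M * c", OF _ _ \<nu>(1)])
          show "norm (exp (\<mu> * s) * (g s - g' s)) \<le> M * c * exp (- \<nu> * Re s)" if "s \<in> strip U" for s
            unfolding \<nu>(2)[symmetric] by (rule hb[OF that]) (use g(5) that in auto)
          show "DERIV (\<lambda>u. prim U g u - prim U g' u) s :> exp (\<mu> * s) * (g s - g' s)"
            if "s \<in> strip U" for s
            using DERIV_diff[OF prim[OF g(1) that] prim[OF g(3) that]] by (simp add: algebra_simps)
        qed auto
        have "(\<lambda>n. prim U g (u + of_nat n) - prim U g' (u + of_nat n)) \<longlonglongrightarrow> C g - C g'"
          using A[OF g(1,2) u] A[OF g(3,4) u] by (intro tendsto_diff) auto
        then have "l = C g - C g'" using l(1)[OF u] LIMSEQ_unique by blast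
        then have eq: "(prim U g u - C g) - (prim U g' u - C g') = (prim U g u - prim U g' u) - l" by simp
        show ?thesis unfolding eq by (rule l(2)[OF u])
      qed
      show "?bound (1 / (1 - exp (- \<nu>))) (- \<nu>) U"
        using A B by (intro exI[of _ C]) blast
    qed
  qed
  then obtain k where k: "k > 0" and kC: "\<And>U. ?bound k (Re \<mu> - \<delta>) U"
    by blast
  show ?thesis
  proof (rule that[of "M * M * k"])
    show "M * M * k > 0" using M0 k by simp
    fix U
    obtain C where C1: "\<And>g g' c1 c2 c u. g holomorphic_on strip U \<Longrightarrow> \<forall>u\<in>strip U. norm (g u) \<le> c1 * exp (- \<delta> * Re u) \<Longrightarrow>
      g' holomorphic_on strip U \<Longrightarrow> \<forall>u\<in>strip U. norm (g' u) \<le> c2 * exp (- \<delta> * Re u) \<Longrightarrow>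
      \<forall>u\<in>strip U. norm (g u - g' u) \<le> c * exp (- \<delta> * Re u) \<Longrightarrow> u \<in> strip U \<Longrightarrow>
        norm ((prim U g u - C g) - (prim U g' u - C g')) \<le> k * (M * c) * exp ((Re \<mu> - \<delta>) * Re u)"
      and C2: "\<And>g c u. g holomorphic_on strip U \<Longrightarrow> \<forall>u\<in>strip U. norm (g u) \<le> c * exp (- \<delta> * Re u) \<Longrightarrow> u \<in> strip U \<Longrightarrow>
         norm (prim U g u - C g) \<le> k * (M * c) * exp ((Re \<mu> - \<delta>) * Re u)"
      using kC[of U] by blast
    define J where "J = (\<lambda>g u. exp (- (\<mu> * u)) * (prim U g u - C g))"
    have "right_inverse U \<mu> (\<lambda>u. exp (- \<delta> * Re u)) (\<lambda>u. exp (- \<delta> * Re u)) (M * M * k) J"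
      unfolding right_inverse_def
    proof (intro conjI allI impI ballI)
      fix g c u assume g: "g holomorphic_on strip U" "\<forall>u\<in>strip U. norm (g u) \<le> c * exp (- \<delta> * Re u)" and u: "u \<in> strip U"
      have "DERIV (J g) u :> exp (- (\<mu> * u)) * (- \<mu>) * (prim U g u - C g)
           + exp (- (\<mu> * u)) * (exp (\<mu> * u) * g u - 0)"
        unfolding J_def
        by (rule DERIV_cong[OF DERIV_mult[OF _ DERIV_diff[OF prim[OF g(1) u] DERIV_const]]])
           (auto intro!: derivative_eq_intros simp: algebra_simps)
      moreover have "exp (- (\<mu> * u)) * (- \<mu>) * (prim U g u - C g) + exp (- (\<mu> * u)) * (exp (\<mu> * u) * g u - 0)
          = g u - \<mu> * J g u"
        by (simp add: J_def exp_minus_inverse mult.assoc[symmetric] exp_minus field_simps)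
      ultimately show "DERIV (J g) u :> g u - \<mu> * J g u" by simp
      show "norm (J g u) \<le> M * M * k * c * exp (- \<delta> * Re u)"
        unfolding J_def by (rule untwist[OF u C2[OF g u]])
    next
      fix g g' c c' u
      assume g: "g holomorphic_on strip U" "\<forall>u\<in>strip U. norm (g u) \<le> c' * exp (- \<delta> * Re u)"
        "g' holomorphic_on strip U" "\<forall>u\<in>strip U. norm (g' u) \<le> c' * exp (- \<delta> * Re u)"
        "\<forall>u\<in>strip U. norm (g u - g' u) \<le> c * exp (- \<delta> * Re u)" and u: "u \<in> strip U"
      have "J g u - J g' u = exp (- (\<mu> * u)) * ((prim U g u - C g) - (prim U g' u - C g'))"
        by (simp add: J_def algebra_simps)
      then show "norm (J g u - J g' u) \<le> M * M * k * c * exp (- \<delta> * Re u)"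
        using untwist[OF u C1[OF g u]] by simp
    qed
    then show "\<exists>J. right_inverse U \<mu> (\<lambda>u. exp (- \<delta> * Re u)) (\<lambda>u. exp (- \<delta> * Re u)) (M * M * k) J" by blast
  qed
qed

text \<open>The resonance \<open>Re \<mu> = \<delta> = 0\<close> excluded above: a bounded
  right-hand side has a primitive of linear growth, so the target weight is
  \<open>norm\<close>.\<close>

lemma right_inverse_0_exists:
  assumes "U \<ge> 1"
  shows "\<exists>J. right_inverse U 0 (\<lambda>u. 1) norm 3 J"
proof -
  define prim where "prim = (\<lambda>g. SOME G. \<forall>u\<in>strip U. DERIV G u :> g u)"
  have prim: "DERIV (prim g) u :> g u" if "g holomorphic_on strip U" "u \<in> strip U" for g u
    using someI_ex[OF strip_primitive[OF that(1)]] that(2) unfolding prim_def by blast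
  define u0 where "u0 = complex_of_real (U + 1)"
  have u0: "u0 \<in> strip U" unfolding u0_def by (rule strip_of_real) simp
  have est: "norm (F u - F u0) \<le> 3 * c * norm u"
    if F: "\<And>s. s \<in> strip U \<Longrightarrow> DERIV F s :> h s" and h: "\<And>s. s \<in> strip U \<Longrightarrow> norm (h s) \<le> c"
      and u: "u \<in> strip U" for F h c u
  proof -
    have c: "c \<ge> 0" using h[OF u0] norm_ge_zero order_trans by blast
    have "norm (F u - F u0) \<le> c * norm (u - u0)"
    proof (rule strip_increment_bound[OF F u0 u])
      fix s assume "s \<in> closed_segment u0 u"
      then have "s \<in> strip U" using u0 u convex_strip convex_contains_segment by blast
      then show "norm (h s) \<le> c" by (rule h)
    qed auto
    also have "norm (u - u0) \<le> norm u + norm u0" by (rule norm_triangle_ineq4)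
    also have "norm u0 \<le> 2 * norm u"
      using assms complex_Re_le_cmod[of u] u by (simp add: u0_def strip_def norm_of_real del: of_real_add)
    finally show ?thesis using c by (simp add: mult_left_mono mult.assoc mult.left_commute)
  qed
  have "right_inverse U 0 (\<lambda>u. 1) norm 3 (\<lambda>g u. prim g u - prim g u0)"
    unfolding right_inverse_def
  proof (intro conjI allI impI ballI)
    fix g c u assume g: "g holomorphic_on strip U" "\<forall>u\<in>strip U. norm (g u) \<le> c * 1" and u: "u \<in> strip U"
    show "DERIV (\<lambda>u. prim g u - prim g u0) u :> g u - 0 * (prim g u - prim g u0)"
      using DERIV_diff[OF prim[OF g(1) u] DERIV_const[of "prim g u0"]] by simp
    show "norm (prim g u - prim g u0) \<le> 3 * c * norm u"
      by (rule est[OF prim[OF g(1)] _ u]) (use g(2) in auto)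
  next
    fix g g' c c' u
    assume g: "g holomorphic_on strip U" "g' holomorphic_on strip U"
      "\<forall>u\<in>strip U. norm (g u - g' u) \<le> c * 1" and u: "u \<in> strip U"
    have "norm ((prim g u - prim g' u) - (prim g u0 - prim g' u0)) \<le> 3 * c * norm u"
      by (rule est[where F = "\<lambda>u. prim g u - prim g' u" and h = "\<lambda>u. g u - g' u", OF _ _ u])
         (use g(3) in \<open>auto intro!: DERIV_diff prim g(1,2)\<close>)
    then show "norm (prim g u - prim g u0 - (prim g' u - prim g' u0)) \<le> 3 * c * norm u"
      by (simp add: algebra_simps)
  qed
  then show ?thesis by blast
qed

lemma right_inverseD:
  assumes "right_inverse U \<mu> V W K J"
  shows "g holomorphic_on strip U \<Longrightarrow> \<forall>u\<in>strip U. norm (g u) \<le> c * V u \<Longrightarrow> u \<in> strip U \<Longrightarrow>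
      DERIV (J g) u :> g u - \<mu> * J g u \<and> norm (J g u) \<le> K * c * W u"
    and "g holomorphic_on strip U \<Longrightarrow> \<forall>u\<in>strip U. norm (g u) \<le> c' * V u \<Longrightarrow>
      g' holomorphic_on strip U \<Longrightarrow> \<forall>u\<in>strip U. norm (g' u) \<le> c' * V u \<Longrightarrow>
      \<forall>u\<in>strip U. norm (g u - g' u) \<le> c * V u \<Longrightarrow> u \<in> strip U \<Longrightarrow> norm (J g u - J g' u) \<le> K * c * W u"
  using assms unfolding right_inverse_def by blast+

lemma right_inverse_scale:
  assumes "right_inverse U \<mu> V W K J"
  shows "right_inverse U \<mu> (\<lambda>u. s * V u) (\<lambda>u. s * W u) K J"
  unfolding right_inverse_def
proof (intro conjI allI impI)
  fix g c assume "g holomorphic_on strip U" "\<forall>u\<in>strip U. norm (g u) \<le> c * (s * V u)"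
  then show "\<forall>u\<in>strip U. DERIV (J g) u :> g u - \<mu> * J g u \<and> norm (J g u) \<le> K * c * (s * W u)"
    using right_inverseD(1)[OF assms, of g "c * s"] by (simp add: mult.assoc)
next
  fix g g' c c' assume "g holomorphic_on strip U" "\<forall>u\<in>strip U. norm (g u) \<le> c' * (s * V u)"
    "g' holomorphic_on strip U" "\<forall>u\<in>strip U. norm (g' u) \<le> c' * (s * V u)"
    "\<forall>u\<in>strip U. norm (g u - g' u) \<le> c * (s * V u)"
  then show "\<forall>u\<in>strip U. norm (J g u - J g' u) \<le> K * c * (s * W u)"
    using right_inverseD(2)[OF assms, of g "c' * s" g' "c * s"] by (simp add: mult.assoc)
qed

text \<open>\<open>norm D * w \<le> v\<close> is the derivative bound after the disc of radius
  \<open>w\<close> has been rescaled to the unit disc.\<close>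

lemma DERIV_bound_scaled:
  fixes g :: "complex \<Rightarrow> complex"
  assumes g: "\<And>s. norm s \<le> w \<Longrightarrow> \<exists>D. DERIV g s :> D \<and> norm D * w \<le> v" and "norm x \<le> w" "norm x' \<le> w"
    and d: "norm (x - x') \<le> d * w" and w: "w > 0"
  shows "norm (g x - g x') \<le> d * v"
proof -
  obtain D where D: "\<And>s. norm s \<le> w \<Longrightarrow> DERIV g s :> D s \<and> norm (D s) * w \<le> v" using g by metis
  have "norm (D 0) * w \<le> v" "norm (D 0) * w \<ge> 0" using D[of 0] w by auto
  then have v: "v \<ge> 0" by linarith
  have "norm (g x - g x') \<le> v / w * norm (x - x')"
    by (rule field_differentiable_bound[of "cball 0 w" g D])
      (use D assms(2,3) w in \<open>auto simp: pos_le_divide_eq intro: has_field_derivative_at_within\<close>)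
  also have "\<dots> \<le> v / w * (d * w)" using d v w by (intro mult_left_mono) auto
  finally show ?thesis using w by (simp add: mult.commute)
qed

text \<open>The solution is a fixed point of \<open>v -> J (Q v)\<close>. Each of the two partial
  derivatives is allowed a share \<open>V / (4 K)\<close>; after multiplication by the norm
  \<open>K\<close> of \<open>J\<close> the two together contract by \<open>1 / 2\<close>. The value
  of \<open>Q\<close> at zero may fill the other half of the ball.\<close>

lemma strip_ode:
  fixes Q :: "bool \<Rightarrow> complex \<Rightarrow> complex \<Rightarrow> complex \<Rightarrow> complex"
  assumes J: "\<And>i. \<exists>J. right_inverse U (\<mu> i) (V i) (W i) (K i) J" and K: "\<And>i. K i > 0"
    and W: "\<And>i. continuous_on (strip U) (W i)" "\<And>i u. u \<in> strip U \<Longrightarrow> W i u > 0"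
    and holo: "\<And>i x y. x holomorphic_on strip U \<Longrightarrow> y holomorphic_on strip U \<Longrightarrow>
      (\<And>u. u \<in> strip U \<Longrightarrow> norm (x u) \<le> W True u \<and> norm (y u) \<le> W False u) \<Longrightarrow>
      (\<lambda>u. Q i u (x u) (y u)) holomorphic_on strip U"
    and der: "\<And>i u x y. u \<in> strip U \<Longrightarrow> norm x \<le> W True u \<Longrightarrow> norm y \<le> W False u \<Longrightarrow>
      (\<exists>D. DERIV (\<lambda>x. Q i u x y) x :> D \<and> norm D * W True u \<le> V i u / (4 * K i)) \<and>
      (\<exists>D. DERIV (\<lambda>y. Q i u x y) y :> D \<and> norm D * W False u \<le> V i u / (4 * K i))"
    and zero: "\<And>i u. u \<in> strip U \<Longrightarrow> norm (Q i u 0 0) \<le> V i u / (2 * K i)"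
  obtains x y where "x holomorphic_on strip U" "y holomorphic_on strip U"
    "\<And>u. u \<in> strip U \<Longrightarrow> norm (x u) \<le> W True u" "\<And>u. u \<in> strip U \<Longrightarrow> norm (y u) \<le> W False u"
    "\<And>u. u \<in> strip U \<Longrightarrow> DERIV x u :> Q True u (x u) (y u) - \<mu> True * x u"
    "\<And>u. u \<in> strip U \<Longrightarrow> DERIV y u :> Q False u (x u) (y u) - \<mu> False * y u"
proof -
  let ?S = "strip U"
  obtain J where J: "\<And>i. right_inverse U (\<mu> i) (V i) (W i) (K i) (J i)" using J by metis
  define G where "G = (\<lambda>v i u. Q i u (v True u) (v False u))"
  define OK where "OK = (\<lambda>v. \<forall>i. v i holomorphic_on ?S \<and> (\<forall>u\<in>?S. norm (v i u) \<le> W i u))"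
  define T where "T = (\<lambda>v i. J i (G v i))"
  have Ghol: "G v i holomorphic_on ?S" if "OK v" for v i
    unfolding G_def by (rule holo) (use that in \<open>auto simp: OK_def\<close>)
  have lip: "norm (Q i u x y - Q i u x' y') \<le> d / (2 * K i) * V i u"
    if u: "u \<in> ?S" and x: "norm x \<le> W True u" "norm x' \<le> W True u" "norm (x - x') \<le> d * W True u"
      and y: "norm y \<le> W False u" "norm y' \<le> W False u" "norm (y - y') \<le> d * W False u" for i u x y x' y' d
  proof -
    have "norm (Q i u x y - Q i u x' y) \<le> d * (V i u / (4 * K i))"
      by (rule DERIV_bound_scaled[OF _ x W(2)[OF u]]) (use der[OF u _ y(1)] in blast)
    moreover have "norm (Q i u x' y - Q i u x' y') \<le> d * (V i u / (4 * K i))"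
      by (rule DERIV_bound_scaled[OF _ y W(2)[OF u]]) (use der[OF u x(2)] in blast)
    moreover have "d * (V i u / (4 * K i)) + d * (V i u / (4 * K i)) = d / (2 * K i) * V i u"
      using K[of i] by (simp add: field_simps)
    ultimately show ?thesis
      using norm_triangle_ineq[of "Q i u x y - Q i u x' y" "Q i u x' y - Q i u x' y'"] by simp
  qed
  have Gdiff: "\<forall>u\<in>?S. norm (G v i u - G w i u) \<le> d / (2 * K i) * V i u"
    if "OK v" "OK w" "\<And>i u. u \<in> ?S \<Longrightarrow> norm (v i u - w i u) \<le> d * W i u" for v w d i
    unfolding G_def using that by (intro ballI lip) (auto simp: OK_def)
  have Gle: "\<forall>u\<in>?S. norm (G v i u) \<le> 1 / K i * V i u" if "OK v" for v i
  proof
    fix u assume u: "u \<in> ?S"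
    have "norm (G v i u - Q i u 0 0) \<le> 1 / (2 * K i) * V i u"
      unfolding G_def using that u less_imp_le[OF W(2)[OF u]] by (intro lip) (auto simp: OK_def)
    with zero[OF u, of i] have "norm (G v i u) \<le> 1 / (2 * K i) * V i u + 1 / (2 * K i) * V i u"
      using norm_triangle_sub[of "G v i u" "Q i u 0 0"] by simp
    then show "norm (G v i u) \<le> 1 / K i * V i u" by (simp add: field_simps)
  qed
  have Tder: "DERIV (T v i) u :> G v i u - \<mu> i * T v i u" "norm (T v i u) \<le> W i u"
    if "OK v" "u \<in> ?S" for v i u
    using right_inverseD(1)[OF J Ghol[OF that(1)] Gle[OF that(1)] that(2), of i] K[of i] by (auto simp: T_def)
  have TOK: "OK (T v)" if "OK v" for v
    unfolding OK_def
  proof (intro allI conjI ballI)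
    show "T v i holomorphic_on ?S" for i
      using Tder(1)[OF that] open_strip by (auto simp: holomorphic_on_open)
    show "norm (T v i u) \<le> W i u" if "u \<in> ?S" for i u by (rule Tder(2)[OF \<open>OK v\<close> that])
  qed
  have contr: "norm (T v i u - T w i u) \<le> d / 2 * W i u"
    if vw: "OK v" "OK w" and d: "d \<ge> 0" "\<And>i u. u \<in> ?S \<Longrightarrow> norm (v i u - w i u) \<le> d * W i u" and u: "u \<in> ?S" for v w d i u
  proof -
    have "norm (T v i u - T w i u) \<le> K i * (d / (2 * K i)) * W i u"
      unfolding T_def
      by (rule right_inverseD(2)[OF J Ghol[OF vw(1)] Gle[OF vw(1)] Ghol[OF vw(2)] Gle[OF vw(2)] Gdiff[OF vw d(2)] u])
    then show ?thesis using K[of i] by auto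
  qed
  obtain v where v: "\<And>i. v i holomorphic_on ?S" "\<And>i t. t \<in> ?S \<Longrightarrow> norm (v i t) \<le> W i t"
    "\<And>i t. t \<in> ?S \<Longrightarrow> T v i t = v i t"
    using weighted_contraction_fixed_point[of ?S W T, OF open_strip W(1) less_imp_le[OF W(2)] TOK[unfolded OK_def] contr[unfolded OK_def]] by blast
  have vOK: "OK v" using v unfolding OK_def by blast
  have der: "DERIV (v i) u :> G v i u - \<mu> i * v i u" if u: "u \<in> ?S" for i u
    using has_field_derivative_transform_within_open[OF Tder(1)[OF vOK u] open_strip u v(3)] v(3)[OF u] by simp
  show ?thesis
    by (rule that[of "v True" "v False"]) (use v der in \<open>auto simp: G_def\<close>)
qed

section \<open>The two nonlinear systems on the strip\<close>

lemma eventually_norm_less: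
  fixes f :: "'a::t2_space \<Rightarrow> 'b::real_normed_vector"
  assumes "isCont f a" "norm (f a) < c"
  shows "\<forall>\<^sub>F x in nhds a. norm (f x) < c"
  using order_tendstoD(2)[OF tendsto_norm[OF assms(1)[unfolded isCont_def tendsto_at_iff_tendsto_nhds]] assms(2)] .

lemma holomorphic2_isCont:
  fixes h :: "'a::t2_space \<Rightarrow> complex \<times> complex"
  assumes "holomorphic2_on g UNIV" "isCont h q"
  shows "isCont (\<lambda>q. g (h q)) q"
proof (rule isCont_o2[OF assms(2)])
  show "isCont g (h q)"
    using holomorphic2_on_continuous_on[OF assms(1)] unfolding continuous_on_eq_continuous_at[OF open_UNIV] by blast
qed

text \<open>\<open>p\<close> is no separate unknown: its \<open>N\<close>-th power is
  \<open>exp (c0 - u - \<theta> - e * y)\<close>, an integrated form of one equation of the original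
  system, in which \<open>\<theta>\<close> records the deviation of the time from \<open>u\<close>.
  The diagonal linear parts of the remaining equations are \<open>d/du + 1\<close> for
  \<open>\<theta>\<close> and \<open>d/du + \<mu>\<close> for \<open>y\<close>. The forcing by
  \<open>p\<close> decays like \<open>exp (- Re u / N)\<close>, faster than the weight.\<close>

lemma normal_form_ode:
  fixes A B :: "complex \<times> complex \<Rightarrow> complex" and N \<delta> \<epsilon> :: real and c0 e \<mu> :: complex
  assumes A: "holomorphic2_on A UNIV" "A (0, 0) = 1"
    and B: "holomorphic2_on B UNIV" "B (0, 0) = 0" "dw B (0, 0) = - \<mu>"
    and N: "N > 0" and \<delta>: "0 < \<delta>" "\<delta> < 1" "\<delta> < 1 / N" "Re \<mu> \<noteq> \<delta>" and \<epsilon>: "\<epsilon> > 0"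
  defines "p \<equiv> \<lambda>u \<theta> y. exp ((c0 - u - \<theta> - e * y) / of_real N)"
  obtains U0 where "\<And>U. U \<ge> U0 \<Longrightarrow> \<exists>\<theta> y. \<forall>u\<in>strip U.
      norm (\<theta> u) \<le> \<epsilon> \<and> norm (y u) \<le> \<epsilon> * exp (- \<delta> * Re u) \<and> norm (p u (\<theta> u) (y u)) \<le> \<epsilon> \<and>
      norm (A (p u (\<theta> u) (y u), y u) - 1) \<le> 1 / 2 \<and> DERIV \<theta> u :> - 1 + exp (- \<theta> u) * A (p u (\<theta> u) (y u), y u) \<and>
      DERIV y u :> exp (- \<theta> u) * B (p u (\<theta> u) (y u), y u)"
proof -
  obtain K1 where K1: "K1 > 0" "\<And>U. \<exists>J. right_inverse U 1 (\<lambda>u. exp (- \<delta> * Re u)) (\<lambda>u. exp (- \<delta> * Re u)) K1 J"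
    using right_inverse_exists[of 1 \<delta>] \<delta> by auto
  obtain K2 where K2: "K2 > 0" "\<And>U. \<exists>J. right_inverse U \<mu> (\<lambda>u. exp (- \<delta> * Re u)) (\<lambda>u. exp (- \<delta> * Re u)) K2 J"
    using right_inverse_exists[of \<mu> \<delta>] \<delta> by auto
  define M where "M = norm (dw A (0, 0)) + 1"
  have M: "M > 0" by (simp add: M_def add_nonneg_pos)
  \<comment> \<open>The coupling of \<open>y\<close> into the equation of \<open>\<theta>\<close>
    has size \<open>M\<close> and is not small. A ball for \<open>y\<close> smaller by the factor
    \<open>\<kappa>\<close> compensates this; the opposite coupling \<open>a21\<close> vanishes at
    the origin and can be made small compared with \<open>\<kappa>\<close>.\<close>
  define \<kappa> where "\<kappa> = min 1 (1 / (4 * K1 * M))"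
  have \<kappa>: "\<kappa> > 0" "\<kappa> \<le> 1" "M * \<kappa> \<le> 1 / (4 * K1)" using K1 M by (auto simp: \<kappa>_def min_def field_simps)
  \<comment> \<open>The partial derivatives with respect to \<open>\<theta>\<close> and
    \<open>y\<close> of the right-hand sides \<open>Q\<close> below, where \<open>q\<close> stands
    for \<open>(p, y)\<close>. All but \<open>a12\<close> vanish at the origin.\<close>
  define a11 where "a11 = (\<lambda>(\<theta>, q). 1 - exp (- \<theta>) * (A q + dz A q * fst q / of_real N))"
  define a12 where "a12 = (\<lambda>(\<theta>, q). exp (- \<theta>) * (dw A q - dz A q * e * fst q / of_real N))"
  define a21 where "a21 = (\<lambda>(\<theta>, q). - exp (- \<theta>) * (B q + dz B q * fst q / of_real N))"
  define a22 where "a22 = (\<lambda>(\<theta>, q). \<mu> + exp (- \<theta>) * (dw B q - dz B q * e * fst q / of_real N))"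
  note a_def = a11_def a12_def a21_def a22_def case_prod_unfold
  define M3 where "M3 = norm (dz A (0, 0)) + norm (dz B (0, 0)) + 1"
  have M3: "M3 > 0" by (simp add: M3_def add_nonneg_pos)
  have "isCont (\<lambda>q :: complex \<times> complex \<times> complex. g (snd q)) (0, 0, 0)" if "holomorphic2_on g UNIV" for g
    by (rule holomorphic2_isCont[OF that]) (intro continuous_intros)
  note cont = this[OF A(1)] this[OF B(1)] this[OF holomorphic2_dz[OF A(1) open_UNIV]] this[OF holomorphic2_dz[OF B(1) open_UNIV]]
    this[OF holomorphic2_dw[OF A(1) open_UNIV]] this[OF holomorphic2_dw[OF B(1) open_UNIV]]
  have "\<forall>\<^sub>F q in nhds (0, 0, 0). norm (a11 q) < 1 / (4 * K1) \<and> norm (a12 q) < M \<and> norm (a21 q) < \<kappa> / (4 * K2) \<and>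
      norm (a22 q) < 1 / (4 * K2) \<and> norm (dz A (snd q)) < M3 \<and> norm (dz B (snd q)) < M3 \<and> norm (A (snd q) - 1) < 1 / 2"
    unfolding a_def
    by (intro eventually_conj eventually_norm_less continuous_intros cont)
      (use N A(2) B(2,3) K1 K2 \<kappa> in \<open>simp_all add: M_def M3_def add_nonneg_pos\<close>)
  then obtain \<rho>0 where \<rho>0: "\<rho>0 > 0" "\<And>q. dist q (0, 0, 0) < \<rho>0 \<Longrightarrow> norm (a11 q) < 1 / (4 * K1) \<and> norm (a12 q) < M \<and>
      norm (a21 q) < \<kappa> / (4 * K2) \<and> norm (a22 q) < 1 / (4 * K2) \<and> norm (dz A (snd q)) < M3 \<and> norm (dz B (snd q)) < M3 \<and> norm (A (snd q) - 1) < 1 / 2"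
    unfolding eventually_nhds_metric by blast
  define \<rho> where "\<rho> = \<rho>0 / 4"
  have \<rho>: "\<rho> > 0" using \<rho>0 by (simp add: \<rho>_def)
  have near: "norm (a11 (\<theta>, z, y)) \<le> 1 / (4 * K1)" "norm (a12 (\<theta>, z, y)) \<le> M" "norm (a21 (\<theta>, z, y)) \<le> \<kappa> / (4 * K2)"
    "norm (a22 (\<theta>, z, y)) \<le> 1 / (4 * K2)" "norm (dz A (z, y)) \<le> M3" "norm (dz B (z, y)) \<le> M3" "norm (A (z, y) - 1) \<le> 1 / 2"
    if "norm \<theta> \<le> \<rho>" "norm z \<le> \<rho>" "norm y \<le> \<rho>" for \<theta> z y
  proof -
    have "dist (\<theta>, z, y) (0, 0, 0) \<le> norm \<theta> + (norm z + norm y)"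
      using norm_Pair_le[of \<theta> "(z, y)"] norm_Pair_le[of z y] by (simp add: dist_norm)
    then have "dist (\<theta>, z, y) (0, 0, 0) < \<rho>0" using that \<rho> unfolding \<rho>_def by linarith
    from \<rho>0(2)[OF this] show "norm (a11 (\<theta>, z, y)) \<le> 1 / (4 * K1)" "norm (a12 (\<theta>, z, y)) \<le> M"
      "norm (a21 (\<theta>, z, y)) \<le> \<kappa> / (4 * K2)" "norm (a22 (\<theta>, z, y)) \<le> 1 / (4 * K2)" "norm (dz A (z, y)) \<le> M3" "norm (dz B (z, y)) \<le> M3" "norm (A (z, y) - 1) \<le> 1 / 2"
      by auto
  qed
  define \<epsilon>1 where "\<epsilon>1 = min \<epsilon> \<rho>"
  define \<epsilon>2 where "\<epsilon>2 = \<kappa> * \<epsilon>1"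
  have \<epsilon>1: "\<epsilon>1 > 0" "\<epsilon>1 \<le> \<epsilon>" "\<epsilon>1 \<le> \<rho>" using \<epsilon> \<rho> by (auto simp: \<epsilon>1_def)
  have \<epsilon>2: "\<epsilon>2 > 0" "\<epsilon>2 \<le> \<epsilon>1" using \<epsilon>1 \<kappa> by (auto simp: \<epsilon>2_def mult_le_cancel_right1)
  define P where "P = exp ((Re c0 + \<rho> + norm e * \<rho>) / N)"
  have P: "P > 0" by (simp add: P_def)
  have p_le: "norm (p u \<theta> y) \<le> P * exp (- Re u / N)" if "norm \<theta> \<le> \<rho>" "norm y \<le> \<rho>" for u \<theta> y
  proof -
    have "- Re \<theta> \<le> \<rho>" using abs_Re_le_cmod[of \<theta>] that(1) by linarith
    moreover have "- Re (e * y) \<le> norm e * \<rho>"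
      using abs_Re_le_cmod[of "e * y"] mult_left_mono[OF that(2) norm_ge_zero[of e]] by (simp add: norm_mult)
    ultimately have "Re (c0 - u - \<theta> - e * y) / N \<le> (Re c0 + \<rho> + norm e * \<rho> - Re u) / N"
      using N by (intro divide_right_mono) (simp_all del: times_complex.sel)
    then show ?thesis unfolding P_def p_def exp_add[symmetric] norm_exp_eq_Re Re_divide_of_real
      by (simp add: add_divide_distrib[symmetric] diff_divide_distrib)
  qed
  define \<eta> where "\<eta> = min (\<epsilon>1 / (2 * K1)) (\<epsilon>2 / (2 * K2))"
  have \<eta>: "\<eta> > 0" using \<epsilon>1 \<epsilon>2 K1 K2 by (simp add: \<eta>_def)
  \<comment> \<open>This is where \<open>\<delta> < 1 / N\<close> enters: \<open>p\<close> divided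
    by the weight still tends to 0.\<close>
  have "((\<lambda>x. exp (- (1 / N - \<delta>) * x)) \<longlongrightarrow> 0) at_top" using \<delta> by real_asymp
  then have "\<forall>\<^sub>F x in at_top. exp (- (1 / N - \<delta>) * x) < min (\<eta> / (M3 * P)) (\<epsilon>1 / P)"
    by (rule order_tendstoD) (use \<eta> M3 P \<epsilon>1 in auto)
  then obtain U1 where U1: "\<And>x. x \<ge> U1 \<Longrightarrow> exp (- (1 / N - \<delta>) * x) < min (\<eta> / (M3 * P)) (\<epsilon>1 / P)"
    by (auto simp: eventually_at_top_linorder)
  show ?thesis
  proof (rule that[of "max U1 0"])
    fix U assume U: "U \<ge> max U1 0"
    define E where "E = (\<lambda>u::complex. exp (- \<delta> * Re u))"
    have E: "E u > 0" "E u \<le> 1" if "u \<in> strip U" for u using that U \<delta> by (auto simp: E_def strip_def)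
    have small: "P * exp (- Re u / N) \<le> \<epsilon>1" "M3 * (P * exp (- Re u / N)) \<le> \<eta> * E u" if u: "u \<in> strip U" for u
    proof -
      define x where "x = exp (- (1 / N - \<delta>) * Re u)"
      have eq: "exp (- Re u / N) = x * E u"
        unfolding E_def x_def exp_add[symmetric] by (simp add: algebra_simps)
      have lt: "x < min (\<eta> / (M3 * P)) (\<epsilon>1 / P)"
        unfolding x_def using u U by (intro U1) (auto simp: strip_def)
      have "x * E u \<le> x" using E[OF u] by (intro mult_left_le) (auto simp: x_def)
      moreover have "x * E u \<le> \<eta> / (M3 * P) * E u" using lt E[OF u] by (intro mult_right_mono) auto
      ultimately have "exp (- Re u / N) \<le> \<epsilon>1 / P" "exp (- Re u / N) \<le> \<eta> / (M3 * P) * E u"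
        using lt unfolding eq by linarith+
      then show "P * exp (- Re u / N) \<le> \<epsilon>1" "M3 * (P * exp (- Re u / N)) \<le> \<eta> * E u"
        using P M3 by (auto simp: field_simps)
    qed
    have p_small: "norm (p u \<theta> y) \<le> \<epsilon>1" if "u \<in> strip U" "norm \<theta> \<le> \<rho>" "norm y \<le> \<rho>" for u \<theta> y
      using p_le[OF that(2,3), of u] small(1)[OF that(1)] by linarith
    have p_der: "DERIV (\<lambda>\<theta>. p u \<theta> y) \<theta> :> - (p u \<theta> y / of_real N)" "DERIV (\<lambda>y. p u \<theta> y) y :> - (e * p u \<theta> y / of_real N)" for u \<theta> y
      unfolding p_def using N by (auto intro!: derivative_eq_intros simp: field_simps)
    define Q where "Q = (\<lambda>i u \<theta> y. if i then exp (- \<theta>) * A (p u \<theta> y, y) - 1 + \<theta> else exp (- \<theta>) * B (p u \<theta> y, y) + \<mu> * y)"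
    have exp_der: "DERIV (\<lambda>\<theta>. exp (- \<theta>)) \<theta> :> - exp (- \<theta>)" for \<theta> :: complex
      by (auto intro!: derivative_eq_intros)
    note d1 = holomorphic2_has_field_derivative_curve[OF _ UNIV_I p_der(1) DERIV_const]
    note d2 = holomorphic2_has_field_derivative_curve[OF _ UNIV_I p_der(2) DERIV_ident]
    have Q_der: "DERIV (\<lambda>\<theta>. Q True u \<theta> y) \<theta> :> a11 (\<theta>, p u \<theta> y, y)" "DERIV (\<lambda>y. Q True u \<theta> y) y :> a12 (\<theta>, p u \<theta> y, y)"
      "DERIV (\<lambda>\<theta>. Q False u \<theta> y) \<theta> :> a21 (\<theta>, p u \<theta> y, y)" "DERIV (\<lambda>y. Q False u \<theta> y) y :> a22 (\<theta>, p u \<theta> y, y)" for u \<theta> y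
      unfolding Q_def if_True if_False
      by (rule DERIV_cong[OF DERIV_add[OF DERIV_diff[OF DERIV_mult[OF exp_der d1[OF A(1)]] DERIV_const] DERIV_ident]]
          DERIV_cong[OF DERIV_add[OF DERIV_diff[OF DERIV_cmult[OF d2[OF A(1)]] DERIV_const] DERIV_const]]
          DERIV_cong[OF DERIV_add[OF DERIV_mult[OF exp_der d1[OF B(1)]] DERIV_const]]
          DERIV_cong[OF DERIV_add[OF DERIV_cmult[OF d2[OF B(1)]] DERIV_cmult[OF DERIV_ident]]],
        simp add: a_def algebra_simps)+
    define W where "W = (\<lambda>i u. (if i then \<epsilon>1 else \<epsilon>2) * E u)"
    have W_le: "W i u \<le> \<epsilon>1" "W i u > 0" "W i u \<le> \<epsilon> * E u" if u: "u \<in> strip U" for i u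
    proof -
      have "W i u \<le> \<epsilon>1 * E u" using \<epsilon>2 E[OF u] by (auto simp: W_def)
      moreover have "\<epsilon>1 * E u \<le> \<epsilon>1" using \<epsilon>1 E[OF u] by (intro mult_left_le) auto
      moreover have "\<epsilon>1 * E u \<le> \<epsilon> * E u" using \<epsilon>1 E[OF u] by (intro mult_right_mono) auto
      ultimately show "W i u \<le> \<epsilon>1" "W i u \<le> \<epsilon> * E u" by linarith+
      show "W i u > 0" using \<epsilon>1 \<epsilon>2 E[OF u] by (auto simp: W_def)
    qed
    obtain x y where xy: "x holomorphic_on strip U" "y holomorphic_on strip U"
      "\<And>u. u \<in> strip U \<Longrightarrow> norm (x u) \<le> W True u" "\<And>u. u \<in> strip U \<Longrightarrow> norm (y u) \<le> W False u"
      "\<And>u. u \<in> strip U \<Longrightarrow> DERIV x u :> Q True u (x u) (y u) - (if True then 1 else \<mu>) * x u"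
      "\<And>u. u \<in> strip U \<Longrightarrow> DERIV y u :> Q False u (x u) (y u) - (if False then 1 else \<mu>) * y u"
    proof (rule strip_ode[of U "\<lambda>i. if i then 1 else \<mu>" W W "\<lambda>i. if i then K1 else K2" Q])
      show "\<exists>J. right_inverse U (if i then 1 else \<mu>) (W i) (W i) (if i then K1 else K2) J" for i
        using K1(2)[of U] K2(2)[of U] right_inverse_scale unfolding W_def E_def by (cases i) (simp; blast)+
      show "0 < (if i then K1 else K2)" for i using K1 K2 by simp
      show "continuous_on (strip U) (W i)" for i unfolding W_def E_def by (intro continuous_intros)
      show "0 < W i u" if "u \<in> strip U" for i u by (rule W_le(2)[OF that])
    next
      fix i x y assume h: "x holomorphic_on strip U" "y holomorphic_on strip U"
      have ph: "(\<lambda>u. p u (x u) (y u)) holomorphic_on strip U"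
        unfolding p_def using N by (intro holomorphic_intros h) auto
      show "(\<lambda>u. Q i u (x u) (y u)) holomorphic_on strip U"
        unfolding Q_def
        using holomorphic2_compose_curve[OF A(1) ph h(2) open_strip UNIV_I] holomorphic2_compose_curve[OF B(1) ph h(2) open_strip UNIV_I] h
        by (cases i) (auto intro!: holomorphic_intros)
    next
      fix i u and x y :: complex
      assume u: "u \<in> strip U" and w: "norm x \<le> W True u" "norm y \<le> W False u"
      have r: "norm x \<le> \<rho>" "norm y \<le> \<rho>" using w W_le(1)[OF u, of True] W_le(1)[OF u, of False] \<epsilon>1 by linarith+
      have "norm (p u x y) \<le> \<rho>" using p_small[OF u r] \<epsilon>1 by linarith
      note a = near(1-4)[OF r(1) this r(2)]
      have mono: "norm D * W j u \<le> k * W j u" if "norm D \<le> k" for D :: complex and j k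
        using that W_le(2)[OF u, of j] by (intro mult_right_mono) auto
      have "M * W False u = M * \<kappa> * W True u" by (simp add: W_def \<epsilon>2_def)
      also have "\<dots> \<le> 1 / (4 * K1) * W True u" using \<kappa> W_le(2)[OF u, of True] by (intro mult_right_mono) auto
      finally have "norm (a12 (x, p u x y, y)) * W False u \<le> W True u / (4 * K1)" using mono[OF a(2), of False] by simp
      moreover have "norm (a21 (x, p u x y, y)) * W True u \<le> W False u / (4 * K2)"
        using mono[OF a(3), of True] by (simp add: W_def \<epsilon>2_def)
      ultimately show "(\<exists>D. DERIV (\<lambda>x. Q i u x y) x :> D \<and> norm D * W True u \<le> W i u / (4 * (if i then K1 else K2))) \<and>
          (\<exists>D. DERIV (\<lambda>y. Q i u x y) y :> D \<and> norm D * W False u \<le> W i u / (4 * (if i then K1 else K2)))"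
        using Q_der[of u y x] Q_der[of u x y] mono[OF a(1), of True] mono[OF a(4), of False] by (cases i) (simp; blast)+
    next
      fix i u assume u: "u \<in> strip U"
      let ?p = "p u 0 0"
      have pn: "norm ?p \<le> P * exp (- Re u / N)" "norm ?p \<le> \<rho>"
      proof -
        have z: "norm (0 :: complex) \<le> \<rho>" using \<rho> by simp
        show "norm ?p \<le> P * exp (- Re u / N)" by (rule p_le[OF z z])
        show "norm ?p \<le> \<rho>" by (rule order_trans[OF p_small[OF u z z] \<epsilon>1(3)])
      qed
      have lin: "norm (g (?p, 0) - g (0, 0)) \<le> M3 * norm (?p - 0)" if g: "holomorphic2_on g UNIV"
        "\<And>\<zeta>. norm \<zeta> \<le> \<rho> \<Longrightarrow> norm (dz g (\<zeta>, 0)) \<le> M3" for g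
      proof (rule field_differentiable_bound[where S = "cball 0 \<rho>" and f' = "\<lambda>\<zeta>. dz g (\<zeta>, 0)"])
        fix \<zeta> :: complex assume "\<zeta> \<in> cball 0 \<rho>"
        then show "norm (dz g (\<zeta>, 0)) \<le> M3" by (intro g(2)) simp
        have "DERIV (\<lambda>\<zeta>. g (\<zeta>, 0)) \<zeta> :> dz g (\<zeta>, 0)"
          using holomorphic_derivI[OF holomorphic2_slice1[OF g(1) open_UNIV], of 0 \<zeta>] by simp
        then show "((\<lambda>\<zeta>. g (\<zeta>, 0)) has_field_derivative dz g (\<zeta>, 0)) (at \<zeta> within cball 0 \<rho>)"
          by (rule has_field_derivative_at_within)
      qed (use pn(2) \<rho> in auto)
      have "norm (Q i u 0 0) \<le> M3 * norm ?p"
        using lin[OF A(1)] lin[OF B(1)] near(5,6)[of 0 _ 0] \<rho> A(2) B(2) by (simp add: Q_def)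
      also have "\<dots> \<le> M3 * (P * exp (- Re u / N))" using M3 by (intro mult_left_mono pn(1)) auto
      also have "\<dots> \<le> \<eta> * E u" by (rule small(2)[OF u])
      also have "\<dots> \<le> (if i then \<epsilon>1 / (2 * K1) else \<epsilon>2 / (2 * K2)) * E u"
        using E[OF u] by (intro mult_right_mono) (auto simp: \<eta>_def)
      finally show "norm (Q i u 0 0) \<le> W i u / (2 * (if i then K1 else K2))" by (simp add: W_def split: if_splits)
    qed blast
    show "\<exists>\<theta> y. \<forall>u\<in>strip U. norm (\<theta> u) \<le> \<epsilon> \<and> norm (y u) \<le> \<epsilon> * exp (- \<delta> * Re u) \<and> norm (p u (\<theta> u) (y u)) \<le> \<epsilon> \<and>
      norm (A (p u (\<theta> u) (y u), y u) - 1) \<le> 1 / 2 \<and> DERIV \<theta> u :> - 1 + exp (- \<theta> u) * A (p u (\<theta> u) (y u), y u) \<and> DERIV y u :> exp (- \<theta> u) * B (p u (\<theta> u) (y u), y u)"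
    proof (rule exI[of _ x], rule exI[of _ y], intro conjI ballI)
      fix u assume u: "u \<in> strip U"
      have xy1: "norm (x u) \<le> \<epsilon>1" "norm (y u) \<le> \<epsilon>1"
        using xy(3,4)[OF u] W_le(1)[OF u, of True] W_le(1)[OF u, of False] by auto
      then have p: "norm (p u (x u) (y u)) \<le> \<epsilon>1" using \<epsilon>1(3) by (intro p_small[OF u]) auto
      show "norm (x u) \<le> \<epsilon>" "norm (p u (x u) (y u)) \<le> \<epsilon>" using xy1 p \<epsilon>1 by auto
      show "norm (A (p u (x u) (y u), y u) - 1) \<le> 1 / 2" using xy1 p \<epsilon>1(3) by (intro near(7)[of "x u"]) auto
      show "norm (y u) \<le> \<epsilon> * exp (- \<delta> * Re u)" using xy(4)[OF u] W_le(3)[OF u, of False] by (auto simp: E_def)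
      show "DERIV x u :> - 1 + exp (- x u) * A (p u (x u) (y u), y u)"
        using xy(5)[OF u] by (simp add: Q_def algebra_simps)
      show "DERIV y u :> exp (- x u) * B (p u (x u) (y u), y u)" using xy(6)[OF u] by (simp add: Q_def)
    qed
  qed
qed

lemma Re_pos_cut: "Re z > 0 \<Longrightarrow> z \<noteq> 0" "Re z > 0 \<Longrightarrow> z \<notin> \<real>\<^sub>\<le>\<^sub>0"
  by (auto simp: complex_nonpos_Reals_iff)

text \<open>At a double equilibrium the leading equation is \<open>x' = - \<kappa> x^2\<close>, with
  solution \<open>1 / (\<kappa> u)\<close>. In the unknown \<open>s = u + \<eta>\<close> with
  \<open>x = 1 / (\<kappa> s)\<close> the derivative of \<open>s\<close> is close to 1, but no decay
  of \<open>\<eta>\<close> is available; the bound \<open>norm \<eta> \<le> norm u / 2\<close> fits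
  the weight of \<open>right_inverse_0_exists\<close>. The power \<open>s^m\<close> inside
  \<open>w^N\<close> comes from a relation of the form
  \<open>x^m w^N = const * exp (- u - \<theta>)\<close>.\<close>

lemma logarithmic_ode:
  fixes A H :: "complex \<times> complex \<Rightarrow> complex" and N m \<epsilon> :: real and c0 \<kappa> :: complex
  assumes A: "holomorphic2_on A UNIV" "A (0, 0) = 1" and H: "holomorphic2_on H UNIV"
    and N: "N > 0" and \<kappa>: "\<kappa> \<noteq> 0" and \<epsilon>: "\<epsilon> > 0" and m: "m \<ge> 0"
  defines "x \<equiv> \<lambda>u \<eta>. 1 / (\<kappa> * (u + \<eta>))" and "w \<equiv> \<lambda>u \<theta> \<eta>. exp ((c0 - u - \<theta> + of_real m * Ln (u + \<eta>)) / of_real N)"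
  obtains U0 where "\<And>U. U \<ge> U0 \<Longrightarrow> \<exists>\<theta> \<eta>. \<forall>u\<in>strip U.
      norm (\<theta> u) \<le> \<epsilon> \<and> norm (\<eta> u) \<le> norm u / 2 \<and> Re (u + \<eta> u) > 0 \<and>
      norm (x u (\<eta> u)) \<le> \<epsilon> \<and> norm (w u (\<theta> u) (\<eta> u)) \<le> exp (- Re u / (2 * N)) \<and>
      norm (A (x u (\<eta> u), w u (\<theta> u) (\<eta> u)) - 1) \<le> 1 / 2 \<and>
      DERIV \<theta> u :> - 1 + exp (- \<theta> u) * A (x u (\<eta> u), w u (\<theta> u) (\<eta> u)) \<and>
      DERIV \<eta> u :> exp (- \<theta> u) * (1 - (u + \<eta> u) * w u (\<theta> u) (\<eta> u) * H (x u (\<eta> u), w u (\<theta> u) (\<eta> u))) - 1"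
proof -
  obtain K1 where K1: "K1 > 0" "\<And>U. \<exists>J. right_inverse U 1 (\<lambda>u. exp (- 0 * Re u)) (\<lambda>u. exp (- 0 * Re u)) K1 J"
    using right_inverse_exists[of 1 0] by auto
  \<comment> \<open>coordinates \<open>(p, \<theta>, v)\<close> with \<open>p = (x, w)\<close> and \<open>v = (u + \<eta>) w\<close>; \<open>b11, exp (- \<theta>) c12 / (u + \<eta>), b21, b22 / (u + \<eta>)\<close>
    are the partial derivatives of the right hand side\<close>
  define b11 where "b11 = (\<lambda>(p, \<theta>, v :: complex). 1 - exp (- \<theta>) * (A p + dw A p * snd p / of_real N))"
  define c12 where "c12 = (\<lambda>p. dw A p * snd p * of_real m / of_real N - dz A p * fst p)"
  define b21 where "b21 = (\<lambda>(p, \<theta>, v). exp (- \<theta>) * (v * (H p + snd p * dw H p) / of_real N - (1 - v * H p)))"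
  define b22 where "b22 = (\<lambda>(p, \<theta>, v). - exp (- \<theta>) * v *
    (H p * (1 + of_real m / of_real N) - dz H p * fst p + dw H p * snd p * of_real m / of_real N))"
  define b0 where "b0 = (\<lambda>(p, \<theta> :: complex, v). v * H p)"
  note b_def = b11_def b21_def b22_def b0_def case_prod_unfold
  have "isCont (\<lambda>q :: (complex \<times> complex) \<times> complex \<times> complex. g (fst q)) ((0, 0), 0, 0)" if "holomorphic2_on g UNIV" for g
    by (rule holomorphic2_isCont[OF that]) (intro continuous_intros)
  note cont = this[OF A(1)] this[OF H] this[OF holomorphic2_dz[OF H open_UNIV]]
    this[OF holomorphic2_dw[OF A(1) open_UNIV]] this[OF holomorphic2_dw[OF H open_UNIV]]
  have "\<forall>\<^sub>F q in nhds ((0, 0), 0, 0). norm (b11 q) < 1 / (4 * K1) \<and> norm (b21 q) < 2 \<and> norm (b22 q) < 1 / 24 \<and> norm (b0 q) < 1 / 12 \<and> norm (A (fst q) - 1) < 1 / 2"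
    unfolding b_def by (intro eventually_conj eventually_norm_less continuous_intros cont) (use N A(2) K1 in simp_all)
  then obtain \<rho>0 where \<rho>0: "\<rho>0 > 0" "\<And>q. dist q ((0, 0), 0, 0) < \<rho>0 \<Longrightarrow>
      norm (b11 q) < 1 / (4 * K1) \<and> norm (b21 q) < 2 \<and> norm (b22 q) < 1 / 24 \<and> norm (b0 q) < 1 / 12 \<and> norm (A (fst q) - 1) < 1 / 2"
    unfolding eventually_nhds_metric by blast
  \<comment> \<open>For the second unknown \<open>strip_ode\<close> is used with
    \<open>V = 1 / 2\<close> and \<open>K = 3\<close>, so the shares are
    \<open>V / (4 K) = 1 / 24\<close> and \<open>V / (2 K) = 1 / 12\<close>. As \<open>b21\<close>
    is only bounded by 2, the radius of \<open>\<theta>\<close> must be at most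
    \<open>1 / 48\<close>.\<close>
  define \<epsilon>1 where "\<epsilon>1 = min (min \<epsilon> (\<rho>0 / 5)) (1 / 48)"
  have \<epsilon>1: "\<epsilon>1 > 0" "\<epsilon>1 \<le> \<epsilon>" "\<epsilon>1 \<le> \<rho>0 / 5" "\<epsilon>1 \<le> 1 / 48" using \<epsilon> \<rho>0(1) by (auto simp: \<epsilon>1_def)
  \<comment> \<open>A second neighbourhood is chosen after \<open>\<epsilon>1\<close>: the bounds
    required for \<open>c12\<close> and \<open>A - 1\<close> are proportional to
    \<open>\<epsilon>1\<close>, which depends on the first neighbourhood.\<close>
  have "isCont (\<lambda>p. g p) (0, 0)" if "holomorphic2_on g UNIV" for g
    by (rule holomorphic2_isCont[OF that]) (intro continuous_intros)
  note cont = this[OF A(1)] this[OF holomorphic2_dz[OF A(1) open_UNIV]] this[OF holomorphic2_dw[OF A(1) open_UNIV]]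
  have "\<forall>\<^sub>F p in nhds (0, 0). norm (c12 p) < \<epsilon>1 / (12 * K1) \<and> norm (A p - 1) < \<epsilon>1 / (2 * K1)"
    unfolding c12_def by (intro eventually_conj eventually_norm_less continuous_intros cont) (use N A(2) K1 \<epsilon>1(1) in simp_all)
  then obtain \<rho>1 where \<rho>1: "\<rho>1 > 0" "\<And>p. dist p (0, 0) < \<rho>1 \<Longrightarrow> norm (c12 p) < \<epsilon>1 / (12 * K1) \<and> norm (A p - 1) < \<epsilon>1 / (2 * K1)"
    unfolding eventually_nhds_metric by blast
  define \<xi> where "\<xi> = min (min \<epsilon> (\<rho>0 / 5)) (\<rho>1 / 3)"
  have \<xi>: "\<xi> > 0" "\<xi> \<le> \<epsilon>" "\<xi> \<le> \<rho>0 / 5" "\<xi> \<le> \<rho>1 / 3" using \<epsilon> \<rho>0(1) \<rho>1(1) by (auto simp: \<xi>_def)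
  define c where "c = Re c0 + \<epsilon>1 + 3 * m"
  \<comment> \<open>With \<open>X = Re u\<close> one has \<open>norm (u + \<eta>) \<le> 3 X\<close>,
    so this expression majorises both \<open>w\<close> and \<open>(u + \<eta>) * w\<close>; the
    linear term \<open>- X\<close> absorbs the logarithm.\<close>
  have "((\<lambda>X. (1 + 3 * X) * exp ((c + m * ln (3 * X) - X) / N)) \<longlongrightarrow> 0) at_top" using N by real_asymp
  then have ev1: "\<forall>\<^sub>F X in at_top. (1 + 3 * X) * exp ((c + m * ln (3 * X) - X) / N) < \<xi>"
    using \<xi> by (intro order_tendstoD)
  have "filterlim (\<lambda>X. X / 2 - (c + m * ln (3 * X))) at_top at_top" by real_asymp
  then have ev2: "\<forall>\<^sub>F X in at_top. X / 2 - (c + m * ln (3 * X)) \<ge> 0"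
    unfolding filterlim_at_top by blast
  have "((\<lambda>X. 2 / (norm \<kappa> * X)) \<longlongrightarrow> 0) at_top" using \<kappa> by real_asymp
  then have ev3: "\<forall>\<^sub>F X in at_top. 2 / (norm \<kappa> * X) < \<xi>" using \<xi> by (intro order_tendstoD)
  have "\<forall>\<^sub>F X in at_top. (1 + 3 * X) * exp ((c + m * ln (3 * X) - X) / N) < \<xi> \<and> X / 2 - (c + m * ln (3 * X)) \<ge> 0 \<and> 2 / (norm \<kappa> * X) < \<xi>"
    using ev1 ev2 ev3 by eventually_elim auto
  then obtain U1 where U1: "\<And>X. X \<ge> U1 \<Longrightarrow> (1 + 3 * X) * exp ((c + m * ln (3 * X) - X) / N) < \<xi>"
    "\<And>X. X \<ge> U1 \<Longrightarrow> X / 2 - (c + m * ln (3 * X)) \<ge> 0" "\<And>X. X \<ge> U1 \<Longrightarrow> 2 / (norm \<kappa> * X) < \<xi>"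
    unfolding eventually_at_top_linorder by blast
  show ?thesis
  proof (rule that[of "max U1 3"])
    fix U assume U: "U \<ge> max U1 3"
    have size: "Re (u + \<eta>) > 0" "norm u \<le> 2 * norm (u + \<eta>)" "norm (x u \<eta>) \<le> \<xi>" "norm (w u \<theta> \<eta>) \<le> exp (- Re u / (2 * N))"
      "norm (w u \<theta> \<eta>) \<le> \<xi>" "norm ((u + \<eta>) * w u \<theta> \<eta>) \<le> \<xi>"
      if u: "u \<in> strip U" and \<theta>: "norm \<theta> \<le> \<epsilon>1" and \<eta>: "norm \<eta> \<le> norm u / 2" for u \<theta> \<eta>
    proof -
      define X where "X = Re u"
      have X: "X \<ge> U1" "X \<ge> 3" using u U by (auto simp: X_def strip_def)
      have nu: "norm u \<le> X + 2" "norm u \<ge> X"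
      proof -
        have "norm u \<le> \<bar>Re u\<bar> + \<bar>Im u\<bar>" by (rule cmod_le)
        then show "norm u \<le> X + 2" using X u pi_less_4 by (auto simp: X_def strip_def)
        show "norm u \<ge> X" unfolding X_def by (rule complex_Re_le_cmod)
      qed
      have "- Re \<eta> \<le> norm u / 2" using abs_Re_le_cmod[of \<eta>] \<eta> by linarith
      then show Re_pos: "Re (u + \<eta>) > 0" using nu X by (simp add: X_def)
      show two: "norm u \<le> 2 * norm (u + \<eta>)" using norm_diff_ineq[of u \<eta>] \<eta> by linarith
      have s0: "u + \<eta> \<noteq> 0" by (rule Re_pos_cut(1)[OF Re_pos])
      have sle: "norm (u + \<eta>) \<le> 3 * X" using norm_triangle_ineq[of u \<eta>] \<eta> nu X by linarith
      have "norm (x u \<eta>) = 1 / (norm \<kappa> * norm (u + \<eta>))" by (simp add: x_def norm_divide norm_mult)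
      also have "\<dots> \<le> 1 / (norm \<kappa> * (X / 2))"
        using \<kappa> s0 X two nu by (intro divide_left_mono mult_left_mono mult_pos_pos) auto
      also have "\<dots> \<le> \<xi>" using U1(3)[OF X(1)] by simp
      finally show "norm (x u \<eta>) \<le> \<xi>" .
      have "Re ((c0 - u - \<theta> + of_real m * Ln (u + \<eta>)) / of_real N) = (Re c0 - X - Re \<theta> + m * ln (norm (u + \<eta>))) / N"
        using s0 by (simp add: X_def)
      also have "\<dots> \<le> (c + m * ln (3 * X) - X) / N"
      proof (rule divide_right_mono)
        have "m * ln (norm (u + \<eta>)) \<le> m * ln (3 * X)" using sle s0 m X by (intro mult_left_mono) auto
        moreover have "- Re \<theta> \<le> \<epsilon>1" using abs_Re_le_cmod[of \<theta>] \<theta> by linarith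
        ultimately show "Re c0 - X - Re \<theta> + m * ln (norm (u + \<eta>)) \<le> c + m * ln (3 * X) - X" using m by (simp add: c_def)
      qed (use N in auto)
      finally have wle: "norm (w u \<theta> \<eta>) \<le> exp ((c + m * ln (3 * X) - X) / N)" by (simp add: w_def)
      also have "\<dots> \<le> exp (- X / (2 * N))"
      proof -
        have "(c + m * ln (3 * X) - X) / N \<le> (- X / 2) / N"
          using U1(2)[OF X(1)] N by (intro divide_right_mono) auto
        then show ?thesis by simp
      qed
      finally show "norm (w u \<theta> \<eta>) \<le> exp (- Re u / (2 * N))" by (simp add: X_def)
      have "norm (w u \<theta> \<eta>) * 1 \<le> exp ((c + m * ln (3 * X) - X) / N) * (1 + 3 * X)"
        using wle X by (intro mult_mono) auto
      then show "norm (w u \<theta> \<eta>) \<le> \<xi>" using U1(1)[OF X(1)] by (simp add: mult.commute)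
      have "norm (u + \<eta>) * norm (w u \<theta> \<eta>) \<le> (1 + 3 * X) * exp ((c + m * ln (3 * X) - X) / N)"
        using wle X sle by (intro mult_mono) auto
      then show "norm ((u + \<eta>) * w u \<theta> \<eta>) \<le> \<xi>" using U1(1)[OF X(1)] by (simp add: norm_mult)
    qed
    define q where "q = (\<lambda>u \<theta> \<eta>. ((x u \<eta>, w u \<theta> \<eta>), \<theta>, (u + \<eta>) * w u \<theta> \<eta>))"
    have q_le: "norm (b11 (q u \<theta> \<eta>)) \<le> 1 / (4 * K1)" "norm (b21 (q u \<theta> \<eta>)) \<le> 2" "norm (b22 (q u \<theta> \<eta>)) \<le> 1 / 24"
      "norm (b0 (q u \<theta> \<eta>)) \<le> 1 / 12" "norm (c12 (x u \<eta>, w u \<theta> \<eta>)) \<le> \<epsilon>1 / (12 * K1)" "norm (A (x u \<eta>, w u \<theta> \<eta>) - 1) \<le> \<epsilon>1 / (2 * K1)"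
      "norm (A (x u \<eta>, w u \<theta> \<eta>) - 1) \<le> 1 / 2"
      if h: "u \<in> strip U" "norm \<theta> \<le> \<epsilon>1" "norm \<eta> \<le> norm u / 2" for u \<theta> \<eta>
    proof -
      let ?p = "(x u \<eta>, w u \<theta> \<eta>)"
      have p: "norm ?p \<le> norm (x u \<eta>) + norm (w u \<theta> \<eta>)" by (rule norm_Pair_le)
      then have "norm ?p < \<rho>1" using size(3,5)[OF h] \<xi>(4) \<rho>1(1) by linarith
      then have "dist ?p (0, 0) < \<rho>1" by (simp add: dist_norm)
      from \<rho>1(2)[OF this] show "norm (c12 ?p) \<le> \<epsilon>1 / (12 * K1)" "norm (A ?p - 1) \<le> \<epsilon>1 / (2 * K1)" by auto
      have "norm (q u \<theta> \<eta>) \<le> norm ?p + (norm \<theta> + norm ((u + \<eta>) * w u \<theta> \<eta>))"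
        unfolding q_def by (intro order_trans[OF norm_Pair_le] add_left_mono norm_Pair_le)
      also have "\<dots> < \<rho>0" using p size(3,5,6)[OF h] h(2) \<epsilon>1(3) \<xi>(3) \<rho>0(1) by linarith
      finally have "dist (q u \<theta> \<eta>) ((0, 0), 0, 0) < \<rho>0" by (simp add: dist_norm q_def)
      from \<rho>0(2)[OF this] show "norm (b11 (q u \<theta> \<eta>)) \<le> 1 / (4 * K1)" "norm (b21 (q u \<theta> \<eta>)) \<le> 2" "norm (b22 (q u \<theta> \<eta>)) \<le> 1 / 24"
        "norm (b0 (q u \<theta> \<eta>)) \<le> 1 / 12" "norm (A ?p - 1) \<le> 1 / 2" by (auto simp: q_def)
    qed
    define Q where "Q = (\<lambda>i u \<theta> \<eta>. if i then exp (- \<theta>) * A (x u \<eta>, w u \<theta> \<eta>) - 1 + \<theta>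
        else exp (- \<theta>) * (1 - (u + \<eta>) * w u \<theta> \<eta> * H (x u \<eta>, w u \<theta> \<eta>)) - 1)"
    have exp_der: "DERIV (\<lambda>\<theta>. exp (- \<theta>)) \<theta> :> - exp (- \<theta>)" for \<theta> :: complex
      by (auto intro!: derivative_eq_intros)
    have w_der: "DERIV (\<lambda>\<theta>. w u \<theta> \<eta>) \<theta> :> - (w u \<theta> \<eta> / of_real N)" for u \<theta> \<eta>
      unfolding w_def using N by (auto intro!: derivative_eq_intros simp: field_simps)
    have w_der': "DERIV (\<lambda>\<eta>. w u \<theta> \<eta>) \<eta> :> w u \<theta> \<eta> * (of_real m / of_real N) / (u + \<eta>)"
      "DERIV (\<lambda>\<eta>. x u \<eta>) \<eta> :> - x u \<eta> / (u + \<eta>)" if "Re (u + \<eta>) > 0" for u \<theta> \<eta>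
    proof -
      have nz: "u + \<eta> \<noteq> 0" "u + \<eta> \<notin> \<real>\<^sub>\<le>\<^sub>0" by (rule Re_pos_cut[OF that])+
      have "DERIV (\<lambda>\<eta>. Ln (u + \<eta>)) \<eta> :> 1 / (u + \<eta>) * 1"
        by (rule DERIV_chain2[where f = Ln]) (use nz in \<open>auto intro!: derivative_eq_intros simp: inverse_eq_divide\<close>)
      then have ln_der: "DERIV (\<lambda>\<eta>. Ln (u + \<eta>)) \<eta> :> 1 / (u + \<eta>)" by simp
      have "((\<lambda>\<eta>. (c0 - u - \<theta> + of_real m * Ln (u + \<eta>)) / of_real N) has_field_derivative
          (0 + of_real m * (1 / (u + \<eta>))) / of_real N) (at \<eta>)"
        by (intro DERIV_cdivide DERIV_add DERIV_const DERIV_cmult ln_der)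
      from DERIV_chain2[OF DERIV_exp this]
      show "DERIV (\<lambda>\<eta>. w u \<theta> \<eta>) \<eta> :> w u \<theta> \<eta> * (of_real m / of_real N) / (u + \<eta>)"
        unfolding w_def by (rule DERIV_cong) simp
      have "((\<lambda>\<eta>. inverse \<kappa> * inverse (u + \<eta>)) has_field_derivative
          inverse \<kappa> * (- (inverse (u + \<eta>) * (0 + 1) * inverse (u + \<eta>)))) (at \<eta>)"
        by (intro DERIV_cmult DERIV_inverse' DERIV_add DERIV_const DERIV_ident nz)
      moreover have "inverse \<kappa> * inverse s = 1 / (\<kappa> * s)"
        "inverse \<kappa> * (- (inverse s * (0 + 1) * inverse s)) = - (1 / (\<kappa> * s)) / s" for s
        by (simp_all add: divide_inverse)
      ultimately have "DERIV (\<lambda>\<eta>. 1 / (\<kappa> * (u + \<eta>))) \<eta> :> - (1 / (\<kappa> * (u + \<eta>))) / (u + \<eta>)"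
        by simp
      then show "DERIV (\<lambda>\<eta>. x u \<eta>) \<eta> :> - x u \<eta> / (u + \<eta>)" by (simp add: x_def)
    qed
    have Q_der: "DERIV (\<lambda>\<theta>. Q True u \<theta> \<eta>) \<theta> :> b11 (q u \<theta> \<eta>)"
      "DERIV (\<lambda>\<eta>. Q True u \<theta> \<eta>) \<eta> :> exp (- \<theta>) * c12 (x u \<eta>, w u \<theta> \<eta>) / (u + \<eta>)"
      "DERIV (\<lambda>\<theta>. Q False u \<theta> \<eta>) \<theta> :> b21 (q u \<theta> \<eta>)"
      "DERIV (\<lambda>\<eta>. Q False u \<theta> \<eta>) \<eta> :> b22 (q u \<theta> \<eta>) / (u + \<eta>)"
      if h: "u \<in> strip U" "norm \<theta> \<le> \<epsilon>1" "norm \<eta> \<le> norm u / 2" for u \<theta> \<eta>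
    proof -
      have s: "u + \<eta> \<noteq> 0" by (rule Re_pos_cut(1)[OF size(1)[OF h]])
      note wd = w_der'(1)[OF size(1)[OF h], of \<theta>]
      note xd = w_der'(2)[OF size(1)[OF h]]
      note d1 = holomorphic2_has_field_derivative_curve[OF _ UNIV_I DERIV_const w_der]
      note d2 = holomorphic2_has_field_derivative_curve[OF _ UNIV_I xd wd]
      show "DERIV (\<lambda>\<theta>. Q True u \<theta> \<eta>) \<theta> :> b11 (q u \<theta> \<eta>)"
        unfolding Q_def if_True
        by (rule DERIV_cong[OF DERIV_add[OF DERIV_diff[OF DERIV_mult[OF exp_der d1[OF A(1)]] DERIV_const] DERIV_ident]])
          (simp add: b11_def q_def algebra_simps)
      show "DERIV (\<lambda>\<eta>. Q True u \<theta> \<eta>) \<eta> :> exp (- \<theta>) * c12 (x u \<eta>, w u \<theta> \<eta>) / (u + \<eta>)"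
        unfolding Q_def if_True
        by (rule DERIV_cong[OF DERIV_add[OF DERIV_diff[OF DERIV_cmult[OF d2[OF A(1)]] DERIV_const] DERIV_const]])
          (simp add: c12_def algebra_simps add_divide_distrib diff_divide_distrib)
      have "((\<lambda>\<theta>. (u + \<eta>) * w u \<theta> \<eta> * H (x u \<eta>, w u \<theta> \<eta>)) has_field_derivative
          (u + \<eta>) * (- (w u \<theta> \<eta> / of_real N)) * H (x u \<eta>, w u \<theta> \<eta>)
          + (dz H (x u \<eta>, w u \<theta> \<eta>) * 0 + dw H (x u \<eta>, w u \<theta> \<eta>) * - (w u \<theta> \<eta> / of_real N)) * ((u + \<eta>) * w u \<theta> \<eta>)) (at \<theta>)"
        by (rule DERIV_mult[OF DERIV_cmult[OF w_der] d1[OF H]])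
      note t1 = DERIV_diff[OF DERIV_mult[OF exp_der DERIV_diff[OF DERIV_const this]] DERIV_const]
      show "DERIV (\<lambda>\<theta>. Q False u \<theta> \<eta>) \<theta> :> b21 (q u \<theta> \<eta>)"
        unfolding Q_def if_False
        by (rule DERIV_cong[OF t1]) (simp add: b21_def q_def algebra_simps add_divide_distrib diff_divide_distrib)
      have "((\<lambda>\<eta>. (u + \<eta>) * w u \<theta> \<eta> * H (x u \<eta>, w u \<theta> \<eta>)) has_field_derivative
          (((0 + 1) * w u \<theta> \<eta> + (w u \<theta> \<eta> * (of_real m / of_real N) / (u + \<eta>)) * (u + \<eta>)) * H (x u \<eta>, w u \<theta> \<eta>)
          + (dz H (x u \<eta>, w u \<theta> \<eta>) * (- x u \<eta> / (u + \<eta>)) + dw H (x u \<eta>, w u \<theta> \<eta>) * (w u \<theta> \<eta> * (of_real m / of_real N) / (u + \<eta>)))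
            * ((u + \<eta>) * w u \<theta> \<eta>))) (at \<eta>)"
        by (rule DERIV_mult[OF DERIV_mult[OF DERIV_add[OF DERIV_const DERIV_ident] wd] d2[OF H]])
      note t2 = DERIV_diff[OF DERIV_cmult[OF DERIV_diff[OF DERIV_const this]] DERIV_const]
      show "DERIV (\<lambda>\<eta>. Q False u \<theta> \<eta>) \<eta> :> b22 (q u \<theta> \<eta>) / (u + \<eta>)"
        unfolding Q_def if_False
        by (rule DERIV_cong[OF t2]) (use s in \<open>simp add: b22_def q_def divide_simps, simp add: algebra_simps\<close>)
    qed
    define W where "W = (\<lambda>i u. if i then \<epsilon>1 * exp (- 0 * Re u) else 1 / 2 * norm (u :: complex))"
    define Vw where "Vw = (\<lambda>i u. if i then \<epsilon>1 * exp (- 0 * Re u) else 1 / 2 * (1 :: real))"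
    define K where "K = (\<lambda>i. if i then K1 else 3)"
    have W: "W True u = \<epsilon>1" "W False u = norm u / 2" "Vw True u = \<epsilon>1" "Vw False u = 1 / 2" "K True = K1" "K False = 3" for u
      by (simp_all add: W_def Vw_def K_def)
    obtain \<theta> \<eta> where sol: "\<theta> holomorphic_on strip U" "\<eta> holomorphic_on strip U"
      "\<And>u. u \<in> strip U \<Longrightarrow> norm (\<theta> u) \<le> W True u" "\<And>u. u \<in> strip U \<Longrightarrow> norm (\<eta> u) \<le> W False u"
      "\<And>u. u \<in> strip U \<Longrightarrow> DERIV \<theta> u :> Q True u (\<theta> u) (\<eta> u) - (if True then 1 else 0) * \<theta> u"
      "\<And>u. u \<in> strip U \<Longrightarrow> DERIV \<eta> u :> Q False u (\<theta> u) (\<eta> u) - (if False then 1 else 0) * \<eta> u"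
    proof (rule strip_ode[of U "\<lambda>i. if i then 1 else 0" Vw W K Q])
      show "\<exists>J. right_inverse U (if i then 1 else 0) (Vw i) (W i) (K i) J" for i
      proof (cases i)
        case True
        then show ?thesis using K1(2)[of U] right_inverse_scale unfolding W_def Vw_def K_def by (simp only: if_True) blast
      next
        case False
        have "U \<ge> 1" using U by simp
        then show ?thesis using False right_inverse_0_exists[of U] right_inverse_scale unfolding W_def Vw_def K_def by (simp only: if_False) blast
      qed
      show "0 < K i" for i using K1 by (simp add: K_def)
      show "continuous_on (strip U) (W i)" for i unfolding W_def by (cases i) (auto intro!: continuous_intros)
      show "0 < W i u" if "u \<in> strip U" for i u using \<epsilon>1 that U by (auto simp: W_def strip_def)
    next
      fix i \<theta> \<eta> assume h: "\<theta> holomorphic_on strip U" "\<eta> holomorphic_on strip U"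
        "\<And>u. u \<in> strip U \<Longrightarrow> norm (\<theta> u) \<le> W True u \<and> norm (\<eta> u) \<le> W False u"
      have nz: "u + \<eta> u \<noteq> 0" "u + \<eta> u \<notin> \<real>\<^sub>\<le>\<^sub>0" if "u \<in> strip U" for u
        using Re_pos_cut[OF size(1)[OF that, of "\<theta> u" "\<eta> u"]] h(3)[OF that] by (simp_all add: W)
      have wh: "(\<lambda>u. w u (\<theta> u) (\<eta> u)) holomorphic_on strip U" and xh: "(\<lambda>u. x u (\<eta> u)) holomorphic_on strip U"
        unfolding w_def x_def using N \<kappa> nz by (intro holomorphic_intros h(1,2); force)+
      show "(\<lambda>u. Q i u (\<theta> u) (\<eta> u)) holomorphic_on strip U"
        unfolding Q_def
        using holomorphic2_compose_curve[OF A(1) xh wh open_strip UNIV_I] holomorphic2_compose_curve[OF H xh wh open_strip UNIV_I] h(1,2) wh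
        by (cases i) (auto intro!: holomorphic_intros)
    next
      fix i u and \<theta> \<eta> :: complex
      assume u: "u \<in> strip U" and "norm \<theta> \<le> W True u" "norm \<eta> \<le> W False u"
      then have h: "u \<in> strip U" "norm \<theta> \<le> \<epsilon>1" "norm \<eta> \<le> norm u / 2" by (simp_all add: W)
      note b = q_le[OF h] and d = Q_der[OF h]
      have quot: "norm (b / (u + \<eta>)) * W False u \<le> \<beta>" if "norm b \<le> \<beta>" for b \<beta>
      proof -
        have s: "norm (u + \<eta>) > 0" using Re_pos_cut(1)[OF size(1)[OF h]] by simp
        have "norm b * (norm u / 2) \<le> \<beta> * norm (u + \<eta>)"
          using size(2)[OF h] that order_trans[OF norm_ge_zero that] by (intro mult_mono) auto
        then show ?thesis using s by (simp add: W norm_divide pos_divide_le_eq)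
      qed
      have "norm (exp (- \<theta>) * c12 (x u \<eta>, w u \<theta> \<eta>)) \<le> 3 * (\<epsilon>1 / (12 * K1))"
        unfolding norm_mult norm_exp_eq_Re
      proof (intro mult_mono b(5))
        have "exp (Re (- \<theta>)) \<le> exp 1" using abs_Re_le_cmod[of \<theta>] h(2) \<epsilon>1(4) by simp
        then show "exp (Re (- \<theta>)) \<le> 3" using exp_le by linarith
      qed auto
      from quot[OF this] have "norm (exp (- \<theta>) * c12 (x u \<eta>, w u \<theta> \<eta>) / (u + \<eta>)) * W False u \<le> Vw True u / (4 * K True)"
        by (simp add: W)
      moreover have "norm (b11 (q u \<theta> \<eta>)) * W True u \<le> Vw True u / (4 * K True)"
        using mult_right_mono[OF b(1), of \<epsilon>1] \<epsilon>1(1) by (simp add: W)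
      moreover have "norm (b21 (q u \<theta> \<eta>)) * W True u \<le> Vw False u / (4 * K False)"
        using mult_mono[OF b(2) \<epsilon>1(4)] \<epsilon>1(1) by (simp add: W)
      moreover have "norm (b22 (q u \<theta> \<eta>) / (u + \<eta>)) * W False u \<le> Vw False u / (4 * K False)"
        using quot[OF b(3)] by (simp add: W)
      ultimately show "(\<exists>D. DERIV (\<lambda>x. Q i u x \<eta>) \<theta> :> D \<and> norm D * W True u \<le> Vw i u / (4 * K i)) \<and>
          (\<exists>D. DERIV (\<lambda>y. Q i u \<theta> y) \<eta> :> D \<and> norm D * W False u \<le> Vw i u / (4 * K i))"
        using d by (cases i) (simp_all only:, blast+)
    next
      fix i u assume u: "u \<in> strip U"
      have z: "norm (0 :: complex) \<le> \<epsilon>1" "norm (0 :: complex) \<le> norm u / 2" using \<epsilon>1 by auto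
      have "Q True u 0 0 = A (x u 0, w u 0 0) - 1" "Q False u 0 0 = - b0 (q u 0 0)" by (simp_all add: Q_def b0_def q_def)
      then show "norm (Q i u 0 0) \<le> Vw i u / (2 * K i)" using q_le(4,6)[OF u z] by (cases i) (simp_all add: W)
    qed blast
    show "\<exists>\<theta> \<eta>. \<forall>u\<in>strip U. norm (\<theta> u) \<le> \<epsilon> \<and> norm (\<eta> u) \<le> norm u / 2 \<and> Re (u + \<eta> u) > 0 \<and>
      norm (x u (\<eta> u)) \<le> \<epsilon> \<and> norm (w u (\<theta> u) (\<eta> u)) \<le> exp (- Re u / (2 * N)) \<and>
      norm (A (x u (\<eta> u), w u (\<theta> u) (\<eta> u)) - 1) \<le> 1 / 2 \<and>
      DERIV \<theta> u :> - 1 + exp (- \<theta> u) * A (x u (\<eta> u), w u (\<theta> u) (\<eta> u)) \<and>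
      DERIV \<eta> u :> exp (- \<theta> u) * (1 - (u + \<eta> u) * w u (\<theta> u) (\<eta> u) * H (x u (\<eta> u), w u (\<theta> u) (\<eta> u))) - 1"
    proof (rule exI[of _ \<theta>], rule exI[of _ \<eta>], intro conjI ballI)
      fix u assume u: "u \<in> strip U"
      have b: "norm (\<theta> u) \<le> \<epsilon>1" "norm (\<eta> u) \<le> norm u / 2" using sol(3,4)[OF u] by (simp_all add: W)
      show "norm (\<theta> u) \<le> \<epsilon>" "norm (\<eta> u) \<le> norm u / 2" using b \<epsilon>1 by auto
      show "Re (u + \<eta> u) > 0" "norm (w u (\<theta> u) (\<eta> u)) \<le> exp (- Re u / (2 * N))" by (rule size[OF u b])+
      show "norm (A (x u (\<eta> u), w u (\<theta> u) (\<eta> u)) - 1) \<le> 1 / 2" by (rule q_le(7)[OF u b])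
      show "norm (x u (\<eta> u)) \<le> \<epsilon>" using size(3)[OF u b] \<xi> by linarith
      show "DERIV \<theta> u :> - 1 + exp (- \<theta> u) * A (x u (\<eta> u), w u (\<theta> u) (\<eta> u))"
        using sol(5)[OF u] by (simp add: Q_def algebra_simps)
      show "DERIV \<eta> u :> exp (- \<theta> u) * (1 - (u + \<eta> u) * w u (\<theta> u) (\<eta> u) * H (x u (\<eta> u), w u (\<theta> u) (\<eta> u))) - 1"
        using sol(6)[OF u] by (simp add: Q_def)
    qed
  qed
qed

section \<open>Solution curves of the interpolating field\<close>

text \<open>The reciprocal of \<open>z^(r-1) w^(k-1)\<close> acts as a complex time: it is
  comparable to \<open>t\<close> and separates points, which later yields injectivity. The lower
  bounds \<open>norm t powr (- c)\<close> turn absolute errors into errors relative to the curve.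
  For \<open>k = 1\<close> nothing keeps \<open>w\<close> away from 0; for \<open>k \<ge> 2\<close>
  the curve stays in a region \<open>norm z \<le> C * norm w ^ k\<close>, where \<open>w\<close> can
  serve as a unit of length.\<close>

definition model_curve :: "nat \<Rightarrow> nat \<Rightarrow> real \<Rightarrow> real \<Rightarrow> real \<Rightarrow> (complex \<times> complex \<Rightarrow> complex) \<Rightarrow>
    (complex \<times> complex \<Rightarrow> complex) \<Rightarrow> real \<Rightarrow> (complex \<Rightarrow> complex) \<Rightarrow> (complex \<Rightarrow> complex) \<Rightarrow> bool"
  where "model_curve r k C \<delta> c A B R z w \<longleftrightarrow>
    (\<forall>t\<in>half_plane R.
      DERIV z t :> z t ^ r * A (z t, w t) \<and>
      DERIV w t :> z t ^ (r - 1) * B (z t, w t) \<and>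
      norm (z t) \<le> norm t powr (- \<delta>) \<and> norm (w t) \<le> norm t powr (- \<delta>) \<and>
      norm (z t) \<ge> norm t powr (- c) \<and> (k \<ge> 2 \<longrightarrow> norm (w t) \<ge> norm t powr (- c)) \<and>
      (k \<ge> 2 \<longrightarrow> norm (z t) \<le> C * norm (w t) ^ k) \<and>
      norm (z t ^ (r - 1) * w t ^ (k - 1)) \<le> C / norm t \<and>
      norm (z t ^ (r - 1) * w t ^ (k - 1)) \<ge> 1 / (C * norm t)) \<and>
    (\<forall>t\<in>half_plane R. \<forall>t'\<in>half_plane R.
      norm (t - t') \<le> C * norm (1 / (z t ^ (r - 1) * w t ^ (k - 1)) - 1 / (z t' ^ (r - 1) * w t' ^ (k - 1))))"

lemma Ln_in_strip:
  assumes "t \<in> half_plane R" "R \<ge> exp U"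
  shows "Ln t \<in> strip U" "exp (Ln t) = t" "Re (Ln t) = ln (norm t)" "t \<notin> \<real>\<^sub>\<le>\<^sub>0" "t \<noteq> 0"
proof -
  have "Re t > R" using assms(1) by (simp add: half_plane_def)
  moreover have "R > 0" using assms(2) less_le_trans[OF exp_gt_zero] by blast
  ultimately have pos: "Re t > 0" "Re t > exp U" using assms(2) by auto
  show t: "t \<notin> \<real>\<^sub>\<le>\<^sub>0" "t \<noteq> 0" by (rule Re_pos_cut[OF pos(1)])+
  show "exp (Ln t) = t" by (simp add: t)
  show re: "Re (Ln t) = ln (norm t)" by (simp add: t)
  have "exp U < norm t" using pos complex_Re_le_cmod[of t] by linarith
  then have "U < ln (norm t)" using t by (metis exp_less_cancel_iff exp_ln zero_less_norm_iff)
  moreover have "\<bar>Im (Ln t)\<bar> < pi / 2" using pos(1) Re_Ln_pos_lt[OF t(2)] by simp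
  ultimately show "Ln t \<in> strip U" by (simp add: strip_def re)
qed

lemma norm_exp_minus_bounds:
  assumes "norm \<theta> \<le> 1"
  shows "norm (exp (- \<theta>)) \<le> exp 1" "norm (exp \<theta>) \<le> exp 1"
    "norm (exp (- u - \<theta>)) \<le> exp 1 * exp (- Re u)" "norm (exp (- u - \<theta>)) \<ge> exp (- 1) * exp (- Re u)"
  using assms abs_Re_le_cmod[of \<theta>] by (auto simp: mult_exp_exp)

lemma le_exp_of_power_le:
  fixes b :: real
  assumes "n > 0" "b ^ n \<le> K * exp (- x)" "K * exp (- (1 / 2) * x) \<le> 1"
  shows "b \<le> exp (- (1 / (2 * real n)) * x)"
proof -
  have "b ^ n \<le> (K * exp (- (1 / 2) * x)) * exp (- (1 / 2) * x)" using assms(2) by (simp add: mult_exp_exp mult.assoc)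
  also have "\<dots> \<le> 1 * exp (real n * (- (1 / (2 * real n)) * x))" using assms by (intro mult_mono) auto
  also have "\<dots> = exp (- (1 / (2 * real n)) * x) ^ n" unfolding exp_of_nat_mult by simp
  finally show ?thesis
    using power_strict_mono[of "exp (- (1 / (2 * real n)) * x)" b n] assms(1) by (meson exp_ge_zero not_le)
qed

text \<open>Passing to \<open>u = Ln t\<close> multiplies the field by \<open>exp u\<close>. The
  reciprocal of \<open>z^(r-1) w^(k-1)\<close> becomes \<open>T / Cc\<close> with
  \<open>T = t * exp \<theta>\<close>, and the equation of \<open>\<theta>\<close> says exactly that
  \<open>T\<close> has derivative \<open>a\<close>. Being within \<open>1 / 2\<close> of 1 on a
  convex domain, this derivative gives the separation of points.\<close>

lemma model_curve_of_strip:
  fixes z w \<theta> :: "complex \<Rightarrow> complex" and Cc :: complex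
  assumes C: "Cc \<noteq> 0" "C \<ge> 2 * exp 1 * norm Cc" "C \<ge> exp 1 / norm Cc"
    and sol: "\<And>u. u \<in> strip U \<Longrightarrow> DERIV z u :> exp u * (z u ^ r * A (z u, w u))"
      "\<And>u. u \<in> strip U \<Longrightarrow> DERIV w u :> exp u * (z u ^ (r - 1) * B (z u, w u))"
      "\<And>u. u \<in> strip U \<Longrightarrow> DERIV \<theta> u :> - 1 + exp (- \<theta> u) * a u"
      "\<And>u. u \<in> strip U \<Longrightarrow> z u ^ (r - 1) * w u ^ (k - 1) = Cc * exp (- u - \<theta> u)"
    and bnd: "\<And>u. u \<in> strip U \<Longrightarrow> norm (\<theta> u) \<le> 1" "\<And>u. u \<in> strip U \<Longrightarrow> norm (a u - 1) \<le> 1 / 2"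
      "\<And>u. u \<in> strip U \<Longrightarrow> norm (z u) \<le> exp (- \<delta> * Re u)" "\<And>u. u \<in> strip U \<Longrightarrow> norm (w u) \<le> exp (- \<delta> * Re u)"
      "\<And>u. u \<in> strip U \<Longrightarrow> norm (z u) \<ge> exp (- c * Re u)" "\<And>u. u \<in> strip U \<Longrightarrow> k \<ge> 2 \<Longrightarrow> norm (w u) \<ge> exp (- c * Re u)"
      "\<And>u. u \<in> strip U \<Longrightarrow> k \<ge> 2 \<Longrightarrow> norm (z u) \<le> C * norm (w u) ^ k"
    and R: "R \<ge> exp U"
  shows "model_curve r k C \<delta> c A B R (\<lambda>t. z (Ln t)) (\<lambda>t. w (Ln t))"
proof -
  note L = Ln_in_strip[OF _ R]
  have Ln_der: "DERIV Ln t :> inverse t" if "t \<in> half_plane R" for t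
    by (rule has_field_derivative_Ln[OF L(4)[OF that]])
  have pw: "norm t powr (- d) = exp (- d * Re (Ln t))" if "t \<in> half_plane R" for t d
    using L(3,5)[OF that] by (simp add: powr_def)
  note e\<theta> = norm_exp_minus_bounds(2,1)[OF bnd(1)]
  have prod: "z (Ln t) ^ (r - 1) * w (Ln t) ^ (k - 1) = Cc * exp (- \<theta> (Ln t)) / t" if "t \<in> half_plane R" for t
    using sol(4)[OF L(1)[OF that]] L(2)[OF that] by (simp add: exp_diff exp_minus field_simps)
  have C0: "C > 0"
  proof -
    have "exp 1 / norm Cc > 0" using C by simp
    with C(3) show ?thesis by linarith
  qed
  define T where "T = (\<lambda>t. t * exp (\<theta> (Ln t)))"
  have T_der: "DERIV T t :> a (Ln t)" if t: "t \<in> half_plane R" for t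
  proof -
    have "DERIV (\<lambda>t. \<theta> (Ln t)) t :> (- 1 + exp (- \<theta> (Ln t)) * a (Ln t)) * inverse t"
      by (rule DERIV_chain2[OF sol(3)[OF L(1)[OF t]] Ln_der[OF t]])
    from DERIV_mult[OF DERIV_ident DERIV_chain2[OF DERIV_exp this]]
    show ?thesis unfolding T_def
      by (rule DERIV_cong) (use L(5)[OF t] in \<open>simp add: exp_minus field_simps\<close>)
  qed
  have T_inj: "norm (t - t') \<le> 2 * norm (T t - T t')" if tt: "t \<in> half_plane R" "t' \<in> half_plane R" for t t'
  proof -
    have "norm ((T t - t) - (T t' - t')) \<le> 1 / 2 * norm (t - t')"
    proof (rule field_differentiable_bound[OF convex_half_plane[of R], where f = "\<lambda>t. T t - t" and f' = "\<lambda>t. a (Ln t) - 1"])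
      fix s assume s: "s \<in> half_plane R"
      show "((\<lambda>t. T t - t) has_field_derivative a (Ln s) - 1) (at s within half_plane R)"
        by (rule has_field_derivative_at_within[OF DERIV_diff[OF T_der[OF s] DERIV_ident]])
      show "norm (a (Ln s) - 1) \<le> 1 / 2" by (rule bnd(2)[OF L(1)[OF s]])
    qed (use tt in auto)
    then show ?thesis using norm_triangle_ineq2[of "t - t'" "(t - t') - (T t - T t')"]
      by (simp add: algebra_simps norm_minus_commute)
  qed
  have inv: "1 / (z (Ln t) ^ (r - 1) * w (Ln t) ^ (k - 1)) = T t / Cc" if "t \<in> half_plane R" for t
    unfolding prod[OF that] T_def using C(1) by (simp add: exp_minus field_simps)
  show ?thesis
    unfolding model_curve_def
  proof (intro conjI ballI)
    fix t assume t: "t \<in> half_plane R"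
    let ?u = "Ln t"
    note u = L(1)[OF t]
    have t0: "norm t > 0" using L(5)[OF t] by simp
    have eu: "exp ?u * x * inverse t = x" for x using L(2,5)[OF t] by (simp add: field_simps)
    show "DERIV (\<lambda>t. z (Ln t)) t :> z ?u ^ r * A (z ?u, w ?u)"
      using DERIV_chain2[OF sol(1)[OF u] Ln_der[OF t]] unfolding eu .
    show "DERIV (\<lambda>t. w (Ln t)) t :> z ?u ^ (r - 1) * B (z ?u, w ?u)"
      using DERIV_chain2[OF sol(2)[OF u] Ln_der[OF t]] unfolding eu .
    show "norm (z ?u) \<le> norm t powr (- \<delta>)" "norm (w ?u) \<le> norm t powr (- \<delta>)" "norm (z ?u) \<ge> norm t powr (- c)"
      "k \<ge> 2 \<longrightarrow> norm (w ?u) \<ge> norm t powr (- c)" "k \<ge> 2 \<longrightarrow> norm (z ?u) \<le> C * norm (w ?u) ^ k"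
      using bnd(3-7)[OF u] pw[OF t] by auto
    have "norm (z ?u ^ (r - 1) * w ?u ^ (k - 1)) = norm Cc * norm (exp (- \<theta> ?u)) / norm t"
      unfolding prod[OF t] by (simp add: norm_mult norm_divide)
    also have "\<dots> \<le> C / norm t"
    proof (rule divide_right_mono)
      have "norm Cc * norm (exp (- \<theta> ?u)) \<le> norm Cc * exp 1" using e\<theta>[OF u] by (intro mult_left_mono) auto
      also have "\<dots> \<le> 2 * exp 1 * norm Cc" by simp
      also have "\<dots> \<le> C" by (rule C(2))
      finally show "norm Cc * norm (exp (- \<theta> ?u)) \<le> C" .
    qed simp
    finally show "norm (z ?u ^ (r - 1) * w ?u ^ (k - 1)) \<le> C / norm t" .
    have "T t / Cc \<noteq> 0" using C(1) L(5)[OF t] by (simp add: T_def)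
    have "norm (T t / Cc) \<le> norm t * exp 1 / norm Cc"
      using e\<theta>[OF u] t0 by (simp add: T_def norm_divide norm_mult divide_right_mono mult_left_mono)
    also have "\<dots> \<le> C * norm t" using mult_right_mono[OF C(3), of "norm t"] t0 by (simp add: mult.commute)
    finally have "norm (T t / Cc) \<le> C * norm t" .
    then have "1 / (C * norm t) \<le> 1 / norm (T t / Cc)" using \<open>T t / Cc \<noteq> 0\<close> C0 t0
      by (intro divide_left_mono mult_pos_pos) auto
    also have "1 / norm (T t / Cc) = norm (z ?u ^ (r - 1) * w ?u ^ (k - 1))"
      unfolding inv[OF t, symmetric] by (simp add: norm_divide)
    finally show "1 / (C * norm t) \<le> norm (z ?u ^ (r - 1) * w ?u ^ (k - 1))" .
  next
    fix t t' assume t: "t \<in> half_plane R" and t': "t' \<in> half_plane R"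
    have "norm (t - t') \<le> 2 * norm (T t - T t')" by (rule T_inj[OF t t'])
    also have "\<dots> = 2 * norm Cc * norm (T t / Cc - T t' / Cc)"
      using C(1) by (simp add: diff_divide_distrib[symmetric] norm_divide)
    also have "\<dots> \<le> C * norm (T t / Cc - T t' / Cc)"
    proof (rule mult_right_mono)
      have "2 * norm Cc * 1 \<le> 2 * norm Cc * exp 1" by (intro mult_left_mono) auto
      then show "2 * norm Cc \<le> C" using C(2) by (simp add: mult_ac)
    qed simp
    finally show "norm (t - t') \<le> C * norm (1 / (z (Ln t) ^ (r - 1) * w (Ln t) ^ (k - 1)) - 1 / (z (Ln t') ^ (r - 1) * w (Ln t') ^ (k - 1)))"
      unfolding inv[OF t] inv[OF t'] .
  qed
qed

section \<open>Existence of model curves in the two cases\<close>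

lemma eventually_exp_le:
  fixes K :: real
  assumes "s > 0"
  obtains U0 where "\<And>x. x \<ge> U0 \<Longrightarrow> K * exp (- s * x) \<le> 1"
proof -
  have "((\<lambda>x. K * exp (- s * x)) \<longlongrightarrow> 0) at_top" using assms by real_asymp
  then have "\<forall>\<^sub>F x in at_top. K * exp (- s * x) < 1" by (rule order_tendstoD) simp
  then obtain U0 where "\<And>x. x \<ge> U0 \<Longrightarrow> K * exp (- s * x) < 1" unfolding eventually_at_top_linorder by blast
  then show ?thesis using that less_imp_le by blast
qed

text \<open>The leading equation is \<open>z' = a0 z^r\<close>, solved by
  \<open>z^(r-1) = Cc / t\<close>. The ansatz \<open>z^(r-1) = Cc * exp (- u - \<theta>)\<close>
  leads to \<open>normal_form_ode\<close> with \<open>e = 0\<close>. The constants involve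
  \<open>r\<close>, \<open>a0\<close> and \<open>b2\<close> only and are thus available before
  \<open>A\<close> and \<open>B\<close>.\<close>

theorem model_curve_nondegenerate:
  fixes a0 b2 :: complex
  assumes r: "r \<ge> 2" and a0: "a0 \<noteq> 0"
  obtains C \<delta> c where "C > 0" "\<delta> > 0"
    "\<And>A B. holomorphic2_on A UNIV \<Longrightarrow> holomorphic2_on B UNIV \<Longrightarrow> A (0, 0) = a0 \<Longrightarrow> B (0, 0) = 0 \<Longrightarrow> dw B (0, 0) = b2 \<Longrightarrow>
      \<exists>R0. \<forall>R\<ge>R0. \<exists>z w. model_curve r 1 C \<delta> c A B R z w"
proof -
  define N where "N = real (r - 1)"
  have N: "N \<ge> 1" using r by (simp add: N_def)
  \<comment> \<open>From differentiating \<open>z^(r-1) = Cc / t\<close> and inserting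
    \<open>z' = a0 z^r\<close>.\<close>
  define Cc where "Cc = - 1 / (of_real N * a0)"
  have Cc: "Cc \<noteq> 0" using a0 N by (auto simp: Cc_def)
  define \<mu> where "\<mu> = - Cc * b2"
  \<comment> \<open>Two candidates below \<open>1 / N\<close>, one of which avoids the resonance
    \<open>Re \<mu> = \<delta>\<close>.\<close>
  define \<delta> where "\<delta> = (if Re \<mu> = 1 / (2 * N) then 1 / (3 * N) else 1 / (2 * N))"
  have \<delta>: "0 < \<delta>" "\<delta> < 1" "\<delta> < 1 / N" "Re \<mu> \<noteq> \<delta>" "\<delta> \<le> 1 / (2 * N)" using N by (auto simp: \<delta>_def field_simps)
  define C where "C = max (2 * exp 1 * norm Cc) (exp 1 / norm Cc)"
  have C: "C > 0" "C \<ge> 2 * exp 1 * norm Cc" "C \<ge> exp 1 / norm Cc" using Cc by (auto simp: C_def less_max_iff_disj)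
  show ?thesis
  proof (rule that[of C \<delta> 2])
    fix A B assume A: "holomorphic2_on A UNIV" "A (0, 0) = a0" and B: "holomorphic2_on B UNIV" "B (0, 0) = 0" "dw B (0, 0) = b2"
    define A' where "A' = (\<lambda>p. A p / a0)"
    define B' where "B' = (\<lambda>p. Cc * B p)"
    have A': "holomorphic2_on A' UNIV" "A' (0, 0) = 1"
      using A a0 unfolding A'_def by (auto intro!: holomorphic2_intros)
    have B': "holomorphic2_on B' UNIV" "B' (0, 0) = 0" using B unfolding B'_def by (auto intro!: holomorphic2_intros)
    have B'd: "dw B' (0, 0) = - \<mu>"
    proof -
      have "DERIV (\<lambda>\<eta>. B (0, \<eta>)) 0 :> b2"
        using holomorphic_derivI[OF holomorphic2_slice2[OF B(1) open_UNIV, of 0], of 0] B(3) by simp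
      from DERIV_imp_deriv[OF DERIV_cmult[OF this, of Cc]] show ?thesis by (simp add: B'_def \<mu>_def)
    qed
    define zz where "zz = (\<lambda>\<theta> u. exp ((Ln Cc - u - \<theta> u - 0 * 0) / of_real N :: complex))"
    obtain U1 where U1: "\<And>U. U \<ge> U1 \<Longrightarrow> \<exists>\<theta> y. \<forall>u\<in>strip U.
      norm (\<theta> u) \<le> 1 \<and> norm (y u) \<le> 1 * exp (- \<delta> * Re u) \<and> norm (zz \<theta> u) \<le> 1 \<and> norm (A' (zz \<theta> u, y u) - 1) \<le> 1 / 2 \<and>
      DERIV \<theta> u :> - 1 + exp (- \<theta> u) * A' (zz \<theta> u, y u) \<and> DERIV y u :> exp (- \<theta> u) * B' (zz \<theta> u, y u)"
    proof (rule normal_form_ode[OF A' B' B'd _ \<delta>(1-4) zero_less_one, of "Ln Cc" 0], goal_cases)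
      case (2 U0)
      show ?case by (rule 2(1)) (use 2(2) in \<open>simp add: zz_def\<close>)
    qed (use N in auto)
    obtain U2 where U2: "\<And>x. x \<ge> U2 \<Longrightarrow> (norm Cc * exp 1) * exp (- (1 / 2) * x) \<le> 1" by (rule eventually_exp_le[of "1 / 2"]) auto
    obtain U3 where U3: "\<And>x. x \<ge> U3 \<Longrightarrow> (exp 1 / norm Cc) * exp (- 1 * x) \<le> 1" by (rule eventually_exp_le[where K = "exp 1 / norm Cc", OF zero_less_one]) blast
    show "\<exists>R0. \<forall>R\<ge>R0. \<exists>z w. model_curve r 1 C \<delta> 2 A B R z w"
    proof (intro exI[of _ "exp (max (max U1 0) (max U2 U3))"] allI impI)
      fix R assume R: "R \<ge> exp (max (max U1 0) (max U2 U3))"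
      define U where "U = max (max U1 0) (max U2 U3)"
      have U: "U \<ge> U1" "U \<ge> 0" "U \<ge> U2" "U \<ge> U3" by (auto simp: U_def)
      obtain \<theta> y where s: "\<forall>u\<in>strip U. norm (\<theta> u) \<le> 1 \<and> norm (y u) \<le> 1 * exp (- \<delta> * Re u) \<and> norm (zz \<theta> u) \<le> 1 \<and>
        norm (A' (zz \<theta> u, y u) - 1) \<le> 1 / 2 \<and>
        DERIV \<theta> u :> - 1 + exp (- \<theta> u) * A' (zz \<theta> u, y u) \<and> DERIV y u :> exp (- \<theta> u) * B' (zz \<theta> u, y u)"
        using U1[OF U(1)] by blast
      define z where "z = zz \<theta>"
      have raw: "norm (\<theta> u) \<le> 1" "norm (y u) \<le> exp (- \<delta> * Re u)" "norm (z u) \<le> 1" "norm (A' (z u, y u) - 1) \<le> 1 / 2"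
        "DERIV \<theta> u :> - 1 + exp (- \<theta> u) * A' (z u, y u)" "DERIV y u :> exp (- \<theta> u) * B' (z u, y u)" if "u \<in> strip U" for u
        using bspec[OF s that] by (simp_all only: z_def mult_1)
      have z_def: "z = (\<lambda>u. exp ((Ln Cc - u - \<theta> u) / of_real N))" by (simp add: z_def zz_def)
      have zN: "z u ^ (r - 1) = Cc * exp (- u - \<theta> u)" for u
      proof -
        have "z u ^ (r - 1) = exp (of_nat (r - 1) * ((Ln Cc - u - \<theta> u) / of_real N))" by (simp only: z_def exp_of_nat_mult)
        also have "of_nat (r - 1) * ((Ln Cc - u - \<theta> u) / of_real N) = Ln Cc + (- u - \<theta> u)" using N by (simp add: N_def)
        finally show ?thesis using Cc by (simp add: exp_add)
      qed
      have zr: "z u ^ r = z u * z u ^ (r - 1)" for u using r by (cases r) auto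
      have "model_curve r 1 C \<delta> 2 A B R (\<lambda>t. z (Ln t)) (\<lambda>t. y (Ln t))"
      proof (rule model_curve_of_strip[OF Cc C(2,3), where U = U and \<theta> = \<theta> and a = "\<lambda>u. A' (z u, y u)"])
        fix u assume u: "u \<in> strip U"
        have eu: "exp u * z u ^ (r - 1) = Cc * exp (- \<theta> u)" unfolding zN by (simp add: exp_diff exp_minus field_simps)
        have "DERIV (\<lambda>u. (Ln Cc - u - \<theta> u) / of_real N) u :> (0 - 1 - (- 1 + exp (- \<theta> u) * A' (z u, y u))) / of_real N"
          by (intro DERIV_cdivide DERIV_diff DERIV_const DERIV_ident raw(5)[OF u])
        from DERIV_chain2[OF DERIV_exp this]
        have "DERIV z u :> z u * ((0 - 1 - (- 1 + exp (- \<theta> u) * A' (z u, y u))) / of_real N)" unfolding z_def .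
        moreover have "exp u * (z u ^ r * A (z u, y u)) = z u * ((exp u * z u ^ (r - 1)) * A (z u, y u))" by (simp add: zr)
        moreover have "(0 - 1 - (- 1 + exp (- \<theta> u) * A' (z u, y u))) / of_real N = Cc * exp (- \<theta> u) * A (z u, y u)"
          using N a0 by (simp add: A'_def Cc_def field_simps)
        ultimately show "DERIV z u :> exp u * (z u ^ r * A (z u, y u))" unfolding eu by (simp only:)
        have "exp u * (z u ^ (r - 1) * B (z u, y u)) = exp (- \<theta> u) * B' (z u, y u)"
          unfolding mult.assoc[symmetric] eu by (simp add: B'_def)
        then show "DERIV y u :> exp u * (z u ^ (r - 1) * B (z u, y u))" using raw(6)[OF u] by simp
        show "z u ^ (r - 1) * y u ^ (1 - 1) = Cc * exp (- u - \<theta> u)" using zN[of u] by simp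
        have x: "Re u \<ge> U2" "Re u \<ge> U3" "Re u \<ge> 0" using u U by (auto simp: strip_def)
        have nz: "norm (z u) ^ (r - 1) = norm Cc * norm (exp (- u - \<theta> u))" unfolding norm_power[symmetric] zN norm_mult ..
        also have "\<dots> \<le> (norm Cc * exp 1) * exp (- Re u)"
          using mult_left_mono[OF norm_exp_minus_bounds(3)[OF raw(1)[OF u]], of "norm Cc" u] by (simp add: mult.assoc)
        finally have "norm (z u) \<le> exp (- (1 / (2 * N)) * Re u)"
          unfolding N_def using r U2[OF x(1)] by (intro le_exp_of_power_le) auto
        also have "\<dots> \<le> exp (- \<delta> * Re u)" using mult_right_mono[OF \<delta>(5) x(3)] by simp
        finally show "norm (z u) \<le> exp (- \<delta> * Re u)" .
        \<comment> \<open>The exponent \<open>c = 2\<close>: one factor \<open>exp (- Re u)\<close>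
          is the size of \<open>z^(r-1)\<close>, the other absorbs the constant.\<close>
        have "exp (- Re u) \<le> norm Cc * exp (- 1)" using U3[OF x(2)] Cc by (simp add: exp_minus field_simps)
        from mult_right_mono[OF this, of "exp (- Re u)"]
        have "exp (- 2 * Re u) \<le> norm Cc * (exp (- 1) * exp (- Re u))" by (simp add: mult_exp_exp mult.assoc)
        also have "\<dots> \<le> norm (z u) ^ (r - 1)"
          unfolding nz by (intro mult_left_mono norm_exp_minus_bounds(4) raw(1)[OF u]) simp
        also have "\<dots> \<le> norm (z u) ^ 1" using raw(3)[OF u] r by (intro power_decreasing) auto
        finally show "norm (z u) \<ge> exp (- 2 * Re u)" by simp
      qed (use raw R in \<open>auto simp: U_def\<close>)
      then show "\<exists>z w. model_curve r 1 C \<delta> 2 A B R z w" by blast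
    qed
  qed (use C \<delta> in auto)
qed

text \<open>The curve \<open>z = x w\<^sup>k\<close> in the coordinate \<open>u\<close>, where \<open>A = w\<^sup>k\<^sup>-\<^sup>1 Ah\<close> and \<open>B = w\<^sup>k Bh\<close>.\<close>

definition blowup_speed :: "nat \<Rightarrow> nat \<Rightarrow> complex \<Rightarrow> (complex \<Rightarrow> complex \<Rightarrow> complex) \<Rightarrow> (complex \<Rightarrow> complex \<Rightarrow> complex) \<Rightarrow> complex \<Rightarrow> complex \<Rightarrow> complex"
  where "blowup_speed r k Cc Ah Bh x w = - Cc * (of_nat (r - 1) * Ah x w + of_nat (k - 1) * Bh x w)"

text \<open>As \<open>k * r - 1 = k * (r - 1) + (k - 1)\<close>, the fourth clause is again
  \<open>z^(r-1) w^(k-1) = Cc * exp (- u - \<theta>)\<close> for \<open>z = x * w^k\<close>. The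
  lower bound on \<open>x\<close> is generous, because \<open>x\<close> may tend to 0 like
  \<open>1 / u\<close>.\<close>

definition blowup_solution where "blowup_solution r k X0 \<delta> Cc Ah Bh U x w \<theta> \<longleftrightarrow> (\<forall>u\<in>strip U.
    DERIV x u :> x u * (Cc * exp (- \<theta> u) * (Ah (x u) (w u) - of_nat k * Bh (x u) (w u))) \<and>
    DERIV w u :> w u * (Cc * exp (- \<theta> u) * Bh (x u) (w u)) \<and>
    DERIV \<theta> u :> - 1 + exp (- \<theta> u) * blowup_speed r k Cc Ah Bh (x u) (w u) \<and>
    x u ^ (r - 1) * w u ^ (k * r - 1) = Cc * exp (- u - \<theta> u) \<and>
    norm (\<theta> u) \<le> 1 \<and> norm (blowup_speed r k Cc Ah Bh (x u) (w u) - 1) \<le> 1 / 2 \<and>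
    norm (x u) \<le> X0 \<and> norm (x u) \<ge> exp (- Re u) \<and> norm (w u) \<le> exp (- \<delta> * Re u))"

text \<open>Since \<open>x\<close> is bounded by \<open>X0\<close> and
  \<open>norm w \<le> 1\<close>, the fourth clause bounds \<open>w\<close> from below by
  \<open>exp (- 2 * Re u)\<close>. Combined with the lower bound on \<open>x\<close> this gives the
  exponent \<open>2 k + 1\<close> for \<open>z = x * w^k\<close>.\<close>

lemma model_curve_of_blowup_solution:
  fixes Cc :: complex
  assumes r: "r \<ge> 2" and k: "k \<ge> 2" and Cc: "Cc \<noteq> 0" and \<delta>: "\<delta> > 0"
    and C: "C \<ge> 2 * exp 1 * norm Cc" "C \<ge> exp 1 / norm Cc" "C \<ge> X0" and X0: "X0 \<ge> 1"
    and fac: "\<And>x w. A (x * w ^ k, w) = w ^ (k - 1) * Ah x w" "\<And>x w. B (x * w ^ k, w) = w ^ k * Bh x w"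
    and sol: "blowup_solution r k X0 \<delta> Cc Ah Bh U x w \<theta>"
    and U: "U \<ge> 0" "\<And>X. X \<ge> U \<Longrightarrow> X0 * exp (- \<delta> * X) \<le> 1" "\<And>X. X \<ge> U \<Longrightarrow> (X0 ^ (r - 1) * exp 1 / norm Cc) * exp (- 1 * X) \<le> 1"
    and R: "R \<ge> exp U"
  shows "model_curve r k C \<delta> (2 * real k + 1) A B R (\<lambda>t. x (Ln t) * w (Ln t) ^ k) (\<lambda>t. w (Ln t))"
proof (rule model_curve_of_strip[OF Cc C(1,2), where U = U and \<theta> = \<theta> and a = "\<lambda>u. blowup_speed r k Cc Ah Bh (x u) (w u)" and z = "\<lambda>u. x u * w u ^ k"])
  define N where "N = k * r - 1"
  have Nk: "k * (r - 1) + (k - 1) = N" using k r N_def by (cases r; cases k) (auto simp: algebra_simps)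
  have N0: "N > 0" using Nk k by linarith
  fix u assume u: "u \<in> strip U"
  have d: "DERIV x u :> x u * (Cc * exp (- \<theta> u) * (Ah (x u) (w u) - of_nat k * Bh (x u) (w u)))"
    "DERIV w u :> w u * (Cc * exp (- \<theta> u) * Bh (x u) (w u))"
    and alg0: "x u ^ (r - 1) * w u ^ N = Cc * exp (- u - \<theta> u)"
    and b: "norm (\<theta> u) \<le> 1" "norm (x u) \<le> X0" "norm (x u) \<ge> exp (- Re u)" "norm (w u) \<le> exp (- \<delta> * Re u)"
    using sol u by (simp_all add: blowup_solution_def N_def)
  have Ru: "Re u \<ge> U" "Re u \<ge> 0" using u U(1) by (auto simp: strip_def)
  have alg: "(x u * w u ^ k) ^ (r - 1) * w u ^ (k - 1) = Cc * exp (- u - \<theta> u)"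
    unfolding alg0[symmetric] power_mult_distrib power_mult[symmetric] mult.assoc power_add[symmetric] Nk ..
  then show "(x u * w u ^ k) ^ (r - 1) * w u ^ (k - 1) = Cc * exp (- u - \<theta> u)" .
  define L where "L = Cc * exp (- \<theta> u)"
  have ealg: "exp u * ((x u * w u ^ k) ^ (r - 1) * w u ^ (k - 1)) = L"
    unfolding alg L_def by (simp add: exp_diff exp_minus field_simps)
  let ?Ah = "Ah (x u) (w u)" and ?Bh = "Bh (x u) (w u)"
  have "DERIV (\<lambda>u. w u ^ k) u :> of_nat k * (w u * (L * ?Bh) * w u ^ (k - Suc 0))"
    using DERIV_power[OF d(2), of k] by (simp add: L_def)
  moreover have "of_nat k * (w u * (L * ?Bh) * w u ^ (k - Suc 0)) = of_nat k * (L * ?Bh) * w u ^ k"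
    using k by (cases k) auto
  ultimately have wkder: "DERIV (\<lambda>u. w u ^ k) u :> of_nat k * (L * ?Bh) * w u ^ k" by simp
  have "DERIV (\<lambda>u. x u * w u ^ k) u :> (x u * (L * (?Ah - of_nat k * ?Bh))) * w u ^ k + (of_nat k * (L * ?Bh) * w u ^ k) * x u"
    using DERIV_mult[OF d(1) wkder] by (simp add: L_def)
  moreover have "(x u * (L * (?Ah - of_nat k * ?Bh))) * w u ^ k + (of_nat k * (L * ?Bh) * w u ^ k) * x u = (x u * w u ^ k) * L * ?Ah"
    by (simp add: algebra_simps)
  moreover have "exp u * ((x u * w u ^ k) ^ r * A (x u * w u ^ k, w u))
      = (x u * w u ^ k) * (exp u * ((x u * w u ^ k) ^ (r - 1) * w u ^ (k - 1))) * ?Ah"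
    unfolding fac(1) using r by (cases r) (auto simp: mult_ac)
  ultimately show "DERIV (\<lambda>u. x u * w u ^ k) u :> exp u * ((x u * w u ^ k) ^ r * A (x u * w u ^ k, w u))" unfolding ealg by (simp only:)
  have "exp u * ((x u * w u ^ k) ^ (r - 1) * B (x u * w u ^ k, w u))
      = (exp u * ((x u * w u ^ k) ^ (r - 1) * w u ^ (k - 1))) * (w u * ?Bh)"
    unfolding fac(2) using k by (cases k) (auto simp: mult_ac)
  then show "DERIV w u :> exp u * ((x u * w u ^ k) ^ (r - 1) * B (x u * w u ^ k, w u))"
    unfolding ealg L_def using d(2) by (simp only: mult_ac)
  have w1: "norm (w u) \<le> 1" using b(4) \<delta> Ru by (smt (verit) exp_le_one_iff mult_nonneg_nonneg mult_minus_left)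
  have "norm (x u * w u ^ k) \<le> X0 * norm (w u) ^ k"
    unfolding norm_mult norm_power by (intro mult_right_mono b(2)) auto
  then show "k \<ge> 2 \<Longrightarrow> norm (x u * w u ^ k) \<le> C * norm (w u) ^ k"
    using mult_right_mono[OF C(3), of "norm (w u) ^ k"] by (simp add: order_trans)
  have "norm (w u) ^ k \<le> norm (w u) ^ 2" using w1 k by (intro power_decreasing) auto
  also have "\<dots> \<le> exp (- \<delta> * Re u) ^ 2" by (intro power_mono b(4)) auto
  finally have "X0 * norm (w u) ^ k \<le> X0 * (exp (- \<delta> * Re u) * exp (- \<delta> * Re u))"
    using X0 by (intro mult_left_mono) (auto simp: power2_eq_square)
  also have "\<dots> \<le> 1 * exp (- \<delta> * Re u)"
    unfolding mult.assoc[symmetric] by (intro mult_right_mono U(2)[OF Ru(1)]) auto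
  finally show "norm (x u * w u ^ k) \<le> exp (- \<delta> * Re u)"
    using \<open>norm (x u * w u ^ k) \<le> X0 * norm (w u) ^ k\<close> by linarith
  have wlow: "exp (- 2 * Re u) \<le> norm (w u)"
  proof -
    have "X0 ^ (r - 1) * exp (- 2 * Re u) = (X0 ^ (r - 1) * exp 1 / norm Cc * exp (- 1 * Re u)) * (norm Cc * exp (- 1) * exp (- Re u))"
      using Cc by (simp add: exp_minus field_simps mult_exp_exp)
    also have "\<dots> \<le> 1 * (norm Cc * exp (- 1) * exp (- Re u))" by (intro mult_right_mono U(3)[OF Ru(1)]) auto
    also have "\<dots> = norm Cc * (exp (- 1) * exp (- Re u))" by simp
    also have "\<dots> \<le> norm Cc * norm (exp (- u - \<theta> u))" by (intro mult_left_mono norm_exp_minus_bounds(4) b(1)) simp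
    also have "\<dots> = norm (x u) ^ (r - 1) * norm (w u) ^ N"
      using arg_cong[OF alg0, of norm] by (simp only: norm_mult norm_power)
    also have "\<dots> \<le> X0 ^ (r - 1) * norm (w u) ^ 1"
      using b(2) w1 X0 N0 by (intro mult_mono power_mono power_decreasing) auto
    finally show ?thesis using X0 by simp
  qed
  have "exp (- (2 * real k + 1) * Re u) \<le> exp (- 2 * Re u)"
  proof -
    have "2 * Re u \<le> (2 * real k + 1) * Re u" using k Ru by (intro mult_right_mono) auto
    then show ?thesis by (simp add: algebra_simps)
  qed
  with wlow show "k \<ge> 2 \<Longrightarrow> norm (w u) \<ge> exp (- (2 * real k + 1) * Re u)" by linarith
  have "exp (- (2 * real k + 1) * Re u) = exp (- Re u) * exp (- 2 * Re u) ^ k"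
    by (simp add: exp_of_nat_mult[symmetric] mult_exp_exp algebra_simps)
  also have "\<dots> \<le> norm (x u) * norm (w u) ^ k" by (intro mult_mono power_mono wlow b(3)) auto
  finally show "norm (x u * w u ^ k) \<ge> exp (- (2 * real k + 1) * Re u)" by (simp add: norm_mult norm_power)
qed (use R sol in \<open>auto simp: blowup_solution_def\<close>)

lemma holomorphic2_split_fst:
  assumes P: "holomorphic2_on P UNIV"
  shows "\<exists>P1. holomorphic2_on P1 UNIV \<and> (\<forall>z w. P (z, w) = P (0, w) + z * P1 (z, w)) \<and> P1 (0, 0) = dz P (0, 0)"
proof -
  define g where "g = (\<lambda>q. P q - P (0, snd q))"
  have "holomorphic2_on (\<lambda>q. P (0, snd q)) UNIV"
    by (rule holomorphic2_compose[OF P]) (auto intro: holomorphic2_intros)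
  then have "holomorphic2_on g UNIV" unfolding g_def by (intro holomorphic2_intros P)
  moreover have "g (0, w) = 0" for w by (simp add: g_def)
  ultimately obtain P1 where P1: "holomorphic2_on P1 UNIV" "\<And>q. q \<in> UNIV \<Longrightarrow> g q = fst q * P1 q" "\<And>w. P1 (0, w) = dz g (0, w)"
    using holomorphic2_factor_fst[OF _ open_UNIV, of g] by blast
  have "DERIV (\<lambda>\<zeta>. P (\<zeta>, 0)) 0 :> dz P (0, 0)"
    using holomorphic_derivI[OF holomorphic2_slice1[OF P open_UNIV, of 0], of 0] by simp
  from DERIV_imp_deriv[OF DERIV_diff[OF this DERIV_const]] have "dz g (0, 0) = dz P (0, 0)" by (simp add: g_def)
  then have "P1 (0, 0) = dz P (0, 0)" using P1(3) by simp
  moreover have "P (z, w) = P (0, w) + z * P1 (z, w)" for z w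
    using P1(2)[of "(z, w)"] by (simp add: g_def diff_eq_eq add.commute)
  ultimately show ?thesis using P1(1) by blast
qed

text \<open>Up to a nonvanishing factor, \<open>x = z / w^k\<close> obeys
  \<open>x' = x (Ah - k Bh)\<close>. At \<open>w = 0\<close> the bracket is
  \<open>\<alpha> - k (ck + x \<beta>)\<close>, with the single zero \<open>x0\<close>. A nonzero
  \<open>x0\<close> is a simple equilibrium and \<open>x = x0 * exp y\<close> leads to
  \<open>normal_form_ode\<close>. If \<open>x0 = 0\<close>, it meets the zero of the factor
  \<open>x\<close>, and \<open>logarithmic_ode\<close> takes over.\<close>

theorem model_curve_degenerate:
  fixes \<alpha> \<beta> ck :: complex
  assumes r: "r \<ge> 2" and k: "k \<ge> 2" and \<alpha>: "\<alpha> \<noteq> 0" and \<beta>: "\<beta> \<noteq> 0"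
  obtains C \<delta> c where "C > 0" "\<delta> > 0"
    "\<And>A B a' b'. holomorphic2_on A UNIV \<Longrightarrow> holomorphic2_on B UNIV \<Longrightarrow> a' holomorphic_on UNIV \<Longrightarrow> b' holomorphic_on UNIV \<Longrightarrow>
      (\<And>w. A (0, w) = w ^ (k - 1) * a' w) \<Longrightarrow> (\<And>w. B (0, w) = w ^ k * b' w) \<Longrightarrow> a' 0 = \<alpha> \<Longrightarrow> b' 0 = ck \<Longrightarrow> dz B (0, 0) = \<beta> \<Longrightarrow>
      \<exists>R0. \<forall>R\<ge>R0. \<exists>z w. model_curve r k C \<delta> c A B R z w"
proof -
  define N where "N = k * r - 1"
  have Nk: "k * (r - 1) + (k - 1) = N" using k r N_def by (cases r; cases k) (auto simp: algebra_simps)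
  have N0: "N > 0" "real N \<ge> 1" using Nk k by linarith+
  have Nc: "(of_nat (r - 1) :: complex) * of_nat k + of_nat (k - 1) = of_nat N" unfolding Nk[symmetric] by (simp add: mult.commute)
  \<comment> \<open>Normalises the speed to \<open>AA x0 0 = 1\<close>: at the equilibrium
    \<open>Bh\<close> equals \<open>\<alpha> / k\<close>.\<close>
  define Cc where "Cc = - of_nat k / (\<alpha> * of_nat N)"
  have Cc: "Cc \<noteq> 0" using \<alpha> k N0 by (simp add: Cc_def)
  define x0 where "x0 = (\<alpha> - of_nat k * ck) / (of_nat k * \<beta>)"
  have k0: "(of_nat k :: complex) \<noteq> 0" using k by simp
  have x0: "of_nat k * (ck + \<beta> * x0) = \<alpha>" using k0 \<beta> by (simp add: x0_def field_simps)
  \<comment> \<open>Bounds \<open>x0 * exp y\<close> for \<open>norm y \<le> 1\<close> in the first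
    case and \<open>norm x \<le> 1\<close> in the second.\<close>
  define X0 where "X0 = max 1 (norm x0 * exp 1)"
  have X0: "X0 \<ge> 1" "norm x0 * exp 1 \<le> X0" by (auto simp: X0_def)
  define C where "C = max (max (2 * exp 1 * norm Cc) (exp 1 / norm Cc)) X0"
  have C: "C > 0" "C \<ge> 2 * exp 1 * norm Cc" "C \<ge> exp 1 / norm Cc" "C \<ge> X0" using X0 by (auto simp: C_def less_max_iff_disj)
  define \<delta> where "\<delta> = 1 / (2 * real N)"
  have \<delta>: "\<delta> > 0" using N0 by (simp add: \<delta>_def)
  show ?thesis
  proof (rule that[OF C(1) \<delta>, of "2 * real k + 1"])
    fix A B a' b'
    assume A: "holomorphic2_on A UNIV" and B: "holomorphic2_on B UNIV" and a': "a' holomorphic_on UNIV" and b': "b' holomorphic_on UNIV"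
      and A0: "\<And>w. A (0, w) = w ^ (k - 1) * a' w" and B0: "\<And>w. B (0, w) = w ^ k * b' w"
      and a'0: "a' 0 = \<alpha>" and b'0: "b' 0 = ck" and dzB: "dz B (0, 0) = \<beta>"
    obtain A1 where A1: "holomorphic2_on A1 UNIV" "\<And>z w. A (z, w) = A (0, w) + z * A1 (z, w)" using holomorphic2_split_fst[OF A] by blast
    obtain B1 where B1: "holomorphic2_on B1 UNIV" "\<And>z w. B (z, w) = B (0, w) + z * B1 (z, w)" "B1 (0, 0) = \<beta>"
      using holomorphic2_split_fst[OF B] dzB by auto
    define Ah where "Ah = (\<lambda>x w. a' w + x * w * A1 (x * w ^ k, w))"
    define Bh where "Bh = (\<lambda>x w. b' w + x * B1 (x * w ^ k, w))"
    have fac: "A (x * w ^ k, w) = w ^ (k - 1) * Ah x w" "B (x * w ^ k, w) = w ^ k * Bh x w" for x w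
    proof -
      have "w ^ k = w * w ^ (k - 1)" using k by (cases k) auto
      then show "A (x * w ^ k, w) = w ^ (k - 1) * Ah x w" unfolding A1(2)[of "x * w ^ k" w] A0 Ah_def by (simp add: algebra_simps)
      show "B (x * w ^ k, w) = w ^ k * Bh x w" unfolding B1(2)[of "x * w ^ k" w] B0 Bh_def by (simp add: algebra_simps)
    qed
    have P1': "holomorphic2_on (\<lambda>q. P (f q * g q ^ k, g q)) UNIV"
      if "holomorphic2_on P UNIV" "holomorphic2_on f UNIV" "holomorphic2_on g UNIV" for P f g
      by (rule holomorphic2_compose[OF that(1)], intro holomorphic2_intros that, rule that, simp)
    have AB: "holomorphic2_on (\<lambda>q. Ah (f q) (g q)) UNIV" "holomorphic2_on (\<lambda>q. Bh (f q) (g q)) UNIV"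
      if "holomorphic2_on f UNIV" "holomorphic2_on g UNIV" for f g
      unfolding Ah_def Bh_def
      by (intro holomorphic2_intros that P1' A1(1) B1(1) holomorphic2_compose1[OF a' open_UNIV] holomorphic2_compose1[OF b' open_UNIV]; simp)+
    have Ah0: "Ah x 0 = \<alpha>" "Bh x 0 = ck + x * \<beta>" for x
      using k by (simp_all add: Ah_def Bh_def a'0 b'0 B1(3) power_0_left)
    define AA where "AA = blowup_speed r k Cc Ah Bh"
    note AA_def = AA_def blowup_speed_def
    have AA0: "AA x0 0 = 1"
    proof -
      define p q where "p = (of_nat (r - 1) :: complex)" and "q = (of_nat (k - 1) :: complex)"
      have "of_nat k * (p * \<alpha> + q * (ck + x0 * \<beta>)) = p * of_nat k * \<alpha> + q * (of_nat k * (ck + \<beta> * x0))"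
        by (simp add: algebra_simps)
      also have "\<dots> = (p * of_nat k + q) * \<alpha>" unfolding x0 by (simp add: algebra_simps)
      finally have "of_nat k * (of_nat (r - 1) * \<alpha> + of_nat (k - 1) * (ck + x0 * \<beta>)) = \<alpha> * of_nat N"
        unfolding p_def q_def Nc by (simp add: mult.commute)
      then show ?thesis unfolding AA_def Ah0 Cc_def using k0 \<alpha> N0 by (simp add: divide_simps)
    qed
    \<comment> \<open>This identity makes the equation of \<open>w\<close> a consequence of the
      others once \<open>w\<close> is defined by
      \<open>x^(r-1) w^N = Cc * exp (- u - \<theta>)\<close>.\<close>
    have AAB: "AA x w + of_nat (r - 1) * (Cc * (Ah x w - of_nat k * Bh x w)) = - (Cc * of_nat N * Bh x w)" for x w
      unfolding AA_def Nc[symmetric] by (simp add: algebra_simps)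
    obtain U1 where U1: "\<And>X. X \<ge> U1 \<Longrightarrow> X0 * exp (- \<delta> * X) \<le> 1" by (rule eventually_exp_le[OF \<delta>, of X0]) blast
    obtain U2 where U2: "\<And>X. X \<ge> U2 \<Longrightarrow> (X0 ^ (r - 1) * exp 1 / norm Cc) * exp (- 1 * X) \<le> 1"
      by (rule eventually_exp_le[OF zero_less_one, of "X0 ^ (r - 1) * exp 1 / norm Cc"]) blast
    have goal: "\<exists>R0. \<forall>R\<ge>R0. \<exists>z w. model_curve r k C \<delta> (2 * real k + 1) A B R z w"
      if ex: "\<And>U. U \<ge> U3 \<Longrightarrow> \<exists>x w \<theta>. blowup_solution r k X0 \<delta> Cc Ah Bh U x w \<theta>" for U3
    proof (intro exI[of _ "exp (max (max U3 0) (max U1 U2))"] allI impI)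
      fix R assume R: "R \<ge> exp (max (max U3 0) (max U1 U2))"
      define U where "U = max (max U3 0) (max U1 U2)"
      have U: "U \<ge> U3" "U \<ge> 0" "U \<ge> U1" "U \<ge> U2" by (auto simp: U_def)
      obtain x w \<theta> where s: "blowup_solution r k X0 \<delta> Cc Ah Bh U x w \<theta>" using ex[OF U(1)] by blast
      have "model_curve r k C \<delta> (2 * real k + 1) A B R (\<lambda>t. x (Ln t) * w (Ln t) ^ k) (\<lambda>t. w (Ln t))"
      proof (rule model_curve_of_blowup_solution[OF r k Cc \<delta> C(2-4) X0(1) fac s U(2)])
        show "X0 * exp (- \<delta> * X) \<le> 1" "(X0 ^ (r - 1) * exp 1 / norm Cc) * exp (- 1 * X) \<le> 1" if "X \<ge> U" for X
          using that U by (intro U1 U2; linarith)+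
      qed (use R in \<open>simp add: U_def\<close>)
      then show "\<exists>z w. model_curve r k C \<delta> (2 * real k + 1) A B R z w" by blast
    qed
    have L0: "exp (Ln Cc) = Cc" using Cc by simp
    \<comment> \<open>Here \<open>y\<close> is the logarithm of \<open>x\<close> up to an additive
      constant: \<open>x = x0 * exp y\<close> in the first case, and
      \<open>y = - Ln (u + \<eta>)\<close> in the second. The constant is contained in
      \<open>c\<close>.\<close>
    have w_der: "DERIV (\<lambda>u. exp ((c - u - \<theta> u - of_nat (r - 1) * y u) / of_nat N)) u :> w' * (Cc * exp (- \<theta> u) * Bh x' w')"
      if "DERIV \<theta> u :> - 1 + exp (- \<theta> u) * AA x' w'" "DERIV y u :> Cc * exp (- \<theta> u) * (Ah x' w' - of_nat k * Bh x' w')"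
        "w' = exp ((c - u - \<theta> u - of_nat (r - 1) * y u) / of_nat N)" for c \<theta> y u x' w'
    proof -
      have "DERIV (\<lambda>u. (c - u - \<theta> u - of_nat (r - 1) * y u) / of_nat N) u :>
          (0 - 1 - (- 1 + exp (- \<theta> u) * AA x' w') - of_nat (r - 1) * (Cc * exp (- \<theta> u) * (Ah x' w' - of_nat k * Bh x' w'))) / of_nat N"
        by (intro DERIV_cdivide DERIV_diff DERIV_const DERIV_ident DERIV_cmult that(1,2))
      moreover have "0 - 1 - (- 1 + exp (- \<theta> u) * AA x' w') - of_nat (r - 1) * (Cc * exp (- \<theta> u) * (Ah x' w' - of_nat k * Bh x' w'))
          = - exp (- \<theta> u) * (AA x' w' + of_nat (r - 1) * (Cc * (Ah x' w' - of_nat k * Bh x' w')))" by (simp add: algebra_simps)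
      ultimately have "DERIV (\<lambda>u. (c - u - \<theta> u - of_nat (r - 1) * y u) / of_nat N) u :> Cc * exp (- \<theta> u) * Bh x' w'"
        unfolding AAB using N0 by (simp add: mult.left_commute mult.commute)
      from DERIV_chain2[OF DERIV_exp this] show ?thesis unfolding that(3) .
    qed
    show "\<exists>R0. \<forall>R\<ge>R0. \<exists>z w. model_curve r k C \<delta> (2 * real k + 1) A B R z w"
    proof (cases "x0 = 0")
      case False
      define A' where "A' = (\<lambda>q. AA (x0 * exp (snd q)) (fst q))"
      define B' where "B' = (\<lambda>q. Cc * (Ah (x0 * exp (snd q)) (fst q) - of_nat k * Bh (x0 * exp (snd q)) (fst q)))"
      have ex: "holomorphic2_on (\<lambda>q. x0 * exp (snd q)) UNIV"
        by (intro holomorphic2_intros holomorphic2_compose1[of exp UNIV]) (auto intro: holomorphic_intros)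
      have A': "holomorphic2_on A' UNIV" "A' (0, 0) = 1"
        unfolding A'_def AA_def using AA0 by (intro holomorphic2_intros AB ex, simp add: AA_def)
      have B': "holomorphic2_on B' UNIV" "B' (0, 0) = 0"
        unfolding B'_def using x0 by (intro holomorphic2_intros AB ex, simp add: Ah0 mult.commute)
      define \<mu> where "\<mu> = Cc * of_nat k * \<beta> * x0"
      have B'd: "dw B' (0, 0) = - \<mu>"
      proof -
        have "DERIV (\<lambda>\<eta>. Cc * (\<alpha> - of_nat k * (ck + x0 * exp \<eta> * \<beta>))) 0 :> - \<mu>"
          by (auto intro!: derivative_eq_intros simp: \<mu>_def)
        from DERIV_imp_deriv[OF this] show ?thesis by (simp add: B'_def Ah0)
      qed
      \<comment> \<open>As in the nondegenerate case, one of two rates avoids the resonance. It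
        measures the decay of \<open>y\<close> and is distinct from the rate \<open>\<delta>\<close>
        of the curve.\<close>
      define \<delta>' where "\<delta>' = (if Re \<mu> = 1 / (2 * real N) then 1 / (3 * real N) else 1 / (2 * real N))"
      have \<delta>': "0 < \<delta>'" "\<delta>' < 1" "\<delta>' < 1 / real N" "Re \<mu> \<noteq> \<delta>'" using N0 by (auto simp: \<delta>'_def field_simps)
      define c0 where "c0 = Ln Cc - of_nat (r - 1) * Ln x0"
      define Wf where "Wf = (\<lambda>\<theta> y u. exp ((c0 - u - \<theta> u - of_nat (r - 1) * y u) / of_nat N))"
      obtain U4 where U4: "\<And>U. U \<ge> U4 \<Longrightarrow> \<exists>\<theta> y. \<forall>u\<in>strip U.
        norm (\<theta> u) \<le> 1 \<and> norm (y u) \<le> 1 * exp (- \<delta>' * Re u) \<and> norm (Wf \<theta> y u) \<le> 1 \<and> norm (A' (Wf \<theta> y u, y u) - 1) \<le> 1 / 2 \<and>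
        DERIV \<theta> u :> - 1 + exp (- \<theta> u) * A' (Wf \<theta> y u, y u) \<and> DERIV y u :> exp (- \<theta> u) * B' (Wf \<theta> y u, y u)"
      proof (rule normal_form_ode[OF A' B' B'd _ \<delta>' zero_less_one, of c0 "of_nat (r - 1)"], goal_cases)
        case (2 U0)
        show ?case by (rule 2(1)) (use 2(2) in \<open>simp add: Wf_def\<close>)
      qed (use N0 in auto)
      define K5 where "K5 = norm Cc * exp 1 * (exp 1 / norm x0) ^ (r - 1)"
      obtain U5 where U5: "\<And>X. X \<ge> U5 \<Longrightarrow> K5 * exp (- (1 / 2) * X) \<le> 1" by (rule eventually_exp_le[of "1 / 2" K5]) (simp, blast)
      obtain U6 where U6: "\<And>X. X \<ge> U6 \<Longrightarrow> (exp 1 / norm x0) * exp (- 1 * X) \<le> 1"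
        by (rule eventually_exp_le[OF zero_less_one, of "exp 1 / norm x0"]) blast
      show ?thesis
      proof (rule goal[of "max (max U4 0) (max U5 U6)"])
        fix U assume U: "U \<ge> max (max U4 0) (max U5 U6)"
        then have "U \<ge> U4" by simp
        from U4[OF this] obtain \<theta> y where s: "\<forall>u\<in>strip U.
          norm (\<theta> u) \<le> 1 \<and> norm (y u) \<le> 1 * exp (- \<delta>' * Re u) \<and> norm (Wf \<theta> y u) \<le> 1 \<and> norm (A' (Wf \<theta> y u, y u) - 1) \<le> 1 / 2 \<and>
          DERIV \<theta> u :> - 1 + exp (- \<theta> u) * A' (Wf \<theta> y u, y u) \<and> DERIV y u :> exp (- \<theta> u) * B' (Wf \<theta> y u, y u)" by blast
        define w where "w = Wf \<theta> y"
        define x where "x = (\<lambda>u. x0 * exp (y u))"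
        have "blowup_solution r k X0 \<delta> Cc Ah Bh U x w \<theta>" unfolding blowup_solution_def AA_def(1)[symmetric] N_def[symmetric]
        proof (intro ballI conjI)
          fix u assume u: "u \<in> strip U"
          show th: "norm (\<theta> u) \<le> 1" and sA: "norm (AA (x u) (w u) - 1) \<le> 1 / 2" and \<theta>_der: "DERIV \<theta> u :> - 1 + exp (- \<theta> u) * AA (x u) (w u)"
            using bspec[OF s u] by (simp_all add: A'_def x_def w_def)
          have y_der: "DERIV y u :> Cc * exp (- \<theta> u) * (Ah (x u) (w u) - of_nat k * Bh (x u) (w u))" and y1: "norm (y u) \<le> exp (- \<delta>' * Re u)"
            using bspec[OF s u] by (simp_all add: B'_def x_def w_def mult_ac)
          show "DERIV x u :> x u * (Cc * exp (- \<theta> u) * (Ah (x u) (w u) - of_nat k * Bh (x u) (w u)))"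
            using DERIV_cmult[OF DERIV_chain2[OF DERIV_exp y_der], of x0] unfolding x_def by (rule DERIV_cong) simp
          show "DERIV w u :> w u * (Cc * exp (- \<theta> u) * Bh (x u) (w u))"
            unfolding w_def Wf_def by (rule w_der[OF \<theta>_der[unfolded w_def Wf_def] y_der[unfolded w_def Wf_def] refl])
          have xe: "x u ^ (r - 1) = exp (of_nat (r - 1) * Ln x0 + of_nat (r - 1) * y u)"
            using False by (simp add: x_def power_mult_distrib exp_add exp_of_nat_mult)
          have we: "w u ^ N = exp (c0 - u - \<theta> u - of_nat (r - 1) * y u)"
            unfolding w_def Wf_def exp_of_nat_mult[symmetric] using N0 by simp
          have "of_nat (r - 1) * Ln x0 + of_nat (r - 1) * y u + (c0 - u - \<theta> u - of_nat (r - 1) * y u) = Ln Cc + (- u - \<theta> u)"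
            by (simp add: c0_def)
          then show alg: "x u ^ (r - 1) * w u ^ N = Cc * exp (- u - \<theta> u)" unfolding xe we exp_add[symmetric] by (simp only: exp_add L0)
          have X: "Re u \<ge> U5" "Re u \<ge> U6" "Re u \<ge> 0" using u U by (auto simp: strip_def)
          have "exp (- \<delta>' * Re u) \<le> 1" using \<delta>' X by simp
          then have "norm (y u) \<le> 1" using y1 by linarith
          then have "Re (y u) \<le> 1" "Re (y u) \<ge> - 1" using abs_Re_le_cmod[of "y u"] by auto
          then have ey: "norm (exp (y u)) \<le> exp 1" "norm (exp (y u)) \<ge> exp (- 1)" by auto
          have "norm (x u) \<le> norm x0 * exp 1" unfolding x_def norm_mult by (intro mult_left_mono ey) auto
          then show "norm (x u) \<le> X0" using X0 by linarith
          have xlow: "norm x0 * exp (- 1) \<le> norm (x u)" unfolding x_def norm_mult by (intro mult_left_mono ey) auto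
          have "exp (- Re u) \<le> norm x0 * exp (- 1)" using U6[OF X(2)] False by (simp add: exp_minus field_simps)
          then show "norm (x u) \<ge> exp (- Re u)" using xlow by linarith
          have "(norm x0 * exp (- 1)) ^ (r - 1) * norm (w u) ^ N \<le> norm (x u) ^ (r - 1) * norm (w u) ^ N"
            by (intro mult_right_mono power_mono xlow) auto
          also have "\<dots> = norm Cc * norm (exp (- u - \<theta> u))" using arg_cong[OF alg, of norm] by (simp only: norm_mult norm_power)
          also have "\<dots> \<le> norm Cc * (exp 1 * exp (- Re u))" by (intro mult_left_mono norm_exp_minus_bounds(3) th) auto
          finally have "norm (w u) ^ N \<le> norm Cc * (exp 1 * exp (- Re u)) / (norm x0 * exp (- 1)) ^ (r - 1)"
            using False by (simp add: field_simps)
          also have "\<dots> = K5 * exp (- Re u)"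
            using False by (simp add: K5_def exp_minus field_simps power_mult_distrib power_divide)
          finally show "norm (w u) \<le> exp (- \<delta> * Re u)" unfolding \<delta>_def by (rule le_exp_of_power_le[OF N0(1) _ U5[OF X(1)]])
        qed
        then show "\<exists>x w \<theta>. blowup_solution r k X0 \<delta> Cc Ah Bh U x w \<theta>" by blast
      qed
    next
      case True
      have \<alpha>k: "\<alpha> = of_nat k * ck" using x0 True by simp
      define \<kappa> where "\<kappa> = Cc * of_nat k * \<beta>"
      have \<kappa>: "\<kappa> \<noteq> 0" using Cc k0 \<beta> by (simp add: \<kappa>_def)
      \<comment> \<open>For \<open>x0 = 0\<close> one has \<open>\<alpha> = k * ck\<close>, so at
        \<open>w = 0\<close> the bracket reduces to its term linear in \<open>x\<close>. Removing
        this term leaves a function divisible by \<open>w\<close>.\<close>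
      define D where "D = (\<lambda>q. Ah (snd q) (fst q) - of_nat k * Bh (snd q) (fst q) + of_nat k * \<beta> * snd q)"
      have "holomorphic2_on D UNIV" unfolding D_def by (intro holomorphic2_intros AB)
      moreover have "D (0, x) = 0" for x by (simp add: D_def Ah0 \<alpha>k algebra_simps)
      ultimately obtain P1 where P1: "holomorphic2_on P1 UNIV" "\<And>q. q \<in> UNIV \<Longrightarrow> D q = fst q * P1 q"
        using holomorphic2_factor_fst[OF _ open_UNIV, of D] by blast
      have P1': "Ah x w - of_nat k * Bh x w = w * P1 (w, x) - of_nat k * \<beta> * x" for x w
        using P1(2)[of "(w, x)"] by (simp add: D_def algebra_simps)
      define A' where "A' = (\<lambda>q. AA (fst q) (snd q))"
      define H where "H = (\<lambda>q. Cc * P1 (snd q, fst q))"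
      have A': "holomorphic2_on A' UNIV" "A' (0, 0) = 1"
        unfolding A'_def AA_def using AA0 True by (intro holomorphic2_intros AB, simp add: AA_def)
      have H: "holomorphic2_on H UNIV" unfolding H_def
        by (intro holomorphic2_intros holomorphic2_compose[OF P1(1)]) auto
      define m where "m = real (r - 1)"
      have m: "m \<ge> 0" by (simp add: m_def)
      define c0 where "c0 = Ln Cc + of_real m * Ln \<kappa>"
      have Npos: "real N > 0" using N0 by simp
      define Wf where "Wf = (\<lambda>\<theta> \<eta> u. exp ((c0 - u - \<theta> u + of_real m * Ln (u + \<eta> u)) / of_real (real N)))"
      define Xf where "Xf = (\<lambda>\<eta> u. 1 / (\<kappa> * (u + \<eta> u)))"
      obtain U4 where U4: "\<And>U. U \<ge> U4 \<Longrightarrow> \<exists>\<theta> \<eta>. \<forall>u\<in>strip U. norm (\<theta> u) \<le> 1 \<and> norm (\<eta> u) \<le> norm u / 2 \<and> Re (u + \<eta> u) > 0 \<and>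
          norm (Xf \<eta> u) \<le> 1 \<and> norm (Wf \<theta> \<eta> u) \<le> exp (- Re u / (2 * real N)) \<and> norm (A' (Xf \<eta> u, Wf \<theta> \<eta> u) - 1) \<le> 1 / 2 \<and>
          DERIV \<theta> u :> - 1 + exp (- \<theta> u) * A' (Xf \<eta> u, Wf \<theta> \<eta> u) \<and>
          DERIV \<eta> u :> exp (- \<theta> u) * (1 - (u + \<eta> u) * Wf \<theta> \<eta> u * H (Xf \<eta> u, Wf \<theta> \<eta> u)) - 1"
        unfolding Wf_def Xf_def
      proof (rule logarithmic_ode[OF A' H Npos \<kappa> zero_less_one m, of c0], goal_cases)
        case (1 U0)
        show ?case by (rule 1(1)) (rule 1(2))
      qed
      have "((\<lambda>X. norm \<kappa> * (3 / 2 * (X + 2)) * exp (- X)) \<longlongrightarrow> 0) at_top" using \<kappa> by real_asymp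
      then have "\<forall>\<^sub>F X in at_top. norm \<kappa> * (3 / 2 * (X + 2)) * exp (- X) < 1" by (rule order_tendstoD) simp
      then obtain U5 where U5: "\<And>X. X \<ge> U5 \<Longrightarrow> norm \<kappa> * (3 / 2 * (X + 2)) * exp (- X) < 1" unfolding eventually_at_top_linorder by blast
      show ?thesis
      proof (rule goal[of "max U4 (max U5 0)"])
        fix U assume U: "U \<ge> max U4 (max U5 0)"
        then have "U \<ge> U4" by simp
        from U4[OF this] obtain \<theta> \<eta> where s: "\<forall>u\<in>strip U. norm (\<theta> u) \<le> 1 \<and> norm (\<eta> u) \<le> norm u / 2 \<and> Re (u + \<eta> u) > 0 \<and>
          norm (Xf \<eta> u) \<le> 1 \<and> norm (Wf \<theta> \<eta> u) \<le> exp (- Re u / (2 * real N)) \<and> norm (A' (Xf \<eta> u, Wf \<theta> \<eta> u) - 1) \<le> 1 / 2 \<and>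
          DERIV \<theta> u :> - 1 + exp (- \<theta> u) * A' (Xf \<eta> u, Wf \<theta> \<eta> u) \<and>
          DERIV \<eta> u :> exp (- \<theta> u) * (1 - (u + \<eta> u) * Wf \<theta> \<eta> u * H (Xf \<eta> u, Wf \<theta> \<eta> u)) - 1" by (elim exE) (rule that)
        define w where "w = Wf \<theta> \<eta>"
        define x where "x = Xf \<eta>"
        have raw: "norm (\<eta> u) \<le> norm u / 2" "Re (u + \<eta> u) > 0" "norm (x u) \<le> 1" "norm (w u) \<le> exp (- Re u / (2 * real N))"
          "DERIV \<eta> u :> exp (- \<theta> u) * (1 - (u + \<eta> u) * w u * H (x u, w u)) - 1"
          "norm (\<theta> u) \<le> 1" "norm (AA (x u) (w u) - 1) \<le> 1 / 2" "DERIV \<theta> u :> - 1 + exp (- \<theta> u) * AA (x u) (w u)" if "u \<in> strip U" for u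
          using bspec[OF s that] unfolding w_def x_def A'_def fst_conv snd_conv by (simp_all only: simp_thms)
        have w_def: "w = (\<lambda>u. exp ((c0 - u - \<theta> u - of_nat (r - 1) * (- Ln (u + \<eta> u))) / of_nat N))" by (simp add: w_def Wf_def m_def)
        have x_def: "x = (\<lambda>u. 1 / (\<kappa> * (u + \<eta> u)))" by (simp add: x_def Xf_def)
        have "blowup_solution r k X0 \<delta> Cc Ah Bh U x w \<theta>" unfolding blowup_solution_def AA_def(1)[symmetric] N_def[symmetric]
        proof (intro ballI conjI)
          fix u assume u: "u \<in> strip U"
          let ?s = "u + \<eta> u"
          have s: "?s \<noteq> 0" "?s \<notin> \<real>\<^sub>\<le>\<^sub>0" by (rule Re_pos_cut[OF raw(2)[OF u]])+
          define L where "L = Cc * exp (- \<theta> u) * (Ah (x u) (w u) - of_nat k * Bh (x u) (w u))"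
          have sx: "?s * x u * \<kappa> = 1" using s \<kappa> by (simp add: x_def)
          \<comment> \<open>This rewrites the equation of \<open>\<eta>\<close> as
            \<open>s' = - L s\<close> for \<open>s = u + \<eta>\<close>, which is
            \<open>x' = x L\<close> because \<open>x = 1 / (\<kappa> s)\<close>.\<close>
          have \<eta>L: "exp (- \<theta> u) * (1 - ?s * w u * H (x u, w u)) = - L * ?s"
          proof -
            have "- L * ?s = exp (- \<theta> u) * (?s * x u * \<kappa> - ?s * w u * H (x u, w u))"
              unfolding L_def P1' H_def \<kappa>_def by (simp add: algebra_simps)
            then show ?thesis unfolding sx by simp
          qed
          have s_der: "DERIV (\<lambda>u. u + \<eta> u) u :> - L * ?s"
            using DERIV_add[OF DERIV_ident raw(5)[OF u]] unfolding \<eta>L by simp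
          have "((\<lambda>u. inverse \<kappa> * inverse (u + \<eta> u)) has_field_derivative
              inverse \<kappa> * (- (inverse ?s * (- L * ?s) * inverse ?s))) (at u)"
            by (intro DERIV_cmult DERIV_inverse' s_der s)
          moreover have "inverse \<kappa> * (- (inverse ?s * (- L * ?s) * inverse ?s)) = x u * L"
          proof -
            have "inverse \<kappa> * (- (inverse t * (- L * t) * inverse t)) = 1 / (\<kappa> * t) * L" if "t \<noteq> 0" for t
              using that \<kappa> by (simp add: field_simps)
            then show ?thesis using s(1) by (simp only: x_def)
          qed
          moreover have "(\<lambda>u. inverse \<kappa> * inverse (u + \<eta> u)) = x" by (simp add: x_def fun_eq_iff field_simps)
          ultimately have xd: "DERIV x u :> x u * L" by (simp only:)
          then show "DERIV x u :> x u * (Cc * exp (- \<theta> u) * (Ah (x u) (w u) - of_nat k * Bh (x u) (w u)))"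
            unfolding L_def .
          show \<theta>_der: "DERIV \<theta> u :> - 1 + exp (- \<theta> u) * AA (x u) (w u)" and "norm (AA (x u) (w u) - 1) \<le> 1 / 2" "norm (\<theta> u) \<le> 1"
            by (rule raw[OF u])+
          have "DERIV (\<lambda>u. Ln (u + \<eta> u)) u :> inverse ?s * (- L * ?s)"
            by (rule DERIV_chain2[OF has_field_derivative_Ln[OF s(2)] s_der])
          from DERIV_minus[OF this] have "DERIV (\<lambda>u. - Ln (u + \<eta> u)) u :> L"
            by (rule DERIV_cong) (use s in simp)
          from w_der[OF \<theta>_der this[unfolded L_def]]
          show "DERIV w u :> w u * (Cc * exp (- \<theta> u) * Bh (x u) (w u))"
            unfolding w_def[symmetric] by (simp add: w_def)
          have "exp (of_nat (r - 1) * Ln \<kappa> + of_nat (r - 1) * Ln ?s) = (\<kappa> * ?s) ^ (r - 1)"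
            using \<kappa> s by (simp add: power_mult_distrib exp_add exp_of_nat_mult)
          moreover have "w u ^ N = exp (c0 - u - \<theta> u + of_real m * Ln ?s)"
            unfolding w_def exp_of_nat_mult[symmetric] using N0 by (simp add: m_def)
          then have "w u ^ N = exp (Ln Cc) * exp (- u - \<theta> u) * exp (of_nat (r - 1) * Ln \<kappa> + of_nat (r - 1) * Ln ?s)"
            by (simp add: c0_def m_def exp_add[symmetric] algebra_simps)
          ultimately have "w u ^ N = Cc * exp (- u - \<theta> u) * (\<kappa> * ?s) ^ (r - 1)" by (simp only: L0)
          moreover have "x u ^ (r - 1) * (\<kappa> * ?s) ^ (r - 1) = 1"
            unfolding power_mult_distrib[symmetric] using sx by (simp add: mult_ac)
          ultimately show "x u ^ (r - 1) * w u ^ N = Cc * exp (- u - \<theta> u)"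
            by (metis mult.left_commute mult.right_neutral)
          have X: "Re u \<ge> U5" "Re u \<ge> 0" using u U by (auto simp: strip_def)
          show "norm (w u) \<le> exp (- \<delta> * Re u)" using raw(4)[OF u] by (simp add: \<delta>_def)
          show "norm (x u) \<le> X0" using raw(3)[OF u] X0 by linarith
          have "norm u \<le> Re u + 2" using cmod_le[of u] u X(2) pi_less_4 by (auto simp: strip_def)
          moreover have "norm ?s \<le> 3 / 2 * norm u"
            by (rule order_trans[OF norm_triangle_ineq order_trans[OF add_left_mono[OF raw(1)[OF u]]]]) simp
          ultimately have "norm ?s \<le> 3 / 2 * (Re u + 2)" by simp
          then have "norm \<kappa> * norm ?s * exp (- Re u) \<le> norm \<kappa> * (3 / 2 * (Re u + 2)) * exp (- Re u)"
            by (intro mult_right_mono mult_left_mono) auto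
          also have "\<dots> \<le> 1" using U5[OF X(1)] by simp
          finally have "exp (- Re u) * norm (\<kappa> * ?s) \<le> 1" unfolding norm_mult by (simp only: mult_ac)
          moreover have "norm (\<kappa> * ?s) > 0" using s \<kappa> by simp
          moreover have "norm (x u) = 1 / norm (\<kappa> * ?s)" unfolding x_def norm_divide norm_one ..
          ultimately show "norm (x u) \<ge> exp (- Re u)" by (simp only: pos_le_divide_eq)
        qed
        then show "\<exists>x w \<theta>. blowup_solution r k X0 \<delta> Cc Ah Bh U x w \<theta>" by blast
      qed
    qed
  qed
qed

section \<open>The invariant curve in the blow-up\<close>

lemma norm_power_minus_one_le:
  fixes p :: complex
  assumes "norm p \<le> 2"
  shows "norm (p ^ m - 1) \<le> (2 ^ m - 1) * norm (p - 1)"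
proof (induction m)
  case (Suc m)
  have "p ^ Suc m - 1 = p * (p ^ m - 1) + (p - 1)" by (simp add: algebra_simps)
  then have "norm (p ^ Suc m - 1) \<le> norm p * norm (p ^ m - 1) + norm (p - 1)"
    by (metis norm_mult norm_triangle_ineq)
  also have "\<dots> \<le> 2 * ((2 ^ m - 1) * norm (p - 1)) + norm (p - 1)"
    using Suc assms by (intro add_right_mono mult_mono) auto
  finally show ?case by (simp add: algebra_simps)
qed simp

lemma norm_inverse_powers_minus_one_le:
  fixes x y :: complex
  assumes x: "norm x \<le> 1 / 2" and y: "norm y \<le> 1 / 2"
  shows "norm (1 / ((1 + x) ^ m * (1 + y) ^ l) - 1) \<le> 2 ^ Suc (m + l) * (norm x + norm y)"
proof -
  have *: "norm (1 / (1 + x)) \<le> 2" "norm (1 / (1 + x) - 1) \<le> 2 * norm x" if "norm x \<le> 1 / 2" for x :: complex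
  proof -
    have g: "norm (1 + x) \<ge> 1 / 2" using that norm_triangle_ineq2[of 1 "- x"] by simp
    then have nz: "1 + x \<noteq> 0" by auto
    show i: "norm (1 / (1 + x)) \<le> 2" using g by (simp add: norm_divide divide_simps)
    have "1 / (1 + x) - 1 = - (1 / (1 + x) * x)" using nz by (simp add: divide_simps)
    then have "norm (1 / (1 + x) - 1) = norm (1 / (1 + x)) * norm x" by (simp only: norm_minus_cancel norm_mult)
    also have "\<dots> \<le> 2 * norm x" by (intro mult_right_mono i) auto
    finally show "norm (1 / (1 + x) - 1) \<le> 2 * norm x" .
  qed
  let ?p = "1 / (1 + x)" and ?s = "1 / (1 + y)"
  have pm: "norm (?p ^ m - 1) \<le> 2 ^ m * (2 * norm x)"
    by (rule order_trans[OF norm_power_minus_one_le[OF *(1)[OF x]]]) (intro mult_mono *(2) x; simp)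
  have sl: "norm (?s ^ l - 1) \<le> 2 ^ l * (2 * norm y)"
    by (rule order_trans[OF norm_power_minus_one_le[OF *(1)[OF y]]]) (intro mult_mono *(2) y; simp)
  have sn: "norm (?s ^ l) \<le> 2 ^ l" unfolding norm_power by (intro power_mono *(1) y) auto
  have "1 / ((1 + x) ^ m * (1 + y) ^ l) - 1 = (?p ^ m - 1) * ?s ^ l + (?s ^ l - 1)"
    by (simp add: power_one_over algebra_simps)
  then have "norm (1 / ((1 + x) ^ m * (1 + y) ^ l) - 1) \<le> norm (?p ^ m - 1) * norm (?s ^ l) + norm (?s ^ l - 1)"
    by (metis norm_mult norm_triangle_ineq)
  also have "\<dots> \<le> (2 ^ m * (2 * norm x)) * 2 ^ l + 2 ^ l * (2 * norm y)"
    by (intro add_mono mult_mono pm sl sn) auto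
  also have "\<dots> \<le> 2 ^ Suc (m + l) * norm x + 2 ^ Suc (m + l) * norm y"
  proof (rule add_mono)
    have "2 ^ Suc l * norm y \<le> 2 ^ Suc (m + l) * norm y" by (intro mult_right_mono power_increasing) auto
    then show "2 ^ l * (2 * norm y) \<le> 2 ^ Suc (m + l) * norm y" by simp
  qed (simp add: power_add)
  finally show ?thesis by (simp add: algebra_simps)
qed

text \<open>The terms free of \<open>z\<close> vanish in the Taylor polynomial truncated at
  \<open>m\<close>, so the polynomial is divisible by \<open>z\<close>. The remainder has order
  \<open>m\<close> in \<open>max (norm z) (norm w)\<close>, and for \<open>m > 0\<close> the power
  of \<open>norm z\<close> is at most \<open>norm z\<close> itself.\<close>

lemma order_bound:
  assumes g: "holomorphic2_on g (bidisc e)" and e: "e > 0" "e \<le> 1"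
    and tc: "\<And>j. j < m \<Longrightarrow> taylor_coeff2 g 0 j = 0"
  obtains M where "M > 0" "\<And>z w. norm z \<le> e / 2 \<Longrightarrow> norm w \<le> e / 2 \<Longrightarrow> norm (g (z, w)) \<le> M * (norm w ^ m + norm z)"
proof (cases "m = 0")
  case True
  have "e / 2 < e" using e by simp
  from holomorphic2_bounded_polydisc[OF g this] obtain M where M: "M > 0"
    "\<And>z w. norm z \<le> e / 2 \<Longrightarrow> norm w \<le> e / 2 \<Longrightarrow> norm (g (z, w)) \<le> M" by blast
  show ?thesis
  proof (rule that[OF M(1)])
    fix z w :: complex assume "norm z \<le> e / 2" "norm w \<le> e / 2"
    from M(2)[OF this] have "norm (g (z, w)) \<le> M * 1" by simp
    also have "\<dots> \<le> M * (norm w ^ m + norm z)" using M(1) True by (intro mult_left_mono) auto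
    finally show "norm (g (z, w)) \<le> M * (norm w ^ m + norm z)" .
  qed
next
  case False
  obtain P C where P: "\<And>i j. coeff (coeff P i) j = (if i < m \<and> j < m then taylor_coeff2 g i j else 0)"
    and C: "C > 0" "\<And>z w. norm z \<le> e / 2 \<Longrightarrow> norm w \<le> e / 2 \<Longrightarrow> norm (g (z, w) - eval2 P z w) \<le> C * max (norm z) (norm w) ^ m"
    by (rule taylor_polynomial_2[OF g e(1)]) blast
  obtain c Q where Q: "P = pCons c Q" by (rule pCons_cases)
  have "coeff c j = 0" for j using P[of 0 j] tc[of j] by (simp add: Q split: if_splits)
  then have "c = 0" by (simp add: poly_eq_iff)
  then have PQ: "eval2 P z w = z * eval2 Q z w" for z w by (simp add: Q eval2_pCons)
  have "holomorphic2_on (\<lambda>p. eval2 Q (fst p) (snd p)) (bidisc e)" by (rule holomorphic2_eval2)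
  moreover have "e / 2 < e" using e by simp
  ultimately obtain M where M: "M > 0"
    "\<And>z w. norm z \<le> e / 2 \<Longrightarrow> norm w \<le> e / 2 \<Longrightarrow> norm (eval2 Q (fst (z, w)) (snd (z, w))) \<le> M"
    by (rule holomorphic2_bounded_polydisc) blast
  show ?thesis
  proof (rule that[of "C + M"])
    fix z w :: complex assume zw: "norm z \<le> e / 2" "norm w \<le> e / 2"
    have "norm z ^ m \<le> norm z" using zw e False by (intro power_le_one_iff[THEN iffD2] power_decreasing[of 1 m "norm z", simplified]) auto
    then have "max (norm z) (norm w) ^ m \<le> norm w ^ m + norm z"
      by (auto simp: max_def add_increasing add_increasing2)
    then have "C * max (norm z) (norm w) ^ m \<le> C * (norm w ^ m + norm z)" using C(1) by (intro mult_left_mono) auto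
    moreover have "norm (z * eval2 Q z w) \<le> M * (norm w ^ m + norm z)"
    proof -
      have "norm (z * eval2 Q z w) \<le> norm z * M" unfolding norm_mult using M(2)[OF zw] by (intro mult_left_mono) auto
      also have "\<dots> \<le> M * (norm w ^ m + norm z)" using M(1) by (simp add: mult.commute mult_left_mono)
      finally show ?thesis .
    qed
    moreover have "norm (g (z, w)) \<le> norm (g (z, w) - eval2 P z w) + norm (z * eval2 Q z w)"
      using norm_triangle_ineq[of "g (z, w) - eval2 P z w" "eval2 P z w"] by (simp add: PQ)
    ultimately show "norm (g (z, w)) \<le> (C + M) * (norm w ^ m + norm z)" using C(2)[OF zw] by (simp add: algebra_simps)
  qed (use C M in auto)
qed

text \<open>If two parameters have the same image, so have all their translates by \<open>n\<close>.
  The approximate time \<open>G\<close> has size \<open>t\<close>, and the correction changes it by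
  a relative error \<open>(Re t)^-q\<close> with \<open>q \<ge> 2\<close>. Along
  \<open>t + n\<close> the difference of the two values of \<open>G\<close> therefore tends to 0,
  whereas \<open>sep\<close> bounds it from below by a multiple of
  \<open>norm (t - t')\<close>.\<close>

lemma invariant_curve_injective:
  fixes z0 w0 om x y :: "complex \<Rightarrow> complex" and F :: "complex \<times> complex \<Rightarrow> complex \<times> complex"
  assumes R: "R \<ge> 2" and q: "q \<ge> 2" and C0: "C0 > 0"
    and lo: "\<And>t. t \<in> half_plane R \<Longrightarrow> norm (z0 t ^ m * w0 t ^ l) \<ge> 1 / (C0 * norm t)"
    and sep: "\<And>t t'. t \<in> half_plane R \<Longrightarrow> t' \<in> half_plane R \<Longrightarrow>
      norm (t - t') \<le> C0 * norm (1 / (z0 t ^ m * w0 t ^ l) - 1 / (z0 t' ^ m * w0 t' ^ l))"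
    and om: "l = 0 \<or> om = w0"
    and x: "\<And>t. t \<in> half_plane R \<Longrightarrow> norm (x t) \<le> 1 / Re t ^ q"
    and y: "\<And>t. t \<in> half_plane R \<Longrightarrow> norm (y t) \<le> 1 / Re t ^ q"
    and F: "\<And>t. t \<in> half_plane R \<Longrightarrow>
      (z0 (t + 1) * (1 + x (t + 1)), w0 (t + 1) + om (t + 1) * y (t + 1)) = F (z0 t * (1 + x t), w0 t + om t * y t)"
  shows "inj_on (\<lambda>t. (z0 t * (1 + x t), w0 t + om t * y t)) (half_plane R)"
proof (rule inj_onI)
  define \<Phi> where "\<Phi> = (\<lambda>t. (z0 t * (1 + x t), w0 t + om t * y t))"
  define G where "G = (\<lambda>t. 1 / (z0 t ^ m * w0 t ^ l))"
  define K where "K = (2 :: real) ^ Suc (m + l)"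
  fix t t' assume t: "t \<in> half_plane R" "t' \<in> half_plane R"
    and eq: "(z0 t * (1 + x t), w0 t + om t * y t) = (z0 t' * (1 + x t'), w0 t' + om t' * y t')"
  have it: "\<Phi> (t + of_nat n) = \<Phi> (t' + of_nat n)" for n
  proof (induction n)
    case 0 show ?case using eq by (simp add: \<Phi>_def)
  next
    case (Suc n)
    have "\<Phi> (t + of_nat (Suc n)) = F (\<Phi> (t + of_nat n))" "\<Phi> (t' + of_nat (Suc n)) = F (\<Phi> (t' + of_nat n))"
      using F[OF half_plane_add[OF t(1), of n]] F[OF half_plane_add[OF t(2), of n]] by (simp_all add: \<Phi>_def add_ac)
    then show ?case using Suc by simp
  qed
  have close: "norm (1 / (fst (\<Phi> s) ^ m * snd (\<Phi> s) ^ l) - G s) \<le> 2 * C0 * K * (norm s / Re s ^ 2)" if s: "s \<in> half_plane R" for s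
  proof -
    have Rs: "Re s \<ge> 2" using s R by (simp add: half_plane_def)
    have "Re s ^ 2 \<le> Re s ^ q" using Rs q by (intro power_increasing) auto
    then have "1 / Re s ^ q \<le> 1 / Re s ^ 2" using Rs by (intro divide_left_mono) auto
    then have xy: "norm (x s) \<le> 1 / Re s ^ 2" "norm (y s) \<le> 1 / Re s ^ 2" using x[OF s] y[OF s] by linarith+
    have "2 ^ 2 \<le> Re s ^ 2" using Rs by (intro power_mono) auto
    then have "1 / Re s ^ 2 \<le> 1 / 2 ^ 2" using Rs by (intro divide_left_mono) auto
    also have "1 / 2 ^ 2 \<le> (1 / 2 :: real)" by simp
    finally have "1 / Re s ^ 2 \<le> 1 / 2" .
    then have xy2: "norm (x s) \<le> 1 / 2" "norm (y s) \<le> 1 / 2" using xy by linarith+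
    have \<Phi>s: "fst (\<Phi> s) ^ m * snd (\<Phi> s) ^ l = (z0 s ^ m * w0 s ^ l) * ((1 + x s) ^ m * (1 + y s) ^ l)"
      using om by (auto simp: \<Phi>_def power_mult_distrib ring_distribs[symmetric] mult_ac
        distrib_left[of "w0 s" 1 "y s", simplified, symmetric])
    have "1 / (fst (\<Phi> s) ^ m * snd (\<Phi> s) ^ l) - G s = G s * (1 / ((1 + x s) ^ m * (1 + y s) ^ l) - 1)"
      unfolding \<Phi>s G_def by (simp add: right_diff_distrib)
    then have "norm (1 / (fst (\<Phi> s) ^ m * snd (\<Phi> s) ^ l) - G s) = norm (G s) * norm (1 / ((1 + x s) ^ m * (1 + y s) ^ l) - 1)"
      by (simp only: norm_mult)
    also have "\<dots> \<le> (C0 * norm s) * (K * (norm (x s) + norm (y s)))"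
    proof (intro mult_mono)
      have s0: "norm s > 0" using Rs complex_Re_le_cmod[of s] by linarith
      define n0 where "n0 = norm (z0 s ^ m * w0 s ^ l)"
      have c: "C0 * norm s > 0" using s0 C0 by simp
      have n0: "n0 \<ge> 1 / (C0 * norm s)" using lo[OF s] by (simp add: n0_def)
      then have "n0 > 0" using c by (meson less_le_trans zero_less_divide_1_iff)
      moreover have "1 \<le> n0 * (C0 * norm s)" using n0 c by (simp only: pos_divide_le_eq)
      ultimately have "1 / n0 \<le> C0 * norm s" by (simp only: pos_divide_le_eq mult.commute)
      then show "norm (G s) \<le> C0 * norm s" by (simp only: G_def norm_divide norm_one n0_def)
      show "norm (1 / ((1 + x s) ^ m * (1 + y s) ^ l) - 1) \<le> K * (norm (x s) + norm (y s))"
        unfolding K_def by (rule norm_inverse_powers_minus_one_le[OF xy2])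
    qed (use C0 in \<open>auto simp: K_def\<close>)
    also have "\<dots> \<le> (C0 * norm s) * (K * (1 / Re s ^ 2 + 1 / Re s ^ 2))"
      using C0 by (intro mult_left_mono add_mono xy) (auto simp: K_def)
    finally show ?thesis by (simp add: mult_ac)
  qed
  have lim: "(\<lambda>n. norm (s + of_nat n) / Re (s + of_nat n) ^ 2) \<longlonglongrightarrow> 0" if "s \<in> half_plane R" for s :: complex
  proof (rule Lim_null_comparison)
    show "\<forall>\<^sub>F n in sequentially. norm (norm (s + of_nat n) / Re (s + of_nat n) ^ 2) \<le> (norm s + real n) / (Re s + real n) ^ 2"
      using norm_triangle_ineq[of s "of_nat _"] by (auto intro!: always_eventually divide_right_mono)
    show "(\<lambda>n. (norm s + real n) / (Re s + real n) ^ 2) \<longlonglongrightarrow> 0" by real_asymp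
  qed
  have bnd: "norm (t - t') \<le> C0 * (2 * C0 * K * (norm (t + of_nat n) / Re (t + of_nat n) ^ 2)
      + 2 * C0 * K * (norm (t' + of_nat n) / Re (t' + of_nat n) ^ 2))" for n
  proof -
    note tn = half_plane_add[OF t(1), of n] half_plane_add[OF t(2), of n]
    have "norm (t - t') \<le> C0 * norm (G (t + of_nat n) - G (t' + of_nat n))"
      using sep[OF tn] by (simp add: G_def)
    also have "\<dots> \<le> C0 * (2 * C0 * K * (norm (t + of_nat n) / Re (t + of_nat n) ^ 2)
      + 2 * C0 * K * (norm (t' + of_nat n) / Re (t' + of_nat n) ^ 2))"
    proof (intro mult_left_mono)
      let ?P = "1 / (fst (\<Phi> (t + of_nat n)) ^ m * snd (\<Phi> (t + of_nat n)) ^ l)"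
      have "norm (?P - G (t' + of_nat n)) \<le> 2 * C0 * K * (norm (t' + of_nat n) / Re (t' + of_nat n) ^ 2)"
        unfolding it by (rule close[OF tn(2)])
      moreover have "norm (G (t + of_nat n) - G (t' + of_nat n)) \<le> norm (?P - G (t + of_nat n)) + norm (?P - G (t' + of_nat n))"
        using norm_triangle_ineq4[of "?P - G (t' + of_nat n)" "?P - G (t + of_nat n)"] by simp
      ultimately show "norm (G (t + of_nat n) - G (t' + of_nat n)) \<le> 2 * C0 * K * (norm (t + of_nat n) / Re (t + of_nat n) ^ 2)
        + 2 * C0 * K * (norm (t' + of_nat n) / Re (t' + of_nat n) ^ 2)"
        using close[OF tn(1)] by linarith
    qed (use C0 in simp)
    finally show ?thesis .
  qed
  have "(\<lambda>n. C0 * (2 * C0 * K * (norm (t + of_nat n) / Re (t + of_nat n) ^ 2)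
      + 2 * C0 * K * (norm (t' + of_nat n) / Re (t' + of_nat n) ^ 2))) \<longlonglongrightarrow> C0 * (2 * C0 * K * 0 + 2 * C0 * K * 0)"
    by (intro tendsto_intros lim t)
  then have "norm (t - t') \<le> C0 * (2 * C0 * K * 0 + 2 * C0 * K * 0)"
    by (rule LIMSEQ_le_const) (use bnd in blast)
  then show "t = t'" by simp
qed

text \<open>The parameter is a Fatou coordinate of the lifted map on the curve. The decay bounds
  contain \<open>Re t\<close>, since the correction of the model is controlled by
  \<open>Re t\<close> and not by \<open>norm t\<close>; this is what later forces the passage to a
  sector.\<close>

definition fatou_curve :: "nat \<Rightarrow> (complex \<times> complex \<Rightarrow> complex) \<Rightarrow> (complex \<times> complex \<Rightarrow> complex) \<Rightarrow>
    real \<Rightarrow> real \<Rightarrow> real \<Rightarrow> (complex \<Rightarrow> complex) \<Rightarrow> (complex \<Rightarrow> complex) \<Rightarrow> bool"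
  where "fatou_curve r a b e \<delta> R Z W \<longleftrightarrow> R \<ge> 1 \<and> Z holomorphic_on half_plane R \<and> W holomorphic_on half_plane R \<and>
    (\<forall>t\<in>half_plane R. Z t \<noteq> 0 \<and> norm (Z t) < e \<and> norm (W t) < e \<and>
      Z (t + 1) = Z t + Z t ^ r * a (Z t, W t) \<and> W (t + 1) = W t + Z t ^ (r - 1) * b (Z t, W t) \<and>
      norm (Z t) \<le> 2 * norm t powr (- \<delta>) + 1 / Re t \<and> norm (W t) \<le> 2 * norm t powr (- \<delta>) + 1 / Re t) \<and>
    inj_on (\<lambda>t. (Z t, W t)) (half_plane R)"

text \<open>The order of choices resolves the dependence between the constants: \<open>C0\<close>,
  \<open>\<delta>\<close>, \<open>c\<close> serve every field with the prescribed low coefficients;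
  they determine \<open>C\<close>, then \<open>q\<close>, then the interpolation order
  \<open>n\<close>. The field, \<open>R\<close> and the model curve come afterwards.\<close>

theorem invariant_curve_of_model:
  fixes a b :: "complex \<times> complex \<Rightarrow> complex"
  assumes r: "r \<ge> 2" and k: "k \<ge> 1" and e: "e > 0" "e \<le> 1"
    and a: "holomorphic2_on a (bidisc e)" and b: "holomorphic2_on b (bidisc e)"
    and tca: "\<And>j. j < k - 1 \<Longrightarrow> taylor_coeff2 a 0 j = 0" and tcb: "\<And>j. j < k \<Longrightarrow> taylor_coeff2 b 0 j = 0"
    and C0: "C0 > 0" and \<delta>: "\<delta> > 0"
    and model: "\<And>A B. (\<And>j. j \<le> k \<Longrightarrow> coeff (coeff A 0) j = taylor_coeff2 a 0 j) \<Longrightarrow>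
      (\<And>j. j \<le> k \<Longrightarrow> coeff (coeff B 0) j = taylor_coeff2 b 0 j) \<Longrightarrow> coeff (coeff B 1) 0 = taylor_coeff2 b 1 0 \<Longrightarrow>
      \<exists>R0. \<forall>R\<ge>R0. \<exists>z w. model_curve r k C0 \<delta> c (\<lambda>p. eval2 A (fst p) (snd p)) (\<lambda>p. eval2 B (fst p) (snd p)) R z w"
  obtains R Z W where "fatou_curve r a b e \<delta> R Z W"
proof -
  let ?V = "bidisc e"
  obtain Ma where Ma: "Ma > 0" "\<And>z w. norm z \<le> e / 2 \<Longrightarrow> norm w \<le> e / 2 \<Longrightarrow> norm (a (z, w)) \<le> Ma * (norm w ^ (k - 1) + norm z)"
    by (rule order_bound[OF a e tca]) blast+
  obtain Mb where Mb: "Mb > 0" "\<And>z w. norm z \<le> e / 2 \<Longrightarrow> norm w \<le> e / 2 \<Longrightarrow> norm (b (z, w)) \<le> Mb * (norm w ^ k + norm z)"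
    by (rule order_bound[OF b e tcb]) blast+
  define M where "M = max Ma Mb * (2 + 2 ^ Suc k * C0)"
  have Mmax: "max Ma Mb > 0" using Ma by simp
  have Mpos: "M > 0" unfolding M_def using Mmax C0 by (intro mult_pos_pos add_pos_pos) auto
  define K1 where "K1 = 2 ^ (r - 1) * 2 ^ (k - 1) * C0"
  have K1: "K1 > 0" using C0 by (simp add: K1_def)
  \<comment> \<open>The summand 1 pays for the defect of the model in the estimate of
    \<open>om (t + 1) - om t\<close>; the \<open>b\<close>-term alone stays below
    \<open>C - 1\<close>.\<close>
  define C where "C = 2 * M * K1 + 1"
  have C: "C \<ge> 0" "C \<ge> 1" using Mpos K1 by (simp_all add: C_def)
  \<comment> \<open>With the model coordinates below \<open>e / 8\<close> and corrections of size
    \<open>\<rho>\<close>, the corrected curve stays within \<open>e / 4\<close>.\<close>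
  define \<rho> where "\<rho> = e / 8"
  have \<rho>: "0 < \<rho>" "\<rho> \<le> 1 / 2" "\<rho> \<le> e / 8" using e by (simp_all add: \<rho>_def)
  define q where "q = nat \<lceil>4 + 32 * (8 * C + 4) / \<rho>\<rceil>"
  have q: "real q \<ge> 4 + 32 * (8 * C + 4) / \<rho>" unfolding q_def by linarith
  have "32 * (8 * C + 4) / \<rho> \<ge> 0" using C \<rho> by simp
  then have q4: "real q \<ge> 4" "q \<ge> 2" using q by linarith+
  \<comment> \<open>The interpolation error \<open>norm t powr (- \<delta> * n)\<close> must lie
    below the lower bound \<open>norm t powr (- c)\<close> of the curve times
    \<open>norm t ^ (- q - 1)\<close>, with one factor \<open>1 / norm t\<close> to spare. The
    summand \<open>k + 2\<close> keeps the prescribed low coefficients inside the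
    truncation.\<close>
  define n where "n = nat \<lceil>(c + real q + 2) / \<delta>\<rceil> + k + 2"
  have "real n \<ge> (c + real q + 2) / \<delta>" unfolding n_def by linarith
  then have n: "\<delta> * real n \<ge> c + real q + 2" using \<delta> by (simp add: field_simps)
  have nk: "n \<ge> k + 2" by (simp add: n_def)
  obtain A0 Ca where A0: "\<And>i j. coeff (coeff A0 i) j = (if i < n \<and> j < n then taylor_coeff2 a i j else 0)" "Ca > 0"
    "\<And>z w. norm z \<le> e / 2 \<Longrightarrow> norm w \<le> e / 2 \<Longrightarrow> norm (a (z, w) - eval2 A0 z w) \<le> Ca * max (norm z) (norm w) ^ n"
    by (rule taylor_polynomial_2[OF a e(1), of n]) blast
  obtain B0 Cb where B0: "\<And>i j. coeff (coeff B0 i) j = (if i < n \<and> j < n then taylor_coeff2 b i j else 0)" "Cb > 0"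
    "\<And>z w. norm z \<le> e / 2 \<Longrightarrow> norm w \<le> e / 2 \<Longrightarrow> norm (b (z, w) - eval2 B0 z w) \<le> Cb * max (norm z) (norm w) ^ n"
    by (rule taylor_polynomial_2[OF b e(1), of n]) blast
  have B00: "eval2 B0 0 0 = 0" using B0(1)[of 0 0] tcb[of 0] k by (simp add: eval2_def poly_0_coeff_0)
  obtain A B Cf where AB: "\<exists>Q. A = A0 + pvarz * Q" "\<exists>Q. B = B0 + pvarz * Q \<and> eval2 Q 0 0 = 0" "Cf \<ge> 0"
    and flow: "\<And>z w \<tau> s. s \<le> 1 \<Longrightarrow> (\<And>t. t \<in> closed_segment \<tau> (\<tau> + 1) \<Longrightarrow> solves_field_at r A B s z w t) \<Longrightarrow>
      norm (z (\<tau> + 1) - (z \<tau> + z \<tau> ^ r * eval2 A0 (z \<tau>) (w \<tau>))) \<le> Cf * s ^ n \<and>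
      norm (w (\<tau> + 1) - (w \<tau> + z \<tau> ^ (r - 1) * eval2 B0 (z \<tau>) (w \<tau>))) \<le> Cf * s ^ n"
    by (rule interpolating_flow[OF r B00, of A0 n]) blast
  have "\<exists>R0. \<forall>R\<ge>R0. \<exists>z w. model_curve r k C0 \<delta> c (\<lambda>p. eval2 A (fst p) (snd p)) (\<lambda>p. eval2 B (fst p) (snd p)) R z w"
  proof (rule model)
    show "coeff (coeff A 0) j = taylor_coeff2 a 0 j" if "j \<le> k" for j
      using AB(1) that nk by (auto simp: A0(1))
    show "coeff (coeff B 0) j = taylor_coeff2 b 0 j" if "j \<le> k" for j
      using AB(2) that nk by (auto simp: B0(1))
    show "coeff (coeff B 1) 0 = taylor_coeff2 b 1 0"
      using AB(2) nk by (auto simp: B0(1) eval2_def poly_0_coeff_0)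
  qed
  then obtain R0 where R0: "\<And>R. R \<ge> R0 \<Longrightarrow>
    \<exists>z w. model_curve r k C0 \<delta> c (\<lambda>p. eval2 A (fst p) (snd p)) (\<lambda>p. eval2 B (fst p) (snd p)) R z w" by blast
  have "((\<lambda>x. x powr (- \<delta>)) \<longlongrightarrow> 0) at_top" using \<delta> by real_asymp
  then have "\<forall>\<^sub>F x in at_top. x powr (- \<delta>) < e / 8" by (rule order_tendstoD) (use e in simp)
  then obtain R1 where R1: "\<And>x. x \<ge> R1 \<Longrightarrow> x powr (- \<delta>) < e / 8" unfolding eventually_at_top_linorder by blast
  \<comment> \<open>\<open>R \<ge> Ca + Cb + Cf\<close> lets the spare factor
    \<open>1 / norm t\<close> absorb the constants of the interpolation error.\<close>
  define R where "R = Max {R0, R1, real q, 2 / \<rho>, 2 * (C + 1), Ca + Cb + Cf}"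
  have R: "R \<ge> R0" "R \<ge> R1" "R \<ge> real q" "R \<ge> 2 / \<rho>" "R \<ge> 2 * (C + 1)" "R \<ge> Ca + Cb + Cf" by (simp_all add: R_def)
  have R4: "R \<ge> 4" using R(3) q4 by linarith
  obtain z0 w0 where mc: "model_curve r k C0 \<delta> c (\<lambda>p. eval2 A (fst p) (snd p)) (\<lambda>p. eval2 B (fst p) (snd p)) R z0 w0"
    using R0[OF R(1)] by blast
  have mt: "DERIV z0 t :> z0 t ^ r * eval2 A (z0 t) (w0 t)"
      "DERIV w0 t :> z0 t ^ (r - 1) * eval2 B (z0 t) (w0 t)"
      "norm (z0 t) \<le> norm t powr (- \<delta>)" "norm (w0 t) \<le> norm t powr (- \<delta>)"
      "norm (z0 t) \<ge> norm t powr (- c)" "k \<ge> 2 \<Longrightarrow> norm (w0 t) \<ge> norm t powr (- c)"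
      "k \<ge> 2 \<Longrightarrow> norm (z0 t) \<le> C0 * norm (w0 t) ^ k"
      "norm (z0 t ^ (r - 1) * w0 t ^ (k - 1)) \<le> C0 / norm t"
      "norm (z0 t ^ (r - 1) * w0 t ^ (k - 1)) \<ge> 1 / (C0 * norm t)" if "t \<in> half_plane R" for t
    using mc that unfolding model_curve_def by simp_all
  have sep: "norm (t - t') \<le> C0 * norm (1 / (z0 t ^ (r - 1) * w0 t ^ (k - 1)) - 1 / (z0 t' ^ (r - 1) * w0 t' ^ (k - 1)))"
    if "t \<in> half_plane R" "t' \<in> half_plane R" for t t'
    using mc that unfolding model_curve_def by blast
  have tf: "norm t \<ge> R" "norm t \<ge> 4" "Re t \<ge> 4" "norm t powr (- \<delta>) < e / 8" if "t \<in> half_plane R" for t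
  proof -
    show "norm t \<ge> R" "Re t \<ge> 4" using that R4 complex_Re_le_cmod[of t] by (auto simp: half_plane_def)
    then show "norm t \<ge> 4" using R4 by linarith
    show "norm t powr (- \<delta>) < e / 8" by (rule R1) (use \<open>norm t \<ge> R\<close> R(2) in linarith)
  qed
  have small: "norm (z0 t) < e / 8" "norm (w0 t) < e / 8" if "t \<in> half_plane R" for t
    using mt(3,4)[OF that] tf(4)[OF that] by linarith+
  \<comment> \<open>For \<open>k = 1\<close> the model may have zeros of \<open>w0\<close>, so the
    correction of \<open>w\<close> is absolute. For \<open>k \<ge> 2\<close> it must be relative to
    \<open>w0\<close>, because the errors are only small compared with it.\<close>
  define om where "om = (if k = 1 then (\<lambda>t. 1) else w0)"
  have om1: "k = 1 \<Longrightarrow> om t = 1" and om2: "k \<ge> 2 \<Longrightarrow> om t = w0 t" for t by (auto simp: om_def)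
  have k12: "k = 1 \<or> k \<ge> 2" using k by linarith
  have z0nz: "z0 t \<noteq> 0" if "t \<in> half_plane R" for t
  proof -
    have "norm t powr (- c) > 0" using tf(2)[OF that] by auto
    then show ?thesis using mt(5)[OF that] by auto
  qed
  have omlo: "norm (om t) \<ge> norm t powr (- c)" if "t \<in> half_plane R" for t
    using k12 mt(5,6)[OF that] small(1)[OF that] e by (auto simp: om1 om2)
  have omnz: "om t \<noteq> 0" if "t \<in> half_plane R" for t
  proof -
    have "norm t powr (- c) > 0" using tf(2)[OF that] by auto
    then show ?thesis using omlo[OF that] by auto
  qed
  have hol: "z0 holomorphic_on half_plane R" "w0 holomorphic_on half_plane R"
    unfolding holomorphic_on_open[OF open_half_plane] by (intro allI ballI impI exI, erule mt(1), intro allI ballI impI exI, erule mt(2))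
  have holo: "om holomorphic_on half_plane R" using hol(2) by (simp add: om_def)
  have omle: "norm (om t) \<le> 1" if "t \<in> half_plane R" for t
    using k12 small(2)[OF that] e by (auto simp: om1 om2)
  have near: "norm (z0 t * (1 + x)) \<le> 2 * norm (z0 t)" "norm (w0 t + om t * y) \<le> norm (w0 t) + \<rho>"
      "norm (z0 t * (1 + x)) \<le> e / 4" "norm (w0 t + om t * y) \<le> e / 4"
      "k \<ge> 2 \<Longrightarrow> norm (w0 t + om t * y) \<le> 2 * norm (w0 t) \<and> norm (w0 t) \<le> 2 * norm (w0 t + om t * y)"
    if t: "t \<in> half_plane R" and x: "norm x \<le> \<rho>" and y: "norm y \<le> \<rho>" for t x y
  proof -
    have "norm (1 + x) \<le> 2" using norm_triangle_ineq[of 1 x] x \<rho> by simp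
    then have "norm (z0 t) * norm (1 + x) \<le> norm (z0 t) * 2" by (intro mult_left_mono) auto
    then show zz: "norm (z0 t * (1 + x)) \<le> 2 * norm (z0 t)" by (simp add: norm_mult)
    then show "norm (z0 t * (1 + x)) \<le> e / 4" using small(1)[OF t] by linarith
    have "norm (om t * y) \<le> 1 * \<rho>" unfolding norm_mult using omle[OF t] y by (intro mult_mono) auto
    then show ww: "norm (w0 t + om t * y) \<le> norm (w0 t) + \<rho>" using norm_triangle_ineq[of "w0 t" "om t * y"] by simp
    then show "norm (w0 t + om t * y) \<le> e / 4" using small(2)[OF t] \<rho> by linarith
    assume "k \<ge> 2"
    then have w: "w0 t + om t * y = w0 t * (1 + y)" by (simp add: om2 algebra_simps)
    have y2: "norm (1 + y) \<le> 2" "norm (1 + y) \<ge> 1 / 2"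
      using norm_triangle_ineq[of 1 y] norm_triangle_ineq2[of 1 "- y"] y \<rho> by auto
    have "norm (w0 t) * 1 \<le> norm (w0 t) * (2 * norm (1 + y))" using y2 by (intro mult_left_mono) auto
    moreover have "norm (w0 t) * norm (1 + y) \<le> norm (w0 t) * 2" using y2 by (intro mult_left_mono) auto
    ultimately show "norm (w0 t + om t * y) \<le> 2 * norm (w0 t) \<and> norm (w0 t) \<le> 2 * norm (w0 t + om t * y)"
      unfolding w norm_mult by simp
  qed
  \<comment> \<open>For \<open>k \<ge> 2\<close> the region
    \<open>norm z \<le> C0 * norm w ^ k\<close> turns the bounds of \<open>order_bound\<close> into
    pure powers of \<open>w\<close>. Multiplied by \<open>z^(r-1)\<close>, the coefficients then
    contain the product \<open>z^(r-1) w^(k-1)\<close> of size \<open>1 / t\<close>.\<close>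
  have prod: "norm (z0 t * (1 + x)) ^ (r - 1) * norm (w0 t + om t * y) ^ (k - 1) \<le> K1 / norm t"
    and bounds: "norm (a (z0 t * (1 + x), w0 t + om t * y)) \<le> M * norm (w0 t + om t * y) ^ (k - 1)"
      "norm (b (z0 t * (1 + x), w0 t + om t * y)) \<le> 2 * M * (norm (w0 t + om t * y) ^ (k - 1) * norm (om t))"
    if t: "t \<in> half_plane R" and x: "norm x \<le> \<rho>" and y: "norm y \<le> \<rho>" for t x y
  proof -
    define Z W where "Z = z0 t * (1 + x)" and "W = w0 t + om t * y"
    note nr = near[OF t x y, folded Z_def W_def]
    have Wk: "norm W ^ (k - 1) \<le> 2 ^ (k - 1) * norm (w0 t) ^ (k - 1)"
    proof (cases "k = 1")
      case False
      then have "norm W \<le> 2 * norm (w0 t)" using k12 nr(5) by blast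
      then show ?thesis unfolding power_mult_distrib[symmetric] by (intro power_mono) auto
    qed simp
    have "norm Z ^ (r - 1) * norm W ^ (k - 1) \<le> (2 * norm (z0 t)) ^ (r - 1) * (2 ^ (k - 1) * norm (w0 t) ^ (k - 1))"
      by (intro mult_mono power_mono nr(1) Wk) auto
    also have "\<dots> = 2 ^ (r - 1) * 2 ^ (k - 1) * norm (z0 t ^ (r - 1) * w0 t ^ (k - 1))"
      by (simp add: norm_mult norm_power power_mult_distrib)
    also have "\<dots> \<le> 2 ^ (r - 1) * 2 ^ (k - 1) * (C0 / norm t)" by (intro mult_left_mono mt(8)[OF t]) auto
    finally show "norm (z0 t * (1 + x)) ^ (r - 1) * norm (w0 t + om t * y) ^ (k - 1) \<le> K1 / norm t"
      by (simp add: K1_def Z_def W_def)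
    have half: "norm Z \<le> e / 2" "norm W \<le> e / 2" "norm Z \<le> 1" "norm W \<le> 1" using nr(3,4) e by linarith+
    have aM: "norm (a (Z, W)) \<le> max Ma Mb * (norm W ^ (k - 1) + norm Z)"
      by (rule order_trans[OF Ma(2)[OF half(1,2)]]) (auto intro: mult_right_mono)
    have bM: "norm (b (Z, W)) \<le> max Ma Mb * (norm W ^ k + norm Z)"
      by (rule order_trans[OF Mb(2)[OF half(1,2)]]) (auto intro: mult_right_mono)
    have "norm (a (Z, W)) \<le> M * norm W ^ (k - 1) \<and> norm (b (Z, W)) \<le> 2 * M * (norm W ^ (k - 1) * norm (om t))"
    proof (cases "k = 1")
      case True
      have "norm W ^ (k - 1) + norm Z \<le> 2 + 2 ^ Suc k * C0" "norm W ^ k + norm Z \<le> 2 + 2 ^ Suc k * C0"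
        using half C0 True by (auto intro: add_increasing2)
      then have "norm (a (Z, W)) \<le> M" "norm (b (Z, W)) \<le> M"
        unfolding M_def using Mmax by (meson aM bM order_trans mult_left_mono less_imp_le)+
      then show ?thesis using True Mpos by (simp add: om1)
    next
      case False
      then have k2: "k \<ge> 2" using k12 by blast
      have "norm Z \<le> 2 * (C0 * norm (w0 t) ^ k)" using nr(1) mt(7)[OF t k2] by linarith
      also have "\<dots> \<le> 2 * (C0 * (2 * norm W) ^ k)" using nr(5)[OF k2] C0 by (intro mult_left_mono power_mono) auto
      finally have Zk: "norm Z \<le> 2 ^ Suc k * C0 * norm W ^ k" by (simp add: power_mult_distrib mult_ac)
      have Wk1: "norm W ^ k \<le> norm W ^ (k - 1)" using half(4) by (intro power_decreasing) auto
      have z1: "norm Z \<le> 2 ^ Suc k * C0 * norm W ^ (k - 1)"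
        by (rule order_trans[OF Zk]) (intro mult_left_mono Wk1, use C0 in simp)
      have "norm (a (Z, W)) \<le> max Ma Mb * ((2 + 2 ^ Suc k * C0) * norm W ^ (k - 1))"
        by (rule order_trans[OF aM], rule mult_left_mono, unfold distrib_right)
          (use z1 Mmax zero_le_power[OF norm_ge_zero[of W], of "k - 1"] in linarith)+
      moreover have "norm (b (Z, W)) \<le> max Ma Mb * ((2 + 2 ^ Suc k * C0) * norm W ^ k)"
        by (rule order_trans[OF bM], rule mult_left_mono, unfold distrib_right)
          (use Zk Mmax zero_le_power[OF norm_ge_zero[of W], of "k"] in linarith)+
      moreover have "M * norm W ^ k \<le> 2 * M * (norm W ^ (k - 1) * norm (om t))"
      proof -
        have "norm W ^ k = norm W ^ (k - 1) * norm W" using k2 by (cases k) auto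
        also have "\<dots> \<le> norm W ^ (k - 1) * (2 * norm (om t))" using nr(5)[OF k2] k2 by (intro mult_left_mono) (auto simp: om2)
        finally show ?thesis using Mpos by simp
      qed
      ultimately show ?thesis by (simp add: M_def mult.assoc)
    qed
    then show "norm (a (z0 t * (1 + x), w0 t + om t * y)) \<le> M * norm (w0 t + om t * y) ^ (k - 1)"
      "norm (b (z0 t * (1 + x), w0 t + om t * y)) \<le> 2 * M * (norm (w0 t + om t * y) ^ (k - 1) * norm (om t))"
      by (simp_all add: Z_def W_def)
  qed
  have ba: "norm ((z0 t * (1 + x)) ^ (r - 1) * a (z0 t * (1 + x), w0 t + om t * y)) \<le> C / norm t"
    and bb: "norm ((z0 t * (1 + x)) ^ (r - 1) * b (z0 t * (1 + x), w0 t + om t * y)) \<le> (C - 1) * norm (om t) / norm t"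
    if t: "t \<in> half_plane R" and x: "norm x \<le> \<rho>" and y: "norm y \<le> \<rho>" for t x y
  proof -
    note pr = prod[OF t x y] and bo = bounds[OF t x y]
    have "norm ((z0 t * (1 + x)) ^ (r - 1) * a (z0 t * (1 + x), w0 t + om t * y))
        \<le> norm (z0 t * (1 + x)) ^ (r - 1) * (M * norm (w0 t + om t * y) ^ (k - 1))"
      unfolding norm_mult[of "_ ^ _"] norm_power by (intro mult_left_mono bo) auto
    also have "\<dots> = M * (norm (z0 t * (1 + x)) ^ (r - 1) * norm (w0 t + om t * y) ^ (k - 1))" by (simp only: mult_ac)
    also have "\<dots> \<le> M * (K1 / norm t)" using Mpos by (intro mult_left_mono pr) auto
    also have "\<dots> \<le> C / norm t" using Mpos K1 by (simp add: C_def divide_right_mono)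
    finally show "norm ((z0 t * (1 + x)) ^ (r - 1) * a (z0 t * (1 + x), w0 t + om t * y)) \<le> C / norm t" .
    have "norm ((z0 t * (1 + x)) ^ (r - 1) * b (z0 t * (1 + x), w0 t + om t * y))
        \<le> norm (z0 t * (1 + x)) ^ (r - 1) * (2 * M * (norm (w0 t + om t * y) ^ (k - 1) * norm (om t)))"
      unfolding norm_mult[of "_ ^ _"] norm_power by (intro mult_left_mono bo) auto
    also have "\<dots> = (2 * M * norm (om t)) * (norm (z0 t * (1 + x)) ^ (r - 1) * norm (w0 t + om t * y) ^ (k - 1))" by (simp only: mult_ac)
    also have "\<dots> \<le> (2 * M * norm (om t)) * (K1 / norm t)" using Mpos by (intro mult_left_mono pr) auto
    also have "\<dots> = (C - 1) * norm (om t) / norm t" by (simp add: C_def)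
    finally show "norm ((z0 t * (1 + x)) ^ (r - 1) * b (z0 t * (1 + x), w0 t + om t * y)) \<le> (C - 1) * norm (om t) / norm t" .
  qed
  have err: "norm (z0 (t + 1) - (z0 t + z0 t ^ r * a (z0 t, w0 t))) \<le> norm t powr (- c) / norm t ^ Suc q"
    "norm (w0 (t + 1) - (w0 t + z0 t ^ (r - 1) * b (z0 t, w0 t))) \<le> norm t powr (- c) / norm t ^ Suc q"
    if t: "t \<in> half_plane R" for t
  proof -
    define s where "s = norm t powr (- \<delta>)"
    have "s < e / 8" unfolding s_def by (rule tf(4)[OF t])
    moreover have "s \<ge> 0" unfolding s_def by (rule powr_ge_zero)
    ultimately have s: "s \<le> 1" "s \<ge> 0" "s \<le> e / 2" using e by linarith+
    have seg: "t' \<in> half_plane R \<and> norm t' powr (- \<delta>) \<le> s" if t': "t' \<in> closed_segment t (t + 1)" for t'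
    proof -
      obtain u where u: "0 \<le> u" "u \<le> 1" and tu: "t' = (1 - u) *\<^sub>R t + u *\<^sub>R (t + 1)"
        using t' unfolding in_segment by blast
      have t'u: "t' = t + of_real u" by (simp add: tu scaleR_conv_of_real algebra_simps)
      have "norm t \<le> norm t'" unfolding norm_complex_def using u tf(3)[OF t]
        by (intro real_sqrt_le_mono add_mono, intro power_mono) (simp_all add: t'u)
      moreover have "norm t > 0" using tf(2)[OF t] by linarith
      ultimately have "norm t' powr (- \<delta>) \<le> s" unfolding s_def using \<delta> by (intro powr_mono2') simp_all
      moreover have "t' \<in> half_plane R" using t u by (simp add: half_plane_def t'u)
      ultimately show ?thesis by blast
    qed
    have fl: "norm (z0 (t + 1) - (z0 t + z0 t ^ r * eval2 A0 (z0 t) (w0 t))) \<le> Cf * s ^ n \<and>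
      norm (w0 (t + 1) - (w0 t + z0 t ^ (r - 1) * eval2 B0 (z0 t) (w0 t))) \<le> Cf * s ^ n"
    proof (rule flow[OF s(1)])
      fix t' assume t': "t' \<in> closed_segment t (t + 1)"
      note m = mt[OF seg[OF t', THEN conjunct1]] and g = seg[OF t', THEN conjunct2]
      show "DERIV z0 t' :> z0 t' ^ r * eval2 A (z0 t') (w0 t') \<and>
        DERIV w0 t' :> z0 t' ^ (r - 1) * eval2 B (z0 t') (w0 t') \<and> norm (z0 t') \<le> s \<and> norm (w0 t') \<le> s"
        by (intro conjI m(1,2) order_trans[OF m(3) g] order_trans[OF m(4) g])
    qed
    have zs: "norm (z0 t) \<le> s" "norm (w0 t) \<le> s" using mt(3,4)[OF t] by (simp_all add: s_def)
    then have mx: "max (norm (z0 t)) (norm (w0 t)) ^ n \<le> s ^ n" by (intro power_mono) (simp_all add: le_max_iff_disj)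
    have ea: "norm (z0 t ^ r * (a (z0 t, w0 t) - eval2 A0 (z0 t) (w0 t))) \<le> Ca * s ^ n"
    proof -
      have "norm (z0 t ^ r * (a (z0 t, w0 t) - eval2 A0 (z0 t) (w0 t))) \<le> 1 * norm (a (z0 t, w0 t) - eval2 A0 (z0 t) (w0 t))"
        unfolding norm_mult norm_power using zs s by (intro mult_right_mono power_le_one) auto
      also have "\<dots> \<le> 1 * (Ca * max (norm (z0 t)) (norm (w0 t)) ^ n)" using zs s by (intro mult_left_mono A0(3)) auto
      also have "\<dots> \<le> 1 * (Ca * s ^ n)" using A0(2) by (intro mult_left_mono mx) auto
      finally show ?thesis by simp
    qed
    have eb: "norm (z0 t ^ (r - 1) * (b (z0 t, w0 t) - eval2 B0 (z0 t) (w0 t))) \<le> Cb * s ^ n"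
    proof -
      have "norm (z0 t ^ (r - 1) * (b (z0 t, w0 t) - eval2 B0 (z0 t) (w0 t))) \<le> 1 * norm (b (z0 t, w0 t) - eval2 B0 (z0 t) (w0 t))"
        unfolding norm_mult norm_power using zs s by (intro mult_right_mono power_le_one) auto
      also have "\<dots> \<le> 1 * (Cb * max (norm (z0 t)) (norm (w0 t)) ^ n)" using zs s by (intro mult_left_mono B0(3)) auto
      also have "\<dots> \<le> 1 * (Cb * s ^ n)" using B0(2) by (intro mult_left_mono mx) auto
      finally show ?thesis by simp
    qed
    have sn: "(Ca + Cb + Cf) * s ^ n \<le> norm t powr (- c) / norm t ^ Suc q"
    proof -
      have t1: "norm t \<ge> 1" "norm t > 0" using tf(2)[OF t] by auto
      have "s ^ n = norm t powr (- \<delta> * real n)" using t1 by (simp add: s_def powr_realpow[symmetric] powr_powr)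
      also have "\<dots> \<le> norm t powr (- c - real (Suc q) - 1)" using n t1 by (intro powr_mono) auto
      also have "\<dots> = norm t powr (- c) / norm t ^ Suc q / norm t"
        unfolding powr_diff using t1 by (simp only: powr_realpow powr_one)
      finally have "(Ca + Cb + Cf) * s ^ n \<le> (Ca + Cb + Cf) * (norm t powr (- c) / norm t ^ Suc q / norm t)"
        using A0(2) B0(2) AB(3) by (intro mult_left_mono) auto
      also have "\<dots> \<le> norm t * (norm t powr (- c) / norm t ^ Suc q / norm t)"
        using R(6) tf(1)[OF t] by (intro mult_right_mono) auto
      also have "\<dots> = norm t powr (- c) / norm t ^ Suc q" using t1 by (simp add: field_simps)
      finally show ?thesis .
    qed
    have sp: "s ^ n \<ge> 0" using s by simp
    have "norm (z0 (t + 1) - (z0 t + z0 t ^ r * a (z0 t, w0 t))) \<le> Cf * s ^ n + Ca * s ^ n"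
      using norm_triangle_ineq4[of "z0 (t + 1) - (z0 t + z0 t ^ r * eval2 A0 (z0 t) (w0 t))" "z0 t ^ r * (a (z0 t, w0 t) - eval2 A0 (z0 t) (w0 t))"] fl ea
      by (simp add: algebra_simps)
    also have "\<dots> \<le> (Ca + Cb + Cf) * s ^ n" using sp B0(2) by (simp add: algebra_simps)
    finally show "norm (z0 (t + 1) - (z0 t + z0 t ^ r * a (z0 t, w0 t))) \<le> norm t powr (- c) / norm t ^ Suc q" using sn by linarith
    have "norm (w0 (t + 1) - (w0 t + z0 t ^ (r - 1) * b (z0 t, w0 t))) \<le> Cf * s ^ n + Cb * s ^ n"
      using norm_triangle_ineq4[of "w0 (t + 1) - (w0 t + z0 t ^ (r - 1) * eval2 B0 (z0 t) (w0 t))" "z0 t ^ (r - 1) * (b (z0 t, w0 t) - eval2 B0 (z0 t) (w0 t))"] fl eb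
      by (simp add: algebra_simps)
    also have "\<dots> \<le> (Ca + Cb + Cf) * s ^ n" using sp A0(2) by (simp add: algebra_simps)
    finally show "norm (w0 (t + 1) - (w0 t + z0 t ^ (r - 1) * b (z0 t, w0 t))) \<le> norm t powr (- c) / norm t ^ Suc q" using sn by linarith
  qed
  have e1: "norm (z0 (t + 1) - (z0 t + z0 t ^ r * a (z0 t, w0 t))) \<le> norm (z0 t) / norm t ^ Suc q" if "t \<in> half_plane R" for t
    by (rule order_trans[OF err(1)[OF that]]) (intro divide_right_mono mt(5)[OF that], simp)
  have e2: "norm (w0 (t + 1) - (w0 t + z0 t ^ (r - 1) * b (z0 t, w0 t))) \<le> norm (om t) / norm t ^ Suc q" if "t \<in> half_plane R" for t
    by (rule order_trans[OF err(2)[OF that]]) (intro divide_right_mono omlo[OF that], simp)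
  have e3: "norm (om (t + 1) - om t) \<le> C * norm (om t) / norm t" if t: "t \<in> half_plane R" for t
  proof (cases "k = 1")
    case True
    then show ?thesis using C by (simp add: om1)
  next
    case False
    then have k2: "k \<ge> 2" using k12 by blast
    have t1: "norm t \<ge> 1" using tf(2)[OF t] by simp
    have "norm (om t) / norm t ^ Suc q \<le> norm (om t) / norm t"
    proof (rule divide_left_mono)
      show "norm t \<le> norm t ^ Suc q" by (rule self_le_power[OF t1]) simp
      have "norm t > 0" using t1 by linarith
      then show "0 < norm t ^ Suc q * norm t" by (intro mult_pos_pos zero_less_power)
    qed simp
    then have "norm (w0 (t + 1) - (w0 t + z0 t ^ (r - 1) * b (z0 t, w0 t))) \<le> norm (om t) / norm t" using e2[OF t] by linarith
    moreover have "norm (z0 t ^ (r - 1) * b (z0 t, w0 t)) \<le> (C - 1) * norm (om t) / norm t"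
      using bb[OF t, of 0 0] \<rho> by simp
    moreover have "norm (w0 (t + 1) - w0 t) \<le> norm (w0 (t + 1) - (w0 t + z0 t ^ (r - 1) * b (z0 t, w0 t))) + norm (z0 t ^ (r - 1) * b (z0 t, w0 t))"
      using norm_triangle_ineq[of "w0 (t + 1) - (w0 t + z0 t ^ (r - 1) * b (z0 t, w0 t))" "z0 t ^ (r - 1) * b (z0 t, w0 t)"] by simp
    ultimately have "norm (w0 (t + 1) - w0 t) \<le> norm (om t) / norm t + (C - 1) * norm (om t) / norm t" by linarith
    then show ?thesis by (simp add: om2[OF k2] add_divide_distrib[symmetric] algebra_simps)
  qed
  have bb': "norm ((z0 t * (1 + x)) ^ (r - 1) * b (z0 t * (1 + x), w0 t + om t * y)) \<le> C * norm (om t) / norm t"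
    if "t \<in> half_plane R" "norm x \<le> \<rho>" "norm y \<le> \<rho>" for t x y
    by (rule order_trans[OF bb[OF that]]) (intro divide_right_mono mult_right_mono, auto)
  have dom: "(z0 t * (1 + x), w0 t + om t * y) \<in> ?V" if "t \<in> half_plane R" "norm x \<le> \<rho>" "norm y \<le> \<rho>" for t x y
    using near(3,4)[OF that] e by auto
  have "r \<ge> 1" using r by simp
  obtain x y where xy: "x holomorphic_on half_plane R" "y holomorphic_on half_plane R"
    "\<And>t. t \<in> half_plane R \<Longrightarrow> norm (x t) \<le> 1 / Re t ^ q"
    "\<And>t. t \<in> half_plane R \<Longrightarrow> norm (y t) \<le> 1 / Re t ^ q"
    "\<And>t. t \<in> half_plane R \<Longrightarrow> norm (x t) \<le> \<rho> \<and> norm (y t) \<le> \<rho>"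
    "\<And>t Z W. t \<in> half_plane R \<Longrightarrow> Z = z0 t * (1 + x t) \<Longrightarrow> W = w0 t + om t * y t \<Longrightarrow>
      z0 (t + 1) * (1 + x (t + 1)) = Z + Z ^ r * a (Z, W) \<and>
      w0 (t + 1) + om (t + 1) * y (t + 1) = W + Z ^ (r - 1) * b (Z, W)"
    by (rule invariant_curve_near_model[OF open_Times[OF open_ball open_ball] a b \<open>r \<ge> 1\<close> \<rho>(1,2) C(1) q R(3-5) hol holo z0nz omnz dom ba bb' e1 e2 e3])
      blast+
  define Z W where "Z = (\<lambda>t. z0 t * (1 + x t))" and "W = (\<lambda>t. w0 t + om t * y t)"
  have xyr: "norm (x t) \<le> \<rho>" "norm (y t) \<le> \<rho>" if "t \<in> half_plane R" for t using xy(5)[OF that] by auto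
  have step: "Z (t + 1) = Z t + Z t ^ r * a (Z t, W t)" "W (t + 1) = W t + Z t ^ (r - 1) * b (Z t, W t)" if "t \<in> half_plane R" for t
    using xy(6)[OF that refl refl] by (simp_all add: Z_def W_def)
  show ?thesis
  proof (rule that[of R Z W], unfold fatou_curve_def, intro conjI ballI)
    show "R \<ge> 1" using R4 by simp
    show "Z holomorphic_on half_plane R" "W holomorphic_on half_plane R"
      unfolding Z_def W_def by (intro holomorphic_intros hol holo xy(1,2))+
    fix t assume t: "t \<in> half_plane R"
    note nr = near[OF t xyr[OF t]]
    have "norm (x t) < 1" using xyr(1)[OF t] \<rho> by linarith
    then have "1 + x t \<noteq> 0" by (metis add_eq_0_iff2 norm_minus_cancel norm_one less_irrefl)
    then show "Z t \<noteq> 0" "norm (Z t) < e" "norm (W t) < e" using z0nz[OF t] nr(3,4) e by (simp_all add: Z_def W_def)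
    show "Z (t + 1) = Z t + Z t ^ r * a (Z t, W t)" "W (t + 1) = W t + Z t ^ (r - 1) * b (Z t, W t)" by (rule step[OF t])+
    have "1 / Re t \<ge> 0" using tf(3)[OF t] by simp
    then show "norm (Z t) \<le> 2 * norm t powr (- \<delta>) + 1 / Re t" using nr(1) mt(3)[OF t] unfolding Z_def by linarith
    have "norm (om t * y t) \<le> 1 * (1 / Re t ^ q)" unfolding norm_mult using omle[OF t] xy(4)[OF t] by (intro mult_mono) auto
    also have "\<dots> \<le> 1 * (1 / Re t)"
    proof (intro mult_left_mono divide_left_mono)
      show "Re t \<le> Re t ^ q" by (rule self_le_power) (use tf(3)[OF t] q4 in auto)
      show "0 < Re t ^ q * Re t" using tf(3)[OF t] by (intro mult_pos_pos zero_less_power) auto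
    qed auto
    finally have "norm (W t) \<le> norm (w0 t) + 1 / Re t" using norm_triangle_ineq[of "w0 t" "om t * y t"] by (simp add: W_def)
    moreover have "norm (w0 t) \<ge> 0" by simp
    ultimately show "norm (W t) \<le> 2 * norm t powr (- \<delta>) + 1 / Re t" using mt(4)[OF t] by linarith
  next
    show "inj_on (\<lambda>t. (Z t, W t)) (half_plane R)" unfolding Z_def W_def
    proof (rule invariant_curve_injective[OF _ q4(2) C0 mt(9) sep _ xy(3,4)])
      show "R \<ge> 2" using R4 by simp
      show "k - 1 = 0 \<or> om = w0" using k12 by (auto simp: om_def)
      fix t assume t: "t \<in> half_plane R"
      show "(z0 (t + 1) * (1 + x (t + 1)), w0 (t + 1) + om (t + 1) * y (t + 1)) =
        (\<lambda>(Z, W). (Z + Z ^ r * a (Z, W), W + Z ^ (r - 1) * b (Z, W))) (z0 t * (1 + x t), w0 t + om t * y t)"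
        using step[OF t] by (simp add: Z_def W_def)
    qed
  qed
qed

lemma eval2_zero_fst: "eval2 P 0 w = poly (coeff P 0) w"
  by (simp add: eval2_def poly_0_coeff_0)

lemma dw_eval2_0: "dw (\<lambda>p. eval2 P (fst p) (snd p)) (0, 0) = coeff (coeff P 0) 1"
proof -
  have "DERIV (poly (coeff P 0)) 0 :> poly (pderiv (coeff P 0)) 0" by (rule poly_DERIV)
  from DERIV_imp_deriv[OF this] show ?thesis by (simp add: eval2_zero_fst[abs_def] poly_0_coeff_0 coeff_pderiv)
qed

lemma dz_eval2_0: "dz (\<lambda>p. eval2 P (fst p) (snd p)) (0, 0) = coeff (coeff P 1) 0"
proof -
  obtain c Q where P: "P = pCons c Q" by (rule pCons_cases)
  have "(\<lambda>z. eval2 Q z 0) holomorphic_on UNIV"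
    using holomorphic2_slice1[OF holomorphic2_eval2 open_UNIV, of Q 0] by simp
  then obtain D where "DERIV (\<lambda>z. eval2 Q z 0) 0 :> D"
    by (metis UNIV_I holomorphic_derivI open_UNIV)
  then have "DERIV (\<lambda>z. poly c 0 + z * eval2 Q z 0) 0 :> eval2 Q 0 0"
    by (auto intro!: derivative_eq_intros)
  from DERIV_imp_deriv[OF this] show ?thesis by (simp add: P eval2_pCons[abs_def] eval2_zero_fst poly_0_coeff_0)
qed

lemma poly_eq_power_mult_shift:
  fixes p :: "complex poly"
  assumes "\<And>j. j < n \<Longrightarrow> coeff p j = 0"
  shows "poly p w = w ^ n * poly (poly_shift n p) w"
proof -
  have "p = monom 1 n * poly_shift n p"
    using assms by (simp add: poly_eq_iff coeff_monom_mult coeff_poly_shift)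
  then have "poly p w = poly (monom 1 n * poly_shift n p) w" by (rule arg_cong)
  then show ?thesis by (simp add: poly_monom)
qed

lemma taylor_coeff2_0_0: "taylor_coeff2 g 0 0 = g (0, 0)"
  by (simp add: taylor_coeff2_def)

text \<open>The nondegenerate alternative is the case \<open>k = 1\<close>. In both alternatives the
  model theorem is invoked with Taylor coefficients of \<open>a\<close> and \<open>b\<close>, which
  the coefficient hypotheses on the interpolating polynomials then match.\<close>

theorem invariant_curve_exists:
  fixes a b :: "complex \<times> complex \<Rightarrow> complex"
  assumes r: "r \<ge> 2" and e: "e > 0" "e \<le> 1"
    and a: "holomorphic2_on a (bidisc e)" and b: "holomorphic2_on b (bidisc e)"
    and b0: "b (0, 0) = 0"
    and cases: "a (0, 0) \<noteq> 0 \<or>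
      (\<exists>k\<ge>2. (\<forall>j<k - 1. taylor_coeff2 a 0 j = 0) \<and> taylor_coeff2 a 0 (k - 1) \<noteq> 0 \<and>
        (\<forall>j<k. taylor_coeff2 b 0 j = 0) \<and> taylor_coeff2 b 1 0 \<noteq> 0)"
  obtains \<delta> R Z W where "\<delta> > 0" "fatou_curve r a b e \<delta> R Z W"
  using cases
proof (elim disjE exE conjE)
  assume a0: "a (0, 0) \<noteq> 0"
  obtain C \<delta> c where C: "C > 0" "\<delta> > 0" and model: "\<And>A B. holomorphic2_on A UNIV \<Longrightarrow> holomorphic2_on B UNIV \<Longrightarrow>
      A (0, 0) = a (0, 0) \<Longrightarrow> B (0, 0) = 0 \<Longrightarrow> dw B (0, 0) = taylor_coeff2 b 0 1 \<Longrightarrow>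
      \<exists>R0. \<forall>R\<ge>R0. \<exists>z w. model_curve r 1 C \<delta> c A B R z w"
    by (rule model_curve_nondegenerate[OF r a0, of "taylor_coeff2 b 0 1"]) blast
  show ?thesis
  proof (rule invariant_curve_of_model[where k = 1, OF r _ e a b _ _ C])
    fix A B
    assume A: "\<And>j. j \<le> 1 \<Longrightarrow> coeff (coeff A 0) j = taylor_coeff2 a 0 j"
      and B: "\<And>j. j \<le> 1 \<Longrightarrow> coeff (coeff B 0) j = taylor_coeff2 b 0 j"
    show "\<exists>R0. \<forall>R\<ge>R0. \<exists>z w. model_curve r 1 C \<delta> c (\<lambda>p. eval2 A (fst p) (snd p)) (\<lambda>p. eval2 B (fst p) (snd p)) R z w"
    proof (rule model)
      show "dw (\<lambda>p. eval2 B (fst p) (snd p)) (0, 0) = taylor_coeff2 b 0 1" unfolding dw_eval2_0 by (rule B) simp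
    qed (simp_all add: holomorphic2_eval2 eval2_zero_fst poly_0_coeff_0 A B taylor_coeff2_0_0 b0)
  next
    fix R Z W
    assume "fatou_curve r a b e \<delta> R Z W"
    then show thesis by (rule that[OF C(2)])
  qed (simp_all add: taylor_coeff2_0_0 b0)
next
  fix k assume k: "k \<ge> 2" and tca: "\<forall>j<k - 1. taylor_coeff2 a 0 j = 0" and \<alpha>: "taylor_coeff2 a 0 (k - 1) \<noteq> 0"
    and tcb: "\<forall>j<k. taylor_coeff2 b 0 j = 0" and \<beta>: "taylor_coeff2 b 1 0 \<noteq> 0"
  obtain C \<delta> c where C: "C > 0" "\<delta> > 0" and model: "\<And>A B a' b'. holomorphic2_on A UNIV \<Longrightarrow> holomorphic2_on B UNIV \<Longrightarrow>
      a' holomorphic_on UNIV \<Longrightarrow> b' holomorphic_on UNIV \<Longrightarrow>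
      (\<And>w. A (0, w) = w ^ (k - 1) * a' w) \<Longrightarrow> (\<And>w. B (0, w) = w ^ k * b' w) \<Longrightarrow> a' 0 = taylor_coeff2 a 0 (k - 1) \<Longrightarrow>
      b' 0 = taylor_coeff2 b 0 k \<Longrightarrow> dz B (0, 0) = taylor_coeff2 b 1 0 \<Longrightarrow>
      \<exists>R0. \<forall>R\<ge>R0. \<exists>z w. model_curve r k C \<delta> c A B R z w"
    by (rule model_curve_degenerate[OF r k \<alpha> \<beta>, of "taylor_coeff2 b 0 k"]) blast
  show ?thesis
  proof (rule invariant_curve_of_model[where k = k, OF r _ e a b _ _ C])
    fix A B
    assume A: "\<And>j. j \<le> k \<Longrightarrow> coeff (coeff A 0) j = taylor_coeff2 a 0 j"
      and B: "\<And>j. j \<le> k \<Longrightarrow> coeff (coeff B 0) j = taylor_coeff2 b 0 j" "coeff (coeff B 1) 0 = taylor_coeff2 b 1 0"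
    show "\<exists>R0. \<forall>R\<ge>R0. \<exists>z w. model_curve r k C \<delta> c (\<lambda>p. eval2 A (fst p) (snd p)) (\<lambda>p. eval2 B (fst p) (snd p)) R z w"
    proof (rule model)
      show "eval2 A (fst (0, w)) (snd (0, w)) = w ^ (k - 1) * poly (poly_shift (k - 1) (coeff A 0)) w" for w
        unfolding fst_conv snd_conv eval2_zero_fst by (rule poly_eq_power_mult_shift) (use A tca in auto)
      show "eval2 B (fst (0, w)) (snd (0, w)) = w ^ k * poly (poly_shift k (coeff B 0)) w" for w
        unfolding fst_conv snd_conv eval2_zero_fst by (rule poly_eq_power_mult_shift) (use B tcb in auto)
      show "dz (\<lambda>p. eval2 B (fst p) (snd p)) (0, 0) = taylor_coeff2 b 1 0" unfolding dz_eval2_0 by (rule B)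
    qed (auto simp: holomorphic2_eval2 poly_0_coeff_0 coeff_poly_shift A B intro!: holomorphic_intros)
  next
    fix R Z W
    assume "fatou_curve r a b e \<delta> R Z W"
    then show thesis by (rule that[OF C(2)])
  qed (use k tca tcb in auto)
qed

section \<open>Blow-up coordinates\<close>

definition det2 :: "complex \<times> complex \<Rightarrow> complex \<times> complex \<Rightarrow> complex"
  where "det2 u v = fst u * snd v - snd u * fst v"

lemma in_line_through_iff:
  assumes "v \<noteq> 0"
  shows "x \<in> line_through v \<longleftrightarrow> det2 x v = 0"
proof
  assume "x \<in> line_through v" then show "det2 x v = 0" by (auto simp: line_through_def det2_def)
next
  assume d: "det2 x v = 0"
  obtain v1 v2 where v: "v = (v1, v2)" by (cases v)
  obtain x1 x2 where x: "x = (x1, x2)" by (cases x)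
  have "v1 \<noteq> 0 \<or> v2 \<noteq> 0" using assms by (auto simp: v zero_prod_def)
  then show "x \<in> line_through v"
  proof
    assume "v1 \<noteq> 0"
    then have "x = (x1 / v1 * fst v, x1 / v1 * snd v)" using d by (simp add: v x det2_def field_simps)
    then show ?thesis unfolding line_through_def by blast
  next
    assume "v2 \<noteq> 0"
    then have "x = (x2 / v2 * fst v, x2 / v2 * snd v)" using d by (simp add: v x det2_def field_simps)
    then show ?thesis unfolding line_through_def by blast
  qed
qed

lemma proj_pt_eq_iff:
  assumes "u \<noteq> 0" "v \<noteq> 0"
  shows "proj_pt u = proj_pt v \<longleftrightarrow> det2 u v = 0"
proof
  have "u \<in> line_through u" unfolding in_line_through_iff[OF assms(1)] by (simp add: det2_def)
  moreover assume "proj_pt u = proj_pt v"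
  then have "line_through u = line_through v" using points_of_proj_pt[OF assms(1)] points_of_proj_pt[OF assms(2)] by simp
  ultimately show "det2 u v = 0" using in_line_through_iff[OF assms(2)] by simp
next
  assume "det2 u v = 0"
  then have "u \<in> line_through v" using in_line_through_iff[OF assms(2)] by simp
  then obtain c where c: "u = (c * fst v, c * snd v)" by (auto simp: line_through_def)
  then have "c \<noteq> 0" using assms(1) by (auto simp: zero_prod_def)
  from line_through_scale[OF this, of "fst v" "snd v"] have "line_through u = line_through v" by (simp add: c)
  then show "proj_pt u = proj_pt v" by (simp add: proj_pt_def)
qed

text \<open>Distinct points \<open>[u]\<close>, \<open>[v]\<close> are separated by the scaling-invariant open conditions
  \<open>\<bar>det (x, u)\<bar> < \<bar>det (x, v)\<bar>\<close> and \<open>\<bar>det (x, v)\<bar> < \<bar>det (x, u)\<bar>\<close>.\<close>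

instance proj_line :: t2_space
proof
  fix L M :: proj_line assume LM: "L \<noteq> M"
  obtain u where u: "u \<noteq> 0" "L = proj_pt u" by (rule proj_pt_cases)
  obtain v where v: "v \<noteq> 0" "M = proj_pt v" by (rule proj_pt_cases)
  define S where "S = (\<lambda>u v. {proj_pt x |x. x \<noteq> 0 \<and> norm (det2 x u) < norm (det2 x v)})"
  have mem: "proj_pt x \<in> S u v \<longleftrightarrow> norm (det2 x u) < norm (det2 x v)" if x: "x \<noteq> 0" for x u v
  proof
    assume "proj_pt x \<in> S u v"
    then obtain y where y: "y \<noteq> 0" "norm (det2 y u) < norm (det2 y v)" "proj_pt x = proj_pt y" by (auto simp: S_def)
    then have "x \<in> line_through y" using x by (simp add: proj_pt_eq_iff in_line_through_iff)
    then obtain c where c: "x = (c * fst y, c * snd y)" by (auto simp: line_through_def)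
    then have "c \<noteq> 0" using x by (auto simp: zero_prod_def)
    moreover have "det2 x z = c * det2 y z" for z by (simp add: c det2_def algebra_simps)
    ultimately show "norm (det2 x u) < norm (det2 x v)" using y(2) by (simp add: norm_mult)
  qed (use x in \<open>unfold S_def, blast\<close>)
  have op: "open (S u v)" for u v
  proof -
    have "{x. x \<noteq> 0 \<and> proj_pt x \<in> S u v} = - {0} \<inter> {x. norm (det2 x u) < norm (det2 x v)}"
      using mem by blast
    also have "open \<dots>" unfolding det2_def
      by (intro open_Int open_Compl closed_singleton open_Collect_less continuous_intros)
    finally show ?thesis unfolding open_proj_line_def .
  qed
  have d: "det2 u v \<noteq> 0" using LM unfolding u(2) v(2) proj_pt_eq_iff[OF u(1) v(1)] .
  then have d: "det2 u v \<noteq> 0" "det2 v u \<noteq> 0" by (simp_all add: det2_def mult.commute eq_commute[of "fst u * snd v"])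
  have d0: "det2 u u = 0" "det2 v v = 0" by (simp_all add: det2_def)
  have "L \<in> S u v" unfolding u(2) mem[OF u(1)] using d d0 by simp
  moreover have "M \<in> S v u" unfolding v(2) mem[OF v(1)] using d d0 by simp
  moreover have "S u v \<inter> S v u = {}"
  proof -
    have False if N: "N \<in> S u v" "N \<in> S v u" for N
    proof -
      obtain x where x: "x \<noteq> 0" "N = proj_pt x" by (rule proj_pt_cases)
      show False using N unfolding x(2) mem[OF x(1)] by simp
    qed
    then show ?thesis by blast
  qed
  ultimately show "\<exists>U V. open U \<and> open V \<and> L \<in> U \<and> M \<in> V \<and> U \<inter> V = {}"
    by (intro exI[of _ "S u v"] exI[of _ "S v u"] conjI op)
qed

section \<open>The centred charts of the blow-up\<close>

lemma continuous_on_proj_pt: "continuous_on (- {0}) proj_pt"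
proof (subst continuous_on_open_vimage)
  show "\<forall>B. open B \<longrightarrow> open (proj_pt -` B \<inter> - {0})"
  proof (intro allI impI)
    fix B :: "proj_line set" assume "open B"
    moreover have "proj_pt -` B \<inter> - {0} = {v. v \<noteq> 0 \<and> proj_pt v \<in> B}" by auto
    ultimately show "open (proj_pt -` B \<inter> - {0})" by (simp add: open_proj_line_def)
  qed
qed (simp add: open_Compl)

text \<open>Treats both affine charts at once: up to an exchange of the coordinates, every centred
  chart projects to \<open>(z, w) -> (z, z * (w + s))\<close>.\<close>

definition coord_flip :: "(complex \<times> complex \<Rightarrow> complex \<times> complex) \<Rightarrow> bool"
  where "coord_flip \<sigma> \<longleftrightarrow> \<sigma> = id \<or> \<sigma> = prod.swap"

definition blowdown :: "(complex \<times> complex \<Rightarrow> complex \<times> complex) \<Rightarrow> complex \<Rightarrow> complex \<times> complex \<Rightarrow> complex \<times> complex"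
  where "blowdown \<sigma> s p = \<sigma> (fst p, fst p * (snd p + s))"

lemma coord_flip_simps:
  assumes "coord_flip \<sigma>"
  shows "\<sigma> (\<sigma> p) = p" "\<sigma> 0 = 0" "norm (\<sigma> p) = norm p" "bounded_linear \<sigma>" "\<sigma> p = 0 \<longleftrightarrow> p = 0" "\<sigma> (1, w) \<noteq> 0"
proof -
  have swap: "prod.swap = (\<lambda>p :: complex \<times> complex. (snd p, fst p))" by auto
  show "\<sigma> (\<sigma> p) = p" "\<sigma> 0 = 0" "norm (\<sigma> p) = norm p" "\<sigma> (1, w) \<noteq> 0"
    using assms by (auto simp: coord_flip_def zero_prod_def norm_prod_def add.commute)
  then show "\<sigma> p = 0 \<longleftrightarrow> p = 0" by auto
  show "bounded_linear \<sigma>" using assms unfolding coord_flip_def swap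
    by (auto simp: id_def intro: bounded_linear_Pair bounded_linear_fst bounded_linear_snd bounded_linear_ident)
qed

lemma blowup_chart_at_cases:
  obtains \<sigma> s where "coord_flip \<sigma>" "L = proj_pt (\<sigma> (1, s))"
    "\<And>p. blowup_chart_at L p = (blowdown \<sigma> s p, proj_pt (\<sigma> (1, snd p + s)))"
proof (cases "\<exists>a. L = proj_pt (1, a)")
  case True
  then obtain a where a: "L = proj_pt (1, a)" by blast
  then have "blowup_chart_at L = (\<lambda>(z, w). blowup_chart1 (z, w + a))"
    by (simp add: blowup_chart_at_def proj_pt_eq1)
  then show ?thesis using a by (intro that[of id a]) (auto simp: coord_flip_def blowdown_def blowup_chart1_def)
next
  case False
  have "L = proj_pt (0, 1)" by (cases L rule: proj_pt_affine_cases) (use False in blast)+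
  moreover have "blowup_chart_at L = blowup_chart2"
    unfolding blowup_chart_at_def using False by (simp only: if_False)
  ultimately show ?thesis by (intro that[of prod.swap 0]) (auto simp: coord_flip_def blowdown_def blowup_chart2_def)
qed

lemma inj_blowup_chart_at: "inj (blowup_chart_at L)"
proof (rule injI)
  fix p q assume eq: "blowup_chart_at L p = blowup_chart_at L q"
  obtain \<sigma> s where \<sigma>: "coord_flip \<sigma>" and ch: "\<And>p. blowup_chart_at L p = (blowdown \<sigma> s p, proj_pt (\<sigma> (1, snd p + s)))"
    by (rule blowup_chart_at_cases[of L]) blast
  have nz: "\<sigma> (1, w) \<noteq> 0" for w by (rule coord_flip_simps(6)[OF \<sigma>])
  have "det2 (\<sigma> (1, snd p + s)) (\<sigma> (1, snd q + s)) = 0" using eq nz by (simp add: ch proj_pt_eq_iff[symmetric])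
  then have "snd p = snd q" using \<sigma> by (auto simp: coord_flip_def det2_def)
  moreover have "\<sigma> (blowdown \<sigma> s p) = \<sigma> (blowdown \<sigma> s q)" using eq by (simp add: ch)
  then have "fst p = fst q" by (simp add: blowdown_def coord_flip_simps(1)[OF \<sigma>])
  ultimately show "p = q" by (simp add: prod_eq_iff)
qed

lemma continuous_proj_pt_affine:
  assumes "coord_flip \<sigma>"
  shows "continuous_on UNIV (\<lambda>w. proj_pt (\<sigma> (1, w + s)))"
proof (rule continuous_on_compose2[OF continuous_on_proj_pt])
  show "continuous_on UNIV (\<lambda>w. \<sigma> (1, w + s))"
    by (rule continuous_on_compose2[OF linear_continuous_on[OF coord_flip_simps(4)[OF assms]], of UNIV])
      (auto intro!: continuous_intros)
  show "(\<lambda>w. \<sigma> (1, w + s)) ` UNIV \<subseteq> - {0}" using coord_flip_simps(6)[OF assms] by auto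
qed

lemma continuous_blowdown:
  assumes "coord_flip \<sigma>"
  shows "continuous_on UNIV (blowdown \<sigma> s)"
  unfolding blowdown_def
  by (rule continuous_on_compose2[OF linear_continuous_on[OF coord_flip_simps(4)[OF assms]], of UNIV])
      (auto intro!: continuous_intros)

lemma continuous_blowup_chart_at: "continuous_on UNIV (blowup_chart_at L)"
proof -
  obtain \<sigma> s where \<sigma>: "coord_flip \<sigma>" and ch: "\<And>p. blowup_chart_at L p = (blowdown \<sigma> s p, proj_pt (\<sigma> (1, snd p + s)))"
    by (rule blowup_chart_at_cases[of L]) blast
  show ?thesis unfolding ch[abs_def]
    by (intro continuous_on_Pair continuous_blowdown[OF \<sigma>]
      continuous_on_compose2[OF continuous_proj_pt_affine[OF \<sigma>]] continuous_intros) auto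
qed

lemma proj_pt_blowdown:
  assumes "coord_flip \<sigma>" "fst p \<noteq> 0"
  shows "blowdown \<sigma> s p \<noteq> 0" "proj_pt (blowdown \<sigma> s p) = proj_pt (\<sigma> (1, snd p + s))"
proof -
  show nz: "blowdown \<sigma> s p \<noteq> 0" using assms(2) coord_flip_simps(5)[OF assms(1)] by (simp add: blowdown_def zero_prod_def)
  have "\<sigma> (1, snd p + s) \<noteq> 0" by (rule coord_flip_simps(6)[OF assms(1)])
  then show "proj_pt (blowdown \<sigma> s p) = proj_pt (\<sigma> (1, snd p + s))" using nz assms(1)
    by (auto simp: proj_pt_eq_iff blowdown_def coord_flip_def det2_def)
qed

section \<open>The map in a chart, in terms of its homogeneous parts\<close>

lemma hom_part_scale: "hom_part g k (c * fst v, c * snd v) = c ^ k * hom_part g k v"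
proof -
  have "taylor_coeff2 g i (k - i) * (c * fst v) ^ i * (c * snd v) ^ (k - i)
      = c ^ k * (taylor_coeff2 g i (k - i) * fst v ^ i * snd v ^ (k - i))" if "i \<le> k" for i
  proof -
    have "c ^ k = c ^ i * c ^ (k - i)" using that by (simp add: power_add[symmetric])
    then show ?thesis by (simp add: power_mult_distrib)
  qed
  then show ?thesis unfolding hom_part_def sum_distrib_left by (intro sum.cong) auto
qed

lemma holomorphic_hom_part:
  assumes "x holomorphic_on S" "y holomorphic_on S"
  shows "(\<lambda>t. hom_part g k (x t, y t)) holomorphic_on S"
  unfolding hom_part_def fst_conv snd_conv by (intro holomorphic_intros assms)

text \<open>The identity theorem extends the equation to all affine points \<open>(1, w)\<close>,
  homogeneity extends it to the points with nonzero first coordinate, and the identity theorem in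
  that coordinate reaches the remaining direction.\<close>

lemma homogeneous_eq_of_affine_ball:
  assumes e: "e > 0" and eq: "\<And>w. w \<in> ball 0 e \<Longrightarrow> hom_part g2 r (1, w + s) = (w + s) * hom_part g1 r (1, w + s)"
  shows "snd v * hom_part g1 r v = fst v * hom_part g2 r v"
proof -
  have aff: "hom_part g2 r (1, w) - w * hom_part g1 r (1, w) = 0" for w
  proof (rule analytic_continuation_open[of "ball s e" UNIV, where g = "\<lambda>_. 0" and f = "\<lambda>w. hom_part g2 r (1, w) - w * hom_part g1 r (1, w)"])
    fix z assume "z \<in> ball s e"
    then have "z - s \<in> ball 0 e" by (simp add: dist_norm norm_minus_commute)
    from eq[OF this] show "hom_part g2 r (1, z) - z * hom_part g1 r (1, z) = 0" by simp
  qed (use e in \<open>auto intro!: holomorphic_intros holomorphic_hom_part\<close>)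
  have nz: "y * hom_part g1 r (x, y) - x * hom_part g2 r (x, y) = 0" if "x \<noteq> 0" for x y
  proof -
    have "hom_part g r (x, y) = x ^ r * hom_part g r (1, y / x)" for g
      using hom_part_scale[of g r x "(1, y / x)"] that by simp
    then have "y * hom_part g1 r (x, y) - x * hom_part g2 r (x, y)
        = - x * x ^ r * (hom_part g2 r (1, y / x) - y / x * hom_part g1 r (1, y / x))"
      using that by (simp add: field_simps)
    then show ?thesis by (simp only: aff mult_zero_right)
  qed
  have "snd v * hom_part g1 r (x, snd v) - x * hom_part g2 r (x, snd v) = 0" for x
  proof (rule analytic_continuation_open[of "- {0}" UNIV, where g = "\<lambda>_. 0" and f = "\<lambda>x. snd v * hom_part g1 r (x, snd v) - x * hom_part g2 r (x, snd v)"])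
    have "(1 :: complex) \<in> - {0}" by simp
    then show "- {0 :: complex} \<noteq> {}" by blast
  qed (use nz in \<open>auto intro!: holomorphic_intros holomorphic_hom_part\<close>)
  from this[of "fst v"] show ?thesis by simp
qed

lemma higher_deriv_minus_linear:
  assumes "h holomorphic_on S" "open S" "0 \<in> S"
  shows "(deriv ^^ i) (\<lambda>\<zeta>. h \<zeta> - \<zeta> * c) 0 = (deriv ^^ i) h 0 - (if i = 1 then c else 0)"
proof -
  have "(deriv ^^ i) (\<lambda>\<zeta>. h \<zeta> - c * \<zeta>) 0 = (deriv ^^ i) h 0 - (deriv ^^ i) (\<lambda>\<zeta>. c * \<zeta>) 0"
    by (rule higher_deriv_diff[OF assms(1) _ assms(2,3)]) (intro holomorphic_intros)
  moreover have "(\<lambda>\<zeta>. h \<zeta> - \<zeta> * c) = (\<lambda>\<zeta>. h \<zeta> - c * \<zeta>)" by (simp add: mult.commute)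
  ultimately show ?thesis by simp
qed

text \<open>The \<open>i\<close>-th \<open>z\<close>-derivative of \<open>g (z, z * (w + s))\<close>
  at 0 is \<open>i!\<close> times the homogeneous part of degree \<open>i\<close> at
  \<open>(1, w + s)\<close>. Below degree \<open>r\<close> only the linear part survives; after its
  subtraction \<open>z^r\<close> splits off. The function \<open>c\<close> is 1 for the first
  component of the map and the identity for the second.\<close>

lemma blowup_factor:
  assumes U: "open U" "0 \<in> U" and g: "holomorphic2_on g U" and g0: "g 0 = 0" and r: "r \<ge> 2"
    and h1: "\<And>w. hom_part g 1 (1, w) = c w" and c: "holomorphic2_on (\<lambda>p. c (snd p + s)) UNIV"
    and low: "\<And>i w. 2 \<le> i \<Longrightarrow> i < r \<Longrightarrow> hom_part g i (1, w) = 0"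
  defines "\<Omega> \<equiv> {p. (fst p, fst p * (snd p + s)) \<in> U}"
  obtains q where "holomorphic2_on q \<Omega>" "\<And>p. p \<in> \<Omega> \<Longrightarrow> g (fst p, fst p * (snd p + s)) = fst p * c (snd p + s) + fst p ^ r * q p"
    "\<And>w. q (0, w) = hom_part g r (1, w + s)"
proof -
  have g2: "g \<in> germs2" using U g unfolding germs2_def by blast
  have \<Omega>: "open \<Omega>" unfolding \<Omega>_def
    by (rule open_vimage[OF U(1), unfolded vimage_def]) (auto intro!: continuous_intros)
  have \<Omega>0: "(0, w) \<in> \<Omega>" for w using U(2) by (simp add: \<Omega>_def zero_prod_def)
  define G where "G = (\<lambda>p. g (fst p, fst p * (snd p + s)) - fst p * c (snd p + s))"
  have c': "holomorphic2_on (\<lambda>p. c (snd p + s)) \<Omega>" by (rule holomorphic2_on_subset[OF c]) simp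
  have hG: "holomorphic2_on G \<Omega>" unfolding G_def
    by (intro holomorphic2_intros c' holomorphic2_compose[OF g]) (auto simp: \<Omega>_def)
  have line: "(deriv ^^ i) (\<lambda>\<zeta>. G (\<zeta>, w)) 0 = fact i * hom_part g i (1, w + s) - (if i = 1 then c (w + s) else 0)" for i w
  proof -
    define S where "S = {\<zeta>. (\<zeta>, \<zeta> * (w + s)) \<in> U}"
    have S: "open S" "0 \<in> S" unfolding S_def using U
      by (auto intro!: open_vimage[OF U(1), unfolded vimage_def] continuous_intros simp: zero_prod_def)
    have "(\<lambda>\<zeta>. g (\<zeta>, \<zeta> * (w + s))) holomorphic_on S"
      by (rule holomorphic2_compose_curve[OF g _ _ S(1)]) (auto simp: S_def intro!: holomorphic_intros)
    from higher_deriv_minus_linear[OF this S, of i "c (w + s)"] show ?thesis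
      by (simp add: G_def hom_part_eq_line_deriv[OF g2])
  qed
  have "(deriv ^^ i) (\<lambda>\<zeta>. G (\<zeta>, w)) 0 = 0" if "i < r" for i w
  proof -
    consider "i = 0" | "i = 1" | "2 \<le> i" by linarith
    then show ?thesis
    proof cases
      case 1
      have "hom_part g 0 (1, w + s) = 0" using g0 by (simp add: hom_part_def taylor_coeff2_def zero_prod_def)
      then show ?thesis unfolding line using 1 by simp
    next
      case 2
      then show ?thesis unfolding line using h1 by simp
    next
      case 3
      then show ?thesis unfolding line using low[OF 3 that] by simp
    qed
  qed
  then obtain q where q: "holomorphic2_on q \<Omega>" "\<And>p. p \<in> \<Omega> \<Longrightarrow> G p = fst p ^ r * q p"
    "\<And>w. (0, w) \<in> \<Omega> \<Longrightarrow> q (0, w) = (deriv ^^ r) (\<lambda>\<zeta>. G (\<zeta>, w)) 0 / fact r"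
    using holomorphic2_factor_fst_power[OF hG \<Omega>, of r] by blast
  show ?thesis
  proof (rule that[OF q(1)])
    show "g (fst p, fst p * (snd p + s)) = fst p * c (snd p + s) + fst p ^ r * q p" if "p \<in> \<Omega>" for p
      using q(2)[OF that] by (simp add: G_def algebra_simps)
    show "q (0, w) = hom_part g r (1, w + s)" for w
      unfolding q(3)[OF \<Omega>0] line using r by simp
  qed
qed

text \<open>The blown-up map has the components \<open>g1\<close> and \<open>g2 / g1 - s\<close>. On
  the divisor, \<open>b\<close> becomes the polynomial whose zeros are the characteristic
  directions: it vanishes at the chosen one, and not identically, by nondicriticality.\<close>

lemma blowup_coordinates:
  assumes U: "open U" "0 \<in> U" and g: "holomorphic2_on g1 U" "holomorphic2_on g2 U" and g0: "g1 0 = 0" "g2 0 = 0" and r: "r \<ge> 2"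
    and h1: "\<And>v. hom_part g1 1 v = fst v" "\<And>v. hom_part g2 1 v = snd v"
    and low: "\<And>i v. 2 \<le> i \<Longrightarrow> i < r \<Longrightarrow> hom_part g1 i v = 0" "\<And>i v. 2 \<le> i \<Longrightarrow> i < r \<Longrightarrow> hom_part g2 i v = 0"
    and char: "hom_part g2 r (1, s) = s * hom_part g1 r (1, s)"
    and nondic: "snd v * hom_part g1 r v \<noteq> fst v * hom_part g2 r v"
  obtains a b e where "e > 0" "e \<le> 1" "holomorphic2_on a (bidisc e)" "holomorphic2_on b (bidisc e)"
    "b (0, 0) = 0" "\<And>\<eta>. \<eta> > 0 \<Longrightarrow> \<exists>w\<in>ball 0 \<eta>. b (0, w) \<noteq> 0"
    "\<And>z w. z \<in> ball 0 e \<Longrightarrow> w \<in> ball 0 e \<Longrightarrow> (z, z * (w + s)) \<in> U \<and> 1 + z ^ (r - 1) * a (z, w) \<noteq> 0 \<and>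
      g1 (z, z * (w + s)) = z + z ^ r * a (z, w) \<and>
      g2 (z, z * (w + s)) = (z + z ^ r * a (z, w)) * (w + z ^ (r - 1) * b (z, w) + s)"
proof -
  define \<Omega> where "\<Omega> = {p. (fst p, fst p * (snd p + s)) \<in> U}"
  have \<Omega>: "open \<Omega>" unfolding \<Omega>_def
    by (rule open_vimage[OF U(1), unfolded vimage_def]) (auto intro!: continuous_intros)
  obtain a where a: "holomorphic2_on a \<Omega>" "\<And>p. p \<in> \<Omega> \<Longrightarrow> g1 (fst p, fst p * (snd p + s)) = fst p * 1 + fst p ^ r * a p"
    "\<And>w. a (0, w) = hom_part g1 r (1, w + s)"
    by (rule blowup_factor[OF U g(1) g0(1) r _ _ low(1), of "\<lambda>_. 1" s, folded \<Omega>_def])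
      (simp_all add: h1[unfolded One_nat_def] holomorphic2_const)
  obtain B where B: "holomorphic2_on B \<Omega>" "\<And>p. p \<in> \<Omega> \<Longrightarrow> g2 (fst p, fst p * (snd p + s)) = fst p * (snd p + s) + fst p ^ r * B p"
    "\<And>w. B (0, w) = hom_part g2 r (1, w + s)"
    by (rule blowup_factor[OF U g(2) g0(2) r _ _ low(2), of "\<lambda>w. w" s, folded \<Omega>_def])
      (simp_all add: h1[unfolded One_nat_def] holomorphic2_intros)
  \<comment> \<open>\<open>D\<close> is \<open>g1 / z\<close>. Where it does not vanish, the
    quotient \<open>g2 / g1\<close> extends across \<open>z = 0\<close>.\<close>
  define D where "D = (\<lambda>p. 1 + fst p ^ (r - 1) * a p)"
  have hD: "holomorphic2_on D \<Omega>" unfolding D_def by (intro holomorphic2_intros a(1))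
  define \<Omega>' where "\<Omega>' = {p \<in> \<Omega>. D p \<noteq> 0}"
  have "\<Omega>' = \<Omega> \<inter> D -` (- {0})" by (auto simp: \<Omega>'_def)
  then have \<Omega>': "open \<Omega>'" "\<Omega>' \<subseteq> \<Omega>"
    using continuous_open_preimage[OF holomorphic2_on_continuous_on[OF hD] \<Omega>, of "- {0}"] by (auto simp: open_Compl)
  have "(0, 0) \<in> \<Omega>'" using U(2) r by (simp add: \<Omega>'_def \<Omega>_def D_def zero_prod_def power_0_left)
  then obtain e0 where e0: "e0 > 0" "bidisc e0 \<subseteq> \<Omega>'" by (rule open_contains_polydisc[OF \<Omega>'(1)])
  define e where "e = min e0 1"
  have e: "e > 0" "e \<le> 1" "bidisc e \<subseteq> \<Omega>'" using e0 by (auto simp: e_def subset_iff)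
  define b where "b = (\<lambda>p. (B p - (snd p + s) * a p) / D p)"
  have b: "holomorphic2_on b \<Omega>'" unfolding b_def
    by (intro holomorphic2_intros holomorphic2_on_subset[OF a(1) \<Omega>'(2)] holomorphic2_on_subset[OF B(1) \<Omega>'(2)]
      holomorphic2_on_subset[OF hD \<Omega>'(2)]) (simp add: \<Omega>'_def)
  have b0: "b (0, w) = hom_part g2 r (1, w + s) - (w + s) * hom_part g1 r (1, w + s)" for w
    using r by (simp add: b_def D_def a(3) B(3) power_0_left)
  show ?thesis
  proof (rule that[OF e(1,2) holomorphic2_on_subset[OF a(1)] holomorphic2_on_subset[OF b e(3)]])
    show "bidisc e \<subseteq> \<Omega>" using e(3) \<Omega>'(2) by blast
    show "b (0, 0) = 0" using char by (simp add: b0)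
    show "\<exists>w\<in>ball 0 \<eta>. b (0, w) \<noteq> 0" if \<eta>: "\<eta> > 0" for \<eta>
    proof (rule ccontr)
      assume "\<not> (\<exists>w\<in>ball 0 \<eta>. b (0, w) \<noteq> 0)"
      then have "hom_part g2 r (1, w + s) = (w + s) * hom_part g1 r (1, w + s)" if "w \<in> ball 0 \<eta>" for w
        using that by (auto simp: b0)
      from homogeneous_eq_of_affine_ball[OF \<eta> this] nondic show False by blast
    qed
    fix z w :: complex assume "z \<in> ball 0 e" "w \<in> ball 0 e"
    then have "(z, w) \<in> \<Omega>'" using e(3) by blast
    then have p: "(z, w) \<in> \<Omega>" and D: "D (z, w) \<noteq> 0" and zw: "(z, z * (w + s)) \<in> U" by (simp_all add: \<Omega>'_def \<Omega>_def)
    have zr: "z ^ r = z * z ^ (r - 1)" using r by (cases r) auto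
    have zD: "z + z ^ r * a (z, w) = z * D (z, w)" unfolding zr by (simp add: D_def algebra_simps)
    have "(z + z ^ r * a (z, w)) * (w + z ^ (r - 1) * b (z, w) + s)
        = z * (D (z, w) * (w + s) + z ^ (r - 1) * (D (z, w) * b (z, w)))" unfolding zD by (simp add: algebra_simps)
    also have "D (z, w) * b (z, w) = B (z, w) - (w + s) * a (z, w)" using D by (simp add: b_def)
    also have "z * (D (z, w) * (w + s) + z ^ (r - 1) * (B (z, w) - (w + s) * a (z, w))) = z * (w + s) + z ^ r * B (z, w)"
      unfolding zr by (simp add: D_def algebra_simps)
    also have "\<dots> = g2 (z, z * (w + s))" using B(2)[OF p] by simp
    finally show "(z, z * (w + s)) \<in> U \<and> 1 + z ^ (r - 1) * a (z, w) \<noteq> 0 \<and>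
      g1 (z, z * (w + s)) = z + z ^ r * a (z, w) \<and>
      g2 (z, z * (w + s)) = (z + z ^ r * a (z, w)) * (w + z ^ (r - 1) * b (z, w) + s)"
      using a(2)[OF p] zw D by (simp add: D_def)
  qed
qed

text \<open>The Taylor coefficients treat the two variables asymmetrically, so the exchange of
  coordinates is carried out on derivatives along lines.\<close>

lemma hom_part_flip:
  assumes \<sigma>: "coord_flip \<sigma>" and U: "open U" "0 \<in> U" and f: "holomorphic_map2_on f U"
  shows "(hom_part (\<lambda>q. fst (\<sigma> (f (\<sigma> q)))) k v, hom_part (\<lambda>q. snd (\<sigma> (f (\<sigma> q)))) k v)
    = \<sigma> (hom_part (\<lambda>q. fst (f q)) k (\<sigma> v), hom_part (\<lambda>q. snd (f q)) k (\<sigma> v))"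
proof (cases "\<sigma> = id")
  case False
  then have sw: "\<sigma> = prod.swap" using \<sigma> by (simp add: coord_flip_def)
  have swap: "hom_part (\<lambda>q. g (prod.swap q)) k v = hom_part g k (prod.swap v)" if g: "holomorphic2_on g U" for g
  proof -
    have "open {p. (snd p, fst p) \<in> U}" by (rule open_vimage[OF U(1), unfolded vimage_def]) (auto intro!: continuous_intros)
    moreover have "holomorphic2_on (\<lambda>q. g (prod.swap q)) {p. (snd p, fst p) \<in> U}" using holomorphic2_swap[OF g] by (simp add: prod.swap_def)
    ultimately have "(\<lambda>q. g (prod.swap q)) \<in> germs2" using U(2) unfolding germs2_def by (auto simp: zero_prod_def)
    moreover have "g \<in> germs2" using g U unfolding germs2_def by blast
    ultimately show ?thesis by (simp add: hom_part_eq_line_deriv)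
  qed
  have "holomorphic2_on (\<lambda>p. fst (f p)) U" "holomorphic2_on (\<lambda>p. snd (f p)) U" using f by (simp_all add: holomorphic_map2_on_def)
  from swap[OF this(1)] swap[OF this(2)] show ?thesis by (simp add: sw)
qed simp

lemma hom_part_tangent_identity:
  assumes U: "open U" "0 \<in> U" and f: "holomorphic_map2_on f U" and f0: "f 0 = 0" and df: "(f has_derivative (\<lambda>h. h)) (at 0)"
  shows "hom_part (\<lambda>q. fst (f q)) 0 v = 0" "hom_part (\<lambda>q. snd (f q)) 0 v = 0"
    "hom_part (\<lambda>q. fst (f q)) 1 v = fst v" "hom_part (\<lambda>q. snd (f q)) 1 v = snd v"
proof -
  have g: "(\<lambda>q. fst (f q)) \<in> germs2" "(\<lambda>q. snd (f q)) \<in> germs2"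
    using f U unfolding germs2_def holomorphic_map2_on_def by blast+
  show "hom_part (\<lambda>q. fst (f q)) 0 v = 0" "hom_part (\<lambda>q. snd (f q)) 0 v = 0"
    using f0 by (simp_all add: hom_part_def taylor_coeff2_def zero_prod_def)
  have "((\<lambda>\<zeta> :: complex. (\<zeta> * fst v, \<zeta> * snd v)) has_derivative (\<lambda>h. (h * fst v, h * snd v))) (at 0)"
    by (auto intro!: derivative_eq_intros)
  moreover have "(f has_derivative (\<lambda>h. h)) (at (0 * fst v, 0 * snd v))" using df by (simp add: zero_prod_def)
  ultimately have line: "((\<lambda>\<zeta>. f (\<zeta> * fst v, \<zeta> * snd v)) has_derivative (\<lambda>h. (h * fst v, h * snd v))) (at 0)"
    by (rule has_derivative_compose)
  have "DERIV (\<lambda>\<zeta>. fst (f (\<zeta> * fst v, \<zeta> * snd v))) 0 :> fst v"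
    using has_derivative_fst[OF line] unfolding has_field_derivative_def fst_conv snd_conv mult.commute[of _ "fst v"] .
  from DERIV_imp_deriv[OF this] show "hom_part (\<lambda>q. fst (f q)) 1 v = fst v" by (simp add: hom_part_eq_line_deriv[OF g(1)])
  have "DERIV (\<lambda>\<zeta>. snd (f (\<zeta> * fst v, \<zeta> * snd v))) 0 :> snd v"
    using has_derivative_snd[OF line] unfolding has_field_derivative_def fst_conv snd_conv mult.commute[of _ "snd v"] .
  from DERIV_imp_deriv[OF this] show "hom_part (\<lambda>q. snd (f q)) 1 v = snd v" by (simp add: hom_part_eq_line_deriv[OF g(2)])
qed

text \<open>The \<open>LEAST\<close> could be an arbitrary number if no term of degree at least 2
  were nonzero. In degrees 0 and 1 the homogeneous parts satisfy the dicritical identity, so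
  nondicriticality excludes these values.\<close>

lemma nondicritical_map_order:
  assumes U: "open U" "0 \<in> U" and f: "holomorphic_map2_on f U" and f0: "f 0 = 0" and df: "(f has_derivative (\<lambda>h. h)) (at 0)"
    and nd: "\<not> dicritical f"
  shows "map_order f \<ge> 2"
    "\<And>i v. 2 \<le> i \<Longrightarrow> i < map_order f \<Longrightarrow> hom_part (\<lambda>q. fst (f q)) i v = 0 \<and> hom_part (\<lambda>q. snd (f q)) i v = 0"
proof -
  note h = hom_part_tangent_identity[OF U f f0 df]
  show "map_order f \<ge> 2"
  proof (rule ccontr)
    assume "\<not> map_order f \<ge> 2"
    then have "map_order f = 0 \<or> map_order f = 1" by linarith
    then have "dicritical f"
    proof
      assume "map_order f = 0" then show ?thesis unfolding dicritical_def by (simp add: h(1,2))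
    next
      assume "map_order f = 1" then show ?thesis unfolding dicritical_def using h(3,4) by simp
    qed
    then show False using nd by blast
  qed
  fix i v assume "2 \<le> i" "i < map_order f"
  then show "hom_part (\<lambda>q. fst (f q)) i v = 0 \<and> hom_part (\<lambda>q. snd (f q)) i v = 0"
    unfolding map_order_def using not_less_Least by blast
qed

lemma proj_pt_eq_multiple:
  assumes "u \<noteq> 0" "v \<noteq> 0" "proj_pt u = proj_pt v"
  obtains c where "c \<noteq> 0" "u = (c * fst v, c * snd v)"
proof -
  have "u \<in> line_through v" using assms by (simp add: proj_pt_eq_iff in_line_through_iff)
  then obtain c where c: "u = (c * fst v, c * snd v)" by (auto simp: line_through_def)
  then have "c \<noteq> 0" using assms(1) by (auto simp: zero_prod_def)
  then show ?thesis using c by (rule that)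
qed

text \<open>Conjugation with \<open>\<sigma>\<close> reduces both charts to one. Homogeneity moves
  the characteristic equation from the given representative \<open>v\<close> to
  \<open>\<sigma> (1, s)\<close>.\<close>

lemma blowup_coordinates_at:
  assumes U: "open U" "0 \<in> U" and f: "holomorphic_map2_on f U" and f0: "f 0 = 0" and df: "(f has_derivative (\<lambda>h. h)) (at 0)"
    and nd: "\<not> dicritical f" and ch: "characteristic_direction f L" and \<sigma>: "coord_flip \<sigma>" and L: "L = proj_pt (\<sigma> (1, s))"
  defines "r \<equiv> map_order f"
  obtains a b e where "e > 0" "e \<le> 1" "holomorphic2_on a (bidisc e)" "holomorphic2_on b (bidisc e)"
    "b (0, 0) = 0" "\<And>\<eta>. \<eta> > 0 \<Longrightarrow> \<exists>w\<in>ball 0 \<eta>. b (0, w) \<noteq> 0"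
    "\<And>z w. z \<in> ball 0 e \<Longrightarrow> w \<in> ball 0 e \<Longrightarrow> blowdown \<sigma> s (z, w) \<in> U \<and> 1 + z ^ (r - 1) * a (z, w) \<noteq> 0 \<and>
      f (blowdown \<sigma> s (z, w)) = blowdown \<sigma> s (z + z ^ r * a (z, w), w + z ^ (r - 1) * b (z, w))"
proof -
  define H where "H = (\<lambda>k v. (hom_part (\<lambda>q. fst (f q)) k v, hom_part (\<lambda>q. snd (f q)) k v))"
  define g1 g2 where "g1 = (\<lambda>q. fst (\<sigma> (f (\<sigma> q))))" and "g2 = (\<lambda>q. snd (\<sigma> (f (\<sigma> q))))"
  have hom: "hom_part g1 k v = fst (\<sigma> (H k (\<sigma> v)))" "hom_part g2 k v = snd (\<sigma> (H k (\<sigma> v)))" for k v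
    using hom_part_flip[OF \<sigma> U f, of k v] unfolding g1_def g2_def H_def by (simp_all add: prod_eq_iff)
  define U' where "U' = {q. \<sigma> q \<in> U}"
  note fl = coord_flip_simps[OF \<sigma>]
  have U': "open U'" "0 \<in> U'"
    unfolding U'_def using U fl(2) open_vimage[OF U(1) linear_continuous_on[OF fl(4)]] by (simp_all add: vimage_def)
  have f12: "holomorphic2_on (\<lambda>q. fst (f q)) U" "holomorphic2_on (\<lambda>q. snd (f q)) U" using f by (simp_all add: holomorphic_map2_on_def)
  have "holomorphic2_on g1 U' \<and> holomorphic2_on g2 U'"
    using \<sigma> f12 holomorphic2_swap[OF f12(1)] holomorphic2_swap[OF f12(2)]
    unfolding coord_flip_def g1_def g2_def U'_def by (auto simp: prod.swap_def)
  then have g: "holomorphic2_on g1 U'" "holomorphic2_on g2 U'" by auto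
  note tan = hom_part_tangent_identity[OF U f f0 df] and ord = nondicritical_map_order[OF U f f0 df nd, folded r_def]
  obtain v c where v0: "v \<noteq> 0" "L = proj_pt v" "hom_part (\<lambda>q. fst (f q)) (map_order f) v = c * fst v"
    "hom_part (\<lambda>q. snd (f q)) (map_order f) v = c * snd v"
    using ch unfolding characteristic_direction_def by blast
  then have v: "v \<noteq> 0" "L = proj_pt v" "H r v = (c * fst v, c * snd v)" by (simp_all add: H_def r_def)
  have \<sigma>c: "\<sigma> (c * x, c * y) = (c * fst (\<sigma> (x, y)), c * snd (\<sigma> (x, y)))" for c x y
    using \<sigma> by (auto simp: coord_flip_def)
  obtain m where m: "m \<noteq> 0" "\<sigma> (1, s) = (m * fst v, m * snd v)"
    by (rule proj_pt_eq_multiple[OF fl(6)[of s] v(1)]) (use L v in auto)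
  have "H r (\<sigma> (1, s)) = (m ^ r * fst (H r v), m ^ r * snd (H r v))"
    unfolding m(2) H_def by (simp add: hom_part_scale)
  also have "\<dots> = (m ^ (r - 1) * c * (m * fst v), m ^ (r - 1) * c * (m * snd v))"
    unfolding v(3) using ord(1) by (cases r) (auto simp: mult_ac)
  also have "\<dots> = (m ^ (r - 1) * c * fst (\<sigma> (1, s)), m ^ (r - 1) * c * snd (\<sigma> (1, s)))" by (simp add: m(2))
  finally have "\<sigma> (H r (\<sigma> (1, s))) = (m ^ (r - 1) * c, m ^ (r - 1) * c * s)"
    by (simp add: \<sigma>c fl(1))
  then have char: "hom_part g2 r (1, s) = s * hom_part g1 r (1, s)" by (simp add: hom)
  obtain z1 z2 where z: "z2 * fst (H r (z1, z2)) \<noteq> z1 * snd (H r (z1, z2))"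
    using nd unfolding dicritical_def H_def r_def by auto
  define u where "u = \<sigma> (z1, z2)"
  have nondic: "snd u * hom_part g1 r u \<noteq> fst u * hom_part g2 r u"
    unfolding hom using z \<sigma> by (auto simp: u_def coord_flip_def)
  obtain a b e where ab: "e > 0" "e \<le> 1" "holomorphic2_on a (bidisc e)" "holomorphic2_on b (bidisc e)"
    "b (0, 0) = 0" "\<And>\<eta>. \<eta> > 0 \<Longrightarrow> \<exists>w\<in>ball 0 \<eta>. b (0, w) \<noteq> 0"
    and step: "\<And>z w. z \<in> ball 0 e \<Longrightarrow> w \<in> ball 0 e \<Longrightarrow> (z, z * (w + s)) \<in> U' \<and> 1 + z ^ (r - 1) * a (z, w) \<noteq> 0 \<and>
      g1 (z, z * (w + s)) = z + z ^ r * a (z, w) \<and>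
      g2 (z, z * (w + s)) = (z + z ^ r * a (z, w)) * (w + z ^ (r - 1) * b (z, w) + s)"
  proof (rule blowup_coordinates[OF U' g _ _ ord(1) _ _ _ _ char nondic])
    show "g1 0 = 0" "g2 0 = 0" by (simp_all add: g1_def g2_def fl(2) f0)
    show "hom_part g1 1 v = fst v" "hom_part g2 1 v = snd v" for v
      unfolding hom by (simp_all add: H_def tan(3,4) fl(1) del: One_nat_def)
    show "hom_part g1 i v = 0" "hom_part g2 i v = 0" if "2 \<le> i" "i < r" for i v
      unfolding hom H_def using ord(2)[OF that] fl(2) by (simp_all add: zero_prod_def)
  qed blast
  show ?thesis
  proof (rule that[OF ab])
    fix z w :: complex assume zw: "z \<in> ball 0 e" "w \<in> ball 0 e"
    note st = step[OF zw]
    have "\<sigma> (f (blowdown \<sigma> s (z, w))) = (z + z ^ r * a (z, w), (z + z ^ r * a (z, w)) * (w + z ^ (r - 1) * b (z, w) + s))"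
      using st by (simp add: g1_def g2_def blowdown_def prod_eq_iff)
    then have "f (blowdown \<sigma> s (z, w)) = blowdown \<sigma> s (z + z ^ r * a (z, w), w + z ^ (r - 1) * b (z, w))"
      using fl(1)[of "f (blowdown \<sigma> s (z, w))"] by (simp add: blowdown_def)
    then show "blowdown \<sigma> s (z, w) \<in> U \<and> 1 + z ^ (r - 1) * a (z, w) \<noteq> 0 \<and>
      f (blowdown \<sigma> s (z, w)) = blowdown \<sigma> s (z + z ^ r * a (z, w), w + z ^ (r - 1) * b (z, w))"
      using st by (simp add: U'_def blowdown_def)
  qed
qed

lemma point_of_blowup:
  assumes "x \<in> blowup" "fst x \<noteq> 0"
  shows "snd x = proj_pt (fst x)"
proof -
  obtain v where v: "v \<noteq> 0" "snd x = proj_pt v" by (rule proj_pt_cases)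
  have "fst x \<in> points_of (snd x)" using assms(1) by (auto simp: blowup_def)
  then have "det2 (fst x) v = 0" unfolding v(2) points_of_proj_pt[OF v(1)] in_line_through_iff[OF v(1)] .
  then show ?thesis using proj_pt_eq_iff[OF assms(2) v(1)] v(2) by simp
qed

lemma blowup_chart_at_in_blowup: "blowup_chart_at L p \<in> blowup"
proof -
  obtain \<sigma> s where \<sigma>: "coord_flip \<sigma>" and ch: "\<And>p. blowup_chart_at L p = (blowdown \<sigma> s p, proj_pt (\<sigma> (1, snd p + s)))"
    by (rule blowup_chart_at_cases[of L]) blast
  have nz: "\<sigma> (1, snd p + s) \<noteq> 0" by (rule coord_flip_simps(6)[OF \<sigma>])
  have "det2 (blowdown \<sigma> s p) (\<sigma> (1, snd p + s)) = 0" using \<sigma> by (auto simp: coord_flip_def blowdown_def det2_def)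
  then show ?thesis by (simp add: ch blowup_def points_of_proj_pt[OF nz] in_line_through_iff[OF nz])
qed

text \<open>Off the divisor a point of the blow-up is determined by its projection, so
  \<open>F\<close> is determined by \<open>f\<close> there; on the divisor continuity decides. The
  radius shrinks to keep the chart inside the domain on which \<open>F\<close> is the
  blow-up.\<close>

lemma local_form_eq:
  assumes F: "is_blowup_of f F" and \<sigma>: "coord_flip \<sigma>"
    and ch: "\<And>p. blowup_chart_at L p = (blowdown \<sigma> s p, proj_pt (\<sigma> (1, snd p + s)))"
    and e: "e > 0" and r: "r \<ge> 1" and a: "holomorphic2_on a (bidisc e)" and b: "holomorphic2_on b (bidisc e)"
    and step: "\<And>z w. z \<in> ball 0 e \<Longrightarrow> w \<in> ball 0 e \<Longrightarrow> 1 + z ^ (r - 1) * a (z, w) \<noteq> 0 \<and>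
      f (blowdown \<sigma> s (z, w)) = blowdown \<sigma> s (z + z ^ r * a (z, w), w + z ^ (r - 1) * b (z, w))"
  obtains e' where "0 < e'" "e' \<le> e"
    "\<And>z w. z \<in> ball 0 e' \<Longrightarrow> w \<in> ball 0 e' \<Longrightarrow> local_form F L (z, w) = (z + z ^ r * a (z, w), w + z ^ (r - 1) * b (z, w))"
proof -
  define \<kappa> where "\<kappa> = blowup_chart_at L"
  define G where "G = (\<lambda>p. (fst p + fst p ^ r * a p, snd p + fst p ^ (r - 1) * b p))"
  obtain W where W: "open W" "exceptional_divisor \<subseteq> W" "blowup_holomorphic_on F W" "\<And>x. x \<in> W \<inter> blowup \<Longrightarrow> fst (F x) = f (fst x)"
    using F unfolding is_blowup_of_def by blast
  have \<kappa>W: "open (\<kappa> -` W)" unfolding \<kappa>_def by (rule open_vimage[OF W(1) continuous_blowup_chart_at])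
  have "\<kappa> 0 \<in> W" using W(2) by (auto simp: \<kappa>_def blowup_chart_at_0 exceptional_divisor_def)
  then have "(0, 0) \<in> \<kappa> -` W" by (simp add: zero_prod_def)
  then obtain e1 where e1: "e1 > 0" "bidisc e1 \<subseteq> \<kappa> -` W" by (rule open_contains_polydisc[OF \<kappa>W])
  define e' where "e' = min e e1"
  have e': "0 < e'" "e' \<le> e" "ball 0 e' \<subseteq> ball 0 e" using e e1 by (auto simp: e'_def)
  have \<kappa>in: "\<kappa> (z, w) \<in> W \<inter> blowup" if "z \<in> ball 0 e'" "w \<in> ball 0 e'" for z w
  proof -
    have "(z, w) \<in> bidisc e1" using that by (simp add: e'_def)
    then have "\<kappa> (z, w) \<in> W" using e1(2) by blast
    then show ?thesis by (simp add: \<kappa>_def blowup_chart_at_in_blowup)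
  qed
  have Fb: "F x \<in> blowup" if "x \<in> W \<inter> blowup" for x
    using W(3) that unfolding blowup_holomorphic_on_def by blast
  have Fc: "continuous_on (W \<inter> blowup) F" using W(3) unfolding blowup_holomorphic_on_def by blast
  have off: "F (\<kappa> (z, w)) = \<kappa> (G (z, w))" if z: "z \<in> ball 0 e'" "z \<noteq> 0" and w: "w \<in> ball 0 e'" for z w
  proof -
    have zw: "z \<in> ball 0 e" "w \<in> ball 0 e" using z w e'(2) by auto
    have "fst (F (\<kappa> (z, w))) = f (blowdown \<sigma> s (z, w))" using W(4)[OF \<kappa>in[OF z(1) w]] by (simp add: \<kappa>_def ch)
    also have "\<dots> = blowdown \<sigma> s (G (z, w))" using step[OF zw] by (simp add: G_def)
    finally have fF: "fst (F (\<kappa> (z, w))) = blowdown \<sigma> s (G (z, w))" .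
    have "z + z ^ r * a (z, w) = z * (1 + z ^ (r - 1) * a (z, w))" using r by (cases r) (auto simp: algebra_simps)
    then have "fst (G (z, w)) \<noteq> 0" using step[OF zw] z(2) by (simp add: G_def)
    note pb = proj_pt_blowdown[OF \<sigma> this, of s]
    have "snd (F (\<kappa> (z, w))) = proj_pt (blowdown \<sigma> s (G (z, w)))"
      using point_of_blowup[OF Fb[OF \<kappa>in[OF z(1) w]]] fF pb(1) by simp
    then show ?thesis using fF pb(2) by (simp add: \<kappa>_def ch prod_eq_iff)
  qed
  have all: "F (\<kappa> (z, w)) = \<kappa> (G (z, w))" if zw: "z \<in> ball 0 e'" "w \<in> ball 0 e'" for z w
  proof (cases "z = 0")
    case True
    have k: "continuous_on UNIV \<kappa>" unfolding \<kappa>_def by (rule continuous_blowup_chart_at)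
    have slice: "continuous_on (ball 0 e') (\<lambda>z. (z, w))" by (intro continuous_intros)
    have kz: "continuous_on (ball 0 e') (\<lambda>z. \<kappa> (z, w))" by (rule continuous_on_compose2[OF k slice]) simp
    have "continuous_on (ball 0 e') (\<lambda>z. F (\<kappa> (z, w)))"
      by (rule continuous_on_compose2[OF Fc kz]) (use \<kappa>in zw(2) in blast)
    then have c1: "((\<lambda>z. F (\<kappa> (z, w))) \<longlongrightarrow> F (\<kappa> (0, w))) (at 0)"
      using e'(1) by (simp add: continuous_on_eq_continuous_at isCont_def)
    have sub: "(\<lambda>z. (z, w)) ` ball 0 e' \<subseteq> bidisc e" using zw(2) e'(2) by auto
    have "continuous_on (ball 0 e') (\<lambda>z. G (z, w))" unfolding G_def fst_conv snd_conv
      by (intro continuous_intros continuous_on_compose2[OF holomorphic2_on_continuous_on[OF a] slice sub]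
        continuous_on_compose2[OF holomorphic2_on_continuous_on[OF b] slice sub])
    from continuous_on_compose2[OF k this] have "continuous_on (ball 0 e') (\<lambda>z. \<kappa> (G (z, w)))" by simp
    then have c2: "((\<lambda>z. \<kappa> (G (z, w))) \<longlongrightarrow> \<kappa> (G (0, w))) (at 0)"
      using e'(1) by (simp add: continuous_on_eq_continuous_at isCont_def)
    have "\<forall>\<^sub>F z in at 0. z \<in> ball 0 e' - {0}"
      using e'(1) by (intro eventually_at_in_open) auto
    then have "\<forall>\<^sub>F z in at 0. F (\<kappa> (z, w)) = \<kappa> (G (z, w))"
      by (rule eventually_mono) (use off zw(2) in auto)
    from tendsto_cong[OF this] c1 have "((\<lambda>z. \<kappa> (G (z, w))) \<longlongrightarrow> F (\<kappa> (0, w))) (at 0)" by simp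
    \<comment> \<open>Uniqueness of limits rests on the Hausdorff property of
      \<open>proj_line\<close>.\<close>
    from tendsto_unique[OF _ this c2] True show ?thesis by simp
  qed (use off zw in blast)
  show ?thesis
  proof (rule that[OF e'(1,2)])
    fix z w :: complex assume "z \<in> ball 0 e'" "w \<in> ball 0 e'"
    from all[OF this] show "local_form F L (z, w) = (z + z ^ r * a (z, w), w + z ^ (r - 1) * b (z, w))"
      using inj_blowup_chart_at[of L] by (simp add: local_form_def \<kappa>_def[symmetric] G_def)
  qed
qed

section \<open>Index and regularity in terms of the coefficients \<open>a\<close> and
  \<open>b\<close>\<close>

lemma holomorphic2_slice_snd_ball:
  assumes "holomorphic2_on g (bidisc e)" "z \<in> ball 0 e"
  shows "(\<lambda>w. g (z, w)) holomorphic_on ball 0 e"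
  by (rule holomorphic_on_subset[OF holomorphic2_slice2[OF assms(1) open_Times[OF open_ball open_ball], of z]]) (use assms(2) in auto)

lemma holomorphic2_slice_fst_ball:
  assumes "holomorphic2_on g (bidisc e)" "w \<in> ball 0 e"
  shows "(\<lambda>z. g (z, w)) holomorphic_on ball 0 e"
  by (rule holomorphic_on_subset[OF holomorphic2_slice1[OF assms(1) open_Times[OF open_ball open_ball], of w]]) (use assms(2) in auto)

text \<open>Without zeros off the divisor, the slice \<open>l (0, w)\<close> would be a uniform
  limit of nonvanishing slices \<open>l (x n, w)\<close>. By Hurwitz's theorem it would have no zero
  unless it were constant, but it vanishes at 0 and is not identically zero.\<close>

lemma zeros_near_slice_zero:
  assumes l: "holomorphic2_on l (bidisc e)" and l0: "l (0, 0) = 0"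
    and nz: "\<And>\<eta>. \<eta> > 0 \<Longrightarrow> \<exists>w\<in>ball 0 \<eta>. l (0, w) \<noteq> 0" and \<eta>: "0 < \<eta>" "\<eta> < e"
  obtains z w where "z \<noteq> 0" "norm z < \<eta>" "norm w < \<eta>" "l (z, w) = 0"
proof (rule ccontr)
  note obt = that
  assume no: "\<not> thesis"
  define x where "x = (\<lambda>n :: nat. complex_of_real (\<eta> / (real n + 2)))"
  have x: "x n \<noteq> 0" "norm (x n) < \<eta>" for n
  proof -
    have "\<eta> * 1 < \<eta> * (real n + 2)" using \<eta> by (intro mult_strict_left_mono) auto
    then have "\<eta> / (real n + 2) < \<eta>" by (simp add: divide_less_eq)
    moreover have "\<eta> / (real n + 2) > 0" using \<eta> by simp
    moreover have nx: "norm (x n) = \<bar>\<eta> / (real n + 2)\<bar>" unfolding x_def by (rule norm_of_real)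
    ultimately have "norm (x n) > 0" and lt: "norm (x n) < \<eta>" by linarith+
    then show "x n \<noteq> 0" by auto
    show "norm (x n) < \<eta>" by (rule lt)
  qed
  have lim: "x \<longlonglongrightarrow> 0"
  proof -
    have "(\<lambda>n. \<eta> / (real n + 2)) \<longlonglongrightarrow> 0" by real_asymp
    from tendsto_of_real[OF this] show ?thesis unfolding x_def of_real_0 .
  qed
  have hol: "(\<lambda>w. l (z, w)) holomorphic_on ball 0 \<eta>" if "norm z < \<eta>" for z
    by (rule holomorphic_on_subset[OF holomorphic2_slice_snd_ball[OF l]]) (use that \<eta> in auto)
  have "l (0, 0) \<noteq> 0"
  proof (rule Hurwitz_no_zeros[of "ball 0 \<eta>" "\<lambda>n w. l (x n, w)" "\<lambda>w. l (0, w)"])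
    show "(\<lambda>w. l (x n, w)) holomorphic_on ball 0 \<eta>" for n by (rule hol[OF x(2)])
    show "(\<lambda>w. l (0, w)) holomorphic_on ball 0 \<eta>" by (rule hol) (use \<eta> in simp)
    show "l (x n, w) \<noteq> 0" if "w \<in> ball 0 \<eta>" for n w
    proof
      assume "l (x n, w) = 0"
      then have thesis using that by (intro obt[OF x[of n], of w]) simp_all
      then show False using no by contradiction
    qed
    show "\<not> (\<lambda>w. l (0, w)) constant_on ball 0 \<eta>"
    proof
      assume "(\<lambda>w. l (0, w)) constant_on ball 0 \<eta>"
      then obtain c where c: "\<And>w. w \<in> ball 0 \<eta> \<Longrightarrow> l (0, w) = c" unfolding constant_on_def by blast
      have "c = 0" using c[of 0] l0 \<eta> by simp
      then show False using nz[OF \<eta>(1)] c by blast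
    qed
    fix K :: "complex set" assume K: "compact K" "K \<subseteq> ball 0 \<eta>"
    have "uniformly_continuous_on (cball 0 \<eta> \<times> cball 0 \<eta>) l"
      by (rule compact_uniformly_continuous[OF continuous_on_subset[OF holomorphic2_on_continuous_on[OF l]]])
        (use \<eta> in \<open>auto intro!: compact_Times\<close>)
    then have uc: "\<exists>d>0. \<forall>p\<in>cball 0 \<eta> \<times> cball 0 \<eta>. \<forall>p'\<in>cball 0 \<eta> \<times> cball 0 \<eta>. dist p' p < d \<longrightarrow> dist (l p') (l p) < \<epsilon>" if "\<epsilon> > 0" for \<epsilon>
      using that unfolding uniformly_continuous_on_def by blast
    show "uniform_limit K (\<lambda>n w. l (x n, w)) (\<lambda>w. l (0, w)) sequentially"
    proof (rule uniform_limitI)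
      fix \<epsilon> :: real assume "\<epsilon> > 0"
      then obtain d where d: "d > 0" "\<And>p p'. p \<in> cball 0 \<eta> \<times> cball 0 \<eta> \<Longrightarrow> p' \<in> cball 0 \<eta> \<times> cball 0 \<eta> \<Longrightarrow> dist p' p < d \<Longrightarrow> dist (l p') (l p) < \<epsilon>"
        using uc by blast
      have "\<forall>\<^sub>F n in sequentially. dist (x n) 0 < d" using lim d(1) by (rule tendstoD)
      then show "\<forall>\<^sub>F n in sequentially. \<forall>w\<in>K. dist (l (x n, w)) (l (0, w)) < \<epsilon>"
      proof (rule eventually_mono, intro ballI)
        fix n w assume n: "dist (x n) 0 < d" and w: "w \<in> K"
        have "norm w < \<eta>" using w K(2) by auto
        then show "dist (l (x n, w)) (l (0, w)) < \<epsilon>"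
          using n x(2)[of n] \<eta> by (intro d(2)) (auto simp: dist_Pair_Pair)
      qed
    qed
  qed (use \<eta> in auto)
  then show False using l0 by blast
qed

text \<open>The order is an infimum in \<open>enat\<close>; being finite, it is attained.\<close>

lemma germ_order_one:
  assumes "germ_order g = 1"
  obtains v where "hom_part g 1 v \<noteq> 0"
proof -
  let ?A = "enat ` {k. \<exists>p. hom_part g k p \<noteq> 0}"
  have I: "Inf ?A = 1" using assms by (simp add: germ_order_def)
  have ne: "?A \<noteq> {}"
  proof
    assume "?A = {}"
    then have "Inf ?A = \<infinity>" by (simp only: Inf_enat_def) simp
    then show False using I by simp
  qed
  then obtain x where x: "x \<in> ?A" by blast
  have "Inf ?A = (LEAST x. x \<in> ?A)" using ne by (simp only: Inf_enat_def if_False)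
  then have "Inf ?A \<in> ?A" using LeastI[of "\<lambda>x. x \<in> ?A", OF x] by (simp only:)
  then have "1 \<in> {k. \<exists>p. hom_part g k p \<noteq> 0}" unfolding I by (auto simp: one_enat_def)
  then show ?thesis using that by blast
qed

lemma line_has_derivative_hom_part:
  assumes "holomorphic2_on g S" "open S" "0 \<in> S"
  shows "DERIV (\<lambda>\<zeta>. g (\<zeta> * fst v, \<zeta> * snd v)) 0 :> hom_part g 1 v"
proof -
  have g: "g \<in> germs2" using assms unfolding germs2_def by blast
  let ?S = "{\<zeta>. (\<zeta> * fst v, \<zeta> * snd v) \<in> S}"
  have S: "open ?S" "0 \<in> ?S" using assms(3)
    by (auto intro!: open_vimage[OF assms(2), unfolded vimage_def] continuous_intros simp: zero_prod_def)
  have "(\<lambda>\<zeta>. g (\<zeta> * fst v, \<zeta> * snd v)) holomorphic_on ?S"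
    by (rule holomorphic2_compose_curve[OF assms(1) _ _ S(1)]) (auto intro!: holomorphic_intros)
  from holomorphic_derivI[OF this S] show ?thesis by (simp add: hom_part_eq_line_deriv[OF g])
qed

lemma hom_part_1_mult:
  assumes S: "open S" "0 \<in> S" and l: "holomorphic2_on l S" and h: "holomorphic2_on h S" and h0: "h 0 = 0"
    and g: "holomorphic2_on g S" and eq: "\<And>p. p \<in> S \<Longrightarrow> g p = l p * h p"
  shows "hom_part g 1 v = l 0 * hom_part h 1 v"
proof -
  let ?S = "{\<zeta>. (\<zeta> * fst v, \<zeta> * snd v) \<in> S}"
  have S': "open ?S" "0 \<in> ?S" using S(2)
    by (auto intro!: open_vimage[OF S(1), unfolded vimage_def] continuous_intros simp: zero_prod_def)
  have "DERIV (\<lambda>\<zeta>. l (\<zeta> * fst v, \<zeta> * snd v) * h (\<zeta> * fst v, \<zeta> * snd v)) 0 :> l 0 * hom_part h 1 v"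
  proof (rule DERIV_cong[OF DERIV_mult[OF line_has_derivative_hom_part[OF l S, of v] line_has_derivative_hom_part[OF h S, of v]]])
    have z: "(0 * fst v, 0 * snd v) = 0" by (simp add: zero_prod_def)
    show "hom_part l 1 v * h (0 * fst v, 0 * snd v) + hom_part h 1 v * l (0 * fst v, 0 * snd v) = l 0 * hom_part h 1 v"
      unfolding z h0 by simp
  qed
  then have "DERIV (\<lambda>\<zeta>. g (\<zeta> * fst v, \<zeta> * snd v)) 0 :> l 0 * hom_part h 1 v"
    by (rule has_field_derivative_transform_within_open[OF _ S']) (rule eq[symmetric], blast)
  from DERIV_unique[OF line_has_derivative_hom_part[OF g S, of v] this] show ?thesis .
qed

lemma holomorphic2_eq_off_divisor:
  assumes f: "holomorphic2_on f (bidisc e)" and g: "holomorphic2_on g (bidisc e)"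
    and eq: "\<And>z w. z \<in> ball 0 e \<Longrightarrow> w \<in> ball 0 e \<Longrightarrow> z \<noteq> 0 \<Longrightarrow> f (z, w) = g (z, w)"
    and zw: "z \<in> ball 0 e" "w \<in> ball 0 e"
  shows "f (z, w) = g (z, w)"
proof (rule analytic_continuation_open[of "ball 0 e - {0}" "ball 0 e" "\<lambda>z. f (z, w)" "\<lambda>z. g (z, w)"])
  have "e > 0" using zw(1) le_less_trans[OF norm_ge_zero] by auto
  then have "of_real (e / 2) \<in> ball (0::complex) e - {0}" by simp
  then show "ball (0::complex) e - {0} \<noteq> {}" by blast
qed (use zw eq holomorphic2_slice_fst_ball[OF f] holomorphic2_slice_fst_ball[OF g] in auto)

lemma holomorphic_factor_power:
  assumes "h holomorphic_on ball 0 e" "e > 0" "\<And>j. j < m \<Longrightarrow> (deriv ^^ j) h 0 = 0"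
  obtains k where "k holomorphic_on ball 0 e" "\<And>z. z \<in> ball 0 e \<Longrightarrow> h z = z ^ m * k z"
proof -
  obtain k where k: "k holomorphic_on ball 0 e"
    "\<And>z. z \<in> ball 0 e \<Longrightarrow> h z = (\<Sum>j<m. z ^ j * ((deriv ^^ j) h 0 / fact j)) + z ^ m * k z"
    by (rule taylor_polynomial_1[OF assms(1,2)]) blast
  show ?thesis by (rule that[OF k(1)]) (simp add: k(2) assms(3))
qed

text \<open>If \<open>a (0, w)\<close> vanished at least to the order \<open>m\<close> of
  \<open>b (0, w)\<close>, the limit function would agree near 0, off 0, with a holomorphic quotient
  and have residue 0. So the order of \<open>a (0, w)\<close> is some \<open>j0 < m\<close>, and
  \<open>k = Suc j0\<close> is at most \<open>m\<close>. As \<open>a (0, 0) = 0\<close> gives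
  \<open>k \<ge> 2\<close>, the coefficient of \<open>w\<close> in \<open>b\<close> vanishes, and
  the linear part of \<open>b\<close> can only be its \<open>z\<close>-term.\<close>

lemma residue_case:
  assumes e: "e > 0" and r: "r \<ge> 1"
    and a: "holomorphic2_on a (bidisc e)" and b: "holomorphic2_on b (bidisc e)"
    and bnz: "\<And>\<eta>. \<eta> > 0 \<Longrightarrow> \<exists>w\<in>ball 0 \<eta>. b (0, w) \<noteq> 0" and b0: "b (0, 0) = 0"
    and G: "\<And>z w. z \<in> ball 0 e \<Longrightarrow> w \<in> ball 0 e \<Longrightarrow> G (z, w) = (z + z ^ r * a (z, w), w + z ^ (r - 1) * b (z, w))"
    and a0: "a (0, 0) = 0" and lin: "taylor_coeff2 b 1 0 \<noteq> 0 \<or> taylor_coeff2 b 0 1 \<noteq> 0"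
    and res: "residue (\<lambda>w. Lim (at 0) (\<lambda>z. (fst (G (z, w)) - z) / (z * (snd (G (z, w)) - w)))) 0 \<noteq> 0"
  shows "\<exists>k\<ge>2. (\<forall>j<k - 1. taylor_coeff2 a 0 j = 0) \<and> taylor_coeff2 a 0 (k - 1) \<noteq> 0 \<and>
        (\<forall>j<k. taylor_coeff2 b 0 j = 0) \<and> taylor_coeff2 b 1 0 \<noteq> 0"
proof -
  define \<alpha> \<beta> where "\<alpha> = (\<lambda>w. a (0, w))" and "\<beta> = (\<lambda>w. b (0, w))"
  have hol: "\<alpha> holomorphic_on ball 0 e" "\<beta> holomorphic_on ball 0 e"
    unfolding \<alpha>_def \<beta>_def using e by (auto intro!: holomorphic2_slice_snd_ball a b)
  have tc: "taylor_coeff2 a 0 j = (deriv ^^ j) \<alpha> 0 / fact j" "taylor_coeff2 b 0 j = (deriv ^^ j) \<beta> 0 / fact j" for j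
    by (simp_all add: taylor_coeff2_def \<alpha>_def \<beta>_def)
  have "\<exists>j. (deriv ^^ j) \<beta> 0 \<noteq> 0"
  proof (rule ccontr)
    assume "\<not> (\<exists>j. (deriv ^^ j) \<beta> 0 \<noteq> 0)"
    then have "\<beta> w = 0" if "w \<in> ball 0 e" for w using holomorphic_fun_eq_0_on_ball[OF hol(2) that] by blast
    then show False using bnz[OF e] by (auto simp: \<beta>_def)
  qed
  define m where "m = (LEAST j. (deriv ^^ j) \<beta> 0 \<noteq> 0)"
  have m: "(deriv ^^ m) \<beta> 0 \<noteq> 0" unfolding m_def by (rule LeastI_ex) fact
  have m': "(deriv ^^ j) \<beta> 0 = 0" if "j < m" for j using not_less_Least[OF that[unfolded m_def]] by blast
  have ex: "\<exists>j<m. (deriv ^^ j) \<alpha> 0 \<noteq> 0"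
  proof (rule ccontr)
    assume "\<not> (\<exists>j<m. (deriv ^^ j) \<alpha> 0 \<noteq> 0)"
    then have \<alpha>m: "(deriv ^^ j) \<alpha> 0 = 0" if "j < m" for j using that by blast
    obtain \<alpha>1 where \<alpha>1: "\<alpha>1 holomorphic_on ball 0 e" "\<And>w. w \<in> ball 0 e \<Longrightarrow> \<alpha> w = w ^ m * \<alpha>1 w"
      by (rule holomorphic_factor_power[OF hol(1) e \<alpha>m]) auto
    obtain \<beta>1 where \<beta>1: "\<beta>1 holomorphic_on ball 0 e" "\<And>w. w \<in> ball 0 e \<Longrightarrow> \<beta> w = w ^ m * \<beta>1 w"
      by (rule holomorphic_factor_power[OF hol(2) e m']) auto
    have "(deriv ^^ m) \<beta> 0 = (deriv ^^ m) (\<lambda>w. w ^ m * \<beta>1 w) 0"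
      by (rule higher_deriv_transform_within_open[OF hol(2) _ open_ball]) (use \<beta>1 e in \<open>auto intro!: holomorphic_intros\<close>)
    moreover have "(deriv ^^ (0 + m)) (\<lambda>w. w ^ m * \<beta>1 w) 0 / fact (0 + m) = (deriv ^^ 0) \<beta>1 0 / fact 0"
      by (rule higher_deriv_power_mult[OF \<beta>1(1) open_ball]) (use e in simp)
    ultimately have "\<beta>1 0 \<noteq> 0" using m by auto
    define S where "S = ball 0 e \<inter> \<beta>1 -` (- {0})"
    have S: "open S" "0 \<in> S" "\<And>w. w \<in> S \<Longrightarrow> \<beta>1 w \<noteq> 0 \<and> w \<in> ball 0 e"
      unfolding S_def using continuous_open_preimage[OF holomorphic_on_imp_continuous_on[OF \<beta>1(1)] open_ball, of "- {0}"]
        \<open>\<beta>1 0 \<noteq> 0\<close> e by (auto simp: open_Compl)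
    have Lim: "Lim (at 0) (\<lambda>z. (fst (G (z, w)) - z) / (z * (snd (G (z, w)) - w))) = \<alpha>1 w / \<beta>1 w" if w: "w \<in> S - {0}" for w
    proof -
      have we: "w \<in> ball 0 e" "\<beta>1 w \<noteq> 0" "w \<noteq> 0" using S(3) w by auto
      have \<beta>w: "b (0, w) \<noteq> 0" using \<beta>1(2)[OF we(1)] we by (simp add: \<beta>_def)
      have "isCont (\<lambda>z. a (z, w)) 0" "isCont (\<lambda>z. b (z, w)) 0"
        using holomorphic_on_imp_continuous_on[OF holomorphic2_slice_fst_ball[OF a we(1)]]
          holomorphic_on_imp_continuous_on[OF holomorphic2_slice_fst_ball[OF b we(1)]] e
        by (simp_all add: continuous_on_eq_continuous_at)
      then have "((\<lambda>z. a (z, w) / b (z, w)) \<longlongrightarrow> a (0, w) / b (0, w)) (at 0)"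
        using \<beta>w unfolding isCont_def by (rule tendsto_divide)
      moreover have "\<forall>\<^sub>F z in at 0. z \<in> ball 0 e - {0}" using e by (intro eventually_at_in_open) auto
      then have "\<forall>\<^sub>F z in at 0. a (z, w) / b (z, w) = (fst (G (z, w)) - z) / (z * (snd (G (z, w)) - w))"
      proof (rule eventually_mono)
        fix z :: complex assume z: "z \<in> ball 0 e - {0}"
        have "z ^ r = z * z ^ (r - 1)" using r by (cases r) auto
        then show "a (z, w) / b (z, w) = (fst (G (z, w)) - z) / (z * (snd (G (z, w)) - w))"
          using z G[of z w] we(1) by simp
      qed
      ultimately have "((\<lambda>z. (fst (G (z, w)) - z) / (z * (snd (G (z, w)) - w))) \<longlongrightarrow> a (0, w) / b (0, w)) (at 0)"
        by (simp add: tendsto_cong)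
      then have "Lim (at 0) (\<lambda>z. (fst (G (z, w)) - z) / (z * (snd (G (z, w)) - w))) = a (0, w) / b (0, w)"
        by (intro tendsto_Lim) auto
      then show ?thesis using \<alpha>1(2)[OF we(1)] \<beta>1(2)[OF we(1)] we(3) by (simp add: \<alpha>_def \<beta>_def)
    qed
    have "\<forall>\<^sub>F w in at 0. w \<in> S - {0}" using S by (intro eventually_at_in_open) auto
    then have "\<forall>\<^sub>F w in at 0. Lim (at 0) (\<lambda>z. (fst (G (z, w)) - z) / (z * (snd (G (z, w)) - w))) = \<alpha>1 w / \<beta>1 w"
      by (rule eventually_mono) (rule Lim)
    from residue_cong[OF this refl]
    have "residue (\<lambda>w. Lim (at 0) (\<lambda>z. (fst (G (z, w)) - z) / (z * (snd (G (z, w)) - w)))) 0 = residue (\<lambda>w. \<alpha>1 w / \<beta>1 w) 0" .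
    also have "\<dots> = 0"
    proof (rule residue_holo[OF S(1,2)])
      have "S \<subseteq> ball 0 e" using S(3) by blast
      then show "(\<lambda>w. \<alpha>1 w / \<beta>1 w) holomorphic_on S"
        using S(3) by (intro holomorphic_intros holomorphic_on_subset[OF \<alpha>1(1)] holomorphic_on_subset[OF \<beta>1(1)]) auto
    qed
    finally show False using res by blast
  qed
  define j0 where "j0 = (LEAST j. (deriv ^^ j) \<alpha> 0 \<noteq> 0)"
  obtain j where j: "j < m" "(deriv ^^ j) \<alpha> 0 \<noteq> 0" using ex by blast
  have j0: "(deriv ^^ j0) \<alpha> 0 \<noteq> 0" "\<And>j. j < j0 \<Longrightarrow> (deriv ^^ j) \<alpha> 0 = 0" "j0 \<le> j"
    unfolding j0_def by (rule LeastI, rule j(2), use not_less_Least in blast, rule Least_le, rule j(2))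
  have "j0 \<noteq> 0"
  proof
    assume "j0 = 0"
    then show False using j0(1) a0 by (simp add: \<alpha>_def)
  qed
  then have k2: "Suc j0 \<ge> 2" by simp
  have tb: "taylor_coeff2 b 0 j = 0" if "j < Suc j0" for j using m'[of j] that j0(3) j(1) by (simp add: tc)
  from tb[of 1] k2 lin have "taylor_coeff2 b 1 0 \<noteq> 0" by simp
  then show ?thesis using k2 tb j0 by (intro exI[of _ "Suc j0"]) (simp add: tc)
qed

lemma germs2I: "holomorphic2_on g U \<Longrightarrow> open U \<Longrightarrow> 0 \<in> U \<Longrightarrow> g \<in> germs2"
  unfolding germs2_def by blast

text \<open>The power \<open>z^(r-1)\<close> divides both displacements, hence their gcd
  \<open>l\<close>. The cofactor \<open>l'\<close> is shown to be a unit, so the reduced pair has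
  the same order as \<open>(z a, b)\<close>, and order 1 means a nonzero linear term in one of the
  two.\<close>

lemma regular_linear_part:
  assumes po: "has_pure_order G 1" and e: "e > 0" and r: "r \<ge> 1"
    and a: "holomorphic2_on a (bidisc e)" and b: "holomorphic2_on b (bidisc e)"
    and bnz: "\<And>\<eta>. \<eta> > 0 \<Longrightarrow> \<exists>w\<in>ball 0 \<eta>. b (0, w) \<noteq> 0" and b0: "b (0, 0) = 0"
    and G: "\<And>z w. z \<in> ball 0 e \<Longrightarrow> w \<in> ball 0 e \<Longrightarrow> G (z, w) = (z + z ^ r * a (z, w), w + z ^ (r - 1) * b (z, w))"
    and nofix: "\<And>z w. z \<in> ball 0 e \<Longrightarrow> w \<in> ball 0 e \<Longrightarrow> z \<noteq> 0 \<Longrightarrow> a (z, w) \<noteq> 0 \<or> b (z, w) \<noteq> 0"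
  shows "a (0, 0) \<noteq> 0 \<or> taylor_coeff2 b 1 0 \<noteq> 0 \<or> taylor_coeff2 b 0 1 \<noteq> 0"
proof -
  let ?P = "\<lambda>e. bidisc e"
  define g h where "g = (\<lambda>p. fst (G p) - fst p)" and "h = (\<lambda>p. snd (G p) - snd p)"
  obtain l g0 h0 where gh: "g0 \<in> germs2" "h0 \<in> germs2" and gcd: "germ_is_gcd l g h"
    and eq: "germ_eq g (\<lambda>p. l p * g0 p)" "germ_eq h (\<lambda>p. l p * h0 p)" and ord: "1 = min (germ_order g0) (germ_order h0)"
    using po unfolding has_pure_order_def Let_def g_def h_def by blast
  define d where "d = (\<lambda>p :: complex \<times> complex. fst p ^ (r - 1))"
  have Pe: "open (?P e)" "0 \<in> ?P e" using e by (auto simp: open_Times zero_prod_def)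
  have ev: "\<forall>\<^sub>F p in nhds 0. p \<in> ?P e" using Pe by (rule eventually_nhds_in_open)
  have d: "d \<in> germs2" unfolding d_def by (rule germs2I[OF holomorphic2_power[OF holomorphic2_fst] open_UNIV]) simp
  have gG: "g p = d p * (fst p * a p)" "h p = d p * b p" if "p \<in> ?P e" for p
  proof -
    have "fst p ^ r = fst p ^ (r - 1) * fst p" using r by (cases r) auto
    then show "g p = d p * (fst p * a p)" "h p = d p * b p"
      using that G[of "fst p" "snd p"] by (auto simp: g_def h_def d_def)
  qed
  have az: "holomorphic2_on (\<lambda>p. fst p * a p) (?P e)" by (intro holomorphic2_intros a)
  have "germ_dvd d g" unfolding germ_dvd_def
  proof (rule bexI[of _ "\<lambda>p. fst p * a p"])
    show "germ_eq g (\<lambda>p. d p * (fst p * a p))" unfolding germ_eq_def using ev by (rule eventually_mono) (rule gG(1))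
    show "(\<lambda>p. fst p * a p) \<in> germs2" by (rule germs2I[OF az Pe])
  qed
  moreover have "germ_dvd d h" unfolding germ_dvd_def
  proof (rule bexI[of _ b])
    show "germ_eq h (\<lambda>p. d p * b p)" unfolding germ_eq_def using ev by (rule eventually_mono) (rule gG(2))
    show "b \<in> germs2" by (rule germs2I[OF b Pe])
  qed
  ultimately have "germ_dvd d l" using gcd d unfolding germ_is_gcd_def by blast
  then obtain l' where l': "l' \<in> germs2" "germ_eq l (\<lambda>p. d p * l' p)" unfolding germ_dvd_def by blast
  have "\<forall>\<^sub>F p in nhds 0. p \<in> ?P e \<and> g p = l p * g0 p \<and> h p = l p * h0 p \<and> l p = d p * l' p"
    using ev eq l'(2) unfolding germ_eq_def by (intro eventually_conj)
  then obtain S where S: "open S" "0 \<in> S" "\<And>p. p \<in> S \<Longrightarrow> p \<in> ?P e \<and> g p = l p * g0 p \<and> h p = l p * h0 p \<and> l p = d p * l' p"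
    unfolding eventually_nhds by blast
  obtain S1 S2 S3 where S13: "open S1" "0 \<in> S1" "holomorphic2_on l' S1" "open S2" "0 \<in> S2" "holomorphic2_on g0 S2"
    "open S3" "0 \<in> S3" "holomorphic2_on h0 S3" using l'(1) gh unfolding germs2_def by blast
  have "open (S \<inter> S1 \<inter> S2 \<inter> S3)" "(0, 0) \<in> S \<inter> S1 \<inter> S2 \<inter> S3"
    using S S13 by (auto simp: zero_prod_def)
  then obtain e1 where e1: "e1 > 0" "?P e1 \<subseteq> S \<inter> S1 \<inter> S2 \<inter> S3" by (rule open_contains_polydisc)
  have P1: "open (?P e1)" "0 \<in> ?P e1" "?P e1 \<subseteq> ?P e" using e1 S(3) by (auto simp: open_Times zero_prod_def)
  have hol: "holomorphic2_on l' (?P e1)" "holomorphic2_on g0 (?P e1)" "holomorphic2_on h0 (?P e1)"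
    "holomorphic2_on b (?P e1)" "holomorphic2_on (\<lambda>p. fst p * a p) (?P e1)" "holomorphic2_on a (?P e1)"
  proof -
    have sub: "?P e1 \<subseteq> S1" "?P e1 \<subseteq> S2" "?P e1 \<subseteq> S3" using e1(2) by blast+
    show "holomorphic2_on l' (?P e1)" "holomorphic2_on g0 (?P e1)" "holomorphic2_on h0 (?P e1)"
      by (rule holomorphic2_on_subset[OF S13(3) sub(1)] holomorphic2_on_subset[OF S13(6) sub(2)] holomorphic2_on_subset[OF S13(9) sub(3)])+
    show "holomorphic2_on b (?P e1)" "holomorphic2_on (\<lambda>p. fst p * a p) (?P e1)" "holomorphic2_on a (?P e1)"
      by (rule holomorphic2_on_subset[OF b P1(3)] holomorphic2_on_subset[OF az P1(3)] holomorphic2_on_subset[OF a P1(3)])+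
  qed
  \<comment> \<open>Cancelling \<open>d\<close> is possible only off the divisor;
    \<open>holomorphic2_eq_off_divisor\<close> then extends both identities across it.\<close>
  have f1: "fst p * a p = l' p * g0 p \<and> b p = l' p * h0 p" if p: "p \<in> ?P e1" "fst p \<noteq> 0" for p
  proof -
    have pS: "p \<in> S" "p \<in> ?P e" using p(1) e1(2) P1(3) by blast+
    have "d p \<noteq> 0" using p(2) by (simp add: d_def)
    moreover have "d p * (fst p * a p) = d p * (l' p * g0 p)" "d p * b p = d p * (l' p * h0 p)"
      using S(3)[OF pS(1)] gG[OF pS(2)] by (simp_all add: mult.assoc)
    ultimately show ?thesis by simp
  qed
  have fa: "fst p * a p = l' p * g0 p" and fb: "b p = l' p * h0 p" if "p \<in> ?P e1" for p
  proof -
    have "(\<lambda>p. fst p * a p) (fst p, snd p) = (\<lambda>p. l' p * g0 p) (fst p, snd p)"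
      by (rule holomorphic2_eq_off_divisor[OF hol(5) holomorphic2_mult[OF hol(1,2)]]) (use f1 that in auto)
    then show "fst p * a p = l' p * g0 p" by simp
    have "b (fst p, snd p) = (\<lambda>p. l' p * h0 p) (fst p, snd p)"
      by (rule holomorphic2_eq_off_divisor[OF hol(4) holomorphic2_mult[OF hol(1,3)]]) (use f1 that in auto)
    then show "b p = l' p * h0 p" by simp
  qed
  \<comment> \<open>On the divisor \<open>l'\<close> is not identically zero, because
    \<open>b\<close> is not. If it vanished at the origin, \<open>zeros_near_slice_zero\<close>
    would give a nearby zero with \<open>z \<noteq> 0\<close>, where \<open>a\<close> and
    \<open>b\<close> vanish together, against \<open>nofix\<close>.\<close>
  have l0: "l' 0 \<noteq> 0"
  proof
    assume z: "l' 0 = 0"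
    then have z: "l' (0, 0) = 0" by (simp add: zero_prod_def)
    have nz: "\<exists>w\<in>ball 0 \<eta>. l' (0, w) \<noteq> 0" if "\<eta> > 0" for \<eta>
    proof -
      have "min \<eta> e1 > 0" using that e1(1) by simp
      from bnz[OF this] obtain w where w: "w \<in> ball 0 (min \<eta> e1)" "b (0, w) \<noteq> 0" by blast
      then have "l' (0, w) \<noteq> 0" using fb[of "(0, w)"] e1(1) by auto
      then show ?thesis using w(1) by auto
    qed
    have h: "0 < e1 / 2" "e1 / 2 < e1" using e1(1) by auto
    obtain z w where zw: "z \<noteq> 0" "norm z < e1 / 2" "norm w < e1 / 2" "l' (z, w) = 0"
      by (rule zeros_near_slice_zero[OF hol(1) z nz h])
    then have p: "(z, w) \<in> ?P e1" using e1(1) by auto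
    then have "(z, w) \<in> ?P e" using P1(3) by blast
    then show False using nofix[of z w] zw fa[OF p] fb[OF p] by auto
  qed
  consider "germ_order g0 = 1" | "germ_order h0 = 1" using ord unfolding min_def by (cases "germ_order g0 \<le> germ_order h0") simp_all
  then show ?thesis
  proof cases
    case 1
    then obtain v where v: "hom_part g0 1 v \<noteq> 0" by (rule germ_order_one)
    have "g0 0 = 0" using fa[OF P1(2)] l0 by simp
    from hom_part_1_mult[OF P1(1,2) hol(1,2) this hol(5) fa] v l0 have "hom_part (\<lambda>p. fst p * a p) 1 v \<noteq> 0" by simp
    moreover have "hom_part (\<lambda>p. fst p * a p) 1 v = a 0 * hom_part fst 1 v"
      by (rule hom_part_1_mult[OF P1(1,2) hol(6) holomorphic2_fst _ hol(5)]) simp_all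
    ultimately show ?thesis by (auto simp: zero_prod_def)
  next
    case 2
    then obtain v where v: "hom_part h0 1 v \<noteq> 0" by (rule germ_order_one)
    have "h0 0 = 0" using fb[OF P1(2)] l0 b0 by (simp add: zero_prod_def)
    from hom_part_1_mult[OF P1(1,2) hol(1,3) this hol(4) fb] v l0 have "hom_part b 1 v \<noteq> 0" by simp
    then show ?thesis by (auto simp: hom_part_def)
  qed
qed

section \<open>The parabolic curve\<close>

lemma norm_blowdown_le:
  assumes "coord_flip \<sigma>" "norm w \<le> 1"
  shows "norm (blowdown \<sigma> s (z, w)) \<le> norm z * (2 + norm s)"
proof -
  have "norm (blowdown \<sigma> s (z, w)) = norm (z, z * (w + s))" by (simp add: blowdown_def coord_flip_simps(3)[OF assms(1)])
  also have "\<dots> \<le> norm z + norm (z * (w + s))" by (rule norm_Pair_le)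
  also have "norm (z * (w + s)) \<le> norm z * (1 + norm s)"
    unfolding norm_mult using norm_triangle_ineq[of w s] assms(2) by (intro mult_left_mono) auto
  finally show ?thesis by (simp add: algebra_simps)
qed

text \<open>A convex part of the half plane, invariant under \<open>t -> t + 1\<close>, on which
  \<open>norm t \<le> 2 * Re t\<close>. There \<open>1 / t -> 0\<close> forces \<open>Re t\<close>
  to infinity, which fails in the half plane itself, where \<open>Re t\<close> may stay
  bounded.\<close>

definition sector :: "real \<Rightarrow> complex set"
  where "sector R = {t. R + \<bar>Im t\<bar> < Re t}"

lemma sector_facts:
  assumes "R \<ge> 1"
  shows "open (sector R)" "convex (sector R)" "sector R \<subseteq> half_plane R" "0 \<notin> sector R"
    "t \<in> sector R \<Longrightarrow> t + of_nat n \<in> sector R" "t \<in> sector R \<Longrightarrow> Re t > 0 \<and> norm t \<le> 2 * Re t"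
proof -
  show "open (sector R)" unfolding sector_def by (intro open_Collect_less continuous_intros)
  have "sector R = {t. R < Re t - Im t} \<inter> {t. R < Re t + Im t}" unfolding sector_def by auto
  also have "\<dots> = {t. inner (1 - \<i>) t > R} \<inter> {t. inner (1 + \<i>) t > R}" by (simp add: inner_complex_def)
  finally show "convex (sector R)" by (simp add: convex_Int convex_halfspace_gt)
  show "sector R \<subseteq> half_plane R" "0 \<notin> sector R" using assms unfolding sector_def half_plane_def by auto
  show "t + of_nat n \<in> sector R" if "t \<in> sector R" using that unfolding sector_def by simp
  show "Re t > 0 \<and> norm t \<le> 2 * Re t" if "t \<in> sector R"
    using that assms cmod_le[of t] unfolding sector_def by auto
qed

lemma inverse_sector:
  assumes R: "R \<ge> 1"
  defines "\<Delta> \<equiv> inverse ` sector R"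
  shows "\<And>\<zeta>. \<zeta> \<in> \<Delta> \<longleftrightarrow> inverse \<zeta> \<in> sector R" "open \<Delta>" "connected \<Delta>" "simply_connected \<Delta>" "0 \<in> frontier \<Delta>"
proof -
  note sf = sector_facts[OF R]
  show mem: "\<zeta> \<in> \<Delta> \<longleftrightarrow> inverse \<zeta> \<in> sector R" for \<zeta>
    unfolding \<Delta>_def by (metis (no_types, lifting) image_iff inverse_inverse_eq)
  have nz: "0 \<notin> \<Delta>" using sf(4) by (simp add: mem)
  have cont: "continuous_on S inverse" if "0 \<notin> S" for S :: "complex set" using that by (intro continuous_intros) auto
  have "\<Delta> = (- {0}) \<inter> inverse -` sector R" using mem nz by auto
  then show op: "open \<Delta>"
    using continuous_open_preimage[OF cont[of "- {0}"] _ sf(1)] by (simp add: open_Compl)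
  have hom: "homeomorphism (sector R) \<Delta> inverse inverse"
    unfolding homeomorphism_def using cont[OF sf(4)] cont[OF nz] by (auto simp: \<Delta>_def image_image)
  show "connected \<Delta>" unfolding \<Delta>_def by (intro connected_continuous_image cont sf(4) convex_connected sf(2))
  have "sector R homeomorphic \<Delta>" using hom unfolding homeomorphic_def by blast
  then show "simply_connected \<Delta>" by (rule homeomorphic_simply_connected[OF _ convex_imp_simply_connected[OF sf(2)]])
  have "0 \<in> closure \<Delta>" unfolding closure_approachable
  proof (intro allI impI)
    fix \<epsilon> :: real assume \<epsilon>: "\<epsilon> > 0"
    define x where "x = max (R + 1) (1 / \<epsilon> + 1)"
    have x: "x > 0" "x > 1 / \<epsilon>" "x > R" using R by (auto simp: x_def)
    have "inverse (of_real x) \<in> \<Delta>" using x by (simp add: mem sector_def)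
    moreover have "dist (inverse (of_real x)) (0 :: complex) < \<epsilon>"
    proof -
      have "norm (inverse (of_real x) :: complex) = 1 / x" using x by (simp add: norm_inverse divide_inverse)
      moreover have "1 / x < \<epsilon>" using x \<epsilon> by (simp add: field_simps)
      ultimately show ?thesis unfolding dist_norm diff_zero by linarith
    qed
    ultimately show "\<exists>y\<in>\<Delta>. dist y 0 < \<epsilon>" by blast
  qed
  then show "0 \<in> frontier \<Delta>" using nz op by (simp add: frontier_def interior_open)
qed

text \<open>In \<open>\<zeta> = 1 / t\<close> the map is \<open>t -> t + 1\<close>, so iteration
  drives \<open>Re t\<close> to infinity and both chart coordinates to 0. Tangency is the statement
  \<open>W -> 0\<close>, since the direction of a point off the divisor is \<open>w + s\<close> in
  the chart.\<close>

lemma parabolic_curve_of_fatou_coordinate: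
  assumes \<sigma>: "coord_flip \<sigma>" and e: "e \<le> 1" and \<delta>: "\<delta> > 0" and curve: "fatou_curve r a b e \<delta> R Z W"
    and chart: "\<And>z w. z \<in> ball 0 e \<Longrightarrow> w \<in> ball 0 e \<Longrightarrow> blowdown \<sigma> s (z, w) \<in> U \<and>
      f (blowdown \<sigma> s (z, w)) = blowdown \<sigma> s (z + z ^ r * a (z, w), w + z ^ (r - 1) * b (z, w))"
  shows "\<exists>\<Delta> \<phi>. parabolic_curve f U \<Delta> \<phi> \<and> tangent_at_origin \<phi> \<Delta> (proj_pt (\<sigma> (1, s)))"
proof -
  have R: "R \<ge> 1" and hol: "Z holomorphic_on half_plane R" "W holomorphic_on half_plane R"
    and inj: "inj_on (\<lambda>t. (Z t, W t)) (half_plane R)" using curve by (simp_all add: fatou_curve_def)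
  have C: "Z t \<noteq> 0 \<and> norm (Z t) < e \<and> norm (W t) < e \<and>
      Z (t + 1) = Z t + Z t ^ r * a (Z t, W t) \<and> W (t + 1) = W t + Z t ^ (r - 1) * b (Z t, W t) \<and>
      norm (Z t) \<le> 2 * norm t powr (- \<delta>) + 1 / Re t \<and> norm (W t) \<le> 2 * norm t powr (- \<delta>) + 1 / Re t"
    if "t \<in> half_plane R" for t using curve that unfolding fatou_curve_def by (elim conjE) (rule bspec)
  have ZW: "Z t \<noteq> 0" "Z t \<in> ball 0 e" "W t \<in> ball 0 e" if "t \<in> half_plane R" for t using C[OF that] by simp_all
  have step: "f (blowdown \<sigma> s (Z t, W t)) = blowdown \<sigma> s (Z (t + 1), W (t + 1))" if "t \<in> half_plane R" for t
    using chart[OF ZW(2,3)[OF that]] C[OF that] by simp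
  define \<Delta> where "\<Delta> = inverse ` sector R"
  define P where "P = (\<lambda>t. blowdown \<sigma> s (Z t, W t))"
  define \<phi> where "\<phi> = (\<lambda>\<zeta>. P (inverse \<zeta>))"
  note sf = sector_facts[OF R] and D = inverse_sector[OF R, folded \<Delta>_def]
  have H: "t \<in> half_plane R" if "t \<in> sector R" for t using that sf(3) by blast
  have HD: "inverse \<zeta> \<in> half_plane R" if "\<zeta> \<in> \<Delta>" for \<zeta> by (rule H) (use that in \<open>unfold D(1)\<close>)
  define b where "b = (\<lambda>x :: real. 2 * x powr (- \<delta>) + 1 / x)"
  have b_mono: "b y \<le> b x" if "0 < x" "x \<le> y" for x y
    unfolding b_def using that \<delta> by (intro add_mono mult_left_mono powr_mono2' divide_left_mono) auto
  have bnd: "norm (Z t) \<le> b (Re t)" "norm (W t) \<le> b (Re t)" if "t \<in> sector R" for t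
  proof -
    have "Re t > 0" using sf(6)[OF that] by blast
    then have "norm t powr (- \<delta>) \<le> Re t powr (- \<delta>)"
      using complex_Re_le_cmod[of t] \<delta> by (intro powr_mono2') auto
    then show "norm (Z t) \<le> b (Re t)" "norm (W t) \<le> b (Re t)"
      unfolding b_def using C[OF H[OF that]] by linarith+
  qed
  define K where "K = 2 + norm s"
  have K: "K > 0" unfolding K_def by (intro add_pos_nonneg) auto
  have PK: "norm (P t) \<le> norm (Z t) * K" if "t \<in> half_plane R" for t
    unfolding P_def K_def using ZW[OF that] e by (intro norm_blowdown_le[OF \<sigma>]) auto
  have PU: "P t \<in> U" if "t \<in> half_plane R" for t unfolding P_def by (rule conjunct1[OF chart[OF ZW(2,3)[OF that]]])
  have iter: "(f ^^ k) (P t) = P (t + of_nat k)" if "t \<in> half_plane R" for t k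
  proof (induction k)
    case (Suc k)
    then show ?case using step[OF half_plane_add[OF that, of k]] by (simp add: P_def add_ac)
  qed simp
  have "((\<lambda>x :: real. 2 * x powr (- \<delta>)) \<longlongrightarrow> 0) at_top" using \<delta> by real_asymp
  moreover have "((\<lambda>x :: real. 1 / x) \<longlongrightarrow> 0) at_top" by real_asymp
  ultimately have b_top: "(b \<longlongrightarrow> 0) at_top" unfolding b_def using tendsto_add by fastforce
  then have b_seq: "(\<lambda>k. K * b (real k)) \<longlonglongrightarrow> 0"
    using tendsto_mult_right_zero[OF filterlim_compose[OF b_top filterlim_real_sequentially]] by simp
  have "((\<lambda>x. b (1 / (2 * x))) \<longlongrightarrow> 0) (at_right 0)"
    by (rule filterlim_compose[OF b_top]) real_asymp
  moreover have "filterlim norm (at_right 0) (at 0 within \<Delta>)"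
    by (rule filterlim_at_withinI) (auto simp: eventually_at_filter intro: tendsto_norm_zero tendsto_ident_at)
  ultimately have b_lim: "((\<lambda>\<zeta> :: complex. b (1 / (2 * norm \<zeta>))) \<longlongrightarrow> 0) (at 0 within \<Delta>)"
    by (rule filterlim_compose)
  have b\<zeta>: "b (Re (inverse \<zeta>)) \<le> b (1 / (2 * norm \<zeta>))" if "\<zeta> \<in> \<Delta>" for \<zeta>
  proof (rule b_mono)
    have "\<zeta> \<noteq> 0"
    proof
      assume "\<zeta> = 0" then show False using that sf(4) unfolding D(1) by simp
    qed
    then show "0 < 1 / (2 * norm \<zeta>)" by simp
    show "1 / (2 * norm \<zeta>) \<le> Re (inverse \<zeta>)"
    proof -
      have "inverse \<zeta> \<in> sector R" using that unfolding D(1) .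
      from sf(6)[OF this] have "inverse (norm \<zeta>) \<le> 2 * Re (inverse \<zeta>)" unfolding norm_inverse by (rule conjunct2)
      moreover have "1 / (2 * norm \<zeta>) = inverse (norm \<zeta>) / 2" by (simp add: inverse_eq_divide)
      ultimately show ?thesis by linarith
    qed
  qed
  have within: "\<forall>\<^sub>F \<zeta> in at 0 within \<Delta>. \<zeta> \<in> \<Delta>" by (simp add: eventually_at_filter)
  have \<phi>0: "(\<phi> \<longlongrightarrow> 0) (at 0 within \<Delta>)"
  proof (rule Lim_null_comparison[OF _ tendsto_mult_left_zero[OF b_lim, of K]], rule eventually_mono[OF within])
    fix \<zeta> assume z: "\<zeta> \<in> \<Delta>"
    have "norm (\<phi> \<zeta>) \<le> norm (Z (inverse \<zeta>)) * K" unfolding \<phi>_def by (rule PK[OF HD[OF z]])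
    also have "\<dots> \<le> b (1 / (2 * norm \<zeta>)) * K"
      using bnd(1)[of "inverse \<zeta>"] b\<zeta>[OF z] z D(1) K by (intro mult_right_mono) auto
    finally show "norm (\<phi> \<zeta>) \<le> b (1 / (2 * norm \<zeta>)) * K" .
  qed
  have W0: "((\<lambda>\<zeta>. W (inverse \<zeta>)) \<longlongrightarrow> 0) (at 0 within \<Delta>)"
  proof (rule Lim_null_comparison[OF _ b_lim], rule eventually_mono[OF within])
    fix \<zeta> assume z: "\<zeta> \<in> \<Delta>"
    show "norm (W (inverse \<zeta>)) \<le> b (1 / (2 * norm \<zeta>))" using bnd(2)[of "inverse \<zeta>"] b\<zeta>[OF z] z D(1) by auto
  qed
  have hinv: "(\<lambda>\<zeta>. g (inverse \<zeta>)) holomorphic_on \<Delta>" if "g holomorphic_on half_plane R" for g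
  proof -
    have "inverse holomorphic_on \<Delta>" using sf(4) D(1) by (intro holomorphic_intros) auto
    from holomorphic_on_compose_gen[OF this that] show ?thesis using HD by (auto simp: o_def)
  qed
  have hol12: "(\<lambda>\<zeta>. fst (\<phi> \<zeta>)) holomorphic_on \<Delta>" "(\<lambda>\<zeta>. snd (\<phi> \<zeta>)) holomorphic_on \<Delta>"
    using \<sigma> hinv[OF hol(1)] hinv[OF hol(2)] unfolding \<phi>_def P_def blowdown_def coord_flip_def
    by (auto intro!: holomorphic_intros)
  \<comment> \<open>The blow-down is injective off the divisor, and the curve avoids the divisor
    because \<open>Z\<close> has no zeros.\<close>
  have injP: "t = t'" if "P t = P t'" "t \<in> half_plane R" "t' \<in> half_plane R" for t t'
  proof -
    have "\<sigma> (P t) = \<sigma> (P t')" using that(1) by simp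
    then have "Z t = Z t' \<and> Z t * (W t + s) = Z t' * (W t' + s)"
      unfolding P_def blowdown_def coord_flip_simps(1)[OF \<sigma>] prod.inject fst_conv snd_conv .
    moreover have "Z t' \<noteq> 0" using ZW[OF that(3)] by blast
    ultimately have "(Z t, W t) = (Z t', W t')" by auto
    then show ?thesis using inj that(2,3) by (auto dest: inj_onD)
  qed
  have inj\<phi>: "inj_on \<phi> \<Delta>"
  proof (rule inj_onI)
    fix x y assume "x \<in> \<Delta>" "y \<in> \<Delta>" "\<phi> x = \<phi> y"
    then have "inverse x = inverse y" unfolding \<phi>_def by (intro injP HD)
    then show "x = y" by simp
  qed
  have invariant: "f (\<phi> \<zeta>) \<in> \<phi> ` \<Delta>" if "\<zeta> \<in> \<Delta>" for \<zeta>
  proof (rule image_eqI)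
    have t: "inverse \<zeta> \<in> sector R" using that unfolding D(1) .
    show "f (\<phi> \<zeta>) = \<phi> (inverse (inverse \<zeta> + 1))" using step[OF H[OF t]] by (simp add: \<phi>_def P_def)
    show "inverse (inverse \<zeta> + 1) \<in> \<Delta>" using sf(5)[OF t, of 1] by (simp add: D(1))
  qed
  \<comment> \<open>The convergence is uniform on every subset of the domain: after \<open>k\<close>
    steps the real part exceeds \<open>k\<close>, whatever the starting point.\<close>
  have unif: "uniform_limit A (\<lambda>k \<zeta>. (f ^^ k) (\<phi> \<zeta>)) (\<lambda>_. 0) sequentially" if A: "A \<subseteq> \<Delta>" for A
  proof (rule uniform_limitI)
    fix \<epsilon> :: real assume "\<epsilon> > 0"
    with b_seq have "\<forall>\<^sub>F k in sequentially. K * b (real k) < \<epsilon>" by (rule order_tendstoD(2))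
    with eventually_gt_at_top[of 0] show "\<forall>\<^sub>F k in sequentially. \<forall>\<zeta>\<in>A. dist ((f ^^ k) (\<phi> \<zeta>)) 0 < \<epsilon>"
    proof eventually_elim
      case (elim k)
      show ?case
      proof
        fix \<zeta> assume "\<zeta> \<in> A"
        then have "\<zeta> \<in> \<Delta>" using A by blast
        then have t: "inverse \<zeta> \<in> sector R" unfolding D(1) .
        let ?t = "inverse \<zeta> + of_nat k"
        have t': "?t \<in> sector R" by (rule sf(5)[OF t])
        have "norm (P ?t) \<le> norm (Z ?t) * K" by (rule PK[OF H[OF t']])
        also have "\<dots> \<le> b (Re ?t) * K" using bnd(1)[OF t'] K by (intro mult_right_mono) auto
        also have "\<dots> \<le> b (real k) * K" using sf(6)[OF t] elim(1) K by (intro mult_right_mono b_mono) auto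
        finally show "dist ((f ^^ k) (\<phi> \<zeta>)) 0 < \<epsilon>" using elim(2) iter[OF H[OF t], of k] by (simp add: \<phi>_def mult.commute)
      qed
    qed
  qed
  have "parabolic_curve f U \<Delta> \<phi>"
    unfolding parabolic_curve_def using D(2-5) hol12 inj\<phi> \<phi>0 invariant PU HD unif by (auto simp: \<phi>_def)
  moreover have "tangent_at_origin \<phi> \<Delta> (proj_pt (\<sigma> (1, s)))" unfolding tangent_at_origin_def
  proof
    have pt: "\<phi> \<zeta> \<noteq> 0 \<and> proj_pt (\<phi> \<zeta>) = proj_pt (\<sigma> (1, W (inverse \<zeta>) + s))" if "\<zeta> \<in> \<Delta>" for \<zeta>
      using proj_pt_blowdown[OF \<sigma>, of "(Z (inverse \<zeta>), W (inverse \<zeta>))" s] ZW[OF HD[OF that]] by (simp add: \<phi>_def P_def)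
    show "\<forall>\<^sub>F \<zeta> in at 0 within \<Delta>. \<phi> \<zeta> \<noteq> 0" using within by (rule eventually_mono) (use pt in blast)
    have "isCont (\<lambda>w. proj_pt (\<sigma> (1, w + s))) 0"
      using continuous_proj_pt_affine[OF \<sigma>, of s] by (simp add: continuous_on_eq_continuous_at)
    from isCont_tendsto_compose[OF this W0]
    have "((\<lambda>\<zeta>. proj_pt (\<sigma> (1, W (inverse \<zeta>) + s))) \<longlongrightarrow> proj_pt (\<sigma> (1, s))) (at 0 within \<Delta>)" by simp
    moreover have "\<forall>\<^sub>F \<zeta> in at 0 within \<Delta>. proj_pt (\<sigma> (1, W (inverse \<zeta>) + s)) = proj_pt (\<phi> \<zeta>)"
      using within by (rule eventually_mono) (use pt in simp)
    ultimately show "((\<lambda>\<zeta>. proj_pt (\<phi> \<zeta>)) \<longlongrightarrow> proj_pt (\<sigma> (1, s))) (at 0 within \<Delta>)" by (rule Lim_transform_eventually)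
  qed
  ultimately show ?thesis by blast
qed

theorem corollary1p7:
  fixes f :: "complex \<times> complex \<Rightarrow> complex \<times> complex"
    and U :: "(complex \<times> complex) set"
    and L :: proj_line
    and F :: "blowup_point \<Rightarrow> blowup_point"
  assumes "open U" and "0 \<in> U" and "holomorphic_map2_on f U"
    and "f 0 = 0" and "(f has_derivative (\<lambda>h. h)) (at 0)"
    and isolated: "\<forall>\<^sub>F p in at 0. f p \<noteq> p"
    and "\<not> dicritical f"
    and "characteristic_direction f L"
    and blow_up: "is_blowup_of f F"
    and "regular_along F L"
    and "residual_index F L \<noteq> 0"
  shows "\<exists>\<Delta> \<phi>. parabolic_curve f U \<Delta> \<phi> \<and> tangent_at_origin \<phi> \<Delta> L"
proof -
  obtain \<sigma> s where \<sigma>: "coord_flip \<sigma>" and L: "L = proj_pt (\<sigma> (1, s))"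
    and ch: "\<And>p. blowup_chart_at L p = (blowdown \<sigma> s p, proj_pt (\<sigma> (1, snd p + s)))"
    by (rule blowup_chart_at_cases[of L]) blast
  define r where "r = map_order f"
  have r: "r \<ge> 2" unfolding r_def by (rule nondicritical_map_order(1)[OF assms(1-5,7)])
  obtain a b e0 where e0: "e0 > 0" "e0 \<le> 1" and a0: "holomorphic2_on a (bidisc e0)"
    and b0: "holomorphic2_on b (bidisc e0)" and b00: "b (0, 0) = 0"
    and bnz: "\<And>\<eta>. \<eta> > 0 \<Longrightarrow> \<exists>w\<in>ball 0 \<eta>. b (0, w) \<noteq> 0"
    and step: "\<And>z w. z \<in> ball 0 e0 \<Longrightarrow> w \<in> ball 0 e0 \<Longrightarrow> blowdown \<sigma> s (z, w) \<in> U \<and> 1 + z ^ (r - 1) * a (z, w) \<noteq> 0 \<and>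
      f (blowdown \<sigma> s (z, w)) = blowdown \<sigma> s (z + z ^ r * a (z, w), w + z ^ (r - 1) * b (z, w))"
    by (rule blowup_coordinates_at[OF assms(1-5,7,8) \<sigma> L, folded r_def]) blast
  obtain d where d: "d > 0" "\<And>p. p \<noteq> 0 \<Longrightarrow> dist p 0 < d \<Longrightarrow> f p \<noteq> p"
    using isolated unfolding eventually_at by auto
  define K where "K = 2 + norm s"
  have K: "K > 0" unfolding K_def by (intro add_pos_nonneg) auto
  have "r \<ge> 1" using r by simp
  obtain e1 where e1: "0 < e1" "e1 \<le> e0" and G1: "\<And>z w. z \<in> ball 0 e1 \<Longrightarrow> w \<in> ball 0 e1 \<Longrightarrow>
      local_form F L (z, w) = (z + z ^ r * a (z, w), w + z ^ (r - 1) * b (z, w))"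
  proof (rule local_form_eq[OF blow_up \<sigma> ch e0(1) \<open>r \<ge> 1\<close> a0 b0])
    show "1 + z ^ (r - 1) * a (z, w) \<noteq> 0 \<and>
      f (blowdown \<sigma> s (z, w)) = blowdown \<sigma> s (z + z ^ r * a (z, w), w + z ^ (r - 1) * b (z, w))"
      if "z \<in> ball 0 e0" "w \<in> ball 0 e0" for z w using step[OF that] by blast
  qed (rule that)
  \<comment> \<open>The blow-down enlarges by at most the factor \<open>K\<close>, so the bidisc of
    radius \<open>e\<close> is mapped into the ball of radius \<open>d\<close>, in which the origin
    is the only fixed point.\<close>
  define e where "e = min e1 (d / K)"
  have e: "0 < e" "e \<le> 1" "e \<le> e1" "e \<le> d / K" using e0 e1 d(1) K by (auto simp: e_def)
  have sub: "ball (0::complex) e \<subseteq> ball 0 e0" "ball (0::complex) e \<subseteq> ball 0 e1" using e e1 by (auto intro: subset_ball)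
  have a: "holomorphic2_on a (bidisc e)" and b: "holomorphic2_on b (bidisc e)"
    using sub(1) by (blast intro: holomorphic2_on_subset[OF a0] holomorphic2_on_subset[OF b0])+
  have G: "local_form F L (z, w) = (z + z ^ r * a (z, w), w + z ^ (r - 1) * b (z, w))"
    if "z \<in> ball 0 e" "w \<in> ball 0 e" for z w using that sub(2) by (intro G1) blast+
  have step': "blowdown \<sigma> s (z, w) \<in> U \<and>
      f (blowdown \<sigma> s (z, w)) = blowdown \<sigma> s (z + z ^ r * a (z, w), w + z ^ (r - 1) * b (z, w))"
    if "z \<in> ball 0 e" "w \<in> ball 0 e" for z w
  proof -
    have "z \<in> ball 0 e0" "w \<in> ball 0 e0" using that sub(1) by blast+
    from step[OF this] show ?thesis by blast
  qed
  have nofix: "a (z, w) \<noteq> 0 \<or> b (z, w) \<noteq> 0" if zw: "z \<in> ball 0 e" "w \<in> ball 0 e" "z \<noteq> 0" for z w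
  proof (rule ccontr)
    assume "\<not> (a (z, w) \<noteq> 0 \<or> b (z, w) \<noteq> 0)"
    then have "f (blowdown \<sigma> s (z, w)) = blowdown \<sigma> s (z, w)" using step'[OF zw(1,2)] by simp
    moreover have "blowdown \<sigma> s (z, w) \<noteq> 0" by (rule proj_pt_blowdown(1)[OF \<sigma>]) (use zw(3) in simp)
    moreover have "dist (blowdown \<sigma> s (z, w)) 0 < d"
    proof -
      have "norm w \<le> 1" using zw(2) e(2) by simp
      then have "norm (blowdown \<sigma> s (z, w)) \<le> norm z * K" unfolding K_def by (rule norm_blowdown_le[OF \<sigma>])
      also have "\<dots> < d / K * K" using zw(1) e(4) K by (intro mult_strict_right_mono) auto
      finally show ?thesis using K by simp
    qed
    ultimately show False using d(2) by blast
  qed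
  have lin: "a (0, 0) \<noteq> 0 \<or> taylor_coeff2 b 1 0 \<noteq> 0 \<or> taylor_coeff2 b 0 1 \<noteq> 0"
    by (rule regular_linear_part[OF assms(10)[unfolded regular_along_def] e(1) \<open>r \<ge> 1\<close> a b bnz b00 G nofix])
  have cases: "a (0, 0) \<noteq> 0 \<or>
      (\<exists>k\<ge>2. (\<forall>j<k - 1. taylor_coeff2 a 0 j = 0) \<and> taylor_coeff2 a 0 (k - 1) \<noteq> 0 \<and>
        (\<forall>j<k. taylor_coeff2 b 0 j = 0) \<and> taylor_coeff2 b 1 0 \<noteq> 0)"
  proof (cases "a (0, 0) = 0")
    case True
    with lin have "taylor_coeff2 b 1 0 \<noteq> 0 \<or> taylor_coeff2 b 0 1 \<noteq> 0" by blast
    from residue_case[OF e(1) \<open>r \<ge> 1\<close> a b bnz b00 G True this assms(11)[unfolded residual_index_def]]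
    show ?thesis by blast
  qed simp
  obtain \<delta> R Z W where \<delta>: "\<delta> > 0" and curve: "fatou_curve r a b e \<delta> R Z W"
    by (rule invariant_curve_exists[OF r e(1,2) a b b00 cases])
  show ?thesis unfolding L by (rule parabolic_curve_of_fatou_coordinate[OF \<sigma> e(2) \<delta> curve step'])
qed

end
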